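(* Let $H$ be a quasi-Hopf algebra, $A$ a left $H$-module algebra, $B$ a right $H$-module algebra and $\mathbb A$ an $H$-bicomodule algebra. Then the two-sided generalized smash product $A\blacktriangleright\!\!<\mathbb A>\!\!\blacktriangleleft B$ is isomorphic as an algebra to the generalized diagonal crossed product $(A\otimes B)\bowtie\mathbb A$, where $A\otimes B$ is the $H$-bimodule algebra with componentwise multiplication and actions $h\cdot(a\otimes b)\cdot h'=h\cdot a\otimes b\cdot h'$.
   Context: All algebras and spaces are over a field $k$, $\otimes=\otimes_k$; summation is understood. A quasi-bialgebra $(H,\Delta,\varepsilon,\Phi)$: a unital associative algebra $H$, algebra maps $\Delta:H\to H\otimes H$ ($\Delta(h)=h_1\otimes h_2$), $\varepsilon:H\to k$, and an invertible $\Phi=X^1\otimes X^2\otimes X^3\in H^{\otimes3}$, $\Phi^{-1}=x^1\otimes x^2\otimes x^3$, with $(id\otimes\Delta)(\Delta(h))=\Phi(\Delta\otimes id)(\Delta(h))\Phi^{-1}$, $(id\otimes\varepsilon)\Delta=id=(\varepsilon\otimes id)\Delta$, $(1\otimes\Phi)(id\otimes\Delta\otimes id)(\Phi)(\Phi\otimes1)=(id\otimes id\otimes\Delta)(\Phi)(\Delta\otimes id\otimes id)(\Phi)$, $(id\otimes\varepsilon\otimes id)(\Phi)=1\otimes1$. A quasi-Hopf algebra is a quasi-bialgebra with an algebra anti-automorphism $S$ (so $S$ is bijective) and $\alpha,\beta\in H$ such that $S(h_1)\alpha h_2=\varepsilon(h)\alpha$, $h_1\beta S(h_2)=\varepsilon(h)\beta$,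 $X^1\beta S(X^2)\alpha X^3=1$, $S(x^1)\alpha x^2\beta S(x^3)=1$; by rescaling one assumes $\varepsilon(\alpha)=\varepsilon(\beta)=1$ and $\varepsilon\circ S=\varepsilon$. Drinfeld twist: $f=f^1\otimes f^2=(S\otimes S)(\Delta^{cop}(x^1))\,\gamma\,\Delta(x^2\beta S(x^3))\in H\otimes H$, where $\Delta^{cop}(h)=h_2\otimes h_1$, $\gamma=S(A^2)\alpha A^3\otimes S(A^1)\alpha A^4$, $A^1\otimes A^2\otimes A^3\otimes A^4=(\Phi\otimes1)(\Delta\otimes id\otimes id)(\Phi^{-1})$; it is invertible. A left $H$-module algebra: a left $H$-module $A$ with bilinear multiplication and two-sided unit $1_A$ with $(aa')a''=(X^1\cdot a)[(X^2\cdot a')(X^3\cdot a'')]$, $h\cdot(aa')=(h_1\cdot a)(h_2\cdot a')$, $h\cdot1_A=\varepsilon(h)1_A$. A right $H$-module algebra: a right $H$-module $B$ with bilinear multiplication and two-sided unit $1_B$ with $(bb')b''=(b\cdot x^1)[(b'\cdot x^2)(b''\cdot x^3)]$, $(bb')\cdot h=(b\cdot h_1)(b'\cdot h_2)$, $1_B\cdot h=\varepsilon(h)1_B$. An $H$-bimodule algebra: an $H$-bimodule $\mathcal A$ with a bilinear multiplication and a two-sided unit $1_{\mathcal A}$ such that $(\varphi\varphi')\varphi''=(X^1\cdot\varphi\cdot x^1)[(X^2\cdot\varphi'\cdot x^2)(X^3\cdot\varphi''\cdot x^3)]$, $h\cdot(\varphi\varphi')=(h_1\cdot\varphi)(h_2\cdot\varphi')$,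 $(\varphi\varphi')\cdot h=(\varphi\cdot h_1)(\varphi'\cdot h_2)$, $h\cdot1_{\mathcal A}=\varepsilon(h)1_{\mathcal A}=1_{\mathcal A}\cdot h$. A right $H$-comodule algebra: a unital associative algebra $\mathfrak A$, an algebra map $\rho:\mathfrak A\to\mathfrak A\otimes H$, $\rho(a)=a_{\langle0\rangle}\otimes a_{\langle1\rangle}$, and an invertible $\Phi_\rho=\tilde X^1_\rho\otimes\tilde X^2_\rho\otimes\tilde X^3_\rho\in\mathfrak A\otimes H\otimes H$, $\Phi_\rho^{-1}=\tilde x^1_\rho\otimes\tilde x^2_\rho\otimes\tilde x^3_\rho$, with $\Phi_\rho(\rho\otimes id)(\rho(a))=(id\otimes\Delta)(\rho(a))\Phi_\rho$, $(1\otimes\Phi)(id\otimes\Delta\otimes id)(\Phi_\rho)(\Phi_\rho\otimes1)=(id\otimes id\otimes\Delta)(\Phi_\rho)(\rho\otimes id\otimes id)(\Phi_\rho)$, $(id\otimes\varepsilon)\rho=id$, $(id\otimes\varepsilon\otimes id)(\Phi_\rho)=(id\otimes id\otimes\varepsilon)(\Phi_\rho)=1\otimes1$. A left $H$-comodule algebra: a unital associative algebra $\mathfrak B$, an algebra map $\lambda:\mathfrak B\to H\otimes\mathfrak B$, $\lambda(b)=b_{[-1]}\otimes b_{[0]}$, and an invertible $\Phi_\lambda\in H\otimes H\otimes\mathfrak B$, $\Phi_\lambda^{-1}=\tilde x^1_\lambda\otimes\tilde x^2_\lambda\otimes\tilde x^3_\lambda$, with $(id\otimes\lambda)(\lambda(b))\Phi_\lambda=\Phi_\lambda(\Delta\otimes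 id)(\lambda(b))$, $(1\otimes\Phi_\lambda)(id\otimes\Delta\otimes id)(\Phi_\lambda)(\Phi\otimes1)=(id\otimes id\otimes\lambda)(\Phi_\lambda)(\Delta\otimes id\otimes id)(\Phi_\lambda)$, $(\varepsilon\otimes id)\lambda=id$, $(id\otimes\varepsilon\otimes id)(\Phi_\lambda)=(\varepsilon\otimes id\otimes id)(\Phi_\lambda)=1\otimes1$. An $H$-bicomodule algebra $(\mathbb A,\lambda,\rho,\Phi_\lambda,\Phi_\rho,\Phi_{\lambda,\rho})$: $(\mathbb A,\lambda,\Phi_\lambda)$ is a left and $(\mathbb A,\rho,\Phi_\rho)$ a right $H$-comodule algebra, and $\Phi_{\lambda,\rho}\in H\otimes\mathbb A\otimes H$ is invertible, $\Phi_{\lambda,\rho}^{-1}=\theta^1\otimes\theta^2\otimes\theta^3$, with $\Phi_{\lambda,\rho}(\lambda\otimes id)(\rho(u))=(id\otimes\rho)(\lambda(u))\Phi_{\lambda,\rho}$, $(1\otimes\Phi_{\lambda,\rho})(id\otimes\lambda\otimes id)(\Phi_{\lambda,\rho})(\Phi_\lambda\otimes1)=(id\otimes id\otimes\rho)(\Phi_\lambda)(\Delta\otimes id\otimes id)(\Phi_{\lambda,\rho})$, $(1\otimes\Phi_\rho)(id\otimes\rho\otimes id)(\Phi_{\lambda,\rho})(\Phi_{\lambda,\rho}\otimes1)=(id\otimes id\otimes\Delta)(\Phi_{\lambda,\rho})(\lambda\otimes id\otimes id)(\Phi_\rho)$. Iterated indices mean successive application of $\lambda,\rho,\Delta$. Generalized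 (left) diagonal crossed product: put $\Omega=\Omega^1\otimes\cdots\otimes\Omega^5=(\tilde X^1_\rho)_{[-1]_1}\tilde x^1_\lambda\theta^1\otimes(\tilde X^1_\rho)_{[-1]_2}\tilde x^2_\lambda\theta^2_{[-1]}\otimes(\tilde X^1_\rho)_{[0]}\tilde x^3_\lambda\theta^2_{[0]}\otimes S^{-1}(f^1\tilde X^2_\rho\theta^3)\otimes S^{-1}(f^2\tilde X^3_\rho)$; for an $H$-bimodule algebra $\mathcal A$, $\mathcal A\bowtie\mathbb A$ is $\mathcal A\otimes\mathbb A$ with the (associative, unital) multiplication $(\varphi\bowtie u)(\varphi'\bowtie u')=(\Omega^1\cdot\varphi\cdot\Omega^5)(\Omega^2u_{\langle0\rangle_{[-1]}}\cdot\varphi'\cdot S^{-1}(u_{\langle1\rangle})\Omega^4)\bowtie\Omega^3u_{\langle0\rangle_{[0]}}u'$. Two-sided generalized smash product: $A\blacktriangleright\!\!<\mathbb A>\!\!\blacktriangleleft B$ is $A\otimes\mathbb A\otimes B$ with the (associative, unital) multiplication $(a\blacktriangleright\!\!<u>\!\!\blacktriangleleft b)(a'\blacktriangleright\!\!<u'>\!\!\blacktriangleleft b')=(\tilde x^1_\lambda\cdot a)(\tilde x^2_\lambda u_{[-1]}\theta^1\cdot a')\blacktriangleright\!\!<\tilde x^3_\lambda u_{[0]}\theta^2u'_{\langle0\rangle}\tilde x^1_\rho>\!\!\blacktriangleleft(b\cdot\theta^3u'_{\langle1\rangle}\tilde x^2_\rho)(b'\cdot\tilde x^3_\rho)$. 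*)

theory Defs
  imports "HOL-Algebra.Module"
begin

section \<open>Tensor products over a field\<close>

text \<open>
  The carrier of \<open>M \<otimes> N\<close> consists of the classes of formal sums
  \<open>a\<^sub>1 \<otimes> b\<^sub>1 + \<dots> + a\<^sub>n \<otimes> b\<^sub>n\<close>, written as lists of pairs, modulo the congruence generated
  by commutativity and by the \<open>k\<close>-bilinearity relations. Scalars and signs need no symbols of
  their own, since \<open>c (a \<otimes> b) = c a \<otimes> b\<close>.
\<close>

inductive tensor_eq ::
  "('k, 'r) ring_scheme \<Rightarrow> ('k, 'a, 'm) module_scheme \<Rightarrow> ('k, 'b, 'n) module_scheme \<Rightarrow>
   ('a \<times> 'b) list \<Rightarrow> ('a \<times> 'b) list \<Rightarrow> bool"
  for k M N where
  refl: "xs \<in> lists (carrier M \<times> carrier N) \<Longrightarrow> tensor_eq k M N xs xs"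
| sym: "tensor_eq k M N xs ys \<Longrightarrow> tensor_eq k M N ys xs"
| trans: "tensor_eq k M N xs ys \<Longrightarrow> tensor_eq k M N ys zs \<Longrightarrow> tensor_eq k M N xs zs"
| append: "tensor_eq k M N xs ys \<Longrightarrow> tensor_eq k M N us vs \<Longrightarrow> tensor_eq k M N (xs @ us) (ys @ vs)"
| comm: "xs \<in> lists (carrier M \<times> carrier N) \<Longrightarrow> ys \<in> lists (carrier M \<times> carrier N) \<Longrightarrow>
    tensor_eq k M N (xs @ ys) (ys @ xs)"
| add_left: "a \<in> carrier M \<Longrightarrow> a' \<in> carrier M \<Longrightarrow> b \<in> carrier N \<Longrightarrow>
    tensor_eq k M N [(a \<oplus>\<^bsub>M\<^esub> a', b)] [(a, b), (a', b)]"
| add_right: "a \<in> carrier M \<Longrightarrow> b \<in> carrier N \<Longrightarrow> b' \<in> carrier N \<Longrightarrow>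
    tensor_eq k M N [(a, b \<oplus>\<^bsub>N\<^esub> b')] [(a, b), (a, b')]"
| balanced: "c \<in> carrier k \<Longrightarrow> a \<in> carrier M \<Longrightarrow> b \<in> carrier N \<Longrightarrow>
    tensor_eq k M N [(c \<odot>\<^bsub>M\<^esub> a, b)] [(a, c \<odot>\<^bsub>N\<^esub> b)]"
| zero: "b \<in> carrier N \<Longrightarrow> tensor_eq k M N [(\<zero>\<^bsub>M\<^esub>, b)] []"

type_synonym ('a, 'b) tens = "('a \<times> 'b) list set"

definition tensor_class ::
  "('k, 'r) ring_scheme \<Rightarrow> ('k, 'a, 'm) module_scheme \<Rightarrow> ('k, 'b, 'n) module_scheme \<Rightarrow>
   ('a \<times> 'b) list \<Rightarrow> ('a, 'b) tens"
  where "tensor_class k M N xs = {ys. tensor_eq k M N xs ys}"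

definition tensor_rep :: "('a, 'b) tens \<Rightarrow> ('a \<times> 'b) list"
  where "tensor_rep X = (SOME xs. xs \<in> X)"

definition tens ::
  "('k, 'r) ring_scheme \<Rightarrow> ('k, 'a, 'm) module_scheme \<Rightarrow> ('k, 'b, 'n) module_scheme \<Rightarrow>
   'a \<Rightarrow> 'b \<Rightarrow> ('a, 'b) tens"
  where "tens k M N a b = tensor_class k M N [(a, b)]"

text \<open>
  The multiplication of \<open>tensor k M N\<close> is the componentwise one,
  \<open>(a \<otimes> b) (c \<otimes> d) = a c \<otimes> b d\<close>, extended bilinearly; it is independent of the representatives
  when the multiplications of \<open>M\<close> and \<open>N\<close> are bilinear (associativity is not needed).
\<close>

definition tensor ::
  "('k, 'r) ring_scheme \<Rightarrow> ('k, 'a, 'm) module_scheme \<Rightarrow> ('k, 'b, 'n) module_scheme \<Rightarrow>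
   ('k, ('a, 'b) tens) module"
  where "tensor k M N =
    \<lparr>carrier = tensor_class k M N ` lists (carrier M \<times> carrier N),
     mult = (\<lambda>X Y. tensor_class k M N
       [(a \<otimes>\<^bsub>M\<^esub> c, b \<otimes>\<^bsub>N\<^esub> d). (a, b) \<leftarrow> tensor_rep X, (c, d) \<leftarrow> tensor_rep Y]),
     one = tens k M N \<one>\<^bsub>M\<^esub> \<one>\<^bsub>N\<^esub>,
     zero = tensor_class k M N [],
     add = (\<lambda>X Y. tensor_class k M N (tensor_rep X @ tensor_rep Y)),
     smult = (\<lambda>c X. tensor_class k M N [(c \<odot>\<^bsub>M\<^esub> a, b). (a, b) \<leftarrow> tensor_rep X])\<rparr>"

text \<open>
  Sweedler summation: for \<open>X = \<Sum>\<^sub>i a\<^sub>i \<otimes> b\<^sub>i\<close>, the value \<open>tsum P X f = \<Sum>\<^sub>i f a\<^sub>i b\<^sub>i\<close> in \<open>P\<close>.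
  It is independent of the representation of \<open>X\<close> whenever \<open>f\<close> is bilinear into \<open>P\<close>, and it is
  only used for such \<open>f\<close>. Iterated tensor products are nested to the right,
  \<open>M \<otimes> (N \<otimes> (P \<otimes> Q))\<close>.
\<close>

definition tsum :: "('p, 'z) ring_scheme \<Rightarrow> ('a, 'b) tens \<Rightarrow> ('a \<Rightarrow> 'b \<Rightarrow> 'p) \<Rightarrow> 'p"
  where "tsum P X f = foldr (\<lambda>(a, b) s. f a b \<oplus>\<^bsub>P\<^esub> s) (tensor_rep X) \<zero>\<^bsub>P\<^esub>"

abbreviation "tsum3 P X f \<equiv> tsum P X (\<lambda>a Y. tsum P Y (\<lambda>b c. f a b c))"
abbreviation "tsum4 P X f \<equiv> tsum P X (\<lambda>a Y. tsum3 P Y (\<lambda>b c d. f a b c d))"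
abbreviation "tsum5 P X f \<equiv> tsum P X (\<lambda>a Y. tsum4 P Y (\<lambda>b c d e. f a b c d e))"

abbreviation "tensor3 k M N P \<equiv> tensor k M (tensor k N P)"
abbreviation "tensor4 k M N P Q \<equiv> tensor k M (tensor3 k N P Q)"
abbreviation "tensor5 k M N P Q R \<equiv> tensor k M (tensor4 k N P Q R)"

abbreviation "tens3 k M N P a b c \<equiv> tens k M (tensor k N P) a (tens k N P b c)"
abbreviation "tens4 k M N P Q a b c d \<equiv> tens k M (tensor3 k N P Q) a (tens3 k N P Q b c d)"
abbreviation "tens5 k M N P Q R a b c d e \<equiv>
  tens k M (tensor4 k N P Q R) a (tens4 k N P Q R b c d e)"


section \<open>Algebras\<close>

definition bilinear_on ::
  "('k, 'r) ring_scheme \<Rightarrow> ('k, 'a, 'm) module_scheme \<Rightarrow> ('k, 'b, 'n) module_scheme \<Rightarrow>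
   ('k, 'c, 'p) module_scheme \<Rightarrow> ('a \<Rightarrow> 'b \<Rightarrow> 'c) \<Rightarrow> bool"
  where "bilinear_on k M N P f \<longleftrightarrow>
    (\<forall>a\<in>carrier M. \<forall>b\<in>carrier N. f a b \<in> carrier P) \<and>
    (\<forall>a\<in>carrier M. \<forall>a'\<in>carrier M. \<forall>b\<in>carrier N. f (a \<oplus>\<^bsub>M\<^esub> a') b = f a b \<oplus>\<^bsub>P\<^esub> f a' b) \<and>
    (\<forall>a\<in>carrier M. \<forall>b\<in>carrier N. \<forall>b'\<in>carrier N. f a (b \<oplus>\<^bsub>N\<^esub> b') = f a b \<oplus>\<^bsub>P\<^esub> f a b') \<and>
    (\<forall>c\<in>carrier k. \<forall>a\<in>carrier M. \<forall>b\<in>carrier N.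
      f (c \<odot>\<^bsub>M\<^esub> a) b = c \<odot>\<^bsub>P\<^esub> f a b \<and> f a (c \<odot>\<^bsub>N\<^esub> b) = c \<odot>\<^bsub>P\<^esub> f a b)"

locale unital_nonassoc_algebra = K: field k + module k A for k and A (structure) +
  assumes mult_bilinear: "bilinear_on k A A A (\<lambda>x y. x \<otimes> y)"
    and one_in_carrier: "\<one> \<in> carrier A"
    and mult_one_left: "x \<in> carrier A \<Longrightarrow> \<one> \<otimes> x = x"
    and mult_one_right: "x \<in> carrier A \<Longrightarrow> x \<otimes> \<one> = x"

locale unital_assoc_algebra = unital_nonassoc_algebra +
  assumes mult_assoc:
    "\<lbrakk>x \<in> carrier A; y \<in> carrier A; z \<in> carrier A\<rbrakk> \<Longrightarrow> (x \<otimes> y) \<otimes> z = x \<otimes> (y \<otimes> z)"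

definition alg_hom ::
  "('k, 'r) ring_scheme \<Rightarrow> ('k, 'a, 'm) module_scheme \<Rightarrow> ('k, 'b, 'n) module_scheme \<Rightarrow> ('a \<Rightarrow> 'b) set"
  where "alg_hom k A B =
    {F \<in> ring_hom A B. \<forall>c\<in>carrier k. \<forall>x\<in>carrier A. F (c \<odot>\<^bsub>A\<^esub> x) = c \<odot>\<^bsub>B\<^esub> F x}"

definition alg_iso ::
  "('k, 'r) ring_scheme \<Rightarrow> ('k, 'a, 'm) module_scheme \<Rightarrow> ('k, 'b, 'n) module_scheme \<Rightarrow> ('a \<Rightarrow> 'b) set"
  where "alg_iso k A B = {F \<in> alg_hom k A B. bij_betw F (carrier A) (carrier B)}"


section \<open>Quasi-bialgebras and quasi-Hopf algebras\<close>

record ('k, 'h) quasi_bialgebra = "('k, 'h) module" +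
  comul :: "'h \<Rightarrow> ('h, 'h) tens"
  counit :: "'h \<Rightarrow> 'k"
  reass :: "('h, ('h, 'h) tens) tens"

record ('k, 'h) quasi_hopf = "('k, 'h) quasi_bialgebra" +
  antip :: "'h \<Rightarrow> 'h"
  antip_alpha :: "'h"
  antip_beta :: "'h"

definition reass_inv ::
  "('k, 'r) ring_scheme \<Rightarrow> ('k, 'h, 'x) quasi_bialgebra_scheme \<Rightarrow> ('h, ('h, 'h) tens) tens"
  where "reass_inv k H = inv\<^bsub>tensor3 k H H H\<^esub> (reass H)"

locale quasi_bialgebra = unital_assoc_algebra k H
  for k :: "('k, 'r) ring_scheme" and H :: "('k, 'h, 'x) quasi_bialgebra_scheme" (structure) +
  assumes comul_hom: "comul H \<in> alg_hom k H (tensor k H H)"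
    and counit_hom: "counit H \<in> ring_hom H k"
    and counit_smult: "\<lbrakk>c \<in> carrier k; h \<in> carrier H\<rbrakk> \<Longrightarrow> counit H (c \<odot> h) = c \<otimes>\<^bsub>k\<^esub> counit H h"
    and reass_unit: "reass H \<in> Units (tensor3 k H H H)"
    and quasi_coassoc: "h \<in> carrier H \<Longrightarrow>
      tsum (tensor3 k H H H) (comul H h) (\<lambda>h1 h2.
        tsum (tensor3 k H H H) (comul H h2) (\<lambda>p q. tens3 k H H H h1 p q)) =
      reass H \<otimes>\<^bsub>tensor3 k H H H\<^esub>
      tsum (tensor3 k H H H) (comul H h) (\<lambda>h1 h2.
        tsum (tensor3 k H H H) (comul H h1) (\<lambda>p q. tens3 k H H H p q h2))
      \<otimes>\<^bsub>tensor3 k H H H\<^esub> reass_inv k H"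
    and counit_right: "h \<in> carrier H \<Longrightarrow> tsum H (comul H h) (\<lambda>h1 h2. counit H h2 \<odot> h1) = h"
    and counit_left: "h \<in> carrier H \<Longrightarrow> tsum H (comul H h) (\<lambda>h1 h2. counit H h1 \<odot> h2) = h"
    and pentagon:
      "tsum3 (tensor4 k H H H H) (reass H) (\<lambda>x y z. tens4 k H H H H \<one> x y z)
        \<otimes>\<^bsub>tensor4 k H H H H\<^esub>
       tsum3 (tensor4 k H H H H) (reass H) (\<lambda>x y z.
         tsum (tensor4 k H H H H) (comul H y) (\<lambda>p q. tens4 k H H H H x p q z))
        \<otimes>\<^bsub>tensor4 k H H H H\<^esub>
       tsum3 (tensor4 k H H H H) (reass H) (\<lambda>x y z. tens4 k H H H H x y z \<one>) =
       tsum3 (tensor4 k H H H H) (reass H) (\<lambda>x y z.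
         tsum (tensor4 k H H H H) (comul H z) (\<lambda>p q. tens4 k H H H H x y p q))
        \<otimes>\<^bsub>tensor4 k H H H H\<^esub>
       tsum3 (tensor4 k H H H H) (reass H) (\<lambda>x y z.
         tsum (tensor4 k H H H H) (comul H x) (\<lambda>p q. tens4 k H H H H p q y z))"
    and reass_counit:
      "tsum3 (tensor k H H) (reass H) (\<lambda>x y z. counit H y \<odot>\<^bsub>tensor k H H\<^esub> tens k H H x z)
        = tens k H H \<one> \<one>"

locale quasi_hopf_algebra = quasi_bialgebra k H
  for k :: "('k, 'r) ring_scheme" and H :: "('k, 'h, 'x) quasi_hopf_scheme" (structure) +
  assumes antip_bij: "bij_betw (antip H) (carrier H) (carrier H)"
    and antip_add: "\<lbrakk>g \<in> carrier H; h \<in> carrier H\<rbrakk> \<Longrightarrow> antip H (g \<oplus> h) = antip H g \<oplus> antip H h"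
    and antip_smult: "\<lbrakk>c \<in> carrier k; h \<in> carrier H\<rbrakk> \<Longrightarrow> antip H (c \<odot> h) = c \<odot> antip H h"
    and antip_mult: "\<lbrakk>g \<in> carrier H; h \<in> carrier H\<rbrakk> \<Longrightarrow> antip H (g \<otimes> h) = antip H h \<otimes> antip H g"
    and antip_one: "antip H \<one> = \<one>"
    and alpha_in_carrier: "antip_alpha H \<in> carrier H"
    and beta_in_carrier: "antip_beta H \<in> carrier H"
    and antip_alpha: "h \<in> carrier H \<Longrightarrow>
      tsum H (comul H h) (\<lambda>h1 h2. antip H h1 \<otimes> antip_alpha H \<otimes> h2) = counit H h \<odot> antip_alpha H"
    and antip_beta: "h \<in> carrier H \<Longrightarrow>
      tsum H (comul H h) (\<lambda>h1 h2. h1 \<otimes> antip_beta H \<otimes> antip H h2) = counit H h \<odot> antip_beta H"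
    and antip_reass:
      "tsum3 H (reass H) (\<lambda>x y z. x \<otimes> antip_beta H \<otimes> antip H y \<otimes> antip_alpha H \<otimes> z) = \<one>"
    and antip_reass_inv:
      "tsum3 H (reass_inv k H)
        (\<lambda>x y z. antip H x \<otimes> antip_alpha H \<otimes> y \<otimes> antip_beta H \<otimes> antip H z) = \<one>"
    and counit_alpha: "counit H (antip_alpha H) = \<one>\<^bsub>k\<^esub>"
    and counit_beta: "counit H (antip_beta H) = \<one>\<^bsub>k\<^esub>"
    and counit_antip: "h \<in> carrier H \<Longrightarrow> counit H (antip H h) = counit H h"

definition antip_inv :: "('k, 'h, 'x) quasi_hopf_scheme \<Rightarrow> 'h \<Rightarrow> 'h"
  where "antip_inv H = inv_into (carrier H) (antip H)"

text \<open>The Drinfeld twist \<open>f = (S \<otimes> S)(\<Delta>\<^sup>c\<^sup>o\<^sup>p(x\<^sup>1)) \<gamma> \<Delta>(x\<^sup>2 \<beta> S(x\<^sup>3))\<close>, where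
  \<open>\<gamma> = S(A\<^sup>2) \<alpha> A\<^sup>3 \<otimes> S(A\<^sup>1) \<alpha> A\<^sup>4\<close> for \<open>A = (\<Phi> \<otimes> 1)(\<Delta> \<otimes> id \<otimes> id)(\<Phi>\<inverse>)\<close>.\<close>

definition twist_A ::
  "('k, 'r) ring_scheme \<Rightarrow> ('k, 'h, 'x) quasi_hopf_scheme \<Rightarrow> ('h, ('h, ('h, 'h) tens) tens) tens"
  where "twist_A k H =
    tsum3 (tensor4 k H H H H) (reass H) (\<lambda>x y z. tens4 k H H H H x y z \<one>\<^bsub>H\<^esub>)
     \<otimes>\<^bsub>tensor4 k H H H H\<^esub>
    tsum3 (tensor4 k H H H H) (reass_inv k H) (\<lambda>x y z.
      tsum (tensor4 k H H H H) (comul H x) (\<lambda>p q. tens4 k H H H H p q y z))"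

definition twist_gamma ::
  "('k, 'r) ring_scheme \<Rightarrow> ('k, 'h, 'x) quasi_hopf_scheme \<Rightarrow> ('h, 'h) tens"
  where "twist_gamma k H = tsum4 (tensor k H H) (twist_A k H) (\<lambda>a1 a2 a3 a4.
    tens k H H
      (antip H a2 \<otimes>\<^bsub>H\<^esub> antip_alpha H \<otimes>\<^bsub>H\<^esub> a3)
      (antip H a1 \<otimes>\<^bsub>H\<^esub> antip_alpha H \<otimes>\<^bsub>H\<^esub> a4))"

definition drinfeld_twist ::
  "('k, 'r) ring_scheme \<Rightarrow> ('k, 'h, 'x) quasi_hopf_scheme \<Rightarrow> ('h, 'h) tens"
  where "drinfeld_twist k H = tsum3 (tensor k H H) (reass_inv k H) (\<lambda>x y z.
    tsum (tensor k H H) (comul H x) (\<lambda>x1 x2. tens k H H (antip H x2) (antip H x1))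
     \<otimes>\<^bsub>tensor k H H\<^esub> twist_gamma k H
     \<otimes>\<^bsub>tensor k H H\<^esub> comul H (y \<otimes>\<^bsub>H\<^esub> antip_beta H \<otimes>\<^bsub>H\<^esub> antip H z))"


section \<open>Module algebras\<close>

definition left_action ::
  "('k, 'r) ring_scheme \<Rightarrow> ('k, 'h, 'x) module_scheme \<Rightarrow> ('k, 'a, 'm) module_scheme \<Rightarrow>
   ('h \<Rightarrow> 'a \<Rightarrow> 'a) \<Rightarrow> bool"
  where "left_action k H A l \<longleftrightarrow> bilinear_on k H A A l \<and>
    (\<forall>a\<in>carrier A. l \<one>\<^bsub>H\<^esub> a = a) \<and>
    (\<forall>g\<in>carrier H. \<forall>h\<in>carrier H. \<forall>a\<in>carrier A. l (g \<otimes>\<^bsub>H\<^esub> h) a = l g (l h a))"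

definition right_action ::
  "('k, 'r) ring_scheme \<Rightarrow> ('k, 'h, 'x) module_scheme \<Rightarrow> ('k, 'b, 'm) module_scheme \<Rightarrow>
   ('b \<Rightarrow> 'h \<Rightarrow> 'b) \<Rightarrow> bool"
  where "right_action k H B r \<longleftrightarrow> bilinear_on k B H B r \<and>
    (\<forall>b\<in>carrier B. r b \<one>\<^bsub>H\<^esub> = b) \<and>
    (\<forall>g\<in>carrier H. \<forall>h\<in>carrier H. \<forall>b\<in>carrier B. r b (g \<otimes>\<^bsub>H\<^esub> h) = r (r b g) h)"

locale left_module_algebra = unital_nonassoc_algebra k A
  for k :: "('k, 'r) ring_scheme" and H :: "('k, 'h, 'x) quasi_bialgebra_scheme"
    and A :: "('k, 'a, 'm) module_scheme" (structure) and l :: "'h \<Rightarrow> 'a \<Rightarrow> 'a" +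
  assumes action: "left_action k H A l"
    and mult_quasi_assoc: "\<lbrakk>a \<in> carrier A; a' \<in> carrier A; a'' \<in> carrier A\<rbrakk> \<Longrightarrow>
      (a \<otimes> a') \<otimes> a'' = tsum3 A (reass H) (\<lambda>x y z. l x a \<otimes> (l y a' \<otimes> l z a''))"
    and action_mult: "\<lbrakk>h \<in> carrier H; a \<in> carrier A; a' \<in> carrier A\<rbrakk> \<Longrightarrow>
      l h (a \<otimes> a') = tsum A (comul H h) (\<lambda>h1 h2. l h1 a \<otimes> l h2 a')"
    and action_one: "h \<in> carrier H \<Longrightarrow> l h \<one> = counit H h \<odot> \<one>"

locale right_module_algebra = unital_nonassoc_algebra k B
  for k :: "('k, 'r) ring_scheme" and H :: "('k, 'h, 'x) quasi_bialgebra_scheme"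
    and B :: "('k, 'b, 'm) module_scheme" (structure) and r :: "'b \<Rightarrow> 'h \<Rightarrow> 'b" +
  assumes action: "right_action k H B r"
    and mult_quasi_assoc: "\<lbrakk>b \<in> carrier B; b' \<in> carrier B; b'' \<in> carrier B\<rbrakk> \<Longrightarrow>
      (b \<otimes> b') \<otimes> b'' = tsum3 B (reass_inv k H) (\<lambda>x y z. r b x \<otimes> (r b' y \<otimes> r b'' z))"
    and action_mult: "\<lbrakk>h \<in> carrier H; b \<in> carrier B; b' \<in> carrier B\<rbrakk> \<Longrightarrow>
      r (b \<otimes> b') h = tsum B (comul H h) (\<lambda>h1 h2. r b h1 \<otimes> r b' h2)"
    and action_one: "h \<in> carrier H \<Longrightarrow> r \<one> h = counit H h \<odot> \<one>"

locale bimodule_algebra = unital_nonassoc_algebra k C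
  for k :: "('k, 'r) ring_scheme" and H :: "('k, 'h, 'x) quasi_bialgebra_scheme"
    and C :: "('k, 'c, 'm) module_scheme" (structure)
    and l :: "'h \<Rightarrow> 'c \<Rightarrow> 'c" and r :: "'c \<Rightarrow> 'h \<Rightarrow> 'c" +
  assumes left_action: "left_action k H C l"
    and right_action: "right_action k H C r"
    and actions_commute: "\<lbrakk>h \<in> carrier H; h' \<in> carrier H; c \<in> carrier C\<rbrakk> \<Longrightarrow>
      r (l h c) h' = l h (r c h')"
    and mult_quasi_assoc: "\<lbrakk>c \<in> carrier C; c' \<in> carrier C; c'' \<in> carrier C\<rbrakk> \<Longrightarrow>
      (c \<otimes> c') \<otimes> c'' =
      tsum3 C (reass H) (\<lambda>X Y Z. tsum3 C (reass_inv k H) (\<lambda>x y z.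
        r (l X c) x \<otimes> (r (l Y c') y \<otimes> r (l Z c'') z)))"
    and left_action_mult: "\<lbrakk>h \<in> carrier H; c \<in> carrier C; c' \<in> carrier C\<rbrakk> \<Longrightarrow>
      l h (c \<otimes> c') = tsum C (comul H h) (\<lambda>h1 h2. l h1 c \<otimes> l h2 c')"
    and right_action_mult: "\<lbrakk>h \<in> carrier H; c \<in> carrier C; c' \<in> carrier C\<rbrakk> \<Longrightarrow>
      r (c \<otimes> c') h = tsum C (comul H h) (\<lambda>h1 h2. r c h1 \<otimes> r c' h2)"
    and left_action_one: "h \<in> carrier H \<Longrightarrow> l h \<one> = counit H h \<odot> \<one>"
    and right_action_one: "h \<in> carrier H \<Longrightarrow> r \<one> h = counit H h \<odot> \<one>"

text \<open>The actions \<open>h \<cdot> (a \<otimes> b) = h \<cdot> a \<otimes> b\<close> and \<open>(a \<otimes> b) \<cdot> h = a \<otimes> b \<cdot> h\<close> on \<open>A \<otimes> B\<close>.\<close>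

definition tensor_lact ::
  "('k, 'r) ring_scheme \<Rightarrow> ('k, 'a, 'm) module_scheme \<Rightarrow> ('k, 'b, 'n) module_scheme \<Rightarrow>
   ('h \<Rightarrow> 'a \<Rightarrow> 'a) \<Rightarrow> 'h \<Rightarrow> ('a, 'b) tens \<Rightarrow> ('a, 'b) tens"
  where "tensor_lact k A B l h X = tsum (tensor k A B) X (\<lambda>a b. tens k A B (l h a) b)"

definition tensor_ract ::
  "('k, 'r) ring_scheme \<Rightarrow> ('k, 'a, 'm) module_scheme \<Rightarrow> ('k, 'b, 'n) module_scheme \<Rightarrow>
   ('b \<Rightarrow> 'h \<Rightarrow> 'b) \<Rightarrow> ('a, 'b) tens \<Rightarrow> 'h \<Rightarrow> ('a, 'b) tens"
  where "tensor_ract k A B r X h = tsum (tensor k A B) X (\<lambda>a b. tens k A B a (r b h))"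


section \<open>Comodule algebras\<close>

record ('k, 'h, 'u) bicomodule_algebra = "('k, 'u) module" +
  lcoact :: "'u \<Rightarrow> ('h, 'u) tens"
  rcoact :: "'u \<Rightarrow> ('u, 'h) tens"
  lreass :: "('h, ('h, 'u) tens) tens"
  rreass :: "('u, ('h, 'h) tens) tens"
  lrreass :: "('h, ('u, 'h) tens) tens"

definition lreass_inv ::
  "('k, 'r) ring_scheme \<Rightarrow> ('k, 'h, 'x) module_scheme \<Rightarrow> ('k, 'h, 'u, 'y) bicomodule_algebra_scheme \<Rightarrow>
   ('h, ('h, 'u) tens) tens"
  where "lreass_inv k H U = inv\<^bsub>tensor3 k H H U\<^esub> (lreass U)"

definition rreass_inv ::
  "('k, 'r) ring_scheme \<Rightarrow> ('k, 'h, 'x) module_scheme \<Rightarrow> ('k, 'h, 'u, 'y) bicomodule_algebra_scheme \<Rightarrow>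
   ('u, ('h, 'h) tens) tens"
  where "rreass_inv k H U = inv\<^bsub>tensor3 k U H H\<^esub> (rreass U)"

definition lrreass_inv ::
  "('k, 'r) ring_scheme \<Rightarrow> ('k, 'h, 'x) module_scheme \<Rightarrow> ('k, 'h, 'u, 'y) bicomodule_algebra_scheme \<Rightarrow>
   ('h, ('u, 'h) tens) tens"
  where "lrreass_inv k H U = inv\<^bsub>tensor3 k H U H\<^esub> (lrreass U)"

locale right_comodule_algebra = unital_assoc_algebra k U
  for k :: "('k, 'r) ring_scheme" and H :: "('k, 'h, 'x) quasi_bialgebra_scheme"
    and U :: "('k, 'u, 'm) module_scheme" (structure)
    and rho :: "'u \<Rightarrow> ('u, 'h) tens" and Phi_r :: "('u, ('h, 'h) tens) tens" +
  assumes rho_hom: "rho \<in> alg_hom k U (tensor k U H)"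
    and Phi_r_unit: "Phi_r \<in> Units (tensor3 k U H H)"
    and rho_quasi_coassoc: "u \<in> carrier U \<Longrightarrow>
      Phi_r \<otimes>\<^bsub>tensor3 k U H H\<^esub>
      tsum (tensor3 k U H H) (rho u) (\<lambda>u0 u1.
        tsum (tensor3 k U H H) (rho u0) (\<lambda>p q. tens3 k U H H p q u1)) =
      tsum (tensor3 k U H H) (rho u) (\<lambda>u0 u1.
        tsum (tensor3 k U H H) (comul H u1) (\<lambda>p q. tens3 k U H H u0 p q))
      \<otimes>\<^bsub>tensor3 k U H H\<^esub> Phi_r"
    and rho_pentagon:
      "tsum3 (tensor4 k U H H H) (reass H) (\<lambda>x y z. tens4 k U H H H \<one> x y z)
        \<otimes>\<^bsub>tensor4 k U H H H\<^esub>
       tsum3 (tensor4 k U H H H) Phi_r (\<lambda>x y z.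
         tsum (tensor4 k U H H H) (comul H y) (\<lambda>p q. tens4 k U H H H x p q z))
        \<otimes>\<^bsub>tensor4 k U H H H\<^esub>
       tsum3 (tensor4 k U H H H) Phi_r (\<lambda>x y z. tens4 k U H H H x y z \<one>\<^bsub>H\<^esub>) =
       tsum3 (tensor4 k U H H H) Phi_r (\<lambda>x y z.
         tsum (tensor4 k U H H H) (comul H z) (\<lambda>p q. tens4 k U H H H x y p q))
        \<otimes>\<^bsub>tensor4 k U H H H\<^esub>
       tsum3 (tensor4 k U H H H) Phi_r (\<lambda>x y z.
         tsum (tensor4 k U H H H) (rho x) (\<lambda>p q. tens4 k U H H H p q y z))"
    and rho_counit: "u \<in> carrier U \<Longrightarrow> tsum U (rho u) (\<lambda>u0 u1. counit H u1 \<odot> u0) = u"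
    and Phi_r_counit_middle:
      "tsum3 (tensor k U H) Phi_r (\<lambda>x y z. counit H y \<odot>\<^bsub>tensor k U H\<^esub> tens k U H x z)
        = tens k U H \<one> \<one>\<^bsub>H\<^esub>"
    and Phi_r_counit_right:
      "tsum3 (tensor k U H) Phi_r (\<lambda>x y z. counit H z \<odot>\<^bsub>tensor k U H\<^esub> tens k U H x y)
        = tens k U H \<one> \<one>\<^bsub>H\<^esub>"

locale left_comodule_algebra = unital_assoc_algebra k U
  for k :: "('k, 'r) ring_scheme" and H :: "('k, 'h, 'x) quasi_bialgebra_scheme"
    and U :: "('k, 'u, 'm) module_scheme" (structure)
    and lam :: "'u \<Rightarrow> ('h, 'u) tens" and Phi_l :: "('h, ('h, 'u) tens) tens" +
  assumes lam_hom: "lam \<in> alg_hom k U (tensor k H U)"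
    and Phi_l_unit: "Phi_l \<in> Units (tensor3 k H H U)"
    and lam_quasi_coassoc: "u \<in> carrier U \<Longrightarrow>
      tsum (tensor3 k H H U) (lam u) (\<lambda>um u0.
        tsum (tensor3 k H H U) (lam u0) (\<lambda>p q. tens3 k H H U um p q))
      \<otimes>\<^bsub>tensor3 k H H U\<^esub> Phi_l =
      Phi_l \<otimes>\<^bsub>tensor3 k H H U\<^esub>
      tsum (tensor3 k H H U) (lam u) (\<lambda>um u0.
        tsum (tensor3 k H H U) (comul H um) (\<lambda>p q. tens3 k H H U p q u0))"
    and lam_pentagon:
      "tsum3 (tensor4 k H H H U) Phi_l (\<lambda>x y z. tens4 k H H H U \<one>\<^bsub>H\<^esub> x y z)
        \<otimes>\<^bsub>tensor4 k H H H U\<^esub>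
       tsum3 (tensor4 k H H H U) Phi_l (\<lambda>x y z.
         tsum (tensor4 k H H H U) (comul H y) (\<lambda>p q. tens4 k H H H U x p q z))
        \<otimes>\<^bsub>tensor4 k H H H U\<^esub>
       tsum3 (tensor4 k H H H U) (reass H) (\<lambda>x y z. tens4 k H H H U x y z \<one>) =
       tsum3 (tensor4 k H H H U) Phi_l (\<lambda>x y z.
         tsum (tensor4 k H H H U) (lam z) (\<lambda>p q. tens4 k H H H U x y p q))
        \<otimes>\<^bsub>tensor4 k H H H U\<^esub>
       tsum3 (tensor4 k H H H U) Phi_l (\<lambda>x y z.
         tsum (tensor4 k H H H U) (comul H x) (\<lambda>p q. tens4 k H H H U p q y z))"
    and lam_counit: "u \<in> carrier U \<Longrightarrow> tsum U (lam u) (\<lambda>um u0. counit H um \<odot> u0) = u"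
    and Phi_l_counit_middle:
      "tsum3 (tensor k H U) Phi_l (\<lambda>x y z. counit H y \<odot>\<^bsub>tensor k H U\<^esub> tens k H U x z)
        = tens k H U \<one>\<^bsub>H\<^esub> \<one>"
    and Phi_l_counit_left:
      "tsum3 (tensor k H U) Phi_l (\<lambda>x y z. counit H x \<odot>\<^bsub>tensor k H U\<^esub> tens k H U y z)
        = tens k H U \<one>\<^bsub>H\<^esub> \<one>"

locale bicomodule_algebra =
  left_comodule_algebra k H U "lcoact U" "lreass U" +
  right_comodule_algebra k H U "rcoact U" "rreass U"
  for k :: "('k, 'r) ring_scheme" and H :: "('k, 'h, 'x) quasi_bialgebra_scheme"
    and U :: "('k, 'h, 'u, 'y) bicomodule_algebra_scheme" (structure) +
  assumes lrreass_unit: "lrreass U \<in> Units (tensor3 k H U H)"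
    and coactions_quasi_commute: "u \<in> carrier U \<Longrightarrow>
      lrreass U \<otimes>\<^bsub>tensor3 k H U H\<^esub>
      tsum (tensor3 k H U H) (rcoact U u) (\<lambda>u0 u1.
        tsum (tensor3 k H U H) (lcoact U u0) (\<lambda>p q. tens3 k H U H p q u1)) =
      tsum (tensor3 k H U H) (lcoact U u) (\<lambda>um u0.
        tsum (tensor3 k H U H) (rcoact U u0) (\<lambda>p q. tens3 k H U H um p q))
      \<otimes>\<^bsub>tensor3 k H U H\<^esub> lrreass U"
    and left_mixed_pentagon:
      "tsum3 (tensor4 k H H U H) (lrreass U) (\<lambda>x y z. tens4 k H H U H \<one>\<^bsub>H\<^esub> x y z)
        \<otimes>\<^bsub>tensor4 k H H U H\<^esub>
       tsum3 (tensor4 k H H U H) (lrreass U) (\<lambda>x y z.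
         tsum (tensor4 k H H U H) (lcoact U y) (\<lambda>p q. tens4 k H H U H x p q z))
        \<otimes>\<^bsub>tensor4 k H H U H\<^esub>
       tsum3 (tensor4 k H H U H) (lreass U) (\<lambda>x y z. tens4 k H H U H x y z \<one>\<^bsub>H\<^esub>) =
       tsum3 (tensor4 k H H U H) (lreass U) (\<lambda>x y z.
         tsum (tensor4 k H H U H) (rcoact U z) (\<lambda>p q. tens4 k H H U H x y p q))
        \<otimes>\<^bsub>tensor4 k H H U H\<^esub>
       tsum3 (tensor4 k H H U H) (lrreass U) (\<lambda>x y z.
         tsum (tensor4 k H H U H) (comul H x) (\<lambda>p q. tens4 k H H U H p q y z))"
    and right_mixed_pentagon:
      "tsum3 (tensor4 k H U H H) (rreass U) (\<lambda>x y z. tens4 k H U H H \<one>\<^bsub>H\<^esub> x y z)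
        \<otimes>\<^bsub>tensor4 k H U H H\<^esub>
       tsum3 (tensor4 k H U H H) (lrreass U) (\<lambda>x y z.
         tsum (tensor4 k H U H H) (rcoact U y) (\<lambda>p q. tens4 k H U H H x p q z))
        \<otimes>\<^bsub>tensor4 k H U H H\<^esub>
       tsum3 (tensor4 k H U H H) (lrreass U) (\<lambda>x y z. tens4 k H U H H x y z \<one>\<^bsub>H\<^esub>) =
       tsum3 (tensor4 k H U H H) (lrreass U) (\<lambda>x y z.
         tsum (tensor4 k H U H H) (comul H z) (\<lambda>p q. tens4 k H U H H x y p q))
        \<otimes>\<^bsub>tensor4 k H U H H\<^esub>
       tsum3 (tensor4 k H U H H) (rreass U) (\<lambda>x y z.
         tsum (tensor4 k H U H H) (lcoact U x) (\<lambda>p q. tens4 k H U H H p q y z))"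


section \<open>Crossed and smash products\<close>

text \<open>
  Below \<open>X\<close>, \<open>xl\<close>, \<open>t\<close> and \<open>f\<close> run over \<open>\<Phi>\<^sub>\<rho>\<close>, \<open>\<Phi>\<^sub>\<lambda>\<inverse>\<close>, \<open>\<Phi>\<^sub>\<lambda>\<^sub>,\<^sub>\<rho>\<inverse>\<close> and the Drinfeld twist;
  \<open>Xm \<otimes> X0 = \<lambda>(X1)\<close>, \<open>Xm1 \<otimes> Xm2 = \<Delta>(Xm)\<close> and \<open>tm \<otimes> t0 = \<lambda>(t2)\<close>.
\<close>

definition Omega ::
  "('k, 'r) ring_scheme \<Rightarrow> ('k, 'h, 'x) quasi_hopf_scheme \<Rightarrow>
   ('k, 'h, 'u, 'y) bicomodule_algebra_scheme \<Rightarrow>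
   ('h, ('h, ('u, ('h, 'h) tens) tens) tens) tens"
  where "Omega k H U = (let T = tensor5 k H H U H H in
    tsum3 T (rreass U) (\<lambda>X1 X2 X3.
    tsum T (lcoact U X1) (\<lambda>Xm X0.
    tsum T (comul H Xm) (\<lambda>Xm1 Xm2.
    tsum3 T (lreass_inv k H U) (\<lambda>xl1 xl2 xl3.
    tsum3 T (lrreass_inv k H U) (\<lambda>t1 t2 t3.
    tsum T (lcoact U t2) (\<lambda>tm t0.
    tsum T (drinfeld_twist k H) (\<lambda>f1 f2.
      tens5 k H H U H H
        (Xm1 \<otimes>\<^bsub>H\<^esub> xl1 \<otimes>\<^bsub>H\<^esub> t1)
        (Xm2 \<otimes>\<^bsub>H\<^esub> xl2 \<otimes>\<^bsub>H\<^esub> tm)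
        (X0 \<otimes>\<^bsub>U\<^esub> xl3 \<otimes>\<^bsub>U\<^esub> t0)
        (antip_inv H (f1 \<otimes>\<^bsub>H\<^esub> X2 \<otimes>\<^bsub>H\<^esub> t3))
        (antip_inv H (f2 \<otimes>\<^bsub>H\<^esub> X3))))))))))"

text \<open>The generalized diagonal crossed product of an \<open>H\<close>-bimodule algebra \<open>C\<close> (with actions
  \<open>l\<close>, \<open>r\<close>) and an \<open>H\<close>-bicomodule algebra \<open>U\<close>: the vector space \<open>C \<otimes> U\<close> with unit \<open>1 \<otimes> 1\<close> and
  a new multiplication.\<close>

definition diag_crossed_mult ::
  "('k, 'r) ring_scheme \<Rightarrow> ('k, 'h, 'x) quasi_hopf_scheme \<Rightarrow> ('k, 'c, 'm) module_scheme \<Rightarrow>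
   ('h \<Rightarrow> 'c \<Rightarrow> 'c) \<Rightarrow> ('c \<Rightarrow> 'h \<Rightarrow> 'c) \<Rightarrow> ('k, 'h, 'u, 'y) bicomodule_algebra_scheme \<Rightarrow>
   ('c, 'u) tens \<Rightarrow> ('c, 'u) tens \<Rightarrow> ('c, 'u) tens"
  where "diag_crossed_mult k H C l r U P Q = (let T = tensor k C U in
    tsum T P (\<lambda>c u. tsum T Q (\<lambda>c' u'.
    tsum5 T (Omega k H U) (\<lambda>o1 o2 o3 o4 o5.
    tsum T (rcoact U u) (\<lambda>u0 u1.
    tsum T (lcoact U u0) (\<lambda>u0m u00.
      tens k C U
        (r (l o1 c) o5 \<otimes>\<^bsub>C\<^esub> r (l (o2 \<otimes>\<^bsub>H\<^esub> u0m) c') (antip_inv H u1 \<otimes>\<^bsub>H\<^esub> o4))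
        (o3 \<otimes>\<^bsub>U\<^esub> u00 \<otimes>\<^bsub>U\<^esub> u')))))))"

definition diag_crossed_product ::
  "('k, 'r) ring_scheme \<Rightarrow> ('k, 'h, 'x) quasi_hopf_scheme \<Rightarrow> ('k, 'c, 'm) module_scheme \<Rightarrow>
   ('h \<Rightarrow> 'c \<Rightarrow> 'c) \<Rightarrow> ('c \<Rightarrow> 'h \<Rightarrow> 'c) \<Rightarrow> ('k, 'h, 'u, 'y) bicomodule_algebra_scheme \<Rightarrow>
   ('k, ('c, 'u) tens) module"
  where "diag_crossed_product k H C l r U =
    (tensor k C U)\<lparr>mult := diag_crossed_mult k H C l r U\<rparr>"

text \<open>The two-sided generalized smash product of a left \<open>H\<close>-module algebra \<open>A\<close>, an
  \<open>H\<close>-bicomodule algebra \<open>U\<close> and a right \<open>H\<close>-module algebra \<open>B\<close>, on the vector space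
  \<open>A \<otimes> (U \<otimes> B)\<close>.\<close>

definition two_sided_smash_mult ::
  "('k, 'r) ring_scheme \<Rightarrow> ('k, 'h, 'x) quasi_hopf_scheme \<Rightarrow> ('k, 'a, 'm) module_scheme \<Rightarrow>
   ('h \<Rightarrow> 'a \<Rightarrow> 'a) \<Rightarrow> ('k, 'h, 'u, 'y) bicomodule_algebra_scheme \<Rightarrow>
   ('k, 'b, 'n) module_scheme \<Rightarrow> ('b \<Rightarrow> 'h \<Rightarrow> 'b) \<Rightarrow>
   ('a, ('u, 'b) tens) tens \<Rightarrow> ('a, ('u, 'b) tens) tens \<Rightarrow> ('a, ('u, 'b) tens) tens"
  where "two_sided_smash_mult k H A l U B r P Q = (let T = tensor3 k A U B in
    tsum3 T P (\<lambda>a u b. tsum3 T Q (\<lambda>a' u' b'.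
    tsum3 T (lreass_inv k H U) (\<lambda>xl1 xl2 xl3.
    tsum3 T (lrreass_inv k H U) (\<lambda>t1 t2 t3.
    tsum3 T (rreass_inv k H U) (\<lambda>xr1 xr2 xr3.
    tsum T (lcoact U u) (\<lambda>um u0.
    tsum T (rcoact U u') (\<lambda>u'0 u'1.
      tens3 k A U B
        (l xl1 a \<otimes>\<^bsub>A\<^esub> l (xl2 \<otimes>\<^bsub>H\<^esub> um \<otimes>\<^bsub>H\<^esub> t1) a')
        (xl3 \<otimes>\<^bsub>U\<^esub> u0 \<otimes>\<^bsub>U\<^esub> t2 \<otimes>\<^bsub>U\<^esub> u'0 \<otimes>\<^bsub>U\<^esub> xr1)
        (r b (t3 \<otimes>\<^bsub>H\<^esub> u'1 \<otimes>\<^bsub>H\<^esub> xr2) \<otimes>\<^bsub>B\<^esub> r b' xr3)))))))))"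

definition two_sided_smash_product ::
  "('k, 'r) ring_scheme \<Rightarrow> ('k, 'h, 'x) quasi_hopf_scheme \<Rightarrow> ('k, 'a, 'm) module_scheme \<Rightarrow>
   ('h \<Rightarrow> 'a \<Rightarrow> 'a) \<Rightarrow> ('k, 'h, 'u, 'y) bicomodule_algebra_scheme \<Rightarrow>
   ('k, 'b, 'n) module_scheme \<Rightarrow> ('b \<Rightarrow> 'h \<Rightarrow> 'b) \<Rightarrow>
   ('k, ('a, ('u, 'b) tens) tens) module"
  where "two_sided_smash_product k H A l U B r =
    (tensor3 k A U B)\<lparr>mult := two_sided_smash_mult k H A l U B r\<rparr>"

end

theory Submission
  imports Defs
begin

text \<open>
  Let \<open>q = X\<^sup>1 \<otimes> S\<inverse>(\<alpha> X\<^sup>3) X\<^sup>2\<close> and \<open>p = x\<^sup>1 \<otimes> x\<^sup>2 \<beta> S(x\<^sup>3)\<close> for \<open>X = \<Phi>\<^sub>\<rho>\<close>, \<open>x = \<Phi>\<^sub>\<rho>\<inverse>\<close>, and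
  let \<open>\<theta>\<close> be the inverse of \<open>\<Phi>\<^sub>\<lambda>\<^sub>,\<^sub>\<rho>\<close>. Put \<open>g(u) = (\<lambda> \<otimes> id)(q) \<theta> (1 \<otimes> \<rho>(u))\<close> in \<open>H \<otimes> U \<otimes> H\<close>.
  The map \<open>G((a \<otimes> b) \<bowtie> u) = g\<^sup>1 \<cdot> a \<otimes> g\<^sup>2 \<otimes> b \<cdot> g\<^sup>3\<close> is the isomorphism from the crossed product
  to the smash product, and \<open>F(a \<otimes> u \<otimes> b) = (w\<^sup>1 \<cdot> a \<otimes> b \<cdot> S\<inverse>(w\<^sup>3)) \<bowtie> w\<^sup>2\<close> with
  \<open>w = \<theta> (1 \<otimes> \<rho>(u) p)\<close> is its inverse, by the relations between \<open>q\<close>, \<open>p\<close> and \<open>\<rho>\<close>.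
  Both multiplications are evaluated by elements of \<open>H \<otimes> H \<otimes> U \<otimes> H \<otimes> H\<close>, so
  multiplicativity of \<open>G\<close> is an identity in that algebra. Its core is the formula for
  \<open>(q \<otimes> 1) (\<rho> \<otimes> id)(q) \<Phi>\<^sub>\<rho>\<inverse>\<close> in terms of the Drinfeld twist \<open>f\<close> (\<open>twist_q_rho\<close>), which follows from
  \<open>f \<Delta>(S(h)) = (S \<otimes> S)(\<Delta>\<^sup>c\<^sup>o\<^sup>p(h)) f\<close> and \<open>f \<Delta>(\<alpha>) = \<gamma>\<close>; the mixed pentagons move everything
  else into the shape of \<open>\<Omega>\<close>.
\<close>

text \<open>Two obstacles shape the proof. The value of \<open>tsum\<close> is read off an
  arbitrarily chosen representative, so a Sweedler sum can be rearranged only after it has been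
  recognised as a linear map applied to its tensor. Sums are therefore traded for composites of slot
  maps, and axioms for equations between products in iterated tensor products. Secondly, S\<inverse>
  and the right action on \<open>B\<close> place the last component of a tensor on the left, while
  its companions act from the right. A sum of this kind over \<theta> or \<rho>(u) is not
  multiplication by an element; it is kept as a linear operator, as in
  \<open>iso_coeff0_move\<close> and \<open>theta_sum\<close>, until a mixed pentagon or the
  compatibility of the coactions turns it into a product. The contractions S(x) \<alpha> y and x
  \<beta> S(y) behind q and p are not multiplicative either, but they absorb a factor \<Delta>(h) at
  the price of \<epsilon>(h). The relations for f, q and p follow one pattern: rearrange a pentagon
  or a coassociativity law, contract it, and let the absorbed factors become units by the counit
  identities.\<close>

named_theorems additivity

section \<open>Linear maps on tensor products\<close>

definition lin ::
  "('k, 'r) ring_scheme \<Rightarrow> ('k, 'a, 'm) module_scheme \<Rightarrow> ('k, 'b, 'n) module_scheme \<Rightarrow> ('a \<Rightarrow> 'b) set"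
  where "lin k M N = {f \<in> carrier M \<rightarrow> carrier N.
    (\<forall>x\<in>carrier M. \<forall>y\<in>carrier M. f (x \<oplus>\<^bsub>M\<^esub> y) = f x \<oplus>\<^bsub>N\<^esub> f y) \<and>
    (\<forall>c\<in>carrier k. \<forall>x\<in>carrier M. f (c \<odot>\<^bsub>M\<^esub> x) = c \<odot>\<^bsub>N\<^esub> f x)}"

lemma linI:
  assumes "\<And>x. x \<in> carrier M \<Longrightarrow> f x \<in> carrier N"
    and "\<And>x y. x \<in> carrier M \<Longrightarrow> y \<in> carrier M \<Longrightarrow> f (x \<oplus>\<^bsub>M\<^esub> y) = f x \<oplus>\<^bsub>N\<^esub> f y"
    and "\<And>c x. c \<in> carrier k \<Longrightarrow> x \<in> carrier M \<Longrightarrow> f (c \<odot>\<^bsub>M\<^esub> x) = c \<odot>\<^bsub>N\<^esub> f x"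
  shows "f \<in> lin k M N"
  using assms by (auto simp: lin_def)

lemma lin_closed: "f \<in> lin k M N \<Longrightarrow> x \<in> carrier M \<Longrightarrow> f x \<in> carrier N"
  and lin_add: "f \<in> lin k M N \<Longrightarrow> x \<in> carrier M \<Longrightarrow> y \<in> carrier M \<Longrightarrow> f (x \<oplus>\<^bsub>M\<^esub> y) = f x \<oplus>\<^bsub>N\<^esub> f y"
  and lin_smult: "f \<in> lin k M N \<Longrightarrow> c \<in> carrier k \<Longrightarrow> x \<in> carrier M \<Longrightarrow> f (c \<odot>\<^bsub>M\<^esub> x) = c \<odot>\<^bsub>N\<^esub> f x"
  by (auto simp: lin_def)

text \<open>With the module as a premise instead of a locale context, these closure facts can serve
  as simplification rules for all iterated tensor products at once; the premise is discharged by
  rewriting.\<close>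

lemma moduleD:
  assumes "module k M"
  shows "x \<in> carrier M \<Longrightarrow> y \<in> carrier M \<Longrightarrow> x \<oplus>\<^bsub>M\<^esub> y \<in> carrier M"
    and "\<zero>\<^bsub>M\<^esub> \<in> carrier M"
    and "c \<in> carrier k \<Longrightarrow> x \<in> carrier M \<Longrightarrow> c \<odot>\<^bsub>M\<^esub> x \<in> carrier M"
    and "x \<in> carrier M \<Longrightarrow> \<ominus>\<^bsub>M\<^esub> x \<in> carrier M"
proof -
  interpret module k M by fact
  show "x \<in> carrier M \<Longrightarrow> y \<in> carrier M \<Longrightarrow> x \<oplus>\<^bsub>M\<^esub> y \<in> carrier M"
    "\<zero>\<^bsub>M\<^esub> \<in> carrier M" "c \<in> carrier k \<Longrightarrow> x \<in> carrier M \<Longrightarrow> c \<odot>\<^bsub>M\<^esub> x \<in> carrier M"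
    "x \<in> carrier M \<Longrightarrow> \<ominus>\<^bsub>M\<^esub> x \<in> carrier M"
    by auto
qed

lemma lin_zero:
  assumes "f \<in> lin k M N" "module k M" "module k N"
  shows "f \<zero>\<^bsub>M\<^esub> = \<zero>\<^bsub>N\<^esub>"
proof -
  interpret M: module k M by fact
  interpret N: module k N by fact
  have z: "f \<zero>\<^bsub>M\<^esub> \<in> carrier N" using assms(1) by (simp add: lin_closed)
  have "f \<zero>\<^bsub>M\<^esub> \<oplus>\<^bsub>N\<^esub> f \<zero>\<^bsub>M\<^esub> = f \<zero>\<^bsub>M\<^esub>"
    using lin_add[OF assms(1), of "\<zero>\<^bsub>M\<^esub>" "\<zero>\<^bsub>M\<^esub>"] by simp
  then show ?thesis using z N.add.l_cancel_one' by metis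
qed

text \<open>\<open>tsum\<close> before the choice of a representative: a function of the list, open
  to list induction.\<close>

definition pair_sum :: "('p, 'z) ring_scheme \<Rightarrow> ('a \<Rightarrow> 'b \<Rightarrow> 'p) \<Rightarrow> ('a \<times> 'b) list \<Rightarrow> 'p"
  where "pair_sum P f xs = foldr (\<lambda>(a, b) s. f a b \<oplus>\<^bsub>P\<^esub> s) xs \<zero>\<^bsub>P\<^esub>"

lemma pair_sum_simps [simp]:
  "pair_sum P f [] = \<zero>\<^bsub>P\<^esub>"
  "pair_sum P f (ab # xs) = f (fst ab) (snd ab) \<oplus>\<^bsub>P\<^esub> pair_sum P f xs"
  by (simp_all add: pair_sum_def case_prod_beta)

lemma tsum_pair_sum: "tsum P X f = pair_sum P f (tensor_rep X)"
  by (simp add: tsum_def pair_sum_def)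

lemma pair_sum_closed:
  assumes "module k P" "\<And>a b. a \<in> M \<Longrightarrow> b \<in> N \<Longrightarrow> f a b \<in> carrier P" "xs \<in> lists (M \<times> N)"
  shows "pair_sum P f xs \<in> carrier P"
  using assms(3) by (induct xs) (auto simp: moduleD[OF assms(1)] assms(2))

lemma pair_sum_append:
  assumes "module k P" "\<And>a b. a \<in> M \<Longrightarrow> b \<in> N \<Longrightarrow> f a b \<in> carrier P"
    "xs \<in> lists (M \<times> N)" "ys \<in> lists (M \<times> N)"
  shows "pair_sum P f (xs @ ys) = pair_sum P f xs \<oplus>\<^bsub>P\<^esub> pair_sum P f ys"
proof -
  interpret P: module k P by fact
  note c = pair_sum_closed[OF assms(1,2)]
  show ?thesis using assms(3)
    by (induct xs) (simp_all add: mem_Times_iff assms c P.a_assoc)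
qed

lemma tensor_eq_carrier:
  assumes "tensor_eq k M N xs ys" "module k M" "module k N"
  shows "xs \<in> lists (carrier M \<times> carrier N) \<and> ys \<in> lists (carrier M \<times> carrier N)"
  using assms(1)
  by induct (auto simp: moduleD[OF assms(2)] moduleD[OF assms(3)])

text \<open>Induction over the generating relations: additivity in each argument, balancedness and
  commutativity of addition match them one by one. This is what makes \<open>tsum\<close>
  independent of the chosen representative.\<close>

lemma pair_sum_tensor_eq:
  assumes "tensor_eq k M N xs ys" and MNP: "module k M" "module k N" "module k P"
    and bil: "bilinear_on k M N P f"
  shows "pair_sum P f xs = pair_sum P f ys"
proof -
  interpret M: module k M by fact
  interpret N: module k N by fact
  interpret P: module k P by fact
  have f [simp]: "\<And>a b. a \<in> carrier M \<Longrightarrow> b \<in> carrier N \<Longrightarrow> f a b \<in> carrier P"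
    using bil by (auto simp: bilinear_on_def)
  note cl [simp] = pair_sum_closed[OF MNP(3) f]
  note app = pair_sum_append[OF MNP(3) f]
  \<comment> \<open>The relation \<open>zero\<close> has no counterpart among the clauses of
    \<open>bilinear_on\<close>; additivity in the first argument supplies it.\<close>
  have fz: "f \<zero>\<^bsub>M\<^esub> b = \<zero>\<^bsub>P\<^esub>" if b: "b \<in> carrier N" for b
    by (rule lin_zero[OF _ MNP(1,3)]) (use bil b in \<open>auto simp: bilinear_on_def lin_def\<close>)
  show ?thesis using assms(1)
  proof induct
    case (append xs ys us vs)
    show ?case
      using tensor_eq_carrier[OF append(1) MNP(1,2)] tensor_eq_carrier[OF append(3) MNP(1,2)] append
      by (simp add: app)
  next
    case (comm xs ys)
    then show ?case by (simp add: app P.a_comm)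
  qed (use bil in \<open>auto simp: fz bilinear_on_def P.a_assoc\<close>)
qed

lemma tensor_class_eq_iff:
  assumes "module k M" "module k N" "xs \<in> lists (carrier M \<times> carrier N)"
  shows "tensor_class k M N xs = tensor_class k M N ys \<longleftrightarrow> tensor_eq k M N xs ys"
proof
  assume *: "tensor_class k M N xs = tensor_class k M N ys"
  have "xs \<in> tensor_class k M N xs" using assms(3) by (simp add: tensor_class_def tensor_eq.refl)
  then have "tensor_eq k M N ys xs" unfolding * by (simp add: tensor_class_def)
  then show "tensor_eq k M N xs ys" by (rule tensor_eq.sym)
next
  assume "tensor_eq k M N xs ys"
  then show "tensor_class k M N xs = tensor_class k M N ys"
    by (auto simp: tensor_class_def intro: tensor_eq.sym tensor_eq.trans)
qed

lemma tensor_rep_class: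
  assumes "module k M" "module k N" "xs \<in> lists (carrier M \<times> carrier N)"
  shows "tensor_eq k M N xs (tensor_rep (tensor_class k M N xs))"
proof -
  have "xs \<in> tensor_class k M N xs" using assms(3) by (simp add: tensor_class_def tensor_eq.refl)
  then have "tensor_rep (tensor_class k M N xs) \<in> tensor_class k M N xs"
    unfolding tensor_rep_def by (rule someI)
  then show ?thesis by (simp add: tensor_class_def)
qed

lemma tensor_carrier: "carrier (tensor k M N) = tensor_class k M N ` lists (carrier M \<times> carrier N)"
  by (simp add: tensor_def)

lemma tensor_rep:
  assumes "module k M" "module k N" "X \<in> carrier (tensor k M N)"
  shows "tensor_rep X \<in> lists (carrier M \<times> carrier N)"
    and "tensor_class k M N (tensor_rep X) = X"
proof -
  obtain xs where xs: "xs \<in> lists (carrier M \<times> carrier N)" and X: "X = tensor_class k M N xs"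
    using assms(3) by (auto simp: tensor_carrier)
  have e: "tensor_eq k M N xs (tensor_rep X)" unfolding X by (rule tensor_rep_class[OF assms(1,2) xs])
  show "tensor_rep X \<in> lists (carrier M \<times> carrier N)"
    using tensor_eq_carrier[OF e assms(1,2)] by simp
  show "tensor_class k M N (tensor_rep X) = X"
    using e tensor_class_eq_iff[OF assms(1,2) xs] X by metis
qed

text \<open>Scaling the left entries sends each generating relation to an instance of the same
  relation, so \<open>smult\<close> does not depend on the representative. The balanced case has to
  exchange two scalars, by commutativity of \<open>k\<close>.\<close>

lemma tensor_eq_map_smult:
  assumes "tensor_eq k M N xs ys" "module k M" "module k N" "c \<in> carrier k"
  shows "tensor_eq k M N [(c \<odot>\<^bsub>M\<^esub> a, b). (a, b) \<leftarrow> xs] [(c \<odot>\<^bsub>M\<^esub> a, b). (a, b) \<leftarrow> ys]"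
proof -
  interpret M: module k M by fact
  interpret N: module k N by fact
  have l: "map (\<lambda>(a, b). (c \<odot>\<^bsub>M\<^esub> a, b)) zs \<in> lists (carrier M \<times> carrier N)"
    if "zs \<in> lists (carrier M \<times> carrier N)" for zs
    using that assms(4) by (induct zs) auto
  show ?thesis using assms(1)
  proof induct
    case (trans xs ys zs)
    then show ?case by (blast intro: tensor_eq.trans)
  next
    case (comm xs ys)
    then show ?case using l by (auto intro!: tensor_eq.comm)
  next
    case (balanced d a b)
    then have "tensor_eq k M N [(d \<odot>\<^bsub>M\<^esub> (c \<odot>\<^bsub>M\<^esub> a), b)] [(c \<odot>\<^bsub>M\<^esub> a, d \<odot>\<^bsub>N\<^esub> b)]"
      using assms(4) by (auto intro!: tensor_eq.balanced)
    moreover have "d \<odot>\<^bsub>M\<^esub> (c \<odot>\<^bsub>M\<^esub> a) = c \<odot>\<^bsub>M\<^esub> (d \<odot>\<^bsub>M\<^esub> a)"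
      using balanced assms(4) by (metis M.smult_assoc1 M.R.m_comm)
    ultimately show ?case by simp
  qed (use assms(4) l in \<open>auto intro: tensor_eq.intros simp: M.smult_r_distr M.smult_r_null\<close>)
qed

section \<open>The tensor product as a module, and linearity of Sweedler sums\<close>

context
  fixes k M N
  assumes M: "module k M" and N: "module k N"
begin

private abbreviation "L \<equiv> lists (carrier M \<times> carrier N)"

lemma tensor_add_class:
  assumes "xs \<in> L" "ys \<in> L"
  shows "tensor_class k M N xs \<oplus>\<^bsub>tensor k M N\<^esub> tensor_class k M N ys = tensor_class k M N (xs @ ys)"
proof -
  have "tensor_eq k M N (xs @ ys)
    (tensor_rep (tensor_class k M N xs) @ tensor_rep (tensor_class k M N ys))"
    using assms tensor_rep_class[OF M N] by (intro tensor_eq.append)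
  then show ?thesis
    using assms by (simp add: tensor_def) (metis append_in_lists_conv tensor_class_eq_iff[OF M N])
qed

lemma tensor_smult_class:
  assumes "xs \<in> L" "c \<in> carrier k"
  shows "c \<odot>\<^bsub>tensor k M N\<^esub> tensor_class k M N xs = tensor_class k M N [(c \<odot>\<^bsub>M\<^esub> a, b). (a, b) \<leftarrow> xs]"
proof -
  have e: "tensor_eq k M N [(c \<odot>\<^bsub>M\<^esub> a, b). (a, b) \<leftarrow> xs]
     [(c \<odot>\<^bsub>M\<^esub> a, b). (a, b) \<leftarrow> tensor_rep (tensor_class k M N xs)]"
    by (rule tensor_eq_map_smult[OF tensor_rep_class[OF M N assms(1)] M N assms(2)])
  then have "[(c \<odot>\<^bsub>M\<^esub> a, b). (a, b) \<leftarrow> xs] \<in> L"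
    using tensor_eq_carrier[OF e M N] by simp
  then show ?thesis
    using e tensor_class_eq_iff[OF M N, THEN iffD2, OF _ e] by (simp add: tensor_def)
qed

lemma tensor_zero_class: "\<zero>\<^bsub>tensor k M N\<^esub> = tensor_class k M N []"
  by (simp add: tensor_def)

lemma tensor_cases:
  assumes "X \<in> carrier (tensor k M N)"
  obtains xs where "xs \<in> L" "X = tensor_class k M N xs"
  using assms by (auto simp: tensor_carrier)

lemma tensor_class_closed: "xs \<in> L \<Longrightarrow> tensor_class k M N xs \<in> carrier (tensor k M N)"
  by (simp add: tensor_carrier)

lemma tensor_class_eqI: "tensor_eq k M N xs ys \<Longrightarrow> tensor_class k M N xs = tensor_class k M N ys"
  using tensor_class_eq_iff[OF M N] tensor_eq_carrier[OF _ M N] by blast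

lemma tensor_module: "module k (tensor k M N)"
proof -
  interpret M: module k M by (rule M)
  interpret N: module k N by (rule N)
  let ?T = "tensor k M N"
  have smash_pure: "[(c \<odot>\<^bsub>M\<^esub> a, b). (a, b) \<leftarrow> xs] \<in> L" if "xs \<in> L" "c \<in> carrier k" for c xs
    using that by (induct xs) auto
  note [simp] = tensor_add_class tensor_smult_class tensor_zero_class tensor_class_closed smash_pure
  show ?thesis
  proof (rule moduleI)
    show "cring k" by (rule M.R.is_cring)
    show "abelian_group ?T"
    proof (rule abelian_groupI)
      fix X Y assume "X \<in> carrier ?T" "Y \<in> carrier ?T"
      then obtain xs ys where xs: "xs \<in> L" "X = tensor_class k M N xs"
        and ys: "ys \<in> L" "Y = tensor_class k M N ys" by (metis tensor_cases)
      show "X \<oplus>\<^bsub>?T\<^esub> Y \<in> carrier ?T" using xs ys by simp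
      show "X \<oplus>\<^bsub>?T\<^esub> Y = Y \<oplus>\<^bsub>?T\<^esub> X"
        using xs ys by (simp, intro tensor_class_eqI tensor_eq.comm) auto
      fix Z assume "Z \<in> carrier ?T"
      then obtain zs where zs: "zs \<in> L" "Z = tensor_class k M N zs" by (metis tensor_cases)
      show "X \<oplus>\<^bsub>?T\<^esub> Y \<oplus>\<^bsub>?T\<^esub> Z = X \<oplus>\<^bsub>?T\<^esub> (Y \<oplus>\<^bsub>?T\<^esub> Z)"
        using xs ys zs by simp
    next
      show "\<zero>\<^bsub>?T\<^esub> \<in> carrier ?T" by simp
    next
      fix X assume "X \<in> carrier ?T"
      then obtain xs where xs: "xs \<in> L" "X = tensor_class k M N xs" by (metis tensor_cases)
      show "\<zero>\<^bsub>?T\<^esub> \<oplus>\<^bsub>?T\<^esub> X = X" using xs by simp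
      \<comment> \<open>Formal sums carry no signs, so the additive inverse is a list of the same
        pairs with negated left entries. It is built one entry at a time: \<open>comm\<close>
        carries the new pair past the older entries, and \<open>add_left\<close> with
        \<open>zero\<close> cancels it against its negative.\<close>
      have "\<exists>ys\<in>L. tensor_eq k M N (ys @ xs) []" using xs(1)
      proof (induct xs)
        case Nil
        then show ?case by (auto intro!: bexI[of _ "[]"] tensor_eq.refl)
      next
        case (Cons ab xs)
        obtain a b where ab: "ab = (a, b)" "a \<in> carrier M" "b \<in> carrier N" using Cons(1) by auto
        obtain ys where ys: "ys \<in> L" "tensor_eq k M N (ys @ xs) []" using Cons by auto
        have 1: "tensor_eq k M N ([(\<ominus>\<^bsub>M\<^esub> a, b)] @ [(a, b)]) [(\<ominus>\<^bsub>M\<^esub> a \<oplus>\<^bsub>M\<^esub> a, b)]"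
          using ab by (auto intro: tensor_eq.sym[OF tensor_eq.add_left])
        have "tensor_eq k M N ([(\<ominus>\<^bsub>M\<^esub> a, b)] @ [(a, b)]) []"
          by (rule tensor_eq.trans[OF 1]) (use ab in \<open>simp add: M.l_neg tensor_eq.zero\<close>)
        from tensor_eq.append[OF ys(2) this]
        have 2: "tensor_eq k M N ((ys @ xs) @ [(\<ominus>\<^bsub>M\<^esub> a, b), (a, b)]) []" by simp
        have 3: "tensor_eq k M N ([(\<ominus>\<^bsub>M\<^esub> a, b), (a, b)] @ ys @ xs) ((ys @ xs) @ [(\<ominus>\<^bsub>M\<^esub> a, b), (a, b)])"
          using ab ys Cons by (intro tensor_eq.comm) auto
        have c: "tensor_eq k M N (ys @ [(a, b)]) ([(a, b)] @ ys)"
          using ab ys by (intro tensor_eq.comm) auto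
        have 4: "tensor_eq k M N ([(\<ominus>\<^bsub>M\<^esub> a, b)] @ ((ys @ [(a, b)]) @ xs))
          ([(\<ominus>\<^bsub>M\<^esub> a, b)] @ (([(a, b)] @ ys) @ xs))"
          by (rule tensor_eq.append[OF tensor_eq.refl tensor_eq.append[OF c tensor_eq.refl]])
            (use ab ys Cons in auto)
        from 4 have 5: "tensor_eq k M N (((\<ominus>\<^bsub>M\<^esub> a, b) # ys) @ (a, b) # xs)
          ([(\<ominus>\<^bsub>M\<^esub> a, b), (a, b)] @ ys @ xs)"
          by (simp only: append_Cons append_Nil append_assoc)
        from tensor_eq.trans[OF 5 tensor_eq.trans[OF 3 2]] show ?case using ab ys by (auto intro!: bexI[of _ "(\<ominus>\<^bsub>M\<^esub> a, b) # ys"])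
      qed
      then obtain ys where ys: "ys \<in> L" "tensor_eq k M N (ys @ xs) []" by auto
      then show "\<exists>Y\<in>carrier ?T. Y \<oplus>\<^bsub>?T\<^esub> X = \<zero>\<^bsub>?T\<^esub>"
        using xs by (intro bexI[of _ "tensor_class k M N ys"]) (auto intro!: tensor_class_eqI)
    qed
  next
    fix c X assume c: "c \<in> carrier k" and "X \<in> carrier ?T"
    then obtain xs where xs: "xs \<in> L" "X = tensor_class k M N xs" by (metis tensor_cases)
    show "c \<odot>\<^bsub>?T\<^esub> X \<in> carrier ?T" using c xs by simp
    fix d assume d: "d \<in> carrier k"
    show "(c \<otimes>\<^bsub>k\<^esub> d) \<odot>\<^bsub>?T\<^esub> X = c \<odot>\<^bsub>?T\<^esub> (d \<odot>\<^bsub>?T\<^esub> X)"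
      using c d xs
      by (simp del: map_map) (rule arg_cong[where f = "tensor_class k M N"], auto simp: M.smult_assoc1)
    \<comment> \<open>Distributivity splits every pair in two and so yields an interleaved list;
      \<open>comm\<close> sorts it into the two blocks.\<close>
    have "tensor_eq k M N [((c \<oplus>\<^bsub>k\<^esub> d) \<odot>\<^bsub>M\<^esub> a, b). (a, b) \<leftarrow> xs]
      ([(c \<odot>\<^bsub>M\<^esub> a, b). (a, b) \<leftarrow> xs] @ [(d \<odot>\<^bsub>M\<^esub> a, b). (a, b) \<leftarrow> xs])" using xs(1)
    proof (induct xs)
      case Nil
      then show ?case by (auto intro!: tensor_eq.refl)
    next
      case (Cons ab xs)
      obtain a b where ab: "ab = (a, b)" "a \<in> carrier M" "b \<in> carrier N" using Cons(1) by auto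
      let ?f = "\<lambda>c. map (\<lambda>(a, b). (c \<odot>\<^bsub>M\<^esub> a, b))"
      have l: "?f c xs \<in> L" "?f d xs \<in> L" using smash_pure Cons(2) c d by blast+
      have 1: "tensor_eq k M N [((c \<oplus>\<^bsub>k\<^esub> d) \<odot>\<^bsub>M\<^esub> a, b)] [(c \<odot>\<^bsub>M\<^esub> a, b), (d \<odot>\<^bsub>M\<^esub> a, b)]"
        using ab c d by (simp add: M.smult_l_distr tensor_eq.add_left)
      have 2: "tensor_eq k M N ([(c \<odot>\<^bsub>M\<^esub> a, b)] @ ([(d \<odot>\<^bsub>M\<^esub> a, b)] @ ?f c xs) @ ?f d xs)
        ([(c \<odot>\<^bsub>M\<^esub> a, b)] @ (?f c xs @ [(d \<odot>\<^bsub>M\<^esub> a, b)]) @ ?f d xs)"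
        using ab c d l by (intro tensor_eq.append tensor_eq.refl tensor_eq.comm) auto
      show ?case
        using tensor_eq.trans[OF tensor_eq.append[OF 1 Cons(3)]] 2 ab by simp
    qed
    then show "(c \<oplus>\<^bsub>k\<^esub> d) \<odot>\<^bsub>?T\<^esub> X = c \<odot>\<^bsub>?T\<^esub> X \<oplus>\<^bsub>?T\<^esub> d \<odot>\<^bsub>?T\<^esub> X"
      using c d xs by (simp add: tensor_class_eqI)
    fix Y assume "Y \<in> carrier ?T"
    then obtain ys where ys: "ys \<in> L" "Y = tensor_class k M N ys" by (metis tensor_cases)
    show "c \<odot>\<^bsub>?T\<^esub> (X \<oplus>\<^bsub>?T\<^esub> Y) = c \<odot>\<^bsub>?T\<^esub> X \<oplus>\<^bsub>?T\<^esub> c \<odot>\<^bsub>?T\<^esub> Y"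
      using c xs ys by simp
  next
    fix X assume "X \<in> carrier ?T"
    then obtain xs where xs: "xs \<in> L" "X = tensor_class k M N xs" by (metis tensor_cases)
    have "map (\<lambda>(a, b). (\<one>\<^bsub>k\<^esub> \<odot>\<^bsub>M\<^esub> a, b)) xs = map id xs"
      using xs(1) by (intro map_cong) auto
    then show "\<one>\<^bsub>k\<^esub> \<odot>\<^bsub>?T\<^esub> X = X" using xs by simp
  qed
qed

lemma tens_closed: "a \<in> carrier M \<Longrightarrow> b \<in> carrier N \<Longrightarrow> tens k M N a b \<in> carrier (tensor k M N)"
  by (simp add: tens_def tensor_class_closed)

lemma tens_add_left:
  assumes "a \<in> carrier M" "a' \<in> carrier M" "b \<in> carrier N"
  shows "tens k M N (a \<oplus>\<^bsub>M\<^esub> a') b = tens k M N a b \<oplus>\<^bsub>tensor k M N\<^esub> tens k M N a' b"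
  using assms by (simp add: tens_def tensor_add_class) (intro tensor_class_eqI tensor_eq.add_left)

lemma tens_add_right:
  assumes "a \<in> carrier M" "b \<in> carrier N" "b' \<in> carrier N"
  shows "tens k M N a (b \<oplus>\<^bsub>N\<^esub> b') = tens k M N a b \<oplus>\<^bsub>tensor k M N\<^esub> tens k M N a b'"
  using assms by (simp add: tens_def tensor_add_class) (intro tensor_class_eqI tensor_eq.add_right)

lemma tens_smult_left:
  assumes "c \<in> carrier k" "a \<in> carrier M" "b \<in> carrier N"
  shows "tens k M N (c \<odot>\<^bsub>M\<^esub> a) b = c \<odot>\<^bsub>tensor k M N\<^esub> tens k M N a b"
  using assms by (simp add: tens_def tensor_smult_class)

lemma tens_smult_right:
  assumes "c \<in> carrier k" "a \<in> carrier M" "b \<in> carrier N"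
  shows "tens k M N a (c \<odot>\<^bsub>N\<^esub> b) = c \<odot>\<^bsub>tensor k M N\<^esub> tens k M N a b"
  using assms
  by (simp flip: tens_smult_left) (simp add: tens_def, intro tensor_class_eqI tensor_eq.sym[OF tensor_eq.balanced])

text \<open>The empty sum needs no case of its own: its class is 0 \<otimes> 0, already a pure
  tensor.\<close>

lemma tensor_induct [consumes 1, case_names tens add]:
  assumes "X \<in> carrier (tensor k M N)"
    and "\<And>a b. a \<in> carrier M \<Longrightarrow> b \<in> carrier N \<Longrightarrow> Q (tens k M N a b)"
    and "\<And>X Y. X \<in> carrier (tensor k M N) \<Longrightarrow> Y \<in> carrier (tensor k M N) \<Longrightarrow> Q X \<Longrightarrow> Q Y \<Longrightarrow>
      Q (X \<oplus>\<^bsub>tensor k M N\<^esub> Y)"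
  shows "Q X"
proof -
  obtain xs where xs: "xs \<in> L" "X = tensor_class k M N xs" using assms(1) tensor_cases by metis
  have "Q (tensor_class k M N xs)" using xs(1)
  proof (induct xs)
    case Nil
    have "tensor_class k M N [] = tens k M N \<zero>\<^bsub>M\<^esub> \<zero>\<^bsub>N\<^esub>"
      unfolding tens_def
      by (intro tensor_class_eqI tensor_eq.sym[OF tensor_eq.zero]) (simp add: moduleD[OF N])
    then show ?case using assms(2) by (simp add: moduleD[OF M] moduleD[OF N])
  next
    case (Cons ab xs)
    obtain a b where ab: "ab = (a, b)" "a \<in> carrier M" "b \<in> carrier N" using Cons(1) by auto
    have "tensor_class k M N (ab # xs) = tens k M N a b \<oplus>\<^bsub>tensor k M N\<^esub> tensor_class k M N xs"
      using ab Cons by (simp add: tens_def tensor_add_class)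
    then show ?case using ab Cons assms(2,3) by (simp add: tens_closed tensor_class_closed)
  qed
  then show ?thesis using xs by simp
qed

lemma lin_eqI:
  assumes "f \<in> lin k (tensor k M N) P" "g \<in> lin k (tensor k M N) P"
    and "\<And>a b. a \<in> carrier M \<Longrightarrow> b \<in> carrier N \<Longrightarrow> f (tens k M N a b) = g (tens k M N a b)"
    and "X \<in> carrier (tensor k M N)"
  shows "f X = g X"
  using assms(4)
  by (induct rule: tensor_induct) (simp_all add: assms(3) lin_add[OF assms(1)] lin_add[OF assms(2)])

lemma tsum_cong:
  assumes "X \<in> carrier (tensor k M N)"
    and "\<And>a b. a \<in> carrier M \<Longrightarrow> b \<in> carrier N \<Longrightarrow> f a b = g a b"
  shows "tsum P X f = tsum P X g"
proof -
  have "pair_sum P f xs = pair_sum P g xs" if "xs \<in> L" for xs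
    using that by (induct xs) (auto simp: assms(2))
  then show ?thesis using tensor_rep(1)[OF M N assms(1)] by (simp add: tsum_pair_sum)
qed

context
  fixes P
  assumes P: "module k P"
begin

lemma tsum_closed:
  assumes "X \<in> carrier (tensor k M N)"
    and "\<And>a b. a \<in> carrier M \<Longrightarrow> b \<in> carrier N \<Longrightarrow> f a b \<in> carrier P"
  shows "tsum P X f \<in> carrier P"
  using pair_sum_closed[OF P assms(2) tensor_rep(1)[OF M N assms(1)]] by (simp add: tsum_pair_sum)

text \<open>Both sides are sums over the same representative, so it is enough that the summands lie
  in \<open>P\<close>. Nested sums can thus be opened from the outside before anything is known
  about their dependence on the tensor.\<close>

lemma lin_tsum:
  assumes "module k P'" "h \<in> lin k P P'" "X \<in> carrier (tensor k M N)"
    and f: "\<And>a b. a \<in> carrier M \<Longrightarrow> b \<in> carrier N \<Longrightarrow> f a b \<in> carrier P"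
  shows "h (tsum P X f) = tsum P' X (\<lambda>a b. h (f a b))"
proof -
  have "h (pair_sum P f xs) = pair_sum P' (\<lambda>a b. h (f a b)) xs" if "xs \<in> L" for xs
    using that
    by (induct xs)
      (simp_all add: mem_Times_iff lin_zero[OF assms(2) P assms(1)] f lin_add[OF assms(2)] pair_sum_closed[OF P f])
  then show ?thesis using tensor_rep(1)[OF M N assms(3)] by (simp add: tsum_pair_sum)
qed

lemma tsum_add:
  assumes "X \<in> carrier (tensor k M N)"
    and f: "\<And>a b. a \<in> carrier M \<Longrightarrow> b \<in> carrier N \<Longrightarrow> f a b \<in> carrier P"
    and g: "\<And>a b. a \<in> carrier M \<Longrightarrow> b \<in> carrier N \<Longrightarrow> g a b \<in> carrier P"
  shows "tsum P X (\<lambda>a b. f a b \<oplus>\<^bsub>P\<^esub> g a b) = tsum P X f \<oplus>\<^bsub>P\<^esub> tsum P X g"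
proof -
  interpret P: module k P by (rule P)
  have "pair_sum P (\<lambda>a b. f a b \<oplus>\<^bsub>P\<^esub> g a b) xs = pair_sum P f xs \<oplus>\<^bsub>P\<^esub> pair_sum P g xs" if "xs \<in> L" for xs
    using that
    by (induct xs) (simp_all add: mem_Times_iff f g P.add.m_ac pair_sum_closed[OF P f] pair_sum_closed[OF P g])
  then show ?thesis using tensor_rep(1)[OF M N assms(1)] by (simp add: tsum_pair_sum)
qed

lemma tsum_smult:
  assumes "X \<in> carrier (tensor k M N)" "c \<in> carrier k"
    and f: "\<And>a b. a \<in> carrier M \<Longrightarrow> b \<in> carrier N \<Longrightarrow> f a b \<in> carrier P"
  shows "tsum P X (\<lambda>a b. c \<odot>\<^bsub>P\<^esub> f a b) = c \<odot>\<^bsub>P\<^esub> tsum P X f"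
proof -
  interpret P: module k P by (rule P)
  have "(\<lambda>x. c \<odot>\<^bsub>P\<^esub> x) \<in> lin k P P"
    using assms(2) by (intro linI) (auto simp: P.smult_r_distr P.smult_assoc1[symmetric] P.R.m_comm)
  from lin_tsum[OF P this assms(1) f] show ?thesis by simp
qed

lemma tsum_bilinear_class:
  assumes "bilinear_on k M N P f" "xs \<in> L"
  shows "tsum P (tensor_class k M N xs) f = pair_sum P f xs"
  using pair_sum_tensor_eq[OF tensor_rep_class[OF M N assms(2)] M N P assms(1)]
  by (simp add: tsum_pair_sum)

lemma tsum_tens:
  assumes "bilinear_on k M N P f" "a \<in> carrier M" "b \<in> carrier N"
  shows "tsum P (tens k M N a b) f = f a b"
proof -
  interpret P: module k P by (rule P)
  have "f a b \<in> carrier P" using assms by (auto simp: bilinear_on_def)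
  then show ?thesis using assms by (simp add: tens_def tsum_bilinear_class)
qed

lemma tsum_lin:
  assumes "bilinear_on k M N P f"
  shows "(\<lambda>X. tsum P X f) \<in> lin k (tensor k M N) P"
proof (rule linI)
  have f: "\<And>a b. a \<in> carrier M \<Longrightarrow> b \<in> carrier N \<Longrightarrow> f a b \<in> carrier P"
    using assms by (auto simp: bilinear_on_def)
  fix X assume X: "X \<in> carrier (tensor k M N)"
  then show "tsum P X f \<in> carrier P" by (rule tsum_closed) (rule f)
  obtain xs where xs: "xs \<in> L" "X = tensor_class k M N xs" using X tensor_cases by metis
  { fix Y assume Y: "Y \<in> carrier (tensor k M N)"
    obtain ys where ys: "ys \<in> L" "Y = tensor_class k M N ys" using Y tensor_cases by metis
    show "tsum P (X \<oplus>\<^bsub>tensor k M N\<^esub> Y) f = tsum P X f \<oplus>\<^bsub>P\<^esub> tsum P Y f"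
      using xs ys
      by (simp add: tensor_add_class tsum_bilinear_class[OF assms] pair_sum_append[OF P f]) }
  { fix c assume c: "c \<in> carrier k"
    interpret M: module k M by (rule M)
    interpret P: module k P by (rule P)
    have l: "[(c \<odot>\<^bsub>M\<^esub> a, b). (a, b) \<leftarrow> xs] \<in> L" using xs(1) c by (induct xs) auto
    have "pair_sum P f [(c \<odot>\<^bsub>M\<^esub> a, b). (a, b) \<leftarrow> xs] = c \<odot>\<^bsub>P\<^esub> pair_sum P f xs"
      using xs(1)
      by (induct xs)
        (use assms c f in \<open>simp_all add: mem_Times_iff split_beta P.smult_r_null bilinear_on_def
            P.smult_r_distr pair_sum_closed[OF P f]\<close>)
    then show "tsum P (c \<odot>\<^bsub>tensor k M N\<^esub> X) f = c \<odot>\<^bsub>P\<^esub> tsum P X f"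
      using xs c l by (simp add: tensor_smult_class tsum_bilinear_class[OF assms]) }
qed

text \<open>The device by which Sweedler notation is eliminated: once the summand is seen to be a
  linear map at the pure tensor, the whole sum is that map at \<open>X\<close>.\<close>

lemma tsum_eq_lin:
  assumes "h \<in> lin k (tensor k M N) P" "X \<in> carrier (tensor k M N)"
    and "\<And>a b. a \<in> carrier M \<Longrightarrow> b \<in> carrier N \<Longrightarrow> f a b = h (tens k M N a b)"
  shows "tsum P X f = h X"
proof -
  have b: "bilinear_on k M N P (\<lambda>a b. h (tens k M N a b))"
    unfolding bilinear_on_def
    by (auto simp: tens_closed lin_closed[OF assms(1)] lin_add[OF assms(1)] lin_smult[OF assms(1)]
        tens_add_left tens_add_right tens_smult_left tens_smult_right)
  have "tsum P X f = tsum P X (\<lambda>a b. h (tens k M N a b))"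
    by (rule tsum_cong[OF assms(2,3)])
  also have "\<dots> = h X"
    by (rule lin_eqI[OF tsum_lin[OF b] assms(1) _ assms(2)]) (rule tsum_tens[OF b])
  finally show ?thesis .
qed

end

end

lemma bilinear_onI:
  assumes "\<And>a. a \<in> carrier M \<Longrightarrow> (\<lambda>b. f a b) \<in> lin k N P"
    and "\<And>b. b \<in> carrier N \<Longrightarrow> (\<lambda>a. f a b) \<in> lin k M P"
  shows "bilinear_on k M N P f"
  using assms unfolding bilinear_on_def lin_def by fastforce

lemma bilinear_onD:
  assumes "bilinear_on k M N P f"
  shows "a \<in> carrier M \<Longrightarrow> (\<lambda>b. f a b) \<in> lin k N P"
    and "b \<in> carrier N \<Longrightarrow> (\<lambda>a. f a b) \<in> lin k M P"
  using assms unfolding bilinear_on_def lin_def by auto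

lemma lin_id: "(\<lambda>x. x) \<in> lin k M M"
  by (rule linI) auto

lemma lin_comp: "g \<in> lin k N P \<Longrightarrow> f \<in> lin k M N \<Longrightarrow> (\<lambda>x. g (f x)) \<in> lin k M P"
  by (auto simp: lin_def Pi_iff)

lemma tensor_class_pair_sum:
  assumes "module k M" "module k N" "xs \<in> lists (carrier M \<times> carrier N)"
  shows "tensor_class k M N xs = pair_sum (tensor k M N) (tens k M N) xs"
  using assms(3)
proof (induct xs)
  case Nil
  then show ?case by (simp add: tensor_def)
next
  case (Cons ab xs)
  then have "tensor_class k M N (ab # xs) = tens k M N (fst ab) (snd ab) \<oplus>\<^bsub>tensor k M N\<^esub> tensor_class k M N xs"
    using tensor_add_class[OF assms(1,2), of "[ab]" xs] by (simp add: tens_def)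
  then show ?case using Cons by simp
qed

text \<open>The module facts are consumed as well, so that the chained facts determine
  \<open>M\<close> and \<open>N\<close> when the rule is used with \<open>induct\<close>.\<close>

lemma tensor_induct' [consumes 3, case_names tens add]:
  assumes "module k M" "module k N" "X \<in> carrier (tensor k M N)"
    and "\<And>a b. a \<in> carrier M \<Longrightarrow> b \<in> carrier N \<Longrightarrow> Q (tens k M N a b)"
    and "\<And>X Y. X \<in> carrier (tensor k M N) \<Longrightarrow> Y \<in> carrier (tensor k M N) \<Longrightarrow> Q X \<Longrightarrow> Q Y \<Longrightarrow>
      Q (X \<oplus>\<^bsub>tensor k M N\<^esub> Y)"
  shows "Q X"
  using tensor_induct[OF assms(1,2,3), of Q] assms(4,5) by blast

section \<open>Algebras and their tensor products\<close>

locale field_base =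
  fixes k :: "('k, 'r) ring_scheme"
  assumes base_field: "field k"
begin

abbreviation tensor_prod (infixr \<open>\<boxtimes>\<close> 75)
  where "M \<boxtimes> N \<equiv> tensor k M N"

abbreviation "md M \<equiv> module k M"
abbreviation "nalg M \<equiv> unital_nonassoc_algebra k M"
abbreviation "alg M \<equiv> unital_assoc_algebra k M"

lemma alg_nalg [simp]: "alg M \<Longrightarrow> nalg M"
  by (simp add: unital_assoc_algebra_def)

lemma nalg_md [simp]: "nalg M \<Longrightarrow> md M"
  by (simp add: unital_nonassoc_algebra_def)

lemma md_tensor [simp]: "md M \<Longrightarrow> md N \<Longrightarrow> md (M \<boxtimes> N)"
  by (rule tensor_module)

lemmas md_closed [simp] = moduleD[where k = k]

lemma nalg_closed [simp]:
  assumes "nalg M"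
  shows "x \<in> carrier M \<Longrightarrow> y \<in> carrier M \<Longrightarrow> x \<otimes>\<^bsub>M\<^esub> y \<in> carrier M"
    and "\<one>\<^bsub>M\<^esub> \<in> carrier M"
    and "x \<in> carrier M \<Longrightarrow> \<one>\<^bsub>M\<^esub> \<otimes>\<^bsub>M\<^esub> x = x"
    and "x \<in> carrier M \<Longrightarrow> x \<otimes>\<^bsub>M\<^esub> \<one>\<^bsub>M\<^esub> = x"
  using assms unital_nonassoc_algebra.one_in_carrier unital_nonassoc_algebra.mult_one_left
    unital_nonassoc_algebra.mult_one_right unital_nonassoc_algebra.mult_bilinear[OF assms]
  by (auto simp: bilinear_on_def)

lemma mult_lin_right: "nalg M \<Longrightarrow> x \<in> carrier M \<Longrightarrow> (\<lambda>y. x \<otimes>\<^bsub>M\<^esub> y) \<in> lin k M M"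
  by (rule bilinear_onD(1)[OF unital_nonassoc_algebra.mult_bilinear])

lemma mult_lin_left: "nalg M \<Longrightarrow> y \<in> carrier M \<Longrightarrow> (\<lambda>x. x \<otimes>\<^bsub>M\<^esub> y) \<in> lin k M M"
  by (rule bilinear_onD(2)[OF unital_nonassoc_algebra.mult_bilinear])

lemma mult_add:
  assumes "nalg M" "x \<in> carrier M" "y \<in> carrier M" "z \<in> carrier M"
  shows "x \<otimes>\<^bsub>M\<^esub> (y \<oplus>\<^bsub>M\<^esub> z) = x \<otimes>\<^bsub>M\<^esub> y \<oplus>\<^bsub>M\<^esub> x \<otimes>\<^bsub>M\<^esub> z"
    and "(y \<oplus>\<^bsub>M\<^esub> z) \<otimes>\<^bsub>M\<^esub> x = y \<otimes>\<^bsub>M\<^esub> x \<oplus>\<^bsub>M\<^esub> z \<otimes>\<^bsub>M\<^esub> x"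
  by (rule lin_add[OF mult_lin_right[OF assms(1,2)] assms(3,4)] lin_add[OF mult_lin_left[OF assms(1,2)] assms(3,4)])+

lemma mult_smult:
  assumes "nalg M" "c \<in> carrier k" "x \<in> carrier M" "y \<in> carrier M"
  shows "x \<otimes>\<^bsub>M\<^esub> (c \<odot>\<^bsub>M\<^esub> y) = c \<odot>\<^bsub>M\<^esub> (x \<otimes>\<^bsub>M\<^esub> y)"
    and "(c \<odot>\<^bsub>M\<^esub> y) \<otimes>\<^bsub>M\<^esub> x = c \<odot>\<^bsub>M\<^esub> (y \<otimes>\<^bsub>M\<^esub> x)"
  by (rule lin_smult[OF mult_lin_right[OF assms(1,3)] assms(2,4)] lin_smult[OF mult_lin_left[OF assms(1,3)] assms(2,4)])+

lemma alg_assoc: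
  assumes "alg M" "x \<in> carrier M" "y \<in> carrier M" "z \<in> carrier M"
  shows "x \<otimes>\<^bsub>M\<^esub> y \<otimes>\<^bsub>M\<^esub> z = x \<otimes>\<^bsub>M\<^esub> (y \<otimes>\<^bsub>M\<^esub> z)"
  using assms by (rule unital_assoc_algebra.mult_assoc)

lemma smult_lin: "md M \<Longrightarrow> c \<in> carrier k \<Longrightarrow> (\<lambda>x. c \<odot>\<^bsub>M\<^esub> x) \<in> lin k M M"
proof (rule linI)
  assume M: "md M" and c: "c \<in> carrier k"
  interpret M: module k M by (rule M)
  show "c \<odot>\<^bsub>M\<^esub> x \<in> carrier M" if "x \<in> carrier M" for x using that c by simp
  show "c \<odot>\<^bsub>M\<^esub> (x \<oplus>\<^bsub>M\<^esub> y) = c \<odot>\<^bsub>M\<^esub> x \<oplus>\<^bsub>M\<^esub> c \<odot>\<^bsub>M\<^esub> y" if "x \<in> carrier M" "y \<in> carrier M" for x y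
    using that c by (simp add: M.smult_r_distr)
  show "c \<odot>\<^bsub>M\<^esub> (d \<odot>\<^bsub>M\<^esub> x) = d \<odot>\<^bsub>M\<^esub> (c \<odot>\<^bsub>M\<^esub> x)" if "d \<in> carrier k" "x \<in> carrier M" for d x
    using that c by (metis M.smult_assoc1 M.R.m_comm)
qed

lemma tens_closed' [simp]:
  "md M \<Longrightarrow> md N \<Longrightarrow> a \<in> carrier M \<Longrightarrow> b \<in> carrier N \<Longrightarrow> tens k M N a b \<in> carrier (M \<boxtimes> N)"
  by (rule tens_closed)

lemma tens_lin_right: "md M \<Longrightarrow> md N \<Longrightarrow> a \<in> carrier M \<Longrightarrow> (\<lambda>b. tens k M N a b) \<in> lin k N (M \<boxtimes> N)"
  by (intro linI) (auto simp: tens_add_right tens_smult_right)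

lemma tens_lin_left: "md M \<Longrightarrow> md N \<Longrightarrow> b \<in> carrier N \<Longrightarrow> (\<lambda>a. tens k M N a b) \<in> lin k M (M \<boxtimes> N)"
  by (intro linI) (auto simp: tens_add_left tens_smult_left)

text \<open>The product is defined on representatives; written as a double sum it comes under the
  bilinearity results for \<open>tsum\<close>.\<close>

lemma tensor_mult_tsum:
  assumes M: "nalg M" and N: "nalg N" and X: "X \<in> carrier (M \<boxtimes> N)" and Y: "Y \<in> carrier (M \<boxtimes> N)"
  shows "X \<otimes>\<^bsub>M \<boxtimes> N\<^esub> Y = tsum (M \<boxtimes> N) X (\<lambda>a b. tsum (M \<boxtimes> N) Y (\<lambda>c d. tens k M N (a \<otimes>\<^bsub>M\<^esub> c) (b \<otimes>\<^bsub>N\<^esub> d)))"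
proof -
  let ?L = "lists (carrier M \<times> carrier N)"
  have m: "md M" "md N" using M N by auto
  note t = tensor_rep(1)[OF m]
  have l: "[(fst ab \<otimes>\<^bsub>M\<^esub> c, snd ab \<otimes>\<^bsub>N\<^esub> d). (c, d) \<leftarrow> ys] \<in> ?L"
    if "ab \<in> carrier M \<times> carrier N" "ys \<in> ?L" for ab ys
    using that(2) by (induct ys) (use that(1) M N in \<open>simp_all add: mem_Times_iff split_beta\<close>)
  note l' = l[unfolded split_beta]
  have l2: "[(a \<otimes>\<^bsub>M\<^esub> c, b \<otimes>\<^bsub>N\<^esub> d). (a, b) \<leftarrow> xs, (c, d) \<leftarrow> ys] \<in> ?L" if "xs \<in> ?L" "ys \<in> ?L" for xs ys
    using that(1) by (induct xs) (use l' that(2) in \<open>simp_all add: split_beta\<close>)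
  have 1: "tensor_class k M N [(fst ab \<otimes>\<^bsub>M\<^esub> c, snd ab \<otimes>\<^bsub>N\<^esub> d). (c, d) \<leftarrow> ys]
      = pair_sum (M \<boxtimes> N) (\<lambda>c d. tens k M N (fst ab \<otimes>\<^bsub>M\<^esub> c) (snd ab \<otimes>\<^bsub>N\<^esub> d)) ys"
    if "ab \<in> carrier M \<times> carrier N" "ys \<in> ?L" for ab ys
  proof -
    have "pair_sum (M \<boxtimes> N) (tens k M N) [(fst ab \<otimes>\<^bsub>M\<^esub> c, snd ab \<otimes>\<^bsub>N\<^esub> d). (c, d) \<leftarrow> ys]
      = pair_sum (M \<boxtimes> N) (\<lambda>c d. tens k M N (fst ab \<otimes>\<^bsub>M\<^esub> c) (snd ab \<otimes>\<^bsub>N\<^esub> d)) ys"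
      by (induct ys) (simp_all add: split_beta)
    then show ?thesis using tensor_class_pair_sum[OF m l[OF that]] by simp
  qed
  have "tensor_class k M N [(a \<otimes>\<^bsub>M\<^esub> c, b \<otimes>\<^bsub>N\<^esub> d). (a, b) \<leftarrow> xs, (c, d) \<leftarrow> ys]
      = pair_sum (M \<boxtimes> N) (\<lambda>a b. pair_sum (M \<boxtimes> N) (\<lambda>c d. tens k M N (a \<otimes>\<^bsub>M\<^esub> c) (b \<otimes>\<^bsub>N\<^esub> d)) ys) xs"
    if "xs \<in> ?L" "ys \<in> ?L" for xs ys
    using that(1)
  proof (induct xs)
    case Nil
    then show ?case by (simp add: tensor_def)
  next
    case (Cons ab xs)
    then show ?case
      using 1[OF Cons(1) that(2)] Cons(3)
        tensor_add_class[OF m l[OF Cons(1) that(2)] l2[OF Cons(2) that(2)], symmetric]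
      unfolding split_beta by simp
  qed
  from this[OF t[OF X] t[OF Y]] show ?thesis
    by (simp add: tensor_def tsum_pair_sum split_beta)
qed

lemma tensor_mult_lin:
  assumes M: "nalg M" and N: "nalg N" and Y: "Y \<in> carrier (M \<boxtimes> N)"
  shows "(\<lambda>X. X \<otimes>\<^bsub>M \<boxtimes> N\<^esub> Y) \<in> lin k (M \<boxtimes> N) (M \<boxtimes> N)"
    and "(\<lambda>X. Y \<otimes>\<^bsub>M \<boxtimes> N\<^esub> X) \<in> lin k (M \<boxtimes> N) (M \<boxtimes> N)"
    and "a \<in> carrier M \<Longrightarrow> b \<in> carrier N \<Longrightarrow> c \<in> carrier M \<Longrightarrow> d \<in> carrier N \<Longrightarrow>
      tens k M N a b \<otimes>\<^bsub>M \<boxtimes> N\<^esub> tens k M N c d = tens k M N (a \<otimes>\<^bsub>M\<^esub> c) (b \<otimes>\<^bsub>N\<^esub> d)"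
proof -
  have m: "md M" "md N" "md (M \<boxtimes> N)" using M N by auto
  let ?h = "\<lambda>a b Y. tsum (M \<boxtimes> N) Y (\<lambda>c d. tens k M N (a \<otimes>\<^bsub>M\<^esub> c) (b \<otimes>\<^bsub>N\<^esub> d))"
  have b1: "bilinear_on k M N (M \<boxtimes> N) (\<lambda>c d. tens k M N (a \<otimes>\<^bsub>M\<^esub> c) (b \<otimes>\<^bsub>N\<^esub> d))"
    if "a \<in> carrier M" "b \<in> carrier N" for a b
    by (intro bilinear_onI lin_comp[OF tens_lin_left[OF m(1,2)] mult_lin_right[OF M]]
        lin_comp[OF tens_lin_right[OF m(1,2)] mult_lin_right[OF N]]) (simp_all add: M N that)
  note h_lin = tsum_lin[OF m b1]
  note h_cl = lin_closed[OF h_lin]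
  \<comment> \<open>For fixed \<open>Y\<close> both sides of each law are sums over the one
    representative of \<open>Y\<close>, so bilinearity can be checked summand by summand.\<close>
  have b2: "bilinear_on k M N (M \<boxtimes> N) (\<lambda>a b. ?h a b Y)" if Y: "Y \<in> carrier (M \<boxtimes> N)" for Y
    unfolding bilinear_on_def
  proof (intro conjI ballI, goal_cases)
    case (1 a b)
    then show ?case using Y h_cl by simp
  next
    case (2 a a' b)
    then show ?case using Y M N m
      by (subst tsum_add[OF m Y, symmetric]) (auto intro!: tsum_cong[OF m(1,2) Y] simp: mult_add tens_add_left)
  next
    case (3 a b b')
    then show ?case using Y M N m
      by (subst tsum_add[OF m Y, symmetric]) (auto intro!: tsum_cong[OF m(1,2) Y] simp: mult_add tens_add_right)
  next
    case (4 c a b)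
    then show ?case using Y M N m
      by (subst tsum_smult[OF m Y, symmetric]) (auto intro!: tsum_cong[OF m(1,2) Y] simp: mult_smult tens_smult_left)
  next
    case (5 c a b)
    then show ?case using Y M N m
      by (subst tsum_smult[OF m Y, symmetric]) (auto intro!: tsum_cong[OF m(1,2) Y] simp: mult_smult tens_smult_right)
  qed
  note mt = tensor_mult_tsum[OF M N]
  show "(\<lambda>X. X \<otimes>\<^bsub>M \<boxtimes> N\<^esub> Y) \<in> lin k (M \<boxtimes> N) (M \<boxtimes> N)"
    using tsum_lin[OF m b2[OF Y]] Y by (simp add: lin_def mt m Pi_iff)
  show "(\<lambda>X. Y \<otimes>\<^bsub>M \<boxtimes> N\<^esub> X) \<in> lin k (M \<boxtimes> N) (M \<boxtimes> N)"
  proof (rule linI)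
    fix X assume X: "X \<in> carrier (M \<boxtimes> N)"
    show "Y \<otimes>\<^bsub>M \<boxtimes> N\<^esub> X \<in> carrier (M \<boxtimes> N)"
      unfolding mt[OF Y X] by (intro tsum_closed[OF m Y] h_cl X)
    { fix X' assume X': "X' \<in> carrier (M \<boxtimes> N)"
      have "Y \<otimes>\<^bsub>M \<boxtimes> N\<^esub> (X \<oplus>\<^bsub>M \<boxtimes> N\<^esub> X') = tsum (M \<boxtimes> N) Y (\<lambda>a b. ?h a b X \<oplus>\<^bsub>M \<boxtimes> N\<^esub> ?h a b X')"
        unfolding mt[OF Y md_closed(1)[OF m(3) X X']]
        by (rule tsum_cong[OF m(1,2) Y]) (simp add: lin_add[OF h_lin] X X')
      then show "Y \<otimes>\<^bsub>M \<boxtimes> N\<^esub> (X \<oplus>\<^bsub>M \<boxtimes> N\<^esub> X') = Y \<otimes>\<^bsub>M \<boxtimes> N\<^esub> X \<oplus>\<^bsub>M \<boxtimes> N\<^esub> Y \<otimes>\<^bsub>M \<boxtimes> N\<^esub> X'"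
        using mt[OF Y X] mt[OF Y X'] tsum_add[OF m Y h_cl h_cl] X X' by simp }
    { fix c assume c: "c \<in> carrier k"
      have "Y \<otimes>\<^bsub>M \<boxtimes> N\<^esub> (c \<odot>\<^bsub>M \<boxtimes> N\<^esub> X) = tsum (M \<boxtimes> N) Y (\<lambda>a b. c \<odot>\<^bsub>M \<boxtimes> N\<^esub> ?h a b X)"
        unfolding mt[OF Y md_closed(3)[OF m(3) c X]]
        by (rule tsum_cong[OF m(1,2) Y]) (simp add: lin_smult[OF h_lin] X c)
      then show "Y \<otimes>\<^bsub>M \<boxtimes> N\<^esub> (c \<odot>\<^bsub>M \<boxtimes> N\<^esub> X) = c \<odot>\<^bsub>M \<boxtimes> N\<^esub> (Y \<otimes>\<^bsub>M \<boxtimes> N\<^esub> X)"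
        using mt[OF Y X] tsum_smult[OF m Y c h_cl] X by simp }
  qed
  show "tens k M N a b \<otimes>\<^bsub>M \<boxtimes> N\<^esub> tens k M N c d = tens k M N (a \<otimes>\<^bsub>M\<^esub> c) (b \<otimes>\<^bsub>N\<^esub> d)"
    if "a \<in> carrier M" "b \<in> carrier N" "c \<in> carrier M" "d \<in> carrier N"
  proof -
    have "tens k M N a b \<otimes>\<^bsub>M \<boxtimes> N\<^esub> tens k M N c d = ?h a b (tens k M N c d)"
      using that m by (subst mt) (simp_all add: tsum_tens[OF m b2])
    also have "\<dots> = tens k M N (a \<otimes>\<^bsub>M\<^esub> c) (b \<otimes>\<^bsub>N\<^esub> d)"
      using that by (simp add: tsum_tens[OF m b1])
    finally show ?thesis .
  qed
qed

lemma tens_mult [simp]: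
  "nalg M \<Longrightarrow> nalg N \<Longrightarrow> a \<in> carrier M \<Longrightarrow> b \<in> carrier N \<Longrightarrow> c \<in> carrier M \<Longrightarrow> d \<in> carrier N \<Longrightarrow>
    tens k M N a b \<otimes>\<^bsub>M \<boxtimes> N\<^esub> tens k M N c d = tens k M N (a \<otimes>\<^bsub>M\<^esub> c) (b \<otimes>\<^bsub>N\<^esub> d)"
  by (rule tensor_mult_lin(3)[OF _ _ md_closed(2)]) auto

lemma tens_one [simp]: "tens k M N \<one>\<^bsub>M\<^esub> \<one>\<^bsub>N\<^esub> = \<one>\<^bsub>M \<boxtimes> N\<^esub>"
  by (simp add: tensor_def)

lemma nalg_tensor [simp]:
  assumes M: "nalg M" and N: "nalg N"
  shows "nalg (M \<boxtimes> N)"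
proof -
  have m: "md M" "md N" "md (M \<boxtimes> N)" using M N by auto
  note l = tensor_mult_lin[OF M N]
  have o: "\<one>\<^bsub>M \<boxtimes> N\<^esub> \<in> carrier (M \<boxtimes> N)" using m M N by (simp flip: tens_one)
  show ?thesis
    unfolding unital_nonassoc_algebra_def unital_nonassoc_algebra_axioms_def
  proof (intro conjI allI impI bilinear_onI l m base_field o)
    fix X assume X: "X \<in> carrier (M \<boxtimes> N)"
    show "\<one>\<^bsub>M \<boxtimes> N\<^esub> \<otimes>\<^bsub>M \<boxtimes> N\<^esub> X = X"
      by (rule lin_eqI[OF m(1,2) l(2)[OF o] lin_id _ X]) (simp add: M N flip: tens_one)
    show "X \<otimes>\<^bsub>M \<boxtimes> N\<^esub> \<one>\<^bsub>M \<boxtimes> N\<^esub> = X"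
      by (rule lin_eqI[OF m(1,2) l(1)[OF o] lin_id _ X]) (simp add: M N flip: tens_one)
  qed
qed

lemma alg_tensor [simp]:
  assumes M: "alg M" and N: "alg N"
  shows "alg (M \<boxtimes> N)"
proof -
  have m: "md M" "md N" "md (M \<boxtimes> N)" and n: "nalg M" "nalg N" "nalg (M \<boxtimes> N)" using M N by auto
  show ?thesis
    unfolding unital_assoc_algebra_def unital_assoc_algebra_axioms_def
  proof (intro conjI allI impI n)
    fix X Y Z assume X: "X \<in> carrier (M \<boxtimes> N)" and Y: "Y \<in> carrier (M \<boxtimes> N)" and Z: "Z \<in> carrier (M \<boxtimes> N)"
    show "X \<otimes>\<^bsub>M \<boxtimes> N\<^esub> Y \<otimes>\<^bsub>M \<boxtimes> N\<^esub> Z = X \<otimes>\<^bsub>M \<boxtimes> N\<^esub> (Y \<otimes>\<^bsub>M \<boxtimes> N\<^esub> Z)"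
      using m(1,2) X
    proof (induct X rule: tensor_induct')
      case (tens a b)
      show ?case using m(1,2) Y
      proof (induct Y rule: tensor_induct')
        case (tens c d)
        show ?case using m(1,2) Z
          by (induct Z rule: tensor_induct')
            (use tens \<open>a \<in> carrier M\<close> \<open>b \<in> carrier N\<close> M N m n in \<open>simp_all add: mult_add alg_assoc\<close>)
      qed (use tens Z m n in \<open>simp add: mult_add\<close>)
    qed (use Y Z m n in \<open>simp add: mult_add\<close>)
  qed
qed

lemma hom_lin [simp]: "f \<in> alg_hom k M N \<Longrightarrow> f \<in> lin k M N"
  by (auto simp: alg_hom_def lin_def ring_hom_def)

lemma hom_mult: "f \<in> alg_hom k M N \<Longrightarrow> x \<in> carrier M \<Longrightarrow> y \<in> carrier M \<Longrightarrow> f (x \<otimes>\<^bsub>M\<^esub> y) = f x \<otimes>\<^bsub>N\<^esub> f y"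
  and hom_one: "f \<in> alg_hom k M N \<Longrightarrow> f \<one>\<^bsub>M\<^esub> = \<one>\<^bsub>N\<^esub>"
  by (auto simp: alg_hom_def ring_hom_def)

lemma alg_homI:
  assumes "f \<in> lin k M N" "f \<one>\<^bsub>M\<^esub> = \<one>\<^bsub>N\<^esub>"
    and "\<And>x y. x \<in> carrier M \<Longrightarrow> y \<in> carrier M \<Longrightarrow> f (x \<otimes>\<^bsub>M\<^esub> y) = f x \<otimes>\<^bsub>N\<^esub> f y"
  shows "f \<in> alg_hom k M N"
  using assms by (auto simp: alg_hom_def ring_hom_def lin_def Pi_iff)

text \<open>Both sides of the multiplicativity law are additive in each argument, which reduces it
  to pure tensors.\<close>

lemma alg_hom_tensorI:
  assumes n: "nalg M" "nalg N" "nalg P"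
    and l: "f \<in> lin k (M \<boxtimes> N) P" and "f \<one>\<^bsub>M \<boxtimes> N\<^esub> = \<one>\<^bsub>P\<^esub>"
    and m: "\<And>a b c d. a \<in> carrier M \<Longrightarrow> b \<in> carrier N \<Longrightarrow> c \<in> carrier M \<Longrightarrow> d \<in> carrier N \<Longrightarrow>
      f (tens k M N (a \<otimes>\<^bsub>M\<^esub> c) (b \<otimes>\<^bsub>N\<^esub> d)) = f (tens k M N a b) \<otimes>\<^bsub>P\<^esub> f (tens k M N c d)"
  shows "f \<in> alg_hom k (M \<boxtimes> N) P"
proof (rule alg_homI)
  have md: "md M" "md N" using n by auto
  note a = lin_add[OF l] lin_closed[OF l] mult_add
  fix X Y assume X: "X \<in> carrier (M \<boxtimes> N)" and Y: "Y \<in> carrier (M \<boxtimes> N)"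
  show "f (X \<otimes>\<^bsub>M \<boxtimes> N\<^esub> Y) = f X \<otimes>\<^bsub>P\<^esub> f Y"
    using md X
  proof (induct X rule: tensor_induct')
    case (tens a b)
    show ?case using md Y
      by (induct Y rule: tensor_induct') (use n tens in \<open>simp_all add: a m\<close>)
  qed (use n Y in \<open>simp add: a\<close>)
qed fact+

lemma lin_comp_tens_right:
  "md M \<Longrightarrow> md N \<Longrightarrow> a \<in> carrier M \<Longrightarrow> f \<in> lin k P N \<Longrightarrow> (\<lambda>x. tens k M N a (f x)) \<in> lin k P (M \<boxtimes> N)"
  by (rule lin_comp[OF tens_lin_right])

lemma lin_comp_tens_left:
  "md M \<Longrightarrow> md N \<Longrightarrow> b \<in> carrier N \<Longrightarrow> f \<in> lin k P M \<Longrightarrow> (\<lambda>x. tens k M N (f x) b) \<in> lin k P (M \<boxtimes> N)"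
  by (rule lin_comp[OF tens_lin_left])

lemma lin_comp_mult_right:
  "nalg M \<Longrightarrow> x \<in> carrier M \<Longrightarrow> f \<in> lin k P M \<Longrightarrow> (\<lambda>y. x \<otimes>\<^bsub>M\<^esub> f y) \<in> lin k P M"
  by (rule lin_comp[OF mult_lin_right])

lemma lin_comp_mult_left:
  "nalg M \<Longrightarrow> x \<in> carrier M \<Longrightarrow> f \<in> lin k P M \<Longrightarrow> (\<lambda>y. f y \<otimes>\<^bsub>M\<^esub> x) \<in> lin k P M"
  by (rule lin_comp[OF mult_lin_left])

lemmas lin_intros = lin_id lin_comp_tens_right lin_comp_tens_left lin_comp_mult_right lin_comp_mult_left

lemma tens_add:
  assumes "md M" "md N"
  shows "a \<in> carrier M \<Longrightarrow> a' \<in> carrier M \<Longrightarrow> b \<in> carrier N \<Longrightarrow>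
      tens k M N (a \<oplus>\<^bsub>M\<^esub> a') b = tens k M N a b \<oplus>\<^bsub>M \<boxtimes> N\<^esub> tens k M N a' b"
    and "a \<in> carrier M \<Longrightarrow> b \<in> carrier N \<Longrightarrow> b' \<in> carrier N \<Longrightarrow>
      tens k M N a (b \<oplus>\<^bsub>N\<^esub> b') = tens k M N a b \<oplus>\<^bsub>M \<boxtimes> N\<^esub> tens k M N a b'"
  using tens_add_left[OF assms] tens_add_right[OF assms] by auto

subsection \<open>Slot maps\<close>

text \<open>In \<open>tmap_r\<close> and \<open>tsplit\<close> the module arguments record source and target, which makes the
  typing side conditions decidable by rewriting.\<close>

definition tmap_r where
  "tmap_r M N P f X = tsum (M \<boxtimes> P) X (\<lambda>a b. tens k M P a (f b))"

text \<open>This is \<open>X \<otimes> y\<close> for \<open>X\<close> in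
  \<open>B \<otimes> C\<close>. Nesting to the right puts \<open>y\<close> inside the second factor,
  so appending a slot at the end is a map on that factor and not a pure tensor.\<close>

definition app2 where
  "app2 B C D y X = tmap_r B C (C \<boxtimes> D) (\<lambda>x. tens k C D x y) X"

definition app3 where
  "app3 A B C D y X = tmap_r A (B \<boxtimes> C) (B \<boxtimes> (C \<boxtimes> D)) (app2 B C D y) X"

definition tsplit where
  "tsplit M N P Q f X = tsum (P \<boxtimes> (Q \<boxtimes> N)) X (\<lambda>m n. app2 P Q N n (f m))"

lemma tmap_r_bilin:
  "md M \<Longrightarrow> md P \<Longrightarrow> f \<in> lin k N P \<Longrightarrow> bilinear_on k M N (M \<boxtimes> P) (\<lambda>a b. tens k M P a (f b))"
  by (intro bilinear_onI lin_intros) (auto simp: lin_closed)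

context
  fixes M :: "('k, 'a, 'm) module_scheme" and N :: "('k, 'b, 'n) module_scheme"
    and P :: "('k, 'c, 'p) module_scheme" and f
  assumes M: "md M" and N: "md N" and P: "md P" and f: "f \<in> lin k N P"
begin

lemma tmap_r_lin [simp]: "tmap_r M N P f \<in> lin k (M \<boxtimes> N) (M \<boxtimes> P)"
proof -
  have "(\<lambda>X. tmap_r M N P f X) \<in> lin k (M \<boxtimes> N) (M \<boxtimes> P)"
    unfolding tmap_r_def using M N P f by (intro tsum_lin tmap_r_bilin) auto
  then show ?thesis by simp
qed

lemma tmap_r_closed [simp]: "X \<in> carrier (M \<boxtimes> N) \<Longrightarrow> tmap_r M N P f X \<in> carrier (M \<boxtimes> P)"
  by (rule lin_closed[OF tmap_r_lin])

lemma tmap_r_add: "X \<in> carrier (M \<boxtimes> N) \<Longrightarrow> Y \<in> carrier (M \<boxtimes> N) \<Longrightarrow>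
    tmap_r M N P f (X \<oplus>\<^bsub>M \<boxtimes> N\<^esub> Y) = tmap_r M N P f X \<oplus>\<^bsub>M \<boxtimes> P\<^esub> tmap_r M N P f Y"
  by (rule lin_add[OF tmap_r_lin])

lemma tmap_r_tens [simp]: "a \<in> carrier M \<Longrightarrow> b \<in> carrier N \<Longrightarrow>
    tmap_r M N P f (tens k M N a b) = tens k M P a (f b)"
  unfolding tmap_r_def using M N P f by (intro tsum_tens tmap_r_bilin) auto

end

lemma tmap_r_hom [simp]:
  assumes M: "nalg M" and N: "nalg N" and P: "nalg P" and f: "f \<in> alg_hom k N P"
  shows "tmap_r M N P f \<in> alg_hom k (M \<boxtimes> N) (M \<boxtimes> P)"
proof (rule alg_hom_tensorI)
  show "tmap_r M N P f \<one>\<^bsub>M \<boxtimes> N\<^esub> = \<one>\<^bsub>M \<boxtimes> P\<^esub>"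
    using tmap_r_tens[of M N P f "\<one>\<^bsub>M\<^esub>" "\<one>\<^bsub>N\<^esub>"] assms by (simp add: hom_one[OF f])
qed (use assms lin_closed[of f k N P] in \<open>simp_all add: hom_mult[OF f]\<close>)

lemma tmap_r_mult:
  assumes M: "nalg M" and N: "nalg N" and P: "nalg P" and f: "f \<in> alg_hom k N P"
    and X: "X \<in> carrier (M \<boxtimes> N)" "Y \<in> carrier (M \<boxtimes> N)"
  shows "tmap_r M N P f (X \<otimes>\<^bsub>M \<boxtimes> N\<^esub> Y) = tmap_r M N P f X \<otimes>\<^bsub>M \<boxtimes> P\<^esub> tmap_r M N P f Y"
  by (rule hom_mult[OF tmap_r_hom[OF assms(1-4)] X])

lemma tmap_r_one [simp]:
  assumes M: "nalg M" and N: "nalg N" and P: "nalg P" and f: "f \<in> alg_hom k N P"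
  shows "tmap_r M N P f \<one>\<^bsub>M \<boxtimes> N\<^esub> = \<one>\<^bsub>M \<boxtimes> P\<^esub>"
  by (rule hom_one[OF tmap_r_hom[OF assms]])

lemma tmap_r_lin_comp:
  "md M \<Longrightarrow> md N \<Longrightarrow> md P \<Longrightarrow> f \<in> lin k N P \<Longrightarrow> g \<in> lin k R (M \<boxtimes> N) \<Longrightarrow>
    (\<lambda>x. tmap_r M N P f (g x)) \<in> lin k R (M \<boxtimes> P)"
  by (rule lin_comp[OF tmap_r_lin])

lemma tmap_r_cong:
  assumes "md M" "md N" "X \<in> carrier (M \<boxtimes> N)" "\<And>x. x \<in> carrier N \<Longrightarrow> f x = g x"
  shows "tmap_r M N P f X = tmap_r M N P g X"
  unfolding tmap_r_def by (rule tsum_cong[OF assms(1-3)]) (simp add: assms(4))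

lemma tmap_r_comp:
  assumes "md M" "md N" "md P" "md Q" "f \<in> lin k N P" "g \<in> lin k P Q" "X \<in> carrier (M \<boxtimes> N)"
  shows "tmap_r M P Q g (tmap_r M N P f X) = tmap_r M N Q (\<lambda>x. g (f x)) X"
  using assms(1,2,7)
  by (induct X rule: tensor_induct')
    (use assms lin_closed[of f k N P] lin_comp[OF assms(6,5)] in \<open>simp_all add: tmap_r_add\<close>)

lemma tmap_r_id:
  assumes "md M" "md N" "X \<in> carrier (M \<boxtimes> N)"
  shows "tmap_r M N N (\<lambda>x. x) X = X"
  using assms
  by (induct X rule: tensor_induct') (use assms in \<open>simp_all add: tmap_r_add lin_id\<close>)

context
  fixes B :: "('k, 'b, 'n) module_scheme" and C :: "('k, 'c, 'p) module_scheme"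
    and D :: "('k, 'd, 'q) module_scheme"
  assumes B: "md B" and C: "md C" and D: "md D"
begin

lemma app2_closed [simp]:
  "y \<in> carrier D \<Longrightarrow> X \<in> carrier (B \<boxtimes> C) \<Longrightarrow> app2 B C D y X \<in> carrier (B \<boxtimes> (C \<boxtimes> D))"
  unfolding app2_def using B C D by (simp add: tens_lin_left)

lemma app2_lin [simp]: "y \<in> carrier D \<Longrightarrow> app2 B C D y \<in> lin k (B \<boxtimes> C) (B \<boxtimes> (C \<boxtimes> D))"
  unfolding app2_def using B C D by (simp add: tens_lin_left)

lemma app2_tens [simp]:
  "b \<in> carrier B \<Longrightarrow> c \<in> carrier C \<Longrightarrow> y \<in> carrier D \<Longrightarrow>
    app2 B C D y (tens k B C b c) = tens k B (C \<boxtimes> D) b (tens k C D c y)"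
  unfolding app2_def using B C D by (simp add: tens_lin_left)

lemma app2_add:
  "y \<in> carrier D \<Longrightarrow> X \<in> carrier (B \<boxtimes> C) \<Longrightarrow> Y \<in> carrier (B \<boxtimes> C) \<Longrightarrow>
    app2 B C D y (X \<oplus>\<^bsub>B \<boxtimes> C\<^esub> Y) = app2 B C D y X \<oplus>\<^bsub>B \<boxtimes> (C \<boxtimes> D)\<^esub> app2 B C D y Y"
  by (rule lin_add[OF app2_lin])

lemma app2_add_arg:
  assumes y: "y \<in> carrier D" and z: "z \<in> carrier D" and X: "X \<in> carrier (B \<boxtimes> C)"
  shows "app2 B C D (y \<oplus>\<^bsub>D\<^esub> z) X = app2 B C D y X \<oplus>\<^bsub>B \<boxtimes> (C \<boxtimes> D)\<^esub> app2 B C D z X"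
proof -
  interpret T: module k "B \<boxtimes> (C \<boxtimes> D)" using B C D by simp
  show ?thesis using B C X
    by (induct X rule: tensor_induct')
      (use B C D y z in \<open>simp_all add: tens_add app2_add T.add.m_ac del: T.add.m_assoc\<close>)
qed

lemma app2_lin_arg [simp]:
  assumes X: "X \<in> carrier (B \<boxtimes> C)"
  shows "(\<lambda>y. app2 B C D y X) \<in> lin k D (B \<boxtimes> (C \<boxtimes> D))"
proof (rule linI)
  fix c y assume c: "c \<in> carrier k" and y: "y \<in> carrier D"
  show "app2 B C D (c \<odot>\<^bsub>D\<^esub> y) X = c \<odot>\<^bsub>B \<boxtimes> (C \<boxtimes> D)\<^esub> app2 B C D y X"
    using B C X
    by (induct X rule: tensor_induct')
      (use B C D c y in \<open>simp_all add: app2_add tens_smult_right lin_add[OF smult_lin[of "B \<boxtimes> (C \<boxtimes> D)" c]]\<close>)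
qed (use X in \<open>simp_all add: app2_add_arg\<close>)

end

lemma app2_mult:
  assumes "nalg B" "nalg C" "nalg D" "y \<in> carrier D" "z \<in> carrier D"
    "X \<in> carrier (B \<boxtimes> C)" "Y \<in> carrier (B \<boxtimes> C)"
  shows "app2 B C D y X \<otimes>\<^bsub>B \<boxtimes> (C \<boxtimes> D)\<^esub> app2 B C D z Y = app2 B C D (y \<otimes>\<^bsub>D\<^esub> z) (X \<otimes>\<^bsub>B \<boxtimes> C\<^esub> Y)"
proof -
  have m: "md B" "md C" using assms by auto
  show ?thesis using m assms(6)
  proof (induct X rule: tensor_induct')
    case (tens a b)
    show ?case using m assms(7)
      by (induct Y rule: tensor_induct') (use assms tens in \<open>simp_all add: app2_add mult_add\<close>)
  qed (use assms in \<open>simp add: app2_add mult_add\<close>)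
qed

lemma app2_one [simp]:
  assumes "nalg B" "nalg C" "nalg D"
  shows "app2 B C D \<one>\<^bsub>D\<^esub> \<one>\<^bsub>B \<boxtimes> C\<^esub> = \<one>\<^bsub>B \<boxtimes> (C \<boxtimes> D)\<^esub>"
  using assms app2_tens[of B C D "\<one>\<^bsub>B\<^esub>" "\<one>\<^bsub>C\<^esub>" "\<one>\<^bsub>D\<^esub>"] by simp

lemma app2_hom [simp]:
  assumes "nalg B" "nalg C" "nalg D"
  shows "app2 B C D \<one>\<^bsub>D\<^esub> \<in> alg_hom k (B \<boxtimes> C) (B \<boxtimes> (C \<boxtimes> D))"
  by (rule alg_homI) (use assms in \<open>simp_all add: app2_mult\<close>)

context
  fixes A :: "('k, 'a, 'm) module_scheme" and B :: "('k, 'b, 'n) module_scheme"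
    and C :: "('k, 'c, 'p) module_scheme" and D :: "('k, 'd, 'q) module_scheme"
  assumes A: "md A" and B: "md B" and C: "md C" and D: "md D"
begin

lemma app3_closed [simp]:
  "y \<in> carrier D \<Longrightarrow> X \<in> carrier (A \<boxtimes> (B \<boxtimes> C)) \<Longrightarrow> app3 A B C D y X \<in> carrier (A \<boxtimes> (B \<boxtimes> (C \<boxtimes> D)))"
  unfolding app3_def using A B C D by simp

lemma app3_lin [simp]:
  "y \<in> carrier D \<Longrightarrow> app3 A B C D y \<in> lin k (A \<boxtimes> (B \<boxtimes> C)) (A \<boxtimes> (B \<boxtimes> (C \<boxtimes> D)))"
  unfolding app3_def using A B C D by simp

lemma app3_tens [simp]:
  "a \<in> carrier A \<Longrightarrow> X \<in> carrier (B \<boxtimes> C) \<Longrightarrow> y \<in> carrier D \<Longrightarrow>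
    app3 A B C D y (tens k A (B \<boxtimes> C) a X) = tens k A (B \<boxtimes> (C \<boxtimes> D)) a (app2 B C D y X)"
  unfolding app3_def using A B C D by simp

lemma app3_add:
  "y \<in> carrier D \<Longrightarrow> X \<in> carrier (A \<boxtimes> (B \<boxtimes> C)) \<Longrightarrow> Y \<in> carrier (A \<boxtimes> (B \<boxtimes> C)) \<Longrightarrow>
    app3 A B C D y (X \<oplus>\<^bsub>A \<boxtimes> (B \<boxtimes> C)\<^esub> Y) = app3 A B C D y X \<oplus>\<^bsub>A \<boxtimes> (B \<boxtimes> (C \<boxtimes> D))\<^esub> app3 A B C D y Y"
  by (rule lin_add[OF app3_lin])

end

lemma app3_mult:
  assumes "nalg A" "nalg B" "nalg C" "nalg D" "y \<in> carrier D" "z \<in> carrier D"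
    "X \<in> carrier (A \<boxtimes> (B \<boxtimes> C))" "Y \<in> carrier (A \<boxtimes> (B \<boxtimes> C))"
  shows "app3 A B C D y X \<otimes>\<^bsub>A \<boxtimes> (B \<boxtimes> (C \<boxtimes> D))\<^esub> app3 A B C D z Y
    = app3 A B C D (y \<otimes>\<^bsub>D\<^esub> z) (X \<otimes>\<^bsub>A \<boxtimes> (B \<boxtimes> C)\<^esub> Y)"
proof -
  have m: "md A" "md (B \<boxtimes> C)" using assms by auto
  show ?thesis using m assms(7)
  proof (induct X rule: tensor_induct')
    case (tens a b)
    show ?case using m assms(8)
      by (induct Y rule: tensor_induct') (use assms tens in \<open>simp_all add: app3_add app2_mult mult_add\<close>)
  qed (use assms in \<open>simp add: app3_add mult_add\<close>)
qed

lemma app3_one [simp]: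
  assumes "nalg A" "nalg B" "nalg C" "nalg D"
  shows "app3 A B C D \<one>\<^bsub>D\<^esub> \<one>\<^bsub>A \<boxtimes> (B \<boxtimes> C)\<^esub> = \<one>\<^bsub>A \<boxtimes> (B \<boxtimes> (C \<boxtimes> D))\<^esub>"
  using assms app3_tens[of A B C D "\<one>\<^bsub>A\<^esub>" "\<one>\<^bsub>B \<boxtimes> C\<^esub>" "\<one>\<^bsub>D\<^esub>"] by simp

lemma app3_hom [simp]:
  assumes "nalg A" "nalg B" "nalg C" "nalg D"
  shows "app3 A B C D \<one>\<^bsub>D\<^esub> \<in> alg_hom k (A \<boxtimes> (B \<boxtimes> C)) (A \<boxtimes> (B \<boxtimes> (C \<boxtimes> D)))"
  by (rule alg_homI) (use assms in \<open>simp_all add: app3_mult\<close>)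

context
  fixes M :: "('k, 'a, 'm) module_scheme" and N :: "('k, 'b, 'n) module_scheme"
    and P :: "('k, 'c, 'p) module_scheme" and Q :: "('k, 'd, 'q) module_scheme" and f
  assumes M: "md M" and N: "md N" and P: "md P" and Q: "md Q" and f: "f \<in> lin k M (P \<boxtimes> Q)"
begin

lemma tsplit_bilin: "bilinear_on k M N (P \<boxtimes> (Q \<boxtimes> N)) (\<lambda>m n. app2 P Q N n (f m))"
  using M N P Q f by (intro bilinear_onI lin_comp[OF app2_lin f]) (simp_all add: lin_closed)

lemma tsplit_lin [simp]: "tsplit M N P Q f \<in> lin k (M \<boxtimes> N) (P \<boxtimes> (Q \<boxtimes> N))"
proof -
  have "(\<lambda>X. tsplit M N P Q f X) \<in> lin k (M \<boxtimes> N) (P \<boxtimes> (Q \<boxtimes> N))"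
    unfolding tsplit_def using M N P Q f by (intro tsum_lin tsplit_bilin) auto
  then show ?thesis by simp
qed

lemma tsplit_closed [simp]: "X \<in> carrier (M \<boxtimes> N) \<Longrightarrow> tsplit M N P Q f X \<in> carrier (P \<boxtimes> (Q \<boxtimes> N))"
  by (rule lin_closed[OF tsplit_lin])

lemma tsplit_add: "X \<in> carrier (M \<boxtimes> N) \<Longrightarrow> Y \<in> carrier (M \<boxtimes> N) \<Longrightarrow>
    tsplit M N P Q f (X \<oplus>\<^bsub>M \<boxtimes> N\<^esub> Y) = tsplit M N P Q f X \<oplus>\<^bsub>P \<boxtimes> (Q \<boxtimes> N)\<^esub> tsplit M N P Q f Y"
  by (rule lin_add[OF tsplit_lin])

lemma tsplit_tens [simp]: "a \<in> carrier M \<Longrightarrow> b \<in> carrier N \<Longrightarrow>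
    tsplit M N P Q f (tens k M N a b) = app2 P Q N b (f a)"
  unfolding tsplit_def using M N P Q f by (intro tsum_tens tsplit_bilin) auto

end

lemma tsplit_hom [simp]:
  assumes M: "nalg M" and N: "nalg N" and P: "nalg P" and Q: "nalg Q" and f: "f \<in> alg_hom k M (P \<boxtimes> Q)"
  shows "tsplit M N P Q f \<in> alg_hom k (M \<boxtimes> N) (P \<boxtimes> (Q \<boxtimes> N))"
proof (rule alg_hom_tensorI)
  show "tsplit M N P Q f \<one>\<^bsub>M \<boxtimes> N\<^esub> = \<one>\<^bsub>P \<boxtimes> (Q \<boxtimes> N)\<^esub>"
    using tsplit_tens[of M N P Q f "\<one>\<^bsub>M\<^esub>" "\<one>\<^bsub>N\<^esub>"] assms by (simp add: hom_one[OF f])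
qed (use assms lin_closed[of f k M "P \<boxtimes> Q"] in \<open>simp_all add: hom_mult[OF f] app2_mult\<close>)

lemma tsplit_mult:
  assumes M: "nalg M" and N: "nalg N" and P: "nalg P" and Q: "nalg Q" and f: "f \<in> alg_hom k M (P \<boxtimes> Q)"
    and X: "X \<in> carrier (M \<boxtimes> N)" "Y \<in> carrier (M \<boxtimes> N)"
  shows "tsplit M N P Q f (X \<otimes>\<^bsub>M \<boxtimes> N\<^esub> Y) = tsplit M N P Q f X \<otimes>\<^bsub>P \<boxtimes> (Q \<boxtimes> N)\<^esub> tsplit M N P Q f Y"
  by (rule hom_mult[OF tsplit_hom[OF assms(1-5)] X])

lemma tsplit_one [simp]:
  assumes M: "nalg M" and N: "nalg N" and P: "nalg P" and Q: "nalg Q" and f: "f \<in> alg_hom k M (P \<boxtimes> Q)"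
  shows "tsplit M N P Q f \<one>\<^bsub>M \<boxtimes> N\<^esub> = \<one>\<^bsub>P \<boxtimes> (Q \<boxtimes> N)\<^esub>"
  by (rule hom_one[OF tsplit_hom[OF assms]])

lemma tsplit_lin_comp:
  "md M \<Longrightarrow> md N \<Longrightarrow> md P \<Longrightarrow> md Q \<Longrightarrow> f \<in> lin k M (P \<boxtimes> Q) \<Longrightarrow> g \<in> lin k R (M \<boxtimes> N) \<Longrightarrow>
    (\<lambda>x. tsplit M N P Q f (g x)) \<in> lin k R (P \<boxtimes> (Q \<boxtimes> N))"
  by (rule lin_comp[OF tsplit_lin])

lemma app2_lin_comp:
  "md M \<Longrightarrow> md N \<Longrightarrow> md P \<Longrightarrow> y \<in> carrier P \<Longrightarrow> g \<in> lin k R (M \<boxtimes> N) \<Longrightarrow>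
    (\<lambda>x. app2 M N P y (g x)) \<in> lin k R (M \<boxtimes> (N \<boxtimes> P))"
  by (rule lin_comp[OF app2_lin])

lemma app2_lin_comp_arg:
  "md M \<Longrightarrow> md N \<Longrightarrow> md P \<Longrightarrow> X \<in> carrier (M \<boxtimes> N) \<Longrightarrow> g \<in> lin k R P \<Longrightarrow>
    (\<lambda>x. app2 M N P (g x) X) \<in> lin k R (M \<boxtimes> (N \<boxtimes> P))"
  by (rule lin_comp[OF app2_lin_arg])

lemma app3_lin_comp:
  "md L \<Longrightarrow> md M \<Longrightarrow> md N \<Longrightarrow> md P \<Longrightarrow> y \<in> carrier P \<Longrightarrow> g \<in> lin k R (L \<boxtimes> (M \<boxtimes> N)) \<Longrightarrow>
    (\<lambda>x. app3 L M N P y (g x)) \<in> lin k R (L \<boxtimes> (M \<boxtimes> (N \<boxtimes> P)))"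
  by (rule lin_comp[OF app3_lin])

lemmas lin_intros' = lin_intros tmap_r_lin_comp tsplit_lin_comp app2_lin_comp app2_lin_comp_arg app3_lin_comp

lemmas [additivity] = tens_add mult_add tmap_r_add app2_add app3_add tsplit_add app2_add_arg

lemma tmap_r_app2:
  assumes "md B" "md C" "md D" "md E" "g \<in> lin k D E" "y \<in> carrier D" "X \<in> carrier (B \<boxtimes> C)"
  shows "tmap_r B (C \<boxtimes> D) (C \<boxtimes> E) (tmap_r C D E g) (app2 B C D y X) = app2 B C E (g y) X"
  using assms(1,2,7)
  by (induct X rule: tensor_induct') (use assms lin_closed[of g k D E] in \<open>simp_all add: additivity\<close>)

text \<open>The two maps act on disjoint slots. Its main use is to pull a contraction of the last
  slots through a coaction or comultiplication of the first.\<close>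

lemma tsplit_tmap_r:
  assumes m: "md M" "md N" "md P" "md Q" "md N'" and f: "f \<in> lin k M (P \<boxtimes> Q)" and g: "g \<in> lin k N N'"
    and X: "X \<in> carrier (M \<boxtimes> N)"
  shows "tsplit M N' P Q f (tmap_r M N N' g X)
    = tmap_r P (Q \<boxtimes> N) (Q \<boxtimes> N') (tmap_r Q N N' g) (tsplit M N P Q f X)"
  using m(1,2) X
  by (induct X rule: tensor_induct')
    (use m f g lin_closed[OF f] lin_closed[OF g] in \<open>simp_all add: additivity tmap_r_app2\<close>)

section \<open>Comparison of linear maps on iterated tensors, and lifting of relations to further
  slots\<close>

lemma lin_eq3I:
  assumes m: "md A" "md B" "md C"
    and f: "f \<in> lin k (A \<boxtimes> (B \<boxtimes> C)) P" and g: "g \<in> lin k (A \<boxtimes> (B \<boxtimes> C)) P"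
    and eq: "\<And>a b c. a \<in> carrier A \<Longrightarrow> b \<in> carrier B \<Longrightarrow> c \<in> carrier C \<Longrightarrow>
      f (tens3 k A B C a b c) = g (tens3 k A B C a b c)"
    and X: "X \<in> carrier (A \<boxtimes> (B \<boxtimes> C))"
  shows "f X = g X"
proof (rule lin_eqI[OF m(1) _ f g _ X])
  show "md (B \<boxtimes> C)" using m by simp
  fix a Y assume a: "a \<in> carrier A" and Y: "Y \<in> carrier (B \<boxtimes> C)"
  show "f (tens k A (B \<boxtimes> C) a Y) = g (tens k A (B \<boxtimes> C) a Y)"
    by (rule lin_eqI[OF m(2,3) lin_comp[OF f] lin_comp[OF g] _ Y])
      (use m a eq in \<open>simp_all add: tens_lin_right\<close>)
qed

lemma lin_eq4I:
  assumes m: "md A" "md B" "md C" "md D"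
    and f: "f \<in> lin k (A \<boxtimes> (B \<boxtimes> (C \<boxtimes> D))) P" and g: "g \<in> lin k (A \<boxtimes> (B \<boxtimes> (C \<boxtimes> D))) P"
    and eq: "\<And>a b c d. a \<in> carrier A \<Longrightarrow> b \<in> carrier B \<Longrightarrow> c \<in> carrier C \<Longrightarrow> d \<in> carrier D \<Longrightarrow>
      f (tens4 k A B C D a b c d) = g (tens4 k A B C D a b c d)"
    and X: "X \<in> carrier (A \<boxtimes> (B \<boxtimes> (C \<boxtimes> D)))"
  shows "f X = g X"
proof (rule lin_eqI[OF m(1) _ f g _ X])
  show "md (B \<boxtimes> (C \<boxtimes> D))" using m by simp
  fix a Y assume a: "a \<in> carrier A" and Y: "Y \<in> carrier (B \<boxtimes> (C \<boxtimes> D))"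
  show "f (tens k A (B \<boxtimes> (C \<boxtimes> D)) a Y) = g (tens k A (B \<boxtimes> (C \<boxtimes> D)) a Y)"
    by (rule lin_eq3I[OF m(2-4) lin_comp[OF f] lin_comp[OF g] _ Y])
      (use m a eq in \<open>simp_all add: tens_lin_right\<close>)
qed

lemma lin_eq5I:
  assumes m: "md A" "md B" "md C" "md D" "md E"
    and f: "f \<in> lin k (A \<boxtimes> (B \<boxtimes> (C \<boxtimes> (D \<boxtimes> E)))) P" and g: "g \<in> lin k (A \<boxtimes> (B \<boxtimes> (C \<boxtimes> (D \<boxtimes> E)))) P"
    and eq: "\<And>a b c d e. a \<in> carrier A \<Longrightarrow> b \<in> carrier B \<Longrightarrow> c \<in> carrier C \<Longrightarrow> d \<in> carrier D \<Longrightarrow>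
      e \<in> carrier E \<Longrightarrow> f (tens5 k A B C D E a b c d e) = g (tens5 k A B C D E a b c d e)"
    and X: "X \<in> carrier (A \<boxtimes> (B \<boxtimes> (C \<boxtimes> (D \<boxtimes> E))))"
  shows "f X = g X"
proof (rule lin_eqI[OF m(1) _ f g _ X])
  show "md (B \<boxtimes> (C \<boxtimes> (D \<boxtimes> E)))" using m by simp
  fix a Y assume a: "a \<in> carrier A" and Y: "Y \<in> carrier (B \<boxtimes> (C \<boxtimes> (D \<boxtimes> E)))"
  show "f (tens k A (B \<boxtimes> (C \<boxtimes> (D \<boxtimes> E))) a Y) = g (tens k A (B \<boxtimes> (C \<boxtimes> (D \<boxtimes> E))) a Y)"
    by (rule lin_eq4I[OF m(2-5) lin_comp[OF f] lin_comp[OF g] _ Y])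
      (use m a eq in \<open>simp_all add: tens_lin_right\<close>)
qed

lemma md_smult:
  assumes "md M"
  shows "a \<in> carrier k \<Longrightarrow> b \<in> carrier k \<Longrightarrow> x \<in> carrier M \<Longrightarrow> (a \<otimes>\<^bsub>k\<^esub> b) \<odot>\<^bsub>M\<^esub> x = a \<odot>\<^bsub>M\<^esub> (b \<odot>\<^bsub>M\<^esub> x)"
    and "a \<in> carrier k \<Longrightarrow> b \<in> carrier k \<Longrightarrow> x \<in> carrier M \<Longrightarrow> (a \<oplus>\<^bsub>k\<^esub> b) \<odot>\<^bsub>M\<^esub> x = a \<odot>\<^bsub>M\<^esub> x \<oplus>\<^bsub>M\<^esub> b \<odot>\<^bsub>M\<^esub> x"
    and "x \<in> carrier M \<Longrightarrow> \<one>\<^bsub>k\<^esub> \<odot>\<^bsub>M\<^esub> x = x"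
    and "a \<in> carrier k \<Longrightarrow> x \<in> carrier M \<Longrightarrow> y \<in> carrier M \<Longrightarrow> a \<odot>\<^bsub>M\<^esub> (x \<oplus>\<^bsub>M\<^esub> y) = a \<odot>\<^bsub>M\<^esub> x \<oplus>\<^bsub>M\<^esub> a \<odot>\<^bsub>M\<^esub> y"
proof -
  interpret module k M by fact
  show "a \<in> carrier k \<Longrightarrow> b \<in> carrier k \<Longrightarrow> x \<in> carrier M \<Longrightarrow> (a \<otimes>\<^bsub>k\<^esub> b) \<odot>\<^bsub>M\<^esub> x = a \<odot>\<^bsub>M\<^esub> (b \<odot>\<^bsub>M\<^esub> x)"
    by (rule smult_assoc1)
  show "a \<in> carrier k \<Longrightarrow> b \<in> carrier k \<Longrightarrow> x \<in> carrier M \<Longrightarrow> (a \<oplus>\<^bsub>k\<^esub> b) \<odot>\<^bsub>M\<^esub> x = a \<odot>\<^bsub>M\<^esub> x \<oplus>\<^bsub>M\<^esub> b \<odot>\<^bsub>M\<^esub> x"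
    by (rule smult_l_distr)
  show "x \<in> carrier M \<Longrightarrow> \<one>\<^bsub>k\<^esub> \<odot>\<^bsub>M\<^esub> x = x" by simp
  show "a \<in> carrier k \<Longrightarrow> x \<in> carrier M \<Longrightarrow> y \<in> carrier M \<Longrightarrow> a \<odot>\<^bsub>M\<^esub> (x \<oplus>\<^bsub>M\<^esub> y) = a \<odot>\<^bsub>M\<^esub> x \<oplus>\<^bsub>M\<^esub> a \<odot>\<^bsub>M\<^esub> y"
    by (rule smult_r_distr)
qed

lemma md_smult_commute:
  "md M \<Longrightarrow> a \<in> carrier k \<Longrightarrow> b \<in> carrier k \<Longrightarrow> x \<in> carrier M \<Longrightarrow>
    a \<odot>\<^bsub>M\<^esub> (b \<odot>\<^bsub>M\<^esub> x) = b \<odot>\<^bsub>M\<^esub> (a \<odot>\<^bsub>M\<^esub> x)"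
  by (rule lin_smult[OF smult_lin])

lemma tens_smult:
  assumes "md M" "md N" "c \<in> carrier k" "a \<in> carrier M" "b \<in> carrier N"
  shows "tens k M N (c \<odot>\<^bsub>M\<^esub> a) b = c \<odot>\<^bsub>M \<boxtimes> N\<^esub> tens k M N a b"
    and "tens k M N a (c \<odot>\<^bsub>N\<^esub> b) = c \<odot>\<^bsub>M \<boxtimes> N\<^esub> tens k M N a b"
  by (rule tens_smult_left tens_smult_right; fact)+

lemma smult_lin_comp: "md M \<Longrightarrow> c \<in> carrier k \<Longrightarrow> f \<in> lin k P M \<Longrightarrow> (\<lambda>x. c \<odot>\<^bsub>M\<^esub> f x) \<in> lin k P M"
  by (rule lin_comp[OF smult_lin])

text \<open>Lifts a rule for left factors to an additional first slot. It is made for contractions: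
  they are not multiplicative, but they do convert factors \<open>p r\<close> into factors
  \<open>q r\<close>, typically with \<open>p\<close> a comultiplication and \<open>q\<close> a
  counit.\<close>

lemma tmap_r_semilin:
  assumes "nalg M" "nalg N" "nalg P" "md R"
    and B: "B \<in> lin k N P" and p: "p \<in> lin k R N" and q: "q \<in> lin k R P"
    and eq: "\<And>r n. r \<in> carrier R \<Longrightarrow> n \<in> carrier N \<Longrightarrow> B (p r \<otimes>\<^bsub>N\<^esub> n) = q r \<otimes>\<^bsub>P\<^esub> B n"
    and Y: "Y \<in> carrier (M \<boxtimes> R)" and t: "t \<in> carrier (M \<boxtimes> N)"
  shows "tmap_r M N P B (tmap_r M R N p Y \<otimes>\<^bsub>M \<boxtimes> N\<^esub> t) = tmap_r M R P q Y \<otimes>\<^bsub>M \<boxtimes> P\<^esub> tmap_r M N P B t"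
proof -
  have m: "md M" "md N" "md R" "md P" using assms by auto
  note cl = lin_closed[OF B] lin_closed[OF p] lin_closed[OF q]
  show ?thesis using m(1,3) Y
  proof (induct Y rule: tensor_induct')
    case (tens a b)
    show ?case using m(1,2) t
      by (induct t rule: tensor_induct') (use assms tens m cl in \<open>simp_all add: additivity\<close>)
  qed (use assms m cl in \<open>simp_all add: additivity\<close>)
qed

lemma tmap_r_semilin_right:
  assumes "nalg M" "nalg N" "nalg P" "md R"
    and B: "B \<in> lin k N P" and p: "p \<in> lin k R N" and q: "q \<in> lin k R P"
    and eq: "\<And>r n. r \<in> carrier R \<Longrightarrow> n \<in> carrier N \<Longrightarrow> B (n \<otimes>\<^bsub>N\<^esub> p r) = B n \<otimes>\<^bsub>P\<^esub> q r"
    and Y: "Y \<in> carrier (M \<boxtimes> R)" and t: "t \<in> carrier (M \<boxtimes> N)"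
  shows "tmap_r M N P B (t \<otimes>\<^bsub>M \<boxtimes> N\<^esub> tmap_r M R N p Y) = tmap_r M N P B t \<otimes>\<^bsub>M \<boxtimes> P\<^esub> tmap_r M R P q Y"
proof -
  have m: "md M" "md N" "md R" "md P" using assms by auto
  note cl = lin_closed[OF B] lin_closed[OF p] lin_closed[OF q]
  show ?thesis using m(1,3) Y
  proof (induct Y rule: tensor_induct')
    case (tens a b)
    show ?case using m(1,2) t
      by (induct t rule: tensor_induct') (use assms tens m cl in \<open>simp_all add: additivity\<close>)
  qed (use assms m cl in \<open>simp_all add: additivity\<close>)
qed

lemma tmap_r_intertwine:
  assumes "nalg M" "nalg N" "md R"
    and p: "p \<in> lin k R N" and q: "q \<in> lin k R N" and c: "c \<in> carrier N"
    and eq: "\<And>r. r \<in> carrier R \<Longrightarrow> c \<otimes>\<^bsub>N\<^esub> p r = q r \<otimes>\<^bsub>N\<^esub> c"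
    and Y: "Y \<in> carrier (M \<boxtimes> R)"
  shows "tens k M N \<one>\<^bsub>M\<^esub> c \<otimes>\<^bsub>M \<boxtimes> N\<^esub> tmap_r M R N p Y = tmap_r M R N q Y \<otimes>\<^bsub>M \<boxtimes> N\<^esub> tens k M N \<one>\<^bsub>M\<^esub> c"
proof -
  have m: "md M" "md N" "md R" using assms by auto
  note cl = lin_closed[OF p] lin_closed[OF q]
  show ?thesis using m(1,3) Y
    by (induct Y rule: tensor_induct') (use assms m cl in \<open>simp_all add: additivity\<close>)
qed

end

section \<open>Quasi-Hopf algebras\<close>

text \<open>The axioms enter as one predicate and are interpreted only where they are used. In this
  way \<open>H\<close> and the later \<open>A\<close>, \<open>B\<close> and \<open>U\<close> are all
  handled by the same conditional rules of \<open>field_base\<close>.\<close>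

locale quasi_hopf_base =
  fixes k :: "('k, 'r) ring_scheme" and H :: "('k, 'h, 'x) quasi_hopf_scheme"
  assumes quasi_hopf: "quasi_hopf_algebra k H"

sublocale quasi_hopf_base \<subseteq> field_base k
proof (rule field_base.intro)
  interpret quasi_hopf_algebra k H by (rule quasi_hopf)
  show "field k" by (rule K.field_axioms)
qed

context quasi_hopf_base
begin

abbreviation "S \<equiv> antip H"
abbreviation "S' \<equiv> antip_inv H"
abbreviation "al \<equiv> antip_alpha H"
abbreviation "be \<equiv> antip_beta H"
abbreviation "ep \<equiv> counit H"
abbreviation "Dl \<equiv> comul H"
abbreviation "Ph \<equiv> reass H"
abbreviation "Ph' \<equiv> reass_inv k H"
abbreviation "H2 \<equiv> H \<boxtimes> H"
abbreviation "H3 \<equiv> H \<boxtimes> H2"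
abbreviation "H4 \<equiv> H \<boxtimes> H3"
abbreviation "dH Y \<equiv> tsplit H Y H H Dl"

lemma alg_H [simp]: "alg H"
  using quasi_hopf by (simp add: quasi_hopf_algebra_def quasi_bialgebra_def)

interpretation qh: quasi_hopf_algebra k H by (rule quasi_hopf)

lemma Dl_hom [simp]: "Dl \<in> alg_hom k H H2" by (rule qh.comul_hom)

lemma Dl_closed [simp]: "h \<in> carrier H \<Longrightarrow> Dl h \<in> carrier H2"
  by (rule lin_closed[OF hom_lin[OF Dl_hom]])

lemma Dl_mult: "g \<in> carrier H \<Longrightarrow> h \<in> carrier H \<Longrightarrow> Dl (g \<otimes>\<^bsub>H\<^esub> h) = Dl g \<otimes>\<^bsub>H2\<^esub> Dl h"
  by (rule hom_mult[OF Dl_hom])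

lemma Dl_one [simp]: "Dl \<one>\<^bsub>H\<^esub> = \<one>\<^bsub>H2\<^esub>"
  by (rule hom_one[OF Dl_hom])

lemma Dl_add: "g \<in> carrier H \<Longrightarrow> h \<in> carrier H \<Longrightarrow> Dl (g \<oplus>\<^bsub>H\<^esub> h) = Dl g \<oplus>\<^bsub>H2\<^esub> Dl h"
  by (rule lin_add[OF hom_lin[OF Dl_hom]])

lemma ep_closed [simp]: "h \<in> carrier H \<Longrightarrow> ep h \<in> carrier k"
  and ep_one [simp]: "ep \<one>\<^bsub>H\<^esub> = \<one>\<^bsub>k\<^esub>"
  and ep_mult: "g \<in> carrier H \<Longrightarrow> h \<in> carrier H \<Longrightarrow> ep (g \<otimes>\<^bsub>H\<^esub> h) = ep g \<otimes>\<^bsub>k\<^esub> ep h"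
  and ep_add: "g \<in> carrier H \<Longrightarrow> h \<in> carrier H \<Longrightarrow> ep (g \<oplus>\<^bsub>H\<^esub> h) = ep g \<oplus>\<^bsub>k\<^esub> ep h"
  using qh.counit_hom by (auto simp: ring_hom_def)

lemma ep_smult: "c \<in> carrier k \<Longrightarrow> h \<in> carrier H \<Longrightarrow> ep (c \<odot>\<^bsub>H\<^esub> h) = c \<otimes>\<^bsub>k\<^esub> ep h"
  by (rule qh.counit_smult)

lemma ep_smult_lin: "md M \<Longrightarrow> x \<in> carrier M \<Longrightarrow> (\<lambda>h. ep h \<odot>\<^bsub>M\<^esub> x) \<in> lin k H M"
  by (rule linI) (simp_all add: ep_add ep_smult md_smult)

lemma S_lin [simp]: "S \<in> lin k H H"
  by (rule linI) (use qh.antip_bij in \<open>auto simp: bij_betw_def qh.antip_add qh.antip_smult\<close>)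

lemma S_closed [simp]: "h \<in> carrier H \<Longrightarrow> S h \<in> carrier H"
  by (rule lin_closed[OF S_lin])

lemma S_mult: "g \<in> carrier H \<Longrightarrow> h \<in> carrier H \<Longrightarrow> S (g \<otimes>\<^bsub>H\<^esub> h) = S h \<otimes>\<^bsub>H\<^esub> S g"
  by (rule qh.antip_mult)

lemma S_one [simp]: "S \<one>\<^bsub>H\<^esub> = \<one>\<^bsub>H\<^esub>" by (rule qh.antip_one)

lemma S_S' [simp]: "h \<in> carrier H \<Longrightarrow> S (S' h) = h"
  unfolding antip_inv_def using qh.antip_bij by (auto simp: bij_betw_def f_inv_into_f)

lemma S'_S [simp]: "h \<in> carrier H \<Longrightarrow> S' (S h) = h"
  unfolding antip_inv_def using qh.antip_bij by (auto simp: bij_betw_def inv_into_f_f)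

lemma S'_closed [simp]: "h \<in> carrier H \<Longrightarrow> S' h \<in> carrier H"
  unfolding antip_inv_def using qh.antip_bij by (metis bij_betw_def inv_into_into)

lemma S_inject: "g \<in> carrier H \<Longrightarrow> h \<in> carrier H \<Longrightarrow> S g = S h \<Longrightarrow> g = h"
  using S'_S by metis

lemma S'_lin [simp]: "S' \<in> lin k H H"
proof (rule linI)
  show "S' (g \<oplus>\<^bsub>H\<^esub> h) = S' g \<oplus>\<^bsub>H\<^esub> S' h" if "g \<in> carrier H" "h \<in> carrier H" for g h
    by (rule S_inject) (simp_all add: that lin_add[OF S_lin])
  show "S' (c \<odot>\<^bsub>H\<^esub> h) = c \<odot>\<^bsub>H\<^esub> S' h" if "c \<in> carrier k" "h \<in> carrier H" for c h
    by (rule S_inject) (simp_all add: that lin_smult[OF S_lin])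
qed simp

lemma S'_mult: "g \<in> carrier H \<Longrightarrow> h \<in> carrier H \<Longrightarrow> S' (g \<otimes>\<^bsub>H\<^esub> h) = S' h \<otimes>\<^bsub>H\<^esub> S' g"
  by (rule S_inject) (simp_all add: S_mult)

lemma S'_one [simp]: "S' \<one>\<^bsub>H\<^esub> = \<one>\<^bsub>H\<^esub>"
  by (rule S_inject) simp_all

lemma al_closed [simp]: "al \<in> carrier H" and be_closed [simp]: "be \<in> carrier H"
  by (rule qh.alpha_in_carrier qh.beta_in_carrier)+

lemma ep_S: "h \<in> carrier H \<Longrightarrow> ep (S h) = ep h" by (rule qh.counit_antip)

lemma ep_S' [simp]: "h \<in> carrier H \<Longrightarrow> ep (S' h) = ep h"
  using ep_S[of "S' h"] by simp

lemma ep_al [simp]: "ep al = \<one>\<^bsub>k\<^esub>" and ep_be [simp]: "ep be = \<one>\<^bsub>k\<^esub>"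
  by (rule qh.counit_alpha qh.counit_beta)+

lemma alg_monoid: "alg M \<Longrightarrow> Group.monoid M"
  by (rule Group.monoidI) (simp_all add: alg_assoc)

lemma Ph_closed [simp]: "Ph \<in> carrier H3" and Ph'_closed [simp]: "Ph' \<in> carrier H3"
  and Ph_inv [simp]: "Ph \<otimes>\<^bsub>H3\<^esub> Ph' = \<one>\<^bsub>H3\<^esub>" "Ph' \<otimes>\<^bsub>H3\<^esub> Ph = \<one>\<^bsub>H3\<^esub>"
proof -
  interpret m: Group.monoid H3 by (rule alg_monoid) simp
  note u = qh.reass_unit
  show "Ph \<in> carrier H3" "Ph' \<in> carrier H3"
    "Ph \<otimes>\<^bsub>H3\<^esub> Ph' = \<one>\<^bsub>H3\<^esub>" "Ph' \<otimes>\<^bsub>H3\<^esub> Ph = \<one>\<^bsub>H3\<^esub>"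
    using u by (auto simp: reass_inv_def m.Units_r_inv m.Units_l_inv)
qed

definition counit_l where "counit_l Y X = tsum Y X (\<lambda>h y. ep h \<odot>\<^bsub>Y\<^esub> y)"
definition counit_r where "counit_r Y X = tsum Y X (\<lambda>y h. ep h \<odot>\<^bsub>Y\<^esub> y)"

lemma counit_l_bilin: "md Y \<Longrightarrow> bilinear_on k H Y Y (\<lambda>h y. ep h \<odot>\<^bsub>Y\<^esub> y)"
  by (intro bilinear_onI ep_smult_lin smult_lin) auto

lemma counit_r_bilin: "md Y \<Longrightarrow> bilinear_on k Y H Y (\<lambda>y h. ep h \<odot>\<^bsub>Y\<^esub> y)"
  by (intro bilinear_onI ep_smult_lin smult_lin) auto

lemma counit_l_tens [simp]: "md Y \<Longrightarrow> h \<in> carrier H \<Longrightarrow> y \<in> carrier Y \<Longrightarrow> counit_l Y (tens k H Y h y) = ep h \<odot>\<^bsub>Y\<^esub> y"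
  unfolding counit_l_def by (rule tsum_tens[OF _ _ _ counit_l_bilin]) auto

lemma counit_r_tens [simp]: "md Y \<Longrightarrow> h \<in> carrier H \<Longrightarrow> y \<in> carrier Y \<Longrightarrow> counit_r Y (tens k Y H y h) = ep h \<odot>\<^bsub>Y\<^esub> y"
  unfolding counit_r_def by (rule tsum_tens[OF _ _ _ counit_r_bilin]) auto

lemma counit_l_lin [simp]: "md Y \<Longrightarrow> counit_l Y \<in> lin k (H \<boxtimes> Y) Y"
  using tsum_lin[OF _ _ _ counit_l_bilin[of Y]] by (simp add: counit_l_def[abs_def])

lemma counit_r_lin [simp]: "md Y \<Longrightarrow> counit_r Y \<in> lin k (Y \<boxtimes> H) Y"
  using tsum_lin[OF _ _ _ counit_r_bilin[of Y]] by (simp add: counit_r_def[abs_def])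

lemma counit_l_closed [simp]: "md Y \<Longrightarrow> X \<in> carrier (H \<boxtimes> Y) \<Longrightarrow> counit_l Y X \<in> carrier Y"
  by (rule lin_closed[OF counit_l_lin])

lemma counit_r_closed [simp]: "md Y \<Longrightarrow> X \<in> carrier (Y \<boxtimes> H) \<Longrightarrow> counit_r Y X \<in> carrier Y"
  by (rule lin_closed[OF counit_r_lin])

lemma counit_l_hom [simp]: assumes "nalg Y" shows "counit_l Y \<in> alg_hom k (H \<boxtimes> Y) Y"
  by (rule alg_hom_tensorI)
    (use assms counit_l_tens[of Y "\<one>\<^bsub>H\<^esub>" "\<one>\<^bsub>Y\<^esub>"] in \<open>simp_all add: ep_mult md_smult mult_smult md_smult_commute\<close>)

lemma counit_r_hom [simp]: assumes "nalg Y" shows "counit_r Y \<in> alg_hom k (Y \<boxtimes> H) Y"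
  by (rule alg_hom_tensorI)
    (use assms counit_r_tens[of Y "\<one>\<^bsub>H\<^esub>" "\<one>\<^bsub>Y\<^esub>"] in \<open>simp_all add: ep_mult md_smult mult_smult md_smult_commute\<close>)

lemma counit_l_add: "md Y \<Longrightarrow> X \<in> carrier (H \<boxtimes> Y) \<Longrightarrow> Z \<in> carrier (H \<boxtimes> Y) \<Longrightarrow>
    counit_l Y (X \<oplus>\<^bsub>H \<boxtimes> Y\<^esub> Z) = counit_l Y X \<oplus>\<^bsub>Y\<^esub> counit_l Y Z"
  by (rule lin_add[OF counit_l_lin])

lemma counit_r_add: "md Y \<Longrightarrow> X \<in> carrier (Y \<boxtimes> H) \<Longrightarrow> Z \<in> carrier (Y \<boxtimes> H) \<Longrightarrow>
    counit_r Y (X \<oplus>\<^bsub>Y \<boxtimes> H\<^esub> Z) = counit_r Y X \<oplus>\<^bsub>Y\<^esub> counit_r Y Z"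
  by (rule lin_add[OF counit_r_lin])

lemmas [additivity] = counit_l_add counit_r_add lin_add[OF S_lin] lin_add[OF S'_lin] Dl_add

lemma counit_Dl [simp]: "h \<in> carrier H \<Longrightarrow> counit_l H (Dl h) = h" "h \<in> carrier H \<Longrightarrow> counit_r H (Dl h) = h"
  using qh.counit_left qh.counit_right by (simp_all add: counit_l_def counit_r_def)

end

section \<open>Multilinear Sweedler sums over three, four and five slots\<close>

context field_base
begin

text \<open>The representative of \<open>X\<close> does not change with the parameter, so linearity
  of each single summand passes to the sum.\<close>

lemma tsum_lin_param:
  assumes m: "md M" "md N" "md P" "md R" and X: "X \<in> carrier (M \<boxtimes> N)"
    and f: "\<And>a b. a \<in> carrier M \<Longrightarrow> b \<in> carrier N \<Longrightarrow> (\<lambda>r. f r a b) \<in> lin k R P"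
  shows "(\<lambda>r. tsum P X (f r)) \<in> lin k R P"
proof (rule linI)
  have f_cl: "f r a b \<in> carrier P" if "r \<in> carrier R" "a \<in> carrier M" "b \<in> carrier N" for r a b
    by (rule lin_closed[OF f]) (use that in auto)
  show "tsum P X (f r) \<in> carrier P" if "r \<in> carrier R" for r
    by (rule tsum_closed[OF m(1-3) X f_cl[OF that]])
  show "tsum P X (f (r \<oplus>\<^bsub>R\<^esub> s)) = tsum P X (f r) \<oplus>\<^bsub>P\<^esub> tsum P X (f s)"
    if rs: "r \<in> carrier R" "s \<in> carrier R" for r s
  proof -
    have "tsum P X (f (r \<oplus>\<^bsub>R\<^esub> s)) = tsum P X (\<lambda>a b. f r a b \<oplus>\<^bsub>P\<^esub> f s a b)"
      by (rule tsum_cong[OF m(1,2) X]) (simp add: lin_add[OF f] rs)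
    then show ?thesis
      using tsum_add[OF m(1-3) X, of "f r" "f s"] f_cl rs by simp
  qed
  show "tsum P X (f (c \<odot>\<^bsub>R\<^esub> r)) = c \<odot>\<^bsub>P\<^esub> tsum P X (f r)"
    if crossed_pure: "c \<in> carrier k" "r \<in> carrier R" for c r
  proof -
    have "tsum P X (f (c \<odot>\<^bsub>R\<^esub> r)) = tsum P X (\<lambda>a b. c \<odot>\<^bsub>P\<^esub> f r a b)"
      by (rule tsum_cong[OF m(1,2) X]) (simp add: lin_smult[OF f] crossed_pure)
    then show ?thesis
      using tsum_smult[OF m(1-3) X crossed_pure(1), of "f r"] f_cl crossed_pure by simp
  qed
qed

lemma tsum2_lin:
  assumes m: "md M" "md N" "md P"
    and f: "\<And>a. a \<in> carrier M \<Longrightarrow> (\<lambda>b. f a b) \<in> lin k N P" "\<And>b. b \<in> carrier N \<Longrightarrow> (\<lambda>a. f a b) \<in> lin k M P"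
  shows "(\<lambda>X. tsum P X f) \<in> lin k (M \<boxtimes> N) P"
    and "a \<in> carrier M \<Longrightarrow> b \<in> carrier N \<Longrightarrow> tsum P (tens k M N a b) f = f a b"
  using tsum_lin[OF m bilinear_onI[OF f]] tsum_tens[OF m bilinear_onI[OF f]] by auto

lemma tsum3_lin:
  assumes m: "md A" "md B" "md C" "md P"
    and f1: "\<And>b c. b \<in> carrier B \<Longrightarrow> c \<in> carrier C \<Longrightarrow> (\<lambda>a. f a b c) \<in> lin k A P"
    and f2: "\<And>a c. a \<in> carrier A \<Longrightarrow> c \<in> carrier C \<Longrightarrow> (\<lambda>b. f a b c) \<in> lin k B P"
    and f3: "\<And>a b. a \<in> carrier A \<Longrightarrow> b \<in> carrier B \<Longrightarrow> (\<lambda>c. f a b c) \<in> lin k C P"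
  shows "(\<lambda>X. tsum3 P X f) \<in> lin k (A \<boxtimes> (B \<boxtimes> C)) P"
    and "a \<in> carrier A \<Longrightarrow> b \<in> carrier B \<Longrightarrow> c \<in> carrier C \<Longrightarrow> tsum3 P (tens3 k A B C a b c) f = f a b c"
proof -
  have 1: "(\<lambda>Y. tsum P Y (f a)) \<in> lin k (B \<boxtimes> C) P" if "a \<in> carrier A" for a
    by (rule tsum2_lin(1)[OF m(2-4) f3 f2]) (use that in auto)
  have 2: "(\<lambda>a. tsum P Y (f a)) \<in> lin k A P" if "Y \<in> carrier (B \<boxtimes> C)" for Y
    by (rule tsum_lin_param[OF m(2-4) m(1) that f1])
  have m': "md (B \<boxtimes> C)" using m by simp
  show "(\<lambda>X. tsum3 P X f) \<in> lin k (A \<boxtimes> (B \<boxtimes> C)) P"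
    by (rule tsum2_lin(1)[OF m(1) m' m(4) 1 2])
  show "tsum3 P (tens3 k A B C a b c) f = f a b c"
    if "a \<in> carrier A" "b \<in> carrier B" "c \<in> carrier C"
  proof -
    have "tsum3 P (tens3 k A B C a b c) f = tsum P (tens k B C b c) (f a)"
      by (rule tsum2_lin(2)[OF m(1) m' m(4) 1 2]) (use that m in auto)
    also have "\<dots> = f a b c"
      by (rule tsum2_lin(2)[OF m(2-4) f3 f2]) (use that in auto)
    finally show ?thesis .
  qed
qed

lemma tsum4_lin:
  assumes m: "md A" "md B" "md C" "md D" "md P"
    and f1: "\<And>b c d. b \<in> carrier B \<Longrightarrow> c \<in> carrier C \<Longrightarrow> d \<in> carrier D \<Longrightarrow> (\<lambda>a. f a b c d) \<in> lin k A P"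
    and f2: "\<And>a c d. a \<in> carrier A \<Longrightarrow> c \<in> carrier C \<Longrightarrow> d \<in> carrier D \<Longrightarrow> (\<lambda>b. f a b c d) \<in> lin k B P"
    and f3: "\<And>a b d. a \<in> carrier A \<Longrightarrow> b \<in> carrier B \<Longrightarrow> d \<in> carrier D \<Longrightarrow> (\<lambda>c. f a b c d) \<in> lin k C P"
    and f4: "\<And>a b c. a \<in> carrier A \<Longrightarrow> b \<in> carrier B \<Longrightarrow> c \<in> carrier C \<Longrightarrow> (\<lambda>d. f a b c d) \<in> lin k D P"
  shows "(\<lambda>X. tsum4 P X f) \<in> lin k (A \<boxtimes> (B \<boxtimes> (C \<boxtimes> D))) P"
    and "a \<in> carrier A \<Longrightarrow> b \<in> carrier B \<Longrightarrow> c \<in> carrier C \<Longrightarrow> d \<in> carrier D \<Longrightarrow>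
      tsum4 P (tens4 k A B C D a b c d) f = f a b c d"
proof -
  have 1: "(\<lambda>Y. tsum3 P Y (f a)) \<in> lin k (B \<boxtimes> (C \<boxtimes> D)) P" if "a \<in> carrier A" for a
    by (rule tsum3_lin(1)[OF m(2-5)]) (use that f2 f3 f4 in auto)
  have 2: "(\<lambda>a. tsum3 P Y (f a)) \<in> lin k A P" if "Y \<in> carrier (B \<boxtimes> (C \<boxtimes> D))" for Y
  proof (rule tsum_lin_param[OF m(2) _ m(5) m(1) that])
    show "(\<lambda>a. tsum P Z (f a b)) \<in> lin k A P" if "b \<in> carrier B" "Z \<in> carrier (C \<boxtimes> D)" for b Z
      by (rule tsum_lin_param[OF m(3-5) m(1) that(2)]) (use f1 that in auto)
  qed (use m in auto)
  have m': "md (B \<boxtimes> (C \<boxtimes> D))" using m by simp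
  show "(\<lambda>X. tsum4 P X f) \<in> lin k (A \<boxtimes> (B \<boxtimes> (C \<boxtimes> D))) P"
    by (rule tsum2_lin(1)[OF m(1) m' m(5) 1 2])
  show "tsum4 P (tens4 k A B C D a b c d) f = f a b c d"
    if "a \<in> carrier A" "b \<in> carrier B" "c \<in> carrier C" "d \<in> carrier D"
  proof -
    have "tsum4 P (tens4 k A B C D a b c d) f = tsum3 P (tens3 k B C D b c d) (f a)"
      by (rule tsum2_lin(2)[OF m(1) m' m(5) 1 2]) (use that m in auto)
    also have "\<dots> = f a b c d"
      by (rule tsum3_lin(2)[OF m(2-5)]) (use that f2 f3 f4 in auto)
    finally show ?thesis .
  qed
qed

lemma tsum3_eq_lin:
  assumes m: "md A" "md B" "md C" "md P"
    and L: "L \<in> lin k (A \<boxtimes> (B \<boxtimes> C)) P" and X: "X \<in> carrier (A \<boxtimes> (B \<boxtimes> C))"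
    and eq: "\<And>a b c. a \<in> carrier A \<Longrightarrow> b \<in> carrier B \<Longrightarrow> c \<in> carrier C \<Longrightarrow> f a b c = L (tens3 k A B C a b c)"
  shows "tsum3 P X f = L X"
proof (rule tsum_eq_lin[OF m(1) _ m(4) L X])
  show "tsum P Y (f a) = L (tens k A (B \<boxtimes> C) a Y)" if "a \<in> carrier A" "Y \<in> carrier (B \<boxtimes> C)" for a Y
    by (rule tsum_eq_lin[OF m(2-4) lin_comp[OF L] that(2)])
      (use m that eq in \<open>simp_all add: tens_lin_right\<close>)
qed (use m in simp)

lemma tsum3_closed:
  assumes m: "md A" "md B" "md C" "md P" and X: "X \<in> carrier (A \<boxtimes> (B \<boxtimes> C))"
    and f: "\<And>a b c. a \<in> carrier A \<Longrightarrow> b \<in> carrier B \<Longrightarrow> c \<in> carrier C \<Longrightarrow> f a b c \<in> carrier P"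
  shows "tsum3 P X f \<in> carrier P"
  by (rule tsum_closed[OF m(1) md_tensor[OF m(2,3)] m(4) X], rule tsum_closed[OF m(2-4)]) (auto intro: f)

lemma tsum3_cong:
  assumes m: "md A" "md B" "md C" and X: "X \<in> carrier (A \<boxtimes> (B \<boxtimes> C))"
    and f: "\<And>a b c. a \<in> carrier A \<Longrightarrow> b \<in> carrier B \<Longrightarrow> c \<in> carrier C \<Longrightarrow> f a b c = g a b c"
  shows "tsum3 P X f = tsum3 P X g"
  by (rule tsum_cong[OF m(1) md_tensor[OF m(2,3)] X], rule tsum_cong[OF m(2,3)]) (auto intro: f)

lemma lin_tsum3:
  assumes m: "md A" "md B" "md C" "md P" "md P'" and L: "L \<in> lin k P P'" and X: "X \<in> carrier (A \<boxtimes> (B \<boxtimes> C))"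
    and f: "\<And>a b c. a \<in> carrier A \<Longrightarrow> b \<in> carrier B \<Longrightarrow> c \<in> carrier C \<Longrightarrow> f a b c \<in> carrier P"
  shows "L (tsum3 P X f) = tsum3 P' X (\<lambda>a b c. L (f a b c))"
proof -
  note m' = m(1) md_tensor[OF m(2,3)]
  have f': "tsum P Y (f a) \<in> carrier P" if "a \<in> carrier A" "Y \<in> carrier (B \<boxtimes> C)" for a Y
    by (rule tsum_closed[OF m(2-4)]) (use that f in auto)
  have "L (tsum3 P X f) = tsum P' X (\<lambda>a Y. L (tsum P Y (f a)))"
    by (rule lin_tsum[OF m' m(4,5) L X f'])
  also have "\<dots> = tsum3 P' X (\<lambda>a b c. L (f a b c))"
    by (rule tsum_cong[OF m' X], rule lin_tsum[OF m(2-5) L]) (auto intro: f)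
  finally show ?thesis .
qed

lemma tsum_closed':
  assumes "md M" "md N" "md P" "X \<in> carrier (M \<boxtimes> N)"
    and "\<And>a b. a \<in> carrier M \<Longrightarrow> b \<in> carrier N \<Longrightarrow> f a b \<in> carrier P"
  shows "tsum P X f \<in> carrier P"
  using assms by (rule tsum_closed)

lemma lin_tsum_eq:
  assumes m: "md M" "md N" "md P" "md P'" and L: "L \<in> lin k P P'" and L': "L' \<in> lin k (M \<boxtimes> N) P'"
    and X: "X \<in> carrier (M \<boxtimes> N)"
    and f: "\<And>a b. a \<in> carrier M \<Longrightarrow> b \<in> carrier N \<Longrightarrow> f a b \<in> carrier P"
    and eq: "\<And>a b. a \<in> carrier M \<Longrightarrow> b \<in> carrier N \<Longrightarrow> L (f a b) = L' (tens k M N a b)"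
  shows "L (tsum P X f) = L' X"
  using lin_tsum[OF m L X, of f] tsum_eq_lin[OF m(1,2,4) L' X, of "\<lambda>a b. L (f a b)"] f eq by simp

lemma lin_tsum3_eq:
  assumes m: "md A" "md B" "md C" "md P" "md P'" and L: "L \<in> lin k P P'"
    and L': "L' \<in> lin k (A \<boxtimes> (B \<boxtimes> C)) P'" and X: "X \<in> carrier (A \<boxtimes> (B \<boxtimes> C))"
    and f: "\<And>a b c. a \<in> carrier A \<Longrightarrow> b \<in> carrier B \<Longrightarrow> c \<in> carrier C \<Longrightarrow> f a b c \<in> carrier P"
    and eq: "\<And>a b c. a \<in> carrier A \<Longrightarrow> b \<in> carrier B \<Longrightarrow> c \<in> carrier C \<Longrightarrow> L (f a b c) = L' (tens3 k A B C a b c)"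
  shows "L (tsum3 P X f) = L' X"
  using lin_tsum3[OF m L X, of f] tsum3_eq_lin[OF m(1-3,5) L' X, of "\<lambda>a b c. L (f a b c)"] f eq by simp

lemma tsum5_lin:
  assumes m: "md A" "md B" "md C" "md D" "md E" "md P"
    and f1: "\<And>b c d e. b \<in> carrier B \<Longrightarrow> c \<in> carrier C \<Longrightarrow> d \<in> carrier D \<Longrightarrow> e \<in> carrier E \<Longrightarrow> (\<lambda>a. f a b c d e) \<in> lin k A P"
    and f2: "\<And>a c d e. a \<in> carrier A \<Longrightarrow> c \<in> carrier C \<Longrightarrow> d \<in> carrier D \<Longrightarrow> e \<in> carrier E \<Longrightarrow> (\<lambda>b. f a b c d e) \<in> lin k B P"
    and f3: "\<And>a b d e. a \<in> carrier A \<Longrightarrow> b \<in> carrier B \<Longrightarrow> d \<in> carrier D \<Longrightarrow> e \<in> carrier E \<Longrightarrow> (\<lambda>c. f a b c d e) \<in> lin k C P"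
    and f4: "\<And>a b c e. a \<in> carrier A \<Longrightarrow> b \<in> carrier B \<Longrightarrow> c \<in> carrier C \<Longrightarrow> e \<in> carrier E \<Longrightarrow> (\<lambda>d. f a b c d e) \<in> lin k D P"
    and f5: "\<And>a b c d. a \<in> carrier A \<Longrightarrow> b \<in> carrier B \<Longrightarrow> c \<in> carrier C \<Longrightarrow> d \<in> carrier D \<Longrightarrow> (\<lambda>e. f a b c d e) \<in> lin k E P"
  shows "(\<lambda>X. tsum5 P X f) \<in> lin k (A \<boxtimes> (B \<boxtimes> (C \<boxtimes> (D \<boxtimes> E)))) P"
    and "a \<in> carrier A \<Longrightarrow> b \<in> carrier B \<Longrightarrow> c \<in> carrier C \<Longrightarrow> d \<in> carrier D \<Longrightarrow> e \<in> carrier E \<Longrightarrow>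
      tsum5 P (tens5 k A B C D E a b c d e) f = f a b c d e"
proof -
  have 1: "(\<lambda>Y. tsum4 P Y (f a)) \<in> lin k (B \<boxtimes> (C \<boxtimes> (D \<boxtimes> E))) P" if "a \<in> carrier A" for a
    by (rule tsum4_lin(1)[OF m(2-6)]) (use that f2 f3 f4 f5 in auto)
  have 2: "(\<lambda>a. tsum4 P Y (f a)) \<in> lin k A P" if "Y \<in> carrier (B \<boxtimes> (C \<boxtimes> (D \<boxtimes> E)))" for Y
  proof (rule tsum_lin_param[OF m(2) _ m(6) m(1) that])
    fix b Z assume b: "b \<in> carrier B" and Z: "Z \<in> carrier (C \<boxtimes> (D \<boxtimes> E))"
    show "(\<lambda>a. tsum3 P Z (f a b)) \<in> lin k A P"
    proof (rule tsum_lin_param[OF m(3) _ m(6) m(1) Z])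
      show "(\<lambda>a. tsum P W (f a b c)) \<in> lin k A P" if "c \<in> carrier C" "W \<in> carrier (D \<boxtimes> E)" for c W
        by (rule tsum_lin_param[OF m(4-6) m(1) that(2)]) (use f1 b that in auto)
    qed (use m in auto)
  qed (use m in auto)
  have m': "md (B \<boxtimes> (C \<boxtimes> (D \<boxtimes> E)))" using m by simp
  show "(\<lambda>X. tsum5 P X f) \<in> lin k (A \<boxtimes> (B \<boxtimes> (C \<boxtimes> (D \<boxtimes> E)))) P"
    by (rule tsum2_lin(1)[OF m(1) m' m(6) 1 2])
  show "tsum5 P (tens5 k A B C D E a b c d e) f = f a b c d e"
    if "a \<in> carrier A" "b \<in> carrier B" "c \<in> carrier C" "d \<in> carrier D" "e \<in> carrier E"
  proof -
    have "tsum5 P (tens5 k A B C D E a b c d e) f = tsum4 P (tens4 k B C D E b c d e) (f a)"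
      by (rule tsum2_lin(2)[OF m(1) m' m(6) 1 2]) (use that m in auto)
    also have "\<dots> = f a b c d e"
      by (rule tsum4_lin(2)[OF m(2-6)]) (use that f2 f3 f4 f5 in auto)
    finally show ?thesis .
  qed
qed

lemma tsum5_closed:
  assumes m: "md A" "md B" "md C" "md D" "md E" "md P" and X: "X \<in> carrier (A \<boxtimes> (B \<boxtimes> (C \<boxtimes> (D \<boxtimes> E))))"
    and f: "\<And>a b c d e. a \<in> carrier A \<Longrightarrow> b \<in> carrier B \<Longrightarrow> c \<in> carrier C \<Longrightarrow> d \<in> carrier D \<Longrightarrow> e \<in> carrier E \<Longrightarrow>
      f a b c d e \<in> carrier P"
  shows "tsum5 P X f \<in> carrier P"
proof (rule tsum_closed'[OF m(1) _ m(6) X])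
  fix a Y assume a: "a \<in> carrier A" and Y: "Y \<in> carrier (B \<boxtimes> (C \<boxtimes> (D \<boxtimes> E)))"
  show "tsum4 P Y (f a) \<in> carrier P"
  proof (rule tsum_closed'[OF m(2) _ m(6) Y])
    fix b Z assume b: "b \<in> carrier B" and Z: "Z \<in> carrier (C \<boxtimes> (D \<boxtimes> E))"
    show "tsum3 P Z (f a b) \<in> carrier P"
      by (rule tsum3_closed[OF m(3-6) Z]) (use f a b in auto)
  qed (use m in simp)
qed (use m in simp)

text \<open>The form needed for \<Omega>, whose five components are bound by a single sum with
  further sums inside.\<close>

lemma lin_tsum5_eq:
  assumes m: "md A" "md B" "md C" "md D" "md E" "md P" "md P'" and L: "L \<in> lin k P P'"
    and L': "L' \<in> lin k (A \<boxtimes> (B \<boxtimes> (C \<boxtimes> (D \<boxtimes> E)))) P'" and X: "X \<in> carrier (A \<boxtimes> (B \<boxtimes> (C \<boxtimes> (D \<boxtimes> E))))"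
    and f: "\<And>a b c d e. a \<in> carrier A \<Longrightarrow> b \<in> carrier B \<Longrightarrow> c \<in> carrier C \<Longrightarrow> d \<in> carrier D \<Longrightarrow> e \<in> carrier E \<Longrightarrow>
      f a b c d e \<in> carrier P"
    and eq: "\<And>a b c d e. a \<in> carrier A \<Longrightarrow> b \<in> carrier B \<Longrightarrow> c \<in> carrier C \<Longrightarrow> d \<in> carrier D \<Longrightarrow> e \<in> carrier E \<Longrightarrow>
      L (f a b c d e) = L' (tens5 k A B C D E a b c d e)"
  shows "L (tsum5 P X f) = L' X"
proof (rule lin_tsum_eq[OF m(1) _ m(6,7) L L' X])
  show mB: "md (B \<boxtimes> (C \<boxtimes> (D \<boxtimes> E)))" using m by simp
  fix a Y assume a: "a \<in> carrier A" and Y: "Y \<in> carrier (B \<boxtimes> (C \<boxtimes> (D \<boxtimes> E)))"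
  have c3: "tsum3 P Z (f a b) \<in> carrier P" if "b \<in> carrier B" "Z \<in> carrier (C \<boxtimes> (D \<boxtimes> E))" for b Z
    by (rule tsum3_closed[OF m(3-6) that(2)]) (use f a that in auto)
  show "tsum4 P Y (f a) \<in> carrier P"
    by (rule tsum_closed'[OF m(2) _ m(6) Y]) (use m c3 in auto)
  show "L (tsum4 P Y (f a)) = L' (tens k A (B \<boxtimes> (C \<boxtimes> (D \<boxtimes> E))) a Y)"
  proof (rule lin_tsum_eq[OF m(2) _ m(6,7) L _ Y])
    show "md (C \<boxtimes> (D \<boxtimes> E))" using m by simp
    show "(\<lambda>Y. L' (tens k A (B \<boxtimes> (C \<boxtimes> (D \<boxtimes> E))) a Y)) \<in> lin k (B \<boxtimes> (C \<boxtimes> (D \<boxtimes> E))) P'"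
      by (rule lin_comp[OF L' tens_lin_right]) (use m a in simp_all)
    fix b Z assume b: "b \<in> carrier B" and Z: "Z \<in> carrier (C \<boxtimes> (D \<boxtimes> E))"
    show "tsum3 P Z (f a b) \<in> carrier P" by (rule c3[OF b Z])
    show "L (tsum3 P Z (f a b)) = L' (tens k A (B \<boxtimes> (C \<boxtimes> (D \<boxtimes> E))) a (tens k B (C \<boxtimes> (D \<boxtimes> E)) b Z))"
    proof (rule lin_tsum3_eq[OF m(3-7) L _ Z])
      show "(\<lambda>Z. L' (tens k A (B \<boxtimes> (C \<boxtimes> (D \<boxtimes> E))) a (tens k B (C \<boxtimes> (D \<boxtimes> E)) b Z))) \<in> lin k (C \<boxtimes> (D \<boxtimes> E)) P'"
        by (intro lin_comp[OF L'] lin_intros; use m a b in simp)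
    qed (use f eq a b in simp_all)
  qed
qed

lemma tsum5_lin_param:
  assumes m: "md A" "md B" "md C" "md D" "md E" "md P" "md R" and X: "X \<in> carrier (A \<boxtimes> (B \<boxtimes> (C \<boxtimes> (D \<boxtimes> E))))"
    and f: "\<And>a b c d e. a \<in> carrier A \<Longrightarrow> b \<in> carrier B \<Longrightarrow> c \<in> carrier C \<Longrightarrow> d \<in> carrier D \<Longrightarrow> e \<in> carrier E \<Longrightarrow>
      (\<lambda>x. f x a b c d e) \<in> lin k R P"
  shows "(\<lambda>x. tsum5 P X (f x)) \<in> lin k R P"
proof (rule tsum_lin_param[OF m(1) _ m(6,7) X])
  fix a Y assume a: "a \<in> carrier A" and Y: "Y \<in> carrier (B \<boxtimes> (C \<boxtimes> (D \<boxtimes> E)))"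
  show "(\<lambda>x. tsum4 P Y (f x a)) \<in> lin k R P"
  proof (rule tsum_lin_param[OF m(2) _ m(6,7) Y])
    fix b Z assume b: "b \<in> carrier B" and Z: "Z \<in> carrier (C \<boxtimes> (D \<boxtimes> E))"
    show "(\<lambda>x. tsum3 P Z (f x a b)) \<in> lin k R P"
    proof (rule tsum_lin_param[OF m(3) _ m(6,7) Z])
      fix c W assume c: "c \<in> carrier C" and W: "W \<in> carrier (D \<boxtimes> E)"
      show "(\<lambda>x. tsum P W (f x a b c)) \<in> lin k R P"
        by (rule tsum_lin_param[OF m(4-7) W]) (use f a b c in auto)
    qed (use m in simp)
  qed (use m in simp)
qed (use m in simp)

lemma tsum3_lin_param:
  assumes m: "md A" "md B" "md C" "md P" "md R" and X: "X \<in> carrier (A \<boxtimes> (B \<boxtimes> C))"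
    and f: "\<And>a b c. a \<in> carrier A \<Longrightarrow> b \<in> carrier B \<Longrightarrow> c \<in> carrier C \<Longrightarrow> (\<lambda>x. f x a b c) \<in> lin k R P"
  shows "(\<lambda>x. tsum3 P X (f x)) \<in> lin k R P"
proof (rule tsum_lin_param[OF m(1) _ m(4,5) X])
  fix a Y assume a: "a \<in> carrier A" and Y: "Y \<in> carrier (B \<boxtimes> C)"
  show "(\<lambda>x. tsum P Y (f x a)) \<in> lin k R P"
    by (rule tsum_lin_param[OF m(2-5) Y]) (use f a in auto)
qed (use m in simp)

section \<open>The summands of the pentagon axioms as slot maps\<close>

context
  fixes A :: "('k, 'a, 'm) module_scheme" and B :: "('k, 'b, 'n) module_scheme"
    and C :: "('k, 'c, 'p) module_scheme" and X
  assumes m: "md A" "md B" "md C" and X: "X \<in> carrier (A \<boxtimes> (B \<boxtimes> C))"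
begin

lemma tsum3_tens_left:
  assumes "md E" "e \<in> carrier E"
  shows "tsum3 (E \<boxtimes> (A \<boxtimes> (B \<boxtimes> C))) X (\<lambda>x y z. tens4 k E A B C e x y z) = tens k E (A \<boxtimes> (B \<boxtimes> C)) e X"
  by (rule tsum3_eq_lin[OF m _ tens_lin_right X]) (use m assms in simp_all)

lemma tsum3_tens_right:
  assumes "md D" "d \<in> carrier D"
  shows "tsum3 (A \<boxtimes> (B \<boxtimes> (C \<boxtimes> D))) X (\<lambda>x y z. tens4 k A B C D x y z d) = app3 A B C D d X"
  by (rule tsum3_eq_lin[OF m _ app3_lin X]) (use m assms in simp_all)

lemma tsum3_split_left:
  assumes "md P" "md Q" and f: "f \<in> lin k A (P \<boxtimes> Q)"
  shows "tsum3 (P \<boxtimes> (Q \<boxtimes> (B \<boxtimes> C))) X (\<lambda>x y z.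
    tsum (P \<boxtimes> (Q \<boxtimes> (B \<boxtimes> C))) (f x) (\<lambda>p q. tens4 k P Q B C p q y z)) = tsplit A (B \<boxtimes> C) P Q f X"
proof (rule tsum3_eq_lin[OF m _ tsplit_lin X])
  show "tsum (P \<boxtimes> (Q \<boxtimes> (B \<boxtimes> C))) (f a) (\<lambda>p q. tens4 k P Q B C p q b c)
      = tsplit A (B \<boxtimes> C) P Q f (tens3 k A B C a b c)"
    if abc: "a \<in> carrier A" "b \<in> carrier B" "c \<in> carrier C" for a b c
    by (subst tsum_eq_lin[OF assms(1,2) _ app2_lin lin_closed[OF f]]) (use m abc assms in simp_all)
qed (use m assms in simp_all)

lemma tsum3_split_middle:
  assumes "md P" "md Q" and f: "f \<in> lin k B (P \<boxtimes> Q)"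
  shows "tsum3 (A \<boxtimes> (P \<boxtimes> (Q \<boxtimes> C))) X (\<lambda>x y z.
    tsum (A \<boxtimes> (P \<boxtimes> (Q \<boxtimes> C))) (f y) (\<lambda>p q. tens4 k A P Q C x p q z))
    = tmap_r A (B \<boxtimes> C) (P \<boxtimes> (Q \<boxtimes> C)) (tsplit B C P Q f) X"
proof (rule tsum3_eq_lin[OF m _ tmap_r_lin X])
  show "tsum (A \<boxtimes> (P \<boxtimes> (Q \<boxtimes> C))) (f b) (\<lambda>p q. tens4 k A P Q C a p q c)
      = tmap_r A (B \<boxtimes> C) (P \<boxtimes> (Q \<boxtimes> C)) (tsplit B C P Q f) (tens3 k A B C a b c)"
    if abc: "a \<in> carrier A" "b \<in> carrier B" "c \<in> carrier C" for a b c
    by (subst tsum_eq_lin[OF assms(1,2) _ lin_comp[OF tens_lin_right app2_lin] lin_closed[OF f]])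
      (use m abc assms in simp_all)
qed (use m assms in simp_all)

lemma tsum3_split_right:
  assumes "md P" "md Q" and f: "f \<in> lin k C (P \<boxtimes> Q)"
  shows "tsum3 (A \<boxtimes> (B \<boxtimes> (P \<boxtimes> Q))) X (\<lambda>x y z.
    tsum (A \<boxtimes> (B \<boxtimes> (P \<boxtimes> Q))) (f z) (\<lambda>p q. tens4 k A B P Q x y p q))
    = tmap_r A (B \<boxtimes> C) (B \<boxtimes> (P \<boxtimes> Q)) (tmap_r B C (P \<boxtimes> Q) f) X"
proof (rule tsum3_eq_lin[OF m _ tmap_r_lin X])
  show "tsum (A \<boxtimes> (B \<boxtimes> (P \<boxtimes> Q))) (f c) (\<lambda>p q. tens4 k A B P Q a b p q)
      = tmap_r A (B \<boxtimes> C) (B \<boxtimes> (P \<boxtimes> Q)) (tmap_r B C (P \<boxtimes> Q) f) (tens3 k A B C a b c)"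
    if abc: "a \<in> carrier A" "b \<in> carrier B" "c \<in> carrier C" for a b c
    by (subst tsum_eq_lin[OF assms(1,2) _ lin_comp[OF tens_lin_right tens_lin_right] lin_closed[OF f]])
      (use m abc assms in simp_all)
qed (use m assms in simp_all)

end

lemma tsum_tsum_right:
  assumes m: "md A" "md B" "md P" "md Q" and f: "f \<in> lin k B (P \<boxtimes> Q)" and X: "X \<in> carrier (A \<boxtimes> B)"
  shows "tsum (A \<boxtimes> (P \<boxtimes> Q)) X (\<lambda>x y. tsum (A \<boxtimes> (P \<boxtimes> Q)) (f y) (\<lambda>p q. tens3 k A P Q x p q))
    = tmap_r A B (P \<boxtimes> Q) f X"
proof (rule tsum_eq_lin[OF m(1,2) _ tmap_r_lin X])
  show "tsum (A \<boxtimes> (P \<boxtimes> Q)) (f b) (\<lambda>p q. tens3 k A P Q a p q) = tmap_r A B (P \<boxtimes> Q) f (tens k A B a b)"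
    if "a \<in> carrier A" "b \<in> carrier B" for a b
    by (subst tsum_eq_lin[OF m(3,4) _ tens_lin_right lin_closed[OF f]]) (use m that f in simp_all)
qed (use m f in simp_all)

lemma tsum_tsum_left:
  assumes m: "md A" "md B" "md P" "md Q" and f: "f \<in> lin k A (P \<boxtimes> Q)" and X: "X \<in> carrier (A \<boxtimes> B)"
  shows "tsum (P \<boxtimes> (Q \<boxtimes> B)) X (\<lambda>x y. tsum (P \<boxtimes> (Q \<boxtimes> B)) (f x) (\<lambda>p q. tens3 k P Q B p q y))
    = tsplit A B P Q f X"
proof (rule tsum_eq_lin[OF m(1,2) _ tsplit_lin X])
  show "tsum (P \<boxtimes> (Q \<boxtimes> B)) (f a) (\<lambda>p q. tens3 k P Q B p q b) = tsplit A B P Q f (tens k A B a b)"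
    if "a \<in> carrier A" "b \<in> carrier B" for a b
    by (subst tsum_eq_lin[OF m(3,4) _ app2_lin lin_closed[OF f]]) (use m that f in simp_all)
qed (use m f in simp_all)

end

section \<open>Contraction of two slots by \<alpha> and \<beta>\<close>

context quasi_hopf_base
begin

interpretation qh: quasi_hopf_algebra k H by (rule quasi_hopf)

text \<open>The axiom with \<Phi>\<inverse> brought to the other side, so that each side is a slot
  map multiplied by \<Phi>.\<close>

lemma quasi_coassoc:
  assumes h: "h \<in> carrier H"
  shows "tmap_r H H H2 Dl (Dl h) \<otimes>\<^bsub>H3\<^esub> Ph = Ph \<otimes>\<^bsub>H3\<^esub> dH H (Dl h)"
proof -
  have "tmap_r H H H2 Dl (Dl h) = Ph \<otimes>\<^bsub>H3\<^esub> dH H (Dl h) \<otimes>\<^bsub>H3\<^esub> Ph'"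
    using qh.quasi_coassoc[OF h] h by (simp add: tsum_tsum_left[where A = H] tsum_tsum_right[where B = H])
  then show ?thesis using h by (simp add: alg_assoc)
qed

lemma pentagon:
  "tens k H H3 \<one>\<^bsub>H\<^esub> Ph \<otimes>\<^bsub>H4\<^esub> tmap_r H H2 H3 (dH H) Ph \<otimes>\<^bsub>H4\<^esub> app3 H H H H \<one>\<^bsub>H\<^esub> Ph
    = tmap_r H H2 H3 (tmap_r H H H2 Dl) Ph \<otimes>\<^bsub>H4\<^esub> dH H2 Ph"
  using qh.pentagon
  by (simp add: tsum3_tens_left tsum3_tens_right tsum3_split_left[where A = H]
      tsum3_split_middle[where B = H] tsum3_split_right[where C = H])

definition alpha_map where "alpha_map Z = tsum H Z (\<lambda>x y. S x \<otimes>\<^bsub>H\<^esub> al \<otimes>\<^bsub>H\<^esub> y)"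
definition beta_map where "beta_map Z = tsum H Z (\<lambda>x y. x \<otimes>\<^bsub>H\<^esub> be \<otimes>\<^bsub>H\<^esub> S y)"

lemma alpha_map_lin [simp]: "alpha_map \<in> lin k H2 H"
  and alpha_map_tens [simp]: "x \<in> carrier H \<Longrightarrow> y \<in> carrier H \<Longrightarrow> alpha_map (tens k H H x y) = S x \<otimes>\<^bsub>H\<^esub> al \<otimes>\<^bsub>H\<^esub> y"
proof -
  have f: "\<And>a. a \<in> carrier H \<Longrightarrow> (\<lambda>b. S a \<otimes>\<^bsub>H\<^esub> al \<otimes>\<^bsub>H\<^esub> b) \<in> lin k H H"
    "\<And>b. b \<in> carrier H \<Longrightarrow> (\<lambda>a. S a \<otimes>\<^bsub>H\<^esub> al \<otimes>\<^bsub>H\<^esub> b) \<in> lin k H H"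
    by (intro lin_intros; simp)+
  show "alpha_map \<in> lin k H2 H" using tsum2_lin(1)[OF _ _ _ f] by (simp add: alpha_map_def[abs_def])
  show "x \<in> carrier H \<Longrightarrow> y \<in> carrier H \<Longrightarrow> alpha_map (tens k H H x y) = S x \<otimes>\<^bsub>H\<^esub> al \<otimes>\<^bsub>H\<^esub> y"
    unfolding alpha_map_def using tsum2_lin(2)[OF _ _ _ f] by simp
qed

lemma beta_map_lin [simp]: "beta_map \<in> lin k H2 H"
  and beta_map_tens [simp]: "x \<in> carrier H \<Longrightarrow> y \<in> carrier H \<Longrightarrow> beta_map (tens k H H x y) = x \<otimes>\<^bsub>H\<^esub> be \<otimes>\<^bsub>H\<^esub> S y"
proof -
  have f: "\<And>a. a \<in> carrier H \<Longrightarrow> (\<lambda>b. a \<otimes>\<^bsub>H\<^esub> be \<otimes>\<^bsub>H\<^esub> S b) \<in> lin k H H"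
    "\<And>b. b \<in> carrier H \<Longrightarrow> (\<lambda>a. a \<otimes>\<^bsub>H\<^esub> be \<otimes>\<^bsub>H\<^esub> S b) \<in> lin k H H"
    by (intro lin_intros; simp)+
  show "beta_map \<in> lin k H2 H" using tsum2_lin(1)[OF _ _ _ f] by (simp add: beta_map_def[abs_def])
  show "x \<in> carrier H \<Longrightarrow> y \<in> carrier H \<Longrightarrow> beta_map (tens k H H x y) = x \<otimes>\<^bsub>H\<^esub> be \<otimes>\<^bsub>H\<^esub> S y"
    unfolding beta_map_def using tsum2_lin(2)[OF _ _ _ f] by simp
qed

lemma alpha_map_closed [simp]: "Z \<in> carrier H2 \<Longrightarrow> alpha_map Z \<in> carrier H"
  and beta_map_closed [simp]: "Z \<in> carrier H2 \<Longrightarrow> beta_map Z \<in> carrier H"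
  by (rule lin_closed[OF alpha_map_lin] lin_closed[OF beta_map_lin]; assumption)+

lemmas [additivity] = lin_add[OF alpha_map_lin] lin_add[OF beta_map_lin]

text \<open>S(x p) \<alpha> y q = S(p) (S(x) \<alpha> y) q: because S reverses products, a right
  factor of the tensor splits and surrounds the contracted element.\<close>

lemma alpha_map_mult_tens:
  assumes "X \<in> carrier H2" "p \<in> carrier H" "q \<in> carrier H"
  shows "alpha_map (X \<otimes>\<^bsub>H2\<^esub> tens k H H p q) = S p \<otimes>\<^bsub>H\<^esub> alpha_map X \<otimes>\<^bsub>H\<^esub> q"
  using nalg_md[OF alg_nalg[OF alg_H]] nalg_md[OF alg_nalg[OF alg_H]] assms(1)
  by (induct X rule: tensor_induct') (use assms in \<open>simp_all add: additivity S_mult alg_assoc\<close>)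

lemma beta_map_mult_tens:
  assumes "X \<in> carrier H2" "p \<in> carrier H" "q \<in> carrier H"
  shows "beta_map (tens k H H p q \<otimes>\<^bsub>H2\<^esub> X) = p \<otimes>\<^bsub>H\<^esub> beta_map X \<otimes>\<^bsub>H\<^esub> S q"
  using nalg_md[OF alg_nalg[OF alg_H]] nalg_md[OF alg_nalg[OF alg_H]] assms(1)
  by (induct X rule: tensor_induct') (use assms in \<open>simp_all add: additivity S_mult alg_assoc\<close>)

lemma alpha_map_Dl: "h \<in> carrier H \<Longrightarrow> alpha_map (Dl h) = ep h \<odot>\<^bsub>H\<^esub> al"
  and beta_map_Dl: "h \<in> carrier H \<Longrightarrow> beta_map (Dl h) = ep h \<odot>\<^bsub>H\<^esub> be"
  unfolding alpha_map_def beta_map_def by (rule qh.antip_alpha qh.antip_beta; assumption)+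

text \<open>A left factor \<Delta>(h) ends up next to \<alpha>, as S(x) (S(\<open>h\<^sub>1\<close>)
  \<alpha> \<open>h\<^sub>2\<close>) y, and the axiom for \<alpha> absorbs it. In the next lemma
  \<beta> absorbs factors from the right in the same way.\<close>

lemma alpha_map_contract:
  assumes "h \<in> carrier H" "Z \<in> carrier H2"
  shows "alpha_map (Dl h \<otimes>\<^bsub>H2\<^esub> Z) = ep h \<odot>\<^bsub>H\<^esub> alpha_map Z"
  using nalg_md[OF alg_nalg[OF alg_H]] nalg_md[OF alg_nalg[OF alg_H]] assms(2)
  by (induct Z rule: tensor_induct')
    (use assms in \<open>simp_all add: additivity alpha_map_mult_tens alpha_map_Dl mult_smult md_smult\<close>)

lemma beta_map_contract:
  assumes "h \<in> carrier H" "Z \<in> carrier H2"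
  shows "beta_map (Z \<otimes>\<^bsub>H2\<^esub> Dl h) = ep h \<odot>\<^bsub>H\<^esub> beta_map Z"
  using nalg_md[OF alg_nalg[OF alg_H]] nalg_md[OF alg_nalg[OF alg_H]] assms(2)
  by (induct Z rule: tensor_induct')
    (use assms in \<open>simp_all add: additivity beta_map_mult_tens beta_map_Dl mult_smult md_smult\<close>)

end

context field_base
begin

lemma tmap_r_comp_eq:
  assumes "md M" "md N" "md P" "md Q" "f \<in> lin k N P" "g \<in> lin k P Q"
    and "\<And>x. x \<in> carrier N \<Longrightarrow> g (f x) = h x" and "X \<in> carrier (M \<boxtimes> N)"
  shows "tmap_r M P Q g (tmap_r M N P f X) = tmap_r M N Q h X"
  unfolding tmap_r_comp[OF assms(1-6,8)] by (rule tmap_r_cong[OF assms(1,2,8,7)])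

lemma tmap_r_comp_id:
  assumes "md M" "md N" "md P" "f \<in> lin k N P" "g \<in> lin k P N"
    and "\<And>x. x \<in> carrier N \<Longrightarrow> g (f x) = x" and "X \<in> carrier (M \<boxtimes> N)"
  shows "tmap_r M P N g (tmap_r M N P f X) = X"
  using tmap_r_comp_eq[OF assms(1,2,3,2,4,5) assms(6,7)] tmap_r_id[OF assms(1,2,7)] by simp

lemma app3_app2:
  assumes "md P" "md Q" "md C" "md D" "c \<in> carrier C" "y \<in> carrier D" "X \<in> carrier (P \<boxtimes> Q)"
  shows "app3 P Q C D y (app2 P Q C c X) = app2 P Q (C \<boxtimes> D) (tens k C D c y) X"
  using assms(1,2,7)
  by (induct X rule: tensor_induct') (use assms in \<open>simp_all add: additivity\<close>)

lemma tsplit_app2: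
  assumes m: "md B" "md C" "md D" "md P" "md Q" and f: "f \<in> lin k B (P \<boxtimes> Q)"
    and y: "y \<in> carrier D" and X: "X \<in> carrier (B \<boxtimes> C)"
  shows "tsplit B (C \<boxtimes> D) P Q f (app2 B C D y X) = app3 P Q C D y (tsplit B C P Q f X)"
  using m(1,2) X
  by (induct X rule: tensor_induct') (use m f y lin_closed[OF f] in \<open>simp_all add: additivity app3_app2\<close>)

lemma tmap_r_tsplit_app2:
  assumes m: "md A" "md B" "md D" "md P" "md Q" and f: "f \<in> lin k B (P \<boxtimes> Q)"
    and y: "y \<in> carrier D" and X: "X \<in> carrier (A \<boxtimes> B)"
  shows "tmap_r A (B \<boxtimes> D) (P \<boxtimes> (Q \<boxtimes> D)) (tsplit B D P Q f) (app2 A B D y X)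
    = app3 A P Q D y (tmap_r A B (P \<boxtimes> Q) f X)"
  using m(1,2) X
  by (induct X rule: tensor_induct') (use m f y lin_closed[OF f] in \<open>simp_all add: additivity\<close>)

end

section \<open>Counit identities for \<Phi>\<close>

context quasi_hopf_base
begin

interpretation qh: quasi_hopf_algebra k H by (rule quasi_hopf)

lemma md_H [simp]: "md H" by simp

lemma tmap_r_counit_l_app2:
  assumes "md B" "md D" "y \<in> carrier D" "X \<in> carrier (B \<boxtimes> H)"
  shows "tmap_r B (H \<boxtimes> D) D (counit_l D) (app2 B H D y X) = tens k B D (counit_r B X) y"
  using assms(1) md_H assms(4)
  by (induct X rule: tensor_induct') (use assms in \<open>simp_all add: additivity tens_smult\<close>)

lemma tmap_r_counit_r_app2:
  assumes "md B" "md C" "X \<in> carrier (B \<boxtimes> C)" "y \<in> carrier H"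
  shows "tmap_r B (C \<boxtimes> H) C (counit_r C) (app2 B C H y X) = ep y \<odot>\<^bsub>B \<boxtimes> C\<^esub> X"
  using assms(1-3)
  by (induct X rule: tensor_induct') (use assms in \<open>simp_all add: additivity tens_smult md_smult\<close>)

lemma counit_l_app2:
  assumes "md C" "md D" "y \<in> carrier D" "X \<in> carrier (H \<boxtimes> C)"
  shows "counit_l (C \<boxtimes> D) (app2 H C D y X) = tens k C D (counit_l C X) y"
  using md_H assms(1,4)
  by (induct X rule: tensor_induct') (use assms in \<open>simp_all add: additivity tens_smult\<close>)

lemma counit_l_tmap_r:
  assumes "md C" "md D" "f \<in> lin k C D" "X \<in> carrier (H \<boxtimes> C)"
  shows "counit_l D (tmap_r H C D f X) = f (counit_l C X)"
  using md_H assms(1,4)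
  by (induct X rule: tensor_induct')
    (use assms lin_closed[OF assms(3)] in \<open>simp_all add: additivity lin_add[OF assms(3)] lin_smult[OF assms(3)]\<close>)

lemma counit_l_dH [simp]:
  assumes "md D" "X \<in> carrier (H \<boxtimes> D)"
  shows "counit_l (H \<boxtimes> D) (dH D X) = X"
  using md_H assms
  by (induct X rule: tensor_induct') (use assms in \<open>simp_all add: additivity counit_l_app2\<close>)

lemma tmap_r_counit_l_dH [simp]:
  assumes "md D" "X \<in> carrier (H \<boxtimes> D)"
  shows "tmap_r H (H \<boxtimes> D) D (counit_l D) (dH D X) = X"
  using md_H assms
  by (induct X rule: tensor_induct') (use assms in \<open>simp_all add: additivity tmap_r_counit_l_app2\<close>)

lemma tmap_r_counit_l_tmap_r_Dl [simp]:
  assumes "md M" "X \<in> carrier (M \<boxtimes> H)"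
  shows "tmap_r M H2 H (counit_l H) (tmap_r M H H2 Dl X) = X"
  using assms(1) md_H assms(2)
  by (induct X rule: tensor_induct') (use assms in \<open>simp_all add: additivity\<close>)

lemma Ph_counit_middle [simp]: "tmap_r H H2 H (counit_l H) Ph = \<one>\<^bsub>H2\<^esub>"
proof -
  have "tsum3 H2 Ph (\<lambda>x y z. ep y \<odot>\<^bsub>H2\<^esub> tens k H H x z) = tmap_r H H2 H (counit_l H) Ph"
    by (rule tsum3_eq_lin[of H H H]) (simp_all add: tens_smult)
  then show ?thesis using qh.reass_counit by simp
qed

lemma unit_cancel_left:
  assumes "alg M" "x \<in> carrier M" "y \<in> carrier M" "u \<in> carrier M" "y \<otimes>\<^bsub>M\<^esub> x = \<one>\<^bsub>M\<^esub>" "x \<otimes>\<^bsub>M\<^esub> u = x"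
  shows "u = \<one>\<^bsub>M\<^esub>"
  using assms alg_assoc[of M y x u] by simp

lemma unit_cancel_right:
  assumes "alg M" "x \<in> carrier M" "y \<in> carrier M" "u \<in> carrier M" "x \<otimes>\<^bsub>M\<^esub> y = \<one>\<^bsub>M\<^esub>" "u \<otimes>\<^bsub>M\<^esub> x = x"
  shows "u = \<one>\<^bsub>M\<^esub>"
  using assms alg_assoc[of M u x y] by simp

text \<open>The axioms contain only the counit in the middle slot. Applying \<epsilon> to the third
  slot of the pentagon turns every factor into \<Phi> or a unit, except for (id \<otimes> id
  \<otimes> \<epsilon>)(\<Phi>) \<otimes> 1. This remains as a right factor of \<Phi> and is forced
  to be 1.\<close>

lemma Ph_counit_right [simp]: "tmap_r H H2 H (counit_r H) Ph = \<one>\<^bsub>H2\<^esub>"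
proof -
  let ?E = "tmap_r H H2 H (counit_r H) Ph"
  let ?t = "tmap_r H H3 H2 (tmap_r H H2 H (counit_l H))"
  have h: "?t \<in> alg_hom k H4 H3" by simp
  have 1: "?t (tens k H H3 \<one>\<^bsub>H\<^esub> Ph) = \<one>\<^bsub>H3\<^esub>" by simp
  have 2: "?t (tmap_r H H2 H3 (dH H) Ph) = Ph"
    by (rule tmap_r_comp_id) simp_all
  have 3: "?t (app3 H H H H \<one>\<^bsub>H\<^esub> Ph) = app2 H H H \<one>\<^bsub>H\<^esub> ?E"
  proof -
    have "?t (app3 H H H H \<one>\<^bsub>H\<^esub> Ph) = tmap_r H H2 H2 (\<lambda>X. tens k H H (counit_r H X) \<one>\<^bsub>H\<^esub>) Ph"
      unfolding app3_def
      by (rule tmap_r_comp_eq) (simp_all add: tmap_r_counit_l_app2)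
    also have "\<dots> = app2 H H H \<one>\<^bsub>H\<^esub> ?E"
      unfolding app2_def by (subst tmap_r_comp) (simp_all add: tens_lin_left)
    finally show ?thesis .
  qed
  have 4: "?t (tmap_r H H2 H3 (tmap_r H H H2 Dl) Ph) = Ph"
    by (rule tmap_r_comp_id) simp_all
  have 5: "?t (dH H2 Ph) = \<one>\<^bsub>H3\<^esub>"
    using tsplit_tmap_r[of H H2 H H H Dl "counit_l H" Ph] by simp
  have "Ph \<otimes>\<^bsub>H3\<^esub> app2 H H H \<one>\<^bsub>H\<^esub> ?E = Ph"
    using arg_cong[OF pentagon, of ?t] by (simp add: hom_mult[OF h] 1 2 3 4 5)
  then have "app2 H H H \<one>\<^bsub>H\<^esub> ?E = \<one>\<^bsub>H3\<^esub>"
    by (rule unit_cancel_left[where x = Ph and y = Ph', rotated -1]) simp_all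
  then have "tmap_r H H2 H (counit_r H) (app2 H H H \<one>\<^bsub>H\<^esub> ?E) = \<one>\<^bsub>H2\<^esub>" by simp
  then show ?thesis by (simp add: tmap_r_counit_r_app2 md_smult)
qed

text \<open>The same with \<epsilon> in the second slot of the pentagon, which leaves 1 \<otimes>
  (\<epsilon> \<otimes> id \<otimes> id)(\<Phi>) as a left factor of \<Phi>.\<close>

lemma Ph_counit_left [simp]: "counit_l H2 Ph = \<one>\<^bsub>H2\<^esub>"
proof -
  let ?E = "counit_l H2 Ph"
  let ?t = "tmap_r H H3 H2 (counit_l H2)"
  have h: "?t \<in> alg_hom k H4 H3" by simp
  have 1: "?t (tens k H H3 \<one>\<^bsub>H\<^esub> Ph) = tens k H H2 \<one>\<^bsub>H\<^esub> ?E" by simp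
  have 2: "?t (tmap_r H H2 H3 (dH H) Ph) = Ph"
    by (rule tmap_r_comp_id) simp_all
  have 3: "?t (app3 H H H H \<one>\<^bsub>H\<^esub> Ph) = \<one>\<^bsub>H3\<^esub>"
  proof -
    have "?t (app3 H H H H \<one>\<^bsub>H\<^esub> Ph) = tmap_r H H2 H2 (\<lambda>X. tens k H H (counit_l H X) \<one>\<^bsub>H\<^esub>) Ph"
      unfolding app3_def
      by (rule tmap_r_comp_eq) (simp_all add: counit_l_app2)
    also have "\<dots> = app2 H H H \<one>\<^bsub>H\<^esub> (tmap_r H H2 H (counit_l H) Ph)"
      unfolding app2_def by (subst tmap_r_comp) (simp_all add: tens_lin_left)
    finally show ?thesis by simp
  qed
  have 4: "?t (tmap_r H H2 H3 (tmap_r H H H2 Dl) Ph) = \<one>\<^bsub>H3\<^esub>"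
  proof -
    have "?t (tmap_r H H2 H3 (tmap_r H H H2 Dl) Ph) = tmap_r H H2 H2 (\<lambda>X. Dl (counit_l H X)) Ph"
      by (rule tmap_r_comp_eq) (simp_all add: counit_l_tmap_r)
    also have "\<dots> = tmap_r H H H2 Dl (tmap_r H H2 H (counit_l H) Ph)"
      by (subst tmap_r_comp) simp_all
    finally show ?thesis by simp
  qed
  have 5: "?t (dH H2 Ph) = Ph" by simp
  have "tens k H H2 \<one>\<^bsub>H\<^esub> ?E \<otimes>\<^bsub>H3\<^esub> Ph = Ph"
    using arg_cong[OF pentagon, of ?t] by (simp add: hom_mult[OF h] 1 2 3 4 5)
  then have "tens k H H2 \<one>\<^bsub>H\<^esub> ?E = \<one>\<^bsub>H3\<^esub>"
    by (rule unit_cancel_right[where x = Ph and y = Ph', rotated -1]) simp_all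
  then have "counit_l H2 (tens k H H2 \<one>\<^bsub>H\<^esub> ?E) = counit_l H2 \<one>\<^bsub>H3\<^esub>" by simp
  then show ?thesis by (simp add: md_smult hom_one[OF counit_l_hom])
qed

section \<open>The Drinfeld twist\<close>

text \<open>The exchange is built in, so that at \<Delta>(h) this is (S \<otimes>
  S)(\<open>\<Delta>\<^sup>c\<^sup>o\<^sup>p(h)\<close>), the left factor in the Drinfeld
  twist.\<close>

definition flip_S where "flip_S Z = tsum H2 Z (\<lambda>a b. tens k H H (S b) (S a))"
definition flip_S' where "flip_S' Z = tsum H2 Z (\<lambda>a b. tens k H H (S' b) (S' a))"
text \<open>Extends the formula for \<gamma> from the tensor \<open>twA\<close> to all of
  \<open>H4\<close>, which gives room for factors to be moved inside. Slots 2 and 3 are contracted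
  by \<alpha>, and so are slots 1 and 4.\<close>

definition gamma_map where "gamma_map t = tsum4 H2 t (\<lambda>a b c d. tens k H H (S b \<otimes>\<^bsub>H\<^esub> al \<otimes>\<^bsub>H\<^esub> c) (S a \<otimes>\<^bsub>H\<^esub> al \<otimes>\<^bsub>H\<^esub> d))"

lemma flip_S_lin [simp]: "flip_S \<in> lin k H2 H2"
  and flip_S_tens [simp]: "x \<in> carrier H \<Longrightarrow> y \<in> carrier H \<Longrightarrow> flip_S (tens k H H x y) = tens k H H (S y) (S x)"
proof -
  have f: "\<And>a. a \<in> carrier H \<Longrightarrow> (\<lambda>b. tens k H H (S b) (S a)) \<in> lin k H H2"
    "\<And>b. b \<in> carrier H \<Longrightarrow> (\<lambda>a. tens k H H (S b) (S a)) \<in> lin k H H2"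
    by (intro lin_intros; simp)+
  show "flip_S \<in> lin k H2 H2" using tsum2_lin(1)[OF _ _ _ f] by (simp add: flip_S_def[abs_def])
  show "x \<in> carrier H \<Longrightarrow> y \<in> carrier H \<Longrightarrow> flip_S (tens k H H x y) = tens k H H (S y) (S x)"
    unfolding flip_S_def using tsum2_lin(2)[OF _ _ _ f] by simp
qed

lemma flip_S'_lin [simp]: "flip_S' \<in> lin k H2 H2"
  and flip_S'_tens [simp]: "x \<in> carrier H \<Longrightarrow> y \<in> carrier H \<Longrightarrow> flip_S' (tens k H H x y) = tens k H H (S' y) (S' x)"
proof -
  have f: "\<And>a. a \<in> carrier H \<Longrightarrow> (\<lambda>b. tens k H H (S' b) (S' a)) \<in> lin k H H2"
    "\<And>b. b \<in> carrier H \<Longrightarrow> (\<lambda>a. tens k H H (S' b) (S' a)) \<in> lin k H H2"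
    by (intro lin_intros; simp)+
  show "flip_S' \<in> lin k H2 H2" using tsum2_lin(1)[OF _ _ _ f] by (simp add: flip_S'_def[abs_def])
  show "x \<in> carrier H \<Longrightarrow> y \<in> carrier H \<Longrightarrow> flip_S' (tens k H H x y) = tens k H H (S' y) (S' x)"
    unfolding flip_S'_def using tsum2_lin(2)[OF _ _ _ f] by simp
qed

lemma flip_closed [simp]: "Z \<in> carrier H2 \<Longrightarrow> flip_S Z \<in> carrier H2"
  "Z \<in> carrier H2 \<Longrightarrow> flip_S' Z \<in> carrier H2"
  by (rule lin_closed[OF flip_S_lin] lin_closed[OF flip_S'_lin]; assumption)+

lemma gamma_map_lin [simp]: "gamma_map \<in> lin k H4 H2"
  and gamma_map_tens [simp]: "a \<in> carrier H \<Longrightarrow> b \<in> carrier H \<Longrightarrow> c \<in> carrier H \<Longrightarrow> d \<in> carrier H \<Longrightarrow>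
    gamma_map (tens4 k H H H H a b c d) = tens k H H (S b \<otimes>\<^bsub>H\<^esub> al \<otimes>\<^bsub>H\<^esub> c) (S a \<otimes>\<^bsub>H\<^esub> al \<otimes>\<^bsub>H\<^esub> d)"
proof -
  let ?f = "\<lambda>a b c d. tens k H H (S b \<otimes>\<^bsub>H\<^esub> al \<otimes>\<^bsub>H\<^esub> c) (S a \<otimes>\<^bsub>H\<^esub> al \<otimes>\<^bsub>H\<^esub> d)"
  have f: "\<And>b c d. b \<in> carrier H \<Longrightarrow> c \<in> carrier H \<Longrightarrow> d \<in> carrier H \<Longrightarrow> (\<lambda>a. ?f a b c d) \<in> lin k H H2"
    "\<And>a c d. a \<in> carrier H \<Longrightarrow> c \<in> carrier H \<Longrightarrow> d \<in> carrier H \<Longrightarrow> (\<lambda>b. ?f a b c d) \<in> lin k H H2"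
    "\<And>a b d. a \<in> carrier H \<Longrightarrow> b \<in> carrier H \<Longrightarrow> d \<in> carrier H \<Longrightarrow> (\<lambda>c. ?f a b c d) \<in> lin k H H2"
    "\<And>a b c. a \<in> carrier H \<Longrightarrow> b \<in> carrier H \<Longrightarrow> c \<in> carrier H \<Longrightarrow> (\<lambda>d. ?f a b c d) \<in> lin k H H2"
    by (intro lin_intros; simp)+
  show "gamma_map \<in> lin k H4 H2" using tsum4_lin(1)[OF _ _ _ _ _ f] by (simp add: gamma_map_def[abs_def])
  show "a \<in> carrier H \<Longrightarrow> b \<in> carrier H \<Longrightarrow> c \<in> carrier H \<Longrightarrow> d \<in> carrier H \<Longrightarrow>
    gamma_map (tens4 k H H H H a b c d) = ?f a b c d"
    unfolding gamma_map_def using tsum4_lin(2)[OF _ _ _ _ _ f] by simp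
qed

lemma gamma_map_closed [simp]: "t \<in> carrier H4 \<Longrightarrow> gamma_map t \<in> carrier H2"
  by (rule lin_closed[OF gamma_map_lin])

lemmas [additivity] = lin_add[OF gamma_map_lin] lin_add[OF flip_S_lin] lin_add[OF flip_S'_lin]

lemma flip_S_mult:
  assumes "X \<in> carrier H2" "Y \<in> carrier H2"
  shows "flip_S (X \<otimes>\<^bsub>H2\<^esub> Y) = flip_S Y \<otimes>\<^bsub>H2\<^esub> flip_S X"
  using md_H md_H assms(1)
proof (induct X rule: tensor_induct')
  case (tens a b)
  show ?case using md_H md_H assms(2)
    by (induct Y rule: tensor_induct') (use tens in \<open>simp_all add: additivity S_mult\<close>)
qed (use assms in \<open>simp add: additivity\<close>)

lemma flip_S'_mult:
  assumes "X \<in> carrier H2" "Y \<in> carrier H2"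
  shows "flip_S' (X \<otimes>\<^bsub>H2\<^esub> Y) = flip_S' Y \<otimes>\<^bsub>H2\<^esub> flip_S' X"
  using md_H md_H assms(1)
proof (induct X rule: tensor_induct')
  case (tens a b)
  show ?case using md_H md_H assms(2)
    by (induct Y rule: tensor_induct') (use tens in \<open>simp_all add: additivity S'_mult\<close>)
qed (use assms in \<open>simp add: additivity\<close>)

lemma flip_S'_flip_S [simp]: "X \<in> carrier H2 \<Longrightarrow> flip_S' (flip_S X) = X"
  using md_H md_H by (induct X rule: tensor_induct') (simp_all add: additivity)

text \<open>Factors around \<gamma> become right factors of the tensor: since S reverses products,
  \<open>P\<close> enters slots 1 and 2 from the right, just as \<open>V\<close> enters slots 3 and
  4.\<close>

lemma gamma_map_flip:
  assumes t: "t \<in> carrier H4" and P: "P \<in> carrier H2" and V: "V \<in> carrier H2"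
  shows "flip_S P \<otimes>\<^bsub>H2\<^esub> gamma_map t \<otimes>\<^bsub>H2\<^esub> V = gamma_map (t \<otimes>\<^bsub>H4\<^esub> app2 H H H2 V P)"
  using md_H md_H P
proof (induct P rule: tensor_induct')
  case (tens p q)
  show ?case using md_H md_H V
  proof (induct V rule: tensor_induct')
    case (tens u v)
    note pq = \<open>p \<in> carrier H\<close> \<open>q \<in> carrier H\<close>
    show ?case
    proof (rule lin_eq4I[where f = "\<lambda>t. flip_S (tens k H H p q) \<otimes>\<^bsub>H2\<^esub> gamma_map t \<otimes>\<^bsub>H2\<^esub> tens k H H u v"
          and g = "\<lambda>t. gamma_map (t \<otimes>\<^bsub>H4\<^esub> app2 H H H2 (tens k H H u v) (tens k H H p q))", OF _ _ _ _ _ _ _ t])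
      show "(\<lambda>t. flip_S (tens k H H p q) \<otimes>\<^bsub>H2\<^esub> gamma_map t \<otimes>\<^bsub>H2\<^esub> tens k H H u v) \<in> lin k H4 H2"
        "(\<lambda>t. gamma_map (t \<otimes>\<^bsub>H4\<^esub> app2 H H H2 (tens k H H u v) (tens k H H p q))) \<in> lin k H4 H2"
        by (intro lin_intros lin_comp[OF gamma_map_lin]; use tens pq in simp)+
    qed (use tens pq in \<open>simp_all add: S_mult alg_assoc\<close>)
  qed (use t tens in \<open>simp_all add: additivity\<close>)
qed (use t V in \<open>simp_all add: additivity\<close>)

abbreviation "twA \<equiv> twist_A k H"
abbreviation "twG \<equiv> twist_gamma k H"
abbreviation "twF \<equiv> drinfeld_twist k H"

lemma twA_eq: "twA = app3 H H H H \<one>\<^bsub>H\<^esub> Ph \<otimes>\<^bsub>H4\<^esub> dH H2 Ph'"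
  by (simp add: twist_A_def tsum3_tens_right tsum3_split_left[where A = H])

lemma twA_closed [simp]: "twA \<in> carrier H4"
  by (simp add: twA_eq)

lemma twG_eq: "twG = gamma_map twA"
  by (simp add: twist_gamma_def gamma_map_def)

text \<open>Quasi-coassociativity in the first factor of \<open>Z\<close>, with the second factor
  carried along in the last slot.\<close>

lemma Ph_intertwine:
  assumes "Z \<in> carrier H2"
  shows "app3 H H H H \<one>\<^bsub>H\<^esub> Ph \<otimes>\<^bsub>H4\<^esub> dH H2 (dH H Z)
    = tmap_r H H2 H3 (dH H) (dH H Z) \<otimes>\<^bsub>H4\<^esub> app3 H H H H \<one>\<^bsub>H\<^esub> Ph"
  using md_H md_H assms
  by (induct Z rule: tensor_induct')
    (simp_all add: additivity tsplit_app2 tmap_r_tsplit_app2 app3_mult quasi_coassoc)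

definition outer_slots where "outer_slots X = tmap_r H H H3 (\<lambda>s. tens3 k H H H \<one>\<^bsub>H\<^esub> \<one>\<^bsub>H\<^esub> s) X"

lemma outer_slots_inner_hom [simp]: "(\<lambda>s. tens3 k H H H \<one>\<^bsub>H\<^esub> \<one>\<^bsub>H\<^esub> s) \<in> alg_hom k H H3"
  by (rule alg_homI) (simp_all add: lin_intros)

lemma outer_slots_hom [simp]: "outer_slots \<in> alg_hom k H2 H4"
  unfolding outer_slots_def[abs_def] using tmap_r_hom[OF _ _ _ outer_slots_inner_hom] by simp

lemma outer_slots_tens [simp]: "x \<in> carrier H \<Longrightarrow> y \<in> carrier H \<Longrightarrow>
    outer_slots (tens k H H x y) = tens4 k H H H H x \<one>\<^bsub>H\<^esub> \<one>\<^bsub>H\<^esub> y"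
  by (simp add: outer_slots_def)

lemma outer_slots_closed [simp]: "X \<in> carrier H2 \<Longrightarrow> outer_slots X \<in> carrier H4"
  by (rule lin_closed[OF hom_lin[OF outer_slots_hom]])

lemmas [additivity] = lin_add[OF hom_lin[OF outer_slots_hom]]

text \<open>Slots 2 and 3 are joined as S(b) \<alpha> c, so a comultiplication placed there from the
  left is absorbed and leaves its counit.\<close>

lemma gamma_map_contract_middle:
  assumes y: "y \<in> carrier H3" and t: "t \<in> carrier H4"
  shows "gamma_map (tmap_r H H2 H3 (dH H) y \<otimes>\<^bsub>H4\<^esub> t) = gamma_map (outer_slots (tmap_r H H2 H (counit_l H) y) \<otimes>\<^bsub>H4\<^esub> t)"
proof (rule lin_eq4I[where f = "\<lambda>t. gamma_map (tmap_r H H2 H3 (dH H) y \<otimes>\<^bsub>H4\<^esub> t)"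
      and g = "\<lambda>t. gamma_map (outer_slots (tmap_r H H2 H (counit_l H) y) \<otimes>\<^bsub>H4\<^esub> t)" and P = H2, OF _ _ _ _ _ _ _ t])
  fix a b c d assume abcd: "a \<in> carrier H" "b \<in> carrier H" "c \<in> carrier H" "d \<in> carrier H"
  have 1: "gamma_map (tens k H H3 p (app2 H H H s X \<otimes>\<^bsub>H3\<^esub> tens3 k H H H b c d))
      = tens k H H (alpha_map (X \<otimes>\<^bsub>H2\<^esub> tens k H H b c)) (S p \<otimes>\<^bsub>H\<^esub> al \<otimes>\<^bsub>H\<^esub> (s \<otimes>\<^bsub>H\<^esub> d))"
    if "X \<in> carrier H2" "p \<in> carrier H" "s \<in> carrier H" for X p s
    using md_H md_H that(1)
    by (induct X rule: tensor_induct') (use abcd that in \<open>simp_all add: additivity\<close>)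
  show "gamma_map (tmap_r H H2 H3 (dH H) y \<otimes>\<^bsub>H4\<^esub> tens4 k H H H H a b c d) =
      gamma_map (outer_slots (tmap_r H H2 H (counit_l H) y) \<otimes>\<^bsub>H4\<^esub> tens4 k H H H H a b c d)"
  proof (rule lin_eq3I[where f = "\<lambda>y. gamma_map (tmap_r H H2 H3 (dH H) y \<otimes>\<^bsub>H4\<^esub> tens4 k H H H H a b c d)"
        and g = "\<lambda>y. gamma_map (outer_slots (tmap_r H H2 H (counit_l H) y) \<otimes>\<^bsub>H4\<^esub> tens4 k H H H H a b c d)", OF _ _ _ _ _ _ y])
    show "(\<lambda>y. gamma_map (tmap_r H H2 H3 (dH H) y \<otimes>\<^bsub>H4\<^esub> tens4 k H H H H a b c d)) \<in> lin k H3 H2"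
      "(\<lambda>y. gamma_map (outer_slots (tmap_r H H2 H (counit_l H) y) \<otimes>\<^bsub>H4\<^esub> tens4 k H H H H a b c d)) \<in> lin k H3 H2"
      by (intro lin_intros lin_comp[OF gamma_map_lin] lin_comp[OF hom_lin[OF outer_slots_hom]]; use abcd in simp)+
  qed (use abcd in \<open>simp_all add: 1 alpha_map_contract S_mult alg_assoc tens_smult mult_smult
          lin_smult[OF gamma_map_lin] lin_smult[OF hom_lin[OF outer_slots_hom]]\<close>)
qed (use y in \<open>simp_all add: lin_comp[OF gamma_map_lin] mult_lin_right\<close>)

text \<open>Slots 1 and 4 are the other contracted pair: \<Delta>(h) spread over them meets \<alpha>
  in the second factor of the value.\<close>

lemma gamma_map_contract_outer:
  assumes h: "h \<in> carrier H" and t: "t \<in> carrier H4"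
  shows "gamma_map (outer_slots (Dl h) \<otimes>\<^bsub>H4\<^esub> t) = ep h \<odot>\<^bsub>H2\<^esub> gamma_map t"
proof (rule lin_eq4I[where f = "\<lambda>t. gamma_map (outer_slots (Dl h) \<otimes>\<^bsub>H4\<^esub> t)"
      and g = "\<lambda>t. ep h \<odot>\<^bsub>H2\<^esub> gamma_map t" and P = H2, OF _ _ _ _ _ _ _ t])
  fix a b c d assume abcd: "a \<in> carrier H" "b \<in> carrier H" "c \<in> carrier H" "d \<in> carrier H"
  have 1: "gamma_map (outer_slots X \<otimes>\<^bsub>H4\<^esub> tens4 k H H H H a b c d)
      = tens k H H (alpha_map (tens k H H b c)) (alpha_map (X \<otimes>\<^bsub>H2\<^esub> tens k H H a d))"
    if "X \<in> carrier H2" for X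
    using md_H md_H that
    by (induct X rule: tensor_induct') (use abcd in \<open>simp_all add: additivity\<close>)
  show "gamma_map (outer_slots (Dl h) \<otimes>\<^bsub>H4\<^esub> tens4 k H H H H a b c d) = ep h \<odot>\<^bsub>H2\<^esub> gamma_map (tens4 k H H H H a b c d)"
    using abcd h by (simp add: 1 alpha_map_contract tens_smult)
qed (use h in \<open>simp_all add: lin_comp[OF gamma_map_lin] mult_lin_right smult_lin_comp\<close>)

text \<open>\<open>x \<otimes> y \<mapsto> (S \<otimes> S)(\<Delta>\<^sup>c\<^sup>o\<^sup>p(x)) \<gamma> \<Delta>(y)\<close>\<close>

definition twist_map where "twist_map Z = gamma_map (twA \<otimes>\<^bsub>H4\<^esub> dH H2 (tmap_r H H H2 Dl Z))"

lemma twist_map_lin [simp]: "twist_map \<in> lin k H2 H2"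
proof -
  have "(\<lambda>Z. gamma_map (twA \<otimes>\<^bsub>H4\<^esub> dH H2 (tmap_r H H H2 Dl Z))) \<in> lin k H2 H2"
    by (intro lin_comp[OF gamma_map_lin] lin_comp_mult_right tsplit_lin_comp) simp_all
  then show ?thesis by (simp add: twist_map_def[abs_def])
qed

lemma twist_map_closed [simp]: "Z \<in> carrier H2 \<Longrightarrow> twist_map Z \<in> carrier H2"
  by (rule lin_closed[OF twist_map_lin])

lemma twist_map_tens: "x \<in> carrier H \<Longrightarrow> y \<in> carrier H \<Longrightarrow>
    twist_map (tens k H H x y) = flip_S (Dl x) \<otimes>\<^bsub>H2\<^esub> twG \<otimes>\<^bsub>H2\<^esub> Dl y"
  by (simp add: twist_map_def twG_eq gamma_map_flip)

lemmas [additivity] = lin_add[OF twist_map_lin]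

lemma twG_closed [simp]: "twG \<in> carrier H2"
  by (simp add: twG_eq)

text \<open>For \<open>Z\<close> = 1 this reads (S \<otimes>
  S)(\<open>\<Delta>\<^sup>c\<^sup>o\<^sup>p(h\<^sub>1)\<close>) \<gamma>
  \<Delta>(\<open>h\<^sub>2\<close>) = \<epsilon>(h) \<gamma>. Quasi-coassociativity, used once for
  the \<Phi>\<inverse> and once for the \<Phi> in \<open>twA\<close>, carries the iterated
  comultiplication of h to the left of \<open>twA\<close>, where first the middle and then the outer
  pair of slots absorbs it.\<close>

lemma twist_map_contract:
  assumes h: "h \<in> carrier H" and Z: "Z \<in> carrier H2"
  shows "twist_map (Dl h \<otimes>\<^bsub>H2\<^esub> Z) = ep h \<odot>\<^bsub>H2\<^esub> twist_map Z"
proof -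
  let ?P = "app3 H H H H \<one>\<^bsub>H\<^esub> Ph" and ?R = "dH H2 (tmap_r H H H2 Dl Z)"
    and ?D = "tmap_r H H H2 Dl (Dl h)"
  have "Ph' \<otimes>\<^bsub>H3\<^esub> ?D = Ph' \<otimes>\<^bsub>H3\<^esub> (?D \<otimes>\<^bsub>H3\<^esub> Ph) \<otimes>\<^bsub>H3\<^esub> Ph'"
    using h by (simp add: alg_assoc)
  also have "\<dots> = dH H (Dl h) \<otimes>\<^bsub>H3\<^esub> Ph'"
    using h by (simp add: quasi_coassoc) (simp add: alg_assoc[symmetric])
  finally have 1: "Ph' \<otimes>\<^bsub>H3\<^esub> ?D = dH H (Dl h) \<otimes>\<^bsub>H3\<^esub> Ph'" .
  have "twA \<otimes>\<^bsub>H4\<^esub> dH H2 ?D = ?P \<otimes>\<^bsub>H4\<^esub> dH H2 (Ph' \<otimes>\<^bsub>H3\<^esub> ?D)"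
    using h by (simp add: twA_eq alg_assoc tsplit_mult)
  also have "\<dots> = ?P \<otimes>\<^bsub>H4\<^esub> dH H2 (dH H (Dl h)) \<otimes>\<^bsub>H4\<^esub> dH H2 Ph'"
    unfolding 1 using h by (simp add: alg_assoc tsplit_mult)
  also have "\<dots> = tmap_r H H2 H3 (dH H) (dH H (Dl h)) \<otimes>\<^bsub>H4\<^esub> twA"
    using h by (simp add: Ph_intertwine twA_eq alg_assoc)
  finally have 2: "twA \<otimes>\<^bsub>H4\<^esub> dH H2 ?D = tmap_r H H2 H3 (dH H) (dH H (Dl h)) \<otimes>\<^bsub>H4\<^esub> twA" .
  have "twist_map (Dl h \<otimes>\<^bsub>H2\<^esub> Z) = gamma_map (twA \<otimes>\<^bsub>H4\<^esub> dH H2 ?D \<otimes>\<^bsub>H4\<^esub> ?R)"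
    using h Z by (simp add: twist_map_def tmap_r_mult tsplit_mult alg_assoc)
  also have "\<dots> = gamma_map (outer_slots (Dl h) \<otimes>\<^bsub>H4\<^esub> (twA \<otimes>\<^bsub>H4\<^esub> ?R))"
    unfolding 2 using h Z by (simp add: alg_assoc gamma_map_contract_middle)
  also have "\<dots> = ep h \<odot>\<^bsub>H2\<^esub> twist_map Z"
    using h Z by (simp add: gamma_map_contract_outer twist_map_def)
  finally show ?thesis .
qed

lemma twist_map_mult_left:
  assumes "h \<in> carrier H" "Z \<in> carrier H2"
  shows "flip_S (Dl h) \<otimes>\<^bsub>H2\<^esub> twist_map Z = twist_map (Z \<otimes>\<^bsub>H2\<^esub> tens k H H h \<one>\<^bsub>H\<^esub>)"
  using md_H md_H assms(2)
  by (induct Z rule: tensor_induct')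
    (use assms in \<open>simp_all add: additivity twist_map_tens Dl_mult flip_S_mult alg_assoc\<close>)

lemma twist_map_mult_right:
  assumes "h \<in> carrier H" "Z \<in> carrier H2"
  shows "twist_map Z \<otimes>\<^bsub>H2\<^esub> Dl h = twist_map (Z \<otimes>\<^bsub>H2\<^esub> tens k H H \<one>\<^bsub>H\<^esub> h)"
  using md_H md_H assms(2)
  by (induct Z rule: tensor_induct')
    (use assms in \<open>simp_all add: additivity twist_map_tens Dl_mult alg_assoc\<close>)

text \<open>The element \<open>x\<^sup>1 \<otimes> x\<^sup>2 \<beta> S(x\<^sup>3)\<close> for x =
  \<Phi>\<inverse>, the analogue of p with \<open>H\<close> in place of \<open>U\<close>. It is the
  argument at which \<open>twist_map\<close> yields f.\<close>

definition twist_arg where "twist_arg = tmap_r H H2 H beta_map Ph'"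

lemma twist_arg_closed [simp]: "twist_arg \<in> carrier H2" by (simp add: twist_arg_def)

lemma twF_eq: "twF = twist_map twist_arg"
  unfolding drinfeld_twist_def twist_arg_def
proof (rule tsum3_eq_lin[where L = "\<lambda>X. twist_map (tmap_r H H2 H beta_map X)" and A = H and B = H and C = H])
  show "(\<lambda>X. twist_map (tmap_r H H2 H beta_map X)) \<in> lin k H3 H2"
    by (intro lin_comp[OF twist_map_lin]) simp
  show "tsum H2 (Dl x) (\<lambda>x1 x2. tens k H H (S x2) (S x1)) \<otimes>\<^bsub>H2\<^esub> twG
      \<otimes>\<^bsub>H2\<^esub> Dl (y \<otimes>\<^bsub>H\<^esub> be \<otimes>\<^bsub>H\<^esub> S z) = twist_map (tmap_r H H2 H beta_map (tens3 k H H H x y z))"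
    if "x \<in> carrier H" "y \<in> carrier H" "z \<in> carrier H" for x y z
    using that by (simp add: twist_map_tens flip_S_def)
qed simp_all

lemma twF_closed [simp]: "twF \<in> carrier H2" by (simp add: twF_eq)

text \<open>Contract both sides of \<Phi>\<inverse> (id \<otimes> \<Delta>)(\<Delta>(h)) = (\<Delta>
  \<otimes> id)(\<Delta>(h)) \<Phi>\<inverse> by \<beta> in the last two slots and apply
  \<open>twist_map\<close>. On the left \<beta> absorbs the inner comultiplication and h stays
  behind in the first slot; on the right \<open>twist_map\<close> absorbs it and S(h) stays behind
  in the second.\<close>

lemma twist_S:
  assumes h: "h \<in> carrier H"
  shows "flip_S (Dl h) \<otimes>\<^bsub>H2\<^esub> twF = twF \<otimes>\<^bsub>H2\<^esub> Dl (S h)"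
proof -
  let ?B = "tmap_r H H2 H beta_map" and ?D = "tmap_r H H H2 Dl (Dl h)"
  have 1: "?B (Ph' \<otimes>\<^bsub>H3\<^esub> tmap_r H H H2 Dl Z) = twist_arg \<otimes>\<^bsub>H2\<^esub> tens k H H (counit_r H Z) \<one>\<^bsub>H\<^esub>" if Z: "Z \<in> carrier H2" for Z
  proof -
    have *: "?B (Ph' \<otimes>\<^bsub>H3\<^esub> tens k H H2 x (Dl y)) = twist_arg \<otimes>\<^bsub>H2\<^esub> tens k H H (ep y \<odot>\<^bsub>H\<^esub> x) \<one>\<^bsub>H\<^esub>"
      if "x \<in> carrier H" "y \<in> carrier H" for x y
    proof -
      have "?B (T \<otimes>\<^bsub>H3\<^esub> tens k H H2 x (Dl y)) = ?B T \<otimes>\<^bsub>H2\<^esub> tens k H H (ep y \<odot>\<^bsub>H\<^esub> x) \<one>\<^bsub>H\<^esub>"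
        if "T \<in> carrier H3" for T
        using md_H _ that
        by (induct T rule: tensor_induct')
          (use \<open>x \<in> carrier H\<close> \<open>y \<in> carrier H\<close> in \<open>simp_all add: additivity beta_map_contract tens_smult mult_smult md_smult\<close>)
      then show ?thesis by (simp add: twist_arg_def)
    qed
    show ?thesis using md_H md_H Z
      by (induct Z rule: tensor_induct') (simp_all add: additivity *)
  qed
  have 2: "?B (app2 H H H y X \<otimes>\<^bsub>H3\<^esub> Ph') = X \<otimes>\<^bsub>H2\<^esub> twist_arg \<otimes>\<^bsub>H2\<^esub> tens k H H \<one>\<^bsub>H\<^esub> (S y)"
    if X: "X \<in> carrier H2" and y: "y \<in> carrier H" for X y
  proof -
    have *: "?B (tens3 k H H H p q y \<otimes>\<^bsub>H3\<^esub> T) = tens k H H p q \<otimes>\<^bsub>H2\<^esub> ?B T \<otimes>\<^bsub>H2\<^esub> tens k H H \<one>\<^bsub>H\<^esub> (S y)"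
      if "p \<in> carrier H" "q \<in> carrier H" "T \<in> carrier H3" for p q T
      using md_H _ that(3)
      by (induct T rule: tensor_induct')
        (use that y in \<open>simp_all add: additivity beta_map_mult_tens alg_assoc\<close>)
    show ?thesis using md_H md_H X
      by (induct X rule: tensor_induct') (use y in \<open>simp_all add: additivity twist_arg_def *\<close>)
  qed
  have 3: "twist_map (?B (dH H Z \<otimes>\<^bsub>H3\<^esub> Ph')) = twF \<otimes>\<^bsub>H2\<^esub> Dl (S (counit_l H Z))" if "Z \<in> carrier H2" for Z
    using md_H md_H that
    by (induct Z rule: tensor_induct')
      (simp_all add: additivity 2 alg_assoc twist_map_contract twF_eq lin_smult[OF S_lin]
        lin_smult[OF hom_lin[OF Dl_hom]] mult_smult twist_map_mult_right)
  have "Ph' \<otimes>\<^bsub>H3\<^esub> ?D = Ph' \<otimes>\<^bsub>H3\<^esub> (?D \<otimes>\<^bsub>H3\<^esub> Ph) \<otimes>\<^bsub>H3\<^esub> Ph'"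
    using h by (simp add: alg_assoc)
  also have "\<dots> = dH H (Dl h) \<otimes>\<^bsub>H3\<^esub> Ph'"
    using h by (simp add: quasi_coassoc) (simp add: alg_assoc[symmetric])
  finally have 4: "Ph' \<otimes>\<^bsub>H3\<^esub> ?D = dH H (Dl h) \<otimes>\<^bsub>H3\<^esub> Ph'" .
  have "flip_S (Dl h) \<otimes>\<^bsub>H2\<^esub> twF = twist_map (?B (Ph' \<otimes>\<^bsub>H3\<^esub> ?D))"
    using h by (simp add: twF_eq twist_map_mult_left 1)
  also have "\<dots> = twF \<otimes>\<^bsub>H2\<^esub> Dl (S h)"
    unfolding 4 using h by (simp add: 3)
  finally show ?thesis .
qed

definition beta_alpha_map where
  "beta_alpha_map Y = tsum3 H Y (\<lambda>x y z. x \<otimes>\<^bsub>H\<^esub> be \<otimes>\<^bsub>H\<^esub> S y \<otimes>\<^bsub>H\<^esub> al \<otimes>\<^bsub>H\<^esub> z)"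

lemma beta_alpha_map_lin [simp]: "beta_alpha_map \<in> lin k H3 H"
  and beta_alpha_map_tens3: "a \<in> carrier H \<Longrightarrow> b \<in> carrier H \<Longrightarrow> c \<in> carrier H \<Longrightarrow>
    beta_alpha_map (tens3 k H H H a b c) = a \<otimes>\<^bsub>H\<^esub> be \<otimes>\<^bsub>H\<^esub> S b \<otimes>\<^bsub>H\<^esub> al \<otimes>\<^bsub>H\<^esub> c"
proof -
  let ?f = "\<lambda>x y z. x \<otimes>\<^bsub>H\<^esub> be \<otimes>\<^bsub>H\<^esub> S y \<otimes>\<^bsub>H\<^esub> al \<otimes>\<^bsub>H\<^esub> z"
  have f: "\<And>b c. b \<in> carrier H \<Longrightarrow> c \<in> carrier H \<Longrightarrow> (\<lambda>a. ?f a b c) \<in> lin k H H"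
    "\<And>a c. a \<in> carrier H \<Longrightarrow> c \<in> carrier H \<Longrightarrow> (\<lambda>b. ?f a b c) \<in> lin k H H"
    "\<And>a b. a \<in> carrier H \<Longrightarrow> b \<in> carrier H \<Longrightarrow> (\<lambda>c. ?f a b c) \<in> lin k H H"
    by (intro lin_intros; simp)+
  show "beta_alpha_map \<in> lin k H3 H" using tsum3_lin(1)[OF _ _ _ _ f] by (simp add: beta_alpha_map_def[abs_def])
  show "a \<in> carrier H \<Longrightarrow> b \<in> carrier H \<Longrightarrow> c \<in> carrier H \<Longrightarrow> beta_alpha_map (tens3 k H H H a b c) = ?f a b c"
    unfolding beta_alpha_map_def using tsum3_lin(2)[OF _ _ _ _ f] by simp
qed

lemma beta_alpha_map_closed [simp]: "Y \<in> carrier H3 \<Longrightarrow> beta_alpha_map Y \<in> carrier H"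
  by (rule lin_closed[OF beta_alpha_map_lin])

lemmas [additivity] = lin_add[OF beta_alpha_map_lin]

lemma beta_alpha_map_tens [simp]:
  assumes "x \<in> carrier H" "Z \<in> carrier H2"
  shows "beta_alpha_map (tens k H H2 x Z) = x \<otimes>\<^bsub>H\<^esub> be \<otimes>\<^bsub>H\<^esub> alpha_map Z"
  using md_H md_H assms(2)
  by (induct Z rule: tensor_induct') (use assms in \<open>simp_all add: additivity beta_alpha_map_tens3 alg_assoc\<close>)

lemma beta_alpha_map_Ph [simp]: "beta_alpha_map Ph = \<one>\<^bsub>H\<^esub>"
  using qh.antip_reass by (simp add: beta_alpha_map_def)

text \<open>A comultiplication in slots 2 and 3 meets \<alpha> from the left. In the companion lemma
  a comultiplication in slots 1 and 2 meets \<beta> from the right.\<close>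

lemma beta_alpha_map_contract_left:
  assumes "Y \<in> carrier H2" "t \<in> carrier H3"
  shows "beta_alpha_map (tmap_r H H H2 Dl Y \<otimes>\<^bsub>H3\<^esub> t) = counit_r H Y \<otimes>\<^bsub>H\<^esub> beta_alpha_map t"
  using md_H md_H assms(1)
proof (induct Y rule: tensor_induct')
  case (tens a b)
  show ?case using md_H _ assms(2)
    by (induct t rule: tensor_induct')
      (use tens in \<open>simp_all add: additivity alpha_map_contract mult_smult md_smult alg_assoc\<close>)
qed (use assms in \<open>simp_all add: additivity\<close>)

lemma beta_alpha_map_contract_right:
  assumes "Y \<in> carrier H2" "t \<in> carrier H3"
  shows "beta_alpha_map (t \<otimes>\<^bsub>H3\<^esub> dH H Y) = beta_alpha_map t \<otimes>\<^bsub>H\<^esub> counit_l H Y"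
  using md_H md_H assms(1)
proof (induct Y rule: tensor_induct')
  case (tens y z)
  have 1: "beta_alpha_map (tens3 k H H H a b c \<otimes>\<^bsub>H3\<^esub> app2 H H H z X) = beta_map (tens k H H a b \<otimes>\<^bsub>H2\<^esub> X) \<otimes>\<^bsub>H\<^esub> al \<otimes>\<^bsub>H\<^esub> (c \<otimes>\<^bsub>H\<^esub> z)"
    if "a \<in> carrier H" "b \<in> carrier H" "c \<in> carrier H" "X \<in> carrier H2" for a b c X
    using md_H md_H that(4)
    by (induct X rule: tensor_induct') (use that tens in \<open>simp_all add: additivity beta_alpha_map_tens3 alg_assoc\<close>)
  show ?case
  proof (rule lin_eq3I[where f = "\<lambda>t. beta_alpha_map (t \<otimes>\<^bsub>H3\<^esub> dH H (tens k H H y z))"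
        and g = "\<lambda>t. beta_alpha_map t \<otimes>\<^bsub>H\<^esub> counit_l H (tens k H H y z)", OF _ _ _ _ _ _ assms(2)])
    show "(\<lambda>t. beta_alpha_map (t \<otimes>\<^bsub>H3\<^esub> dH H (tens k H H y z))) \<in> lin k H3 H"
      "(\<lambda>t. beta_alpha_map t \<otimes>\<^bsub>H\<^esub> counit_l H (tens k H H y z)) \<in> lin k H3 H"
      by (intro lin_intros lin_comp[OF beta_alpha_map_lin]; use tens in simp)+
  qed (use tens 1 in \<open>simp_all add: beta_map_contract mult_smult md_smult alg_assoc del: tens_mult\<close>)
qed (use assms in \<open>simp_all add: additivity\<close>)

text \<open>The pentagon, multiplied by \<Phi>\<inverse> \<otimes> 1, is contracted by x \<beta>
  S(y) \<alpha> z in slots 2 to 4 and sent through \<open>twist_map\<close>. Its left side collapses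
  to the value at 1 \<otimes> 1, which is \<gamma>. On the right (id \<otimes> id \<otimes>
  \<Delta>)(\<Phi>) is absorbed by \<alpha> and (\<Delta> \<otimes> id \<otimes> id)(\<Phi>) by
  \<open>twist_map_contract\<close>, while \<Phi>\<inverse> \<otimes> 1 leaves
  \<open>twist_arg\<close> times 1 \<otimes> \<alpha>, that is, f \<Delta>(\<alpha>).\<close>

lemma twist_alpha: "twF \<otimes>\<^bsub>H2\<^esub> Dl al = twG"
proof -
  let ?B = "tmap_r H H3 H beta_alpha_map"
  let ?V = "\<lambda>t. twist_map (?B t)"
  let ?X1 = "tens k H H3 \<one>\<^bsub>H\<^esub> Ph" and ?X2 = "tmap_r H H2 H3 (dH H) Ph"
  let ?X3 = "tmap_r H H2 H3 (tmap_r H H H2 Dl) Ph" and ?X4 = "dH H2 Ph"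
  let ?P = "app3 H H H H \<one>\<^bsub>H\<^esub> Ph" and ?P' = "app3 H H H H \<one>\<^bsub>H\<^esub> Ph'"
  have PP: "?P \<otimes>\<^bsub>H4\<^esub> ?P' = \<one>\<^bsub>H4\<^esub>" by (simp add: app3_mult)
  have "?X1 \<otimes>\<^bsub>H4\<^esub> ?X2 = ?X1 \<otimes>\<^bsub>H4\<^esub> ?X2 \<otimes>\<^bsub>H4\<^esub> (?P \<otimes>\<^bsub>H4\<^esub> ?P')"
    by (simp add: PP)
  also have "\<dots> = ?X3 \<otimes>\<^bsub>H4\<^esub> ?X4 \<otimes>\<^bsub>H4\<^esub> ?P'"
    unfolding pentagon[symmetric] by (simp add: alg_assoc)
  finally have eq: "?X1 \<otimes>\<^bsub>H4\<^esub> ?X2 = ?X3 \<otimes>\<^bsub>H4\<^esub> (?X4 \<otimes>\<^bsub>H4\<^esub> ?P')" by (simp add: alg_assoc)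
  have "?B (?X1 \<otimes>\<^bsub>H4\<^esub> ?X2) = ?B ?X1 \<otimes>\<^bsub>H2\<^esub> tmap_r H H2 H (counit_l H) Ph"
    by (rule tmap_r_semilin_right) (simp_all add: beta_alpha_map_contract_right)
  then have l: "?V (?X1 \<otimes>\<^bsub>H4\<^esub> ?X2) = twG"
    using twist_map_tens[of "\<one>\<^bsub>H\<^esub>" "\<one>\<^bsub>H\<^esub>"] flip_S_tens[of "\<one>\<^bsub>H\<^esub>" "\<one>\<^bsub>H\<^esub>"] by simp
  have "?B (?X3 \<otimes>\<^bsub>H4\<^esub> (?X4 \<otimes>\<^bsub>H4\<^esub> ?P')) = tmap_r H H2 H (counit_r H) Ph \<otimes>\<^bsub>H2\<^esub> ?B (?X4 \<otimes>\<^bsub>H4\<^esub> ?P')"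
    by (rule tmap_r_semilin) (simp_all add: beta_alpha_map_contract_left)
  then have r1: "?V (?X3 \<otimes>\<^bsub>H4\<^esub> (?X4 \<otimes>\<^bsub>H4\<^esub> ?P')) = ?V (?X4 \<otimes>\<^bsub>H4\<^esub> ?P')"
    by simp
  \<comment> \<open>Slot 1 is not contracted and slot 2 supplies the leading factor of x \<beta>
    S(y) \<alpha> z, so \<open>X\<close> leaves the contraction as a left factor, ready for
    \<open>twist_map_contract\<close>.\<close>
  have b: "?B (app2 H H H2 w X \<otimes>\<^bsub>H4\<^esub> t) = X \<otimes>\<^bsub>H2\<^esub> ?B (tens k H H3 \<one>\<^bsub>H\<^esub> (tens k H H2 \<one>\<^bsub>H\<^esub> w) \<otimes>\<^bsub>H4\<^esub> t)"
    if X: "X \<in> carrier H2" and w: "w \<in> carrier H2" and t: "t \<in> carrier H4" for X w t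
    using md_H md_H X
  proof (induct X rule: tensor_induct')
    case (tens a b)
    have 1: "beta_alpha_map (tens k H H2 b w \<otimes>\<^bsub>H3\<^esub> u) = b \<otimes>\<^bsub>H\<^esub> beta_alpha_map (tens k H H2 \<one>\<^bsub>H\<^esub> w \<otimes>\<^bsub>H3\<^esub> u)" if "u \<in> carrier H3" for u
      using md_H _ that
      by (induct u rule: tensor_induct') (use tens w in \<open>simp_all add: additivity alg_assoc\<close>)
    show ?case using md_H _ t
      by (induct t rule: tensor_induct') (use tens w in \<open>simp_all add: additivity 1\<close>)
  qed (use w t in \<open>simp_all add: additivity\<close>)
  have r2: "?V (dH H2 Y \<otimes>\<^bsub>H4\<^esub> t) = ?V (tens k H H3 \<one>\<^bsub>H\<^esub> (tens k H H2 \<one>\<^bsub>H\<^esub> (counit_l H2 Y)) \<otimes>\<^bsub>H4\<^esub> t)"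
    if Y: "Y \<in> carrier H3" and t: "t \<in> carrier H4" for Y t
    using md_H _ Y
    by (induct Y rule: tensor_induct')
      (use t in \<open>simp_all add: additivity b twist_map_contract tens_smult mult_smult lin_smult[OF tmap_r_lin] lin_smult[OF twist_map_lin]\<close>)
  have p: "?B (app3 H H H H \<one>\<^bsub>H\<^esub> Z) = tmap_r H H2 H beta_map Z \<otimes>\<^bsub>H2\<^esub> tens k H H \<one>\<^bsub>H\<^esub> al" if "Z \<in> carrier H3" for Z
  proof -
    have 1: "beta_alpha_map (app2 H H H \<one>\<^bsub>H\<^esub> X) = beta_map X \<otimes>\<^bsub>H\<^esub> al" if "X \<in> carrier H2" for X
      using md_H md_H that by (induct X rule: tensor_induct') (simp_all add: additivity alg_assoc)
    show ?thesis using md_H _ that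
      by (induct Z rule: tensor_induct') (simp_all add: additivity 1)
  qed
  have "twG = ?V ?P'"
    using l r1 r2[of Ph ?P'] by (simp add: eq)
  also have "\<dots> = twF \<otimes>\<^bsub>H2\<^esub> Dl al"
    by (simp add: p twF_eq twist_map_mult_right twist_arg_def)
  finally show ?thesis by simp
qed

text \<open>\<open>twist_S\<close> for h = S\<inverse>(\<alpha> x), then \<open>twist_alpha\<close>,
  then the inverse flip. This is the form in which the f of \<Omega> meets the S\<inverse> of
  q.\<close>

lemma flip_twist:
  assumes "x \<in> carrier H"
  shows "flip_S' twF \<otimes>\<^bsub>H2\<^esub> Dl (S' (al \<otimes>\<^bsub>H\<^esub> x)) = flip_S' (twG \<otimes>\<^bsub>H2\<^esub> Dl x)"
proof -
  have "flip_S (Dl (S' (al \<otimes>\<^bsub>H\<^esub> x))) \<otimes>\<^bsub>H2\<^esub> twF = twF \<otimes>\<^bsub>H2\<^esub> (Dl al \<otimes>\<^bsub>H2\<^esub> Dl x)"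
    using assms by (simp add: twist_S Dl_mult)
  also have "\<dots> = twG \<otimes>\<^bsub>H2\<^esub> Dl x"
    using assms by (simp add: alg_assoc[symmetric] twist_alpha)
  finally have "flip_S' (twG \<otimes>\<^bsub>H2\<^esub> Dl x) = flip_S' (flip_S (Dl (S' (al \<otimes>\<^bsub>H\<^esub> x))) \<otimes>\<^bsub>H2\<^esub> twF)"
    by simp
  then show ?thesis using assms by (simp add: flip_S'_mult)
qed

end

section \<open>Bicomodule algebras\<close>

locale crossed_base = quasi_hopf_base k H
  for k :: "('k, 'r) ring_scheme" and H :: "('k, 'h, 'x) quasi_hopf_scheme" +
  fixes U :: "('k, 'h, 'u, 'y) bicomodule_algebra_scheme"
  assumes bicomodule: "bicomodule_algebra k H U"
begin

interpretation qh: quasi_hopf_algebra k H by (rule quasi_hopf)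
interpretation bc: bicomodule_algebra k H U by (rule bicomodule)

abbreviation "lam \<equiv> lcoact U"
abbreviation "rho \<equiv> rcoact U"
abbreviation "Pl \<equiv> lreass U"
abbreviation "Pl' \<equiv> lreass_inv k H U"
abbreviation "Pr \<equiv> rreass U"
abbreviation "Pr' \<equiv> rreass_inv k H U"
abbreviation "Th \<equiv> lrreass U"
abbreviation "Th' \<equiv> lrreass_inv k H U"
abbreviation "UH \<equiv> U \<boxtimes> H"
abbreviation "UHH \<equiv> U \<boxtimes> H2"
abbreviation "UH3 \<equiv> U \<boxtimes> H3"
abbreviation "HU \<equiv> H \<boxtimes> U"
abbreviation "HHU \<equiv> H \<boxtimes> HU"
abbreviation "HUH \<equiv> H \<boxtimes> UH"
abbreviation "HUHH \<equiv> H \<boxtimes> UHH"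
abbreviation "HHUH \<equiv> H \<boxtimes> HUH"
abbreviation "HHUHH \<equiv> H \<boxtimes> HUHH"
abbreviation "dl Y \<equiv> tsplit U Y H U lam"
abbreviation "dr Y \<equiv> tsplit U Y U H rho"

lemma alg_U [simp]: "alg U"
  using bicomodule by (simp add: bicomodule_algebra_def right_comodule_algebra_def)

lemma md_U [simp]: "md U" by simp

lemma lam_hom [simp]: "lam \<in> alg_hom k U HU" by (rule bc.lam_hom)
lemma rho_hom [simp]: "rho \<in> alg_hom k U UH" by (rule bc.rho_hom)

lemma lam_closed [simp]: "u \<in> carrier U \<Longrightarrow> lam u \<in> carrier HU"
  by (rule lin_closed[OF hom_lin[OF lam_hom]])
lemma rho_closed [simp]: "u \<in> carrier U \<Longrightarrow> rho u \<in> carrier UH"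
  by (rule lin_closed[OF hom_lin[OF rho_hom]])
lemma lam_one [simp]: "lam \<one>\<^bsub>U\<^esub> = \<one>\<^bsub>HU\<^esub>" by (rule hom_one[OF lam_hom])
lemma rho_one [simp]: "rho \<one>\<^bsub>U\<^esub> = \<one>\<^bsub>UH\<^esub>" by (rule hom_one[OF rho_hom])
lemmas lam_mult = hom_mult[OF lam_hom] and rho_mult = hom_mult[OF rho_hom]
lemmas [additivity] = lin_add[OF hom_lin[OF lam_hom]] lin_add[OF hom_lin[OF rho_hom]]

lemma unit_inverse:
  assumes "alg M" "x \<in> Units M"
  shows "x \<in> carrier M" "inv\<^bsub>M\<^esub> x \<in> carrier M" "x \<otimes>\<^bsub>M\<^esub> inv\<^bsub>M\<^esub> x = \<one>\<^bsub>M\<^esub>" "inv\<^bsub>M\<^esub> x \<otimes>\<^bsub>M\<^esub> x = \<one>\<^bsub>M\<^esub>"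
proof -
  interpret m: Group.monoid M by (rule alg_monoid[OF assms(1)])
  show "x \<in> carrier M" "inv\<^bsub>M\<^esub> x \<in> carrier M" "x \<otimes>\<^bsub>M\<^esub> inv\<^bsub>M\<^esub> x = \<one>\<^bsub>M\<^esub>" "inv\<^bsub>M\<^esub> x \<otimes>\<^bsub>M\<^esub> x = \<one>\<^bsub>M\<^esub>"
    using assms(2) by (auto simp: m.Units_r_inv m.Units_l_inv)
qed

lemma Pl_closed [simp]: "Pl \<in> carrier HHU" "Pl' \<in> carrier HHU"
  and Pl_inv [simp]: "Pl \<otimes>\<^bsub>HHU\<^esub> Pl' = \<one>\<^bsub>HHU\<^esub>" "Pl' \<otimes>\<^bsub>HHU\<^esub> Pl = \<one>\<^bsub>HHU\<^esub>"
  unfolding lreass_inv_def by (rule unit_inverse[OF _ bc.Phi_l_unit]; simp)+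

lemma Pr_closed [simp]: "Pr \<in> carrier UHH" "Pr' \<in> carrier UHH"
  and Pr_inv [simp]: "Pr \<otimes>\<^bsub>UHH\<^esub> Pr' = \<one>\<^bsub>UHH\<^esub>" "Pr' \<otimes>\<^bsub>UHH\<^esub> Pr = \<one>\<^bsub>UHH\<^esub>"
  unfolding rreass_inv_def by (rule unit_inverse[OF _ bc.Phi_r_unit]; simp)+

lemma Th_closed [simp]: "Th \<in> carrier HUH" "Th' \<in> carrier HUH"
  and Th_inv [simp]: "Th \<otimes>\<^bsub>HUH\<^esub> Th' = \<one>\<^bsub>HUH\<^esub>" "Th' \<otimes>\<^bsub>HUH\<^esub> Th = \<one>\<^bsub>HUH\<^esub>"
  unfolding lrreass_inv_def by (rule unit_inverse[OF _ bc.lrreass_unit]; simp)+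

lemma rho_quasi_coassoc:
  assumes "u \<in> carrier U"
  shows "Pr \<otimes>\<^bsub>UHH\<^esub> dr H (rho u) = tmap_r U H H2 Dl (rho u) \<otimes>\<^bsub>UHH\<^esub> Pr"
  using bc.rho_quasi_coassoc[OF assms] assms
  by (simp add: tsum_tsum_left[where A = U] tsum_tsum_right[where B = H])

lemma lam_quasi_coassoc:
  assumes "u \<in> carrier U"
  shows "tmap_r H U HU lam (lam u) \<otimes>\<^bsub>HHU\<^esub> Pl = Pl \<otimes>\<^bsub>HHU\<^esub> dH U (lam u)"
  using bc.lam_quasi_coassoc[OF assms] assms
  by (simp add: tsum_tsum_left[where A = H] tsum_tsum_right[where B = U])

lemma coactions_commute:
  assumes "u \<in> carrier U"
  shows "Th \<otimes>\<^bsub>HUH\<^esub> dl H (rho u) = tmap_r H U UH rho (lam u) \<otimes>\<^bsub>HUH\<^esub> Th"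
  using bc.coactions_quasi_commute[OF assms] assms
  by (simp add: tsum_tsum_left[where A = U] tsum_tsum_right[where B = U])

lemma rho_pentagon:
  "tens k U H3 \<one>\<^bsub>U\<^esub> Ph \<otimes>\<^bsub>UH3\<^esub> tmap_r U H2 H3 (dH H) Pr \<otimes>\<^bsub>UH3\<^esub> app3 U H H H \<one>\<^bsub>H\<^esub> Pr
    = tmap_r U H2 H3 (tmap_r H H H2 Dl) Pr \<otimes>\<^bsub>UH3\<^esub> dr H2 Pr"
  using bc.rho_pentagon
  by (simp add: tsum3_tens_left tsum3_tens_right tsum3_split_left[where A = U]
      tsum3_split_middle[where B = H] tsum3_split_right[where C = H])

lemma left_mixed_pentagon:
  "tens k H HUH \<one>\<^bsub>H\<^esub> Th \<otimes>\<^bsub>HHUH\<^esub> tmap_r H UH HUH (dl H) Th \<otimes>\<^bsub>HHUH\<^esub> app3 H H U H \<one>\<^bsub>H\<^esub> Pl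
    = tmap_r H HU HUH (tmap_r H U UH rho) Pl \<otimes>\<^bsub>HHUH\<^esub> dH UH Th"
  using bc.left_mixed_pentagon
  by (simp add: tsum3_tens_left tsum3_tens_right tsum3_split_left[where A = H]
      tsum3_split_middle[where B = U] tsum3_split_right[where C = U])

lemma right_mixed_pentagon:
  "tens k H UHH \<one>\<^bsub>H\<^esub> Pr \<otimes>\<^bsub>HUHH\<^esub> tmap_r H UH UHH (dr H) Th \<otimes>\<^bsub>HUHH\<^esub> app3 H U H H \<one>\<^bsub>H\<^esub> Th
    = tmap_r H UH UHH (tmap_r U H H2 Dl) Th \<otimes>\<^bsub>HUHH\<^esub> dl H2 Pr"
  using bc.right_mixed_pentagon
  by (simp add: tsum3_tens_left tsum3_tens_right tsum3_split_left[where A = U]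
      tsum3_split_middle[where B = U] tsum3_split_right[where C = H])

lemma lam_counit [simp]: "u \<in> carrier U \<Longrightarrow> counit_l U (lam u) = u"
  using bc.lam_counit by (simp add: counit_l_def)

lemma rho_counit [simp]: "u \<in> carrier U \<Longrightarrow> counit_r U (rho u) = u"
  using bc.rho_counit by (simp add: counit_r_def)

lemma Pr_counit_middle [simp]: "tmap_r U H2 H (counit_l H) Pr = \<one>\<^bsub>UH\<^esub>"
proof -
  have "tsum3 UH Pr (\<lambda>x y z. ep y \<odot>\<^bsub>UH\<^esub> tens k U H x z) = tmap_r U H2 H (counit_l H) Pr"
    by (rule tsum3_eq_lin[of U H H]) (simp_all add: tens_smult)
  then show ?thesis using bc.Phi_r_counit_middle by simp
qed

lemma Pr_counit_right [simp]: "tmap_r U H2 H (counit_r H) Pr = \<one>\<^bsub>UH\<^esub>"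
proof -
  have "tsum3 UH Pr (\<lambda>x y z. ep z \<odot>\<^bsub>UH\<^esub> tens k U H x y) = tmap_r U H2 H (counit_r H) Pr"
    by (rule tsum3_eq_lin[of U H H]) (simp_all add: tens_smult)
  then show ?thesis using bc.Phi_r_counit_right by simp
qed

lemma hom_inverse_one:
  assumes f: "f \<in> alg_hom k M N" and "nalg M" "nalg N"
    and "x \<in> carrier M" "y \<in> carrier M" "x \<otimes>\<^bsub>M\<^esub> y = \<one>\<^bsub>M\<^esub>" "f x = \<one>\<^bsub>N\<^esub>"
  shows "f y = \<one>\<^bsub>N\<^esub>"
  using hom_mult[OF f assms(4,5)] lin_closed[OF hom_lin[OF f] assms(5)] assms by (simp add: hom_one[OF f])

lemma Pr'_counit_middle [simp]: "tmap_r U H2 H (counit_l H) Pr' = \<one>\<^bsub>UH\<^esub>"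
  by (rule hom_inverse_one[of "tmap_r U H2 H (counit_l H)" UHH UH Pr]) simp_all

lemma Pr'_counit_right [simp]: "tmap_r U H2 H (counit_r H) Pr' = \<one>\<^bsub>UH\<^esub>"
  by (rule hom_inverse_one[of "tmap_r U H2 H (counit_r H)" UHH UH Pr]) simp_all

text \<open>As for \<Phi>: \<epsilon> in the third slot of the right mixed pentagon leaves (id
  \<otimes> id \<otimes> \<epsilon>)(\<open>Th\<close>) \<otimes> 1 as the only factor that is
  neither \<open>Th\<close> nor a unit.\<close>

lemma Th_counit_right [simp]: "tmap_r H UH U (counit_r U) Th = \<one>\<^bsub>HU\<^esub>"
proof -
  let ?E = "tmap_r H UH U (counit_r U) Th"
  let ?t = "tmap_r H UHH UH (tmap_r U H2 H (counit_l H))"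
  have h: "?t \<in> alg_hom k HUHH HUH" by simp
  have 1: "?t (tens k H UHH \<one>\<^bsub>H\<^esub> Pr) = \<one>\<^bsub>HUH\<^esub>" by simp
  have 20: "tmap_r U H2 H (counit_l H) (dr H X) = X" if "X \<in> carrier UH" for X
    using md_U md_H that
    by (induct X rule: tensor_induct') (simp_all add: additivity tmap_r_counit_l_app2)
  have 2: "?t (tmap_r H UH UHH (dr H) Th) = Th"
    by (rule tmap_r_comp_id) (simp_all add: 20)
  have 3: "?t (app3 H U H H \<one>\<^bsub>H\<^esub> Th) = app2 H U H \<one>\<^bsub>H\<^esub> ?E"
  proof -
    have "?t (app3 H U H H \<one>\<^bsub>H\<^esub> Th) = tmap_r H UH UH (\<lambda>X. tens k U H (counit_r U X) \<one>\<^bsub>H\<^esub>) Th"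
      unfolding app3_def
      by (rule tmap_r_comp_eq) (simp_all add: tmap_r_counit_l_app2)
    also have "\<dots> = app2 H U H \<one>\<^bsub>H\<^esub> ?E"
      unfolding app2_def by (subst tmap_r_comp) (simp_all add: tens_lin_left)
    finally show ?thesis .
  qed
  have 4: "?t (tmap_r H UH UHH (tmap_r U H H2 Dl) Th) = Th"
    by (rule tmap_r_comp_id) simp_all
  have 5: "?t (dl H2 Pr) = \<one>\<^bsub>HUH\<^esub>"
    using tsplit_tmap_r[of U H2 H U H lam "counit_l H" Pr] by simp
  have "Th \<otimes>\<^bsub>HUH\<^esub> app2 H U H \<one>\<^bsub>H\<^esub> ?E = Th"
    using arg_cong[OF right_mixed_pentagon, of ?t] by (simp add: hom_mult[OF h] 1 2 3 4 5)
  then have "app2 H U H \<one>\<^bsub>H\<^esub> ?E = \<one>\<^bsub>HUH\<^esub>"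
    by (rule unit_cancel_left[where x = Th and y = Th', rotated -1]) simp_all
  then have "tmap_r H UH U (counit_r U) (app2 H U H \<one>\<^bsub>H\<^esub> ?E) = \<one>\<^bsub>HU\<^esub>" by simp
  then show ?thesis by (simp add: tmap_r_counit_r_app2 md_smult)
qed

lemma Th'_counit_right [simp]: "tmap_r H UH U (counit_r U) Th' = \<one>\<^bsub>HU\<^esub>"
  by (rule hom_inverse_one[of "tmap_r H UH U (counit_r U)" HUH HU Th]) simp_all

lemma inverse_swap:
  assumes "alg M" and c: "x \<in> carrier M" "x' \<in> carrier M" "a \<in> carrier M" "b \<in> carrier M"
    and "x \<otimes>\<^bsub>M\<^esub> x' = \<one>\<^bsub>M\<^esub>" "x' \<otimes>\<^bsub>M\<^esub> x = \<one>\<^bsub>M\<^esub>" and eq: "x \<otimes>\<^bsub>M\<^esub> a = b \<otimes>\<^bsub>M\<^esub> x"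
  shows "x' \<otimes>\<^bsub>M\<^esub> b = a \<otimes>\<^bsub>M\<^esub> x'"
proof -
  have "x' \<otimes>\<^bsub>M\<^esub> b = x' \<otimes>\<^bsub>M\<^esub> (b \<otimes>\<^bsub>M\<^esub> x) \<otimes>\<^bsub>M\<^esub> x'"
    using assms by (simp add: alg_assoc)
  also have "\<dots> = (x' \<otimes>\<^bsub>M\<^esub> x) \<otimes>\<^bsub>M\<^esub> a \<otimes>\<^bsub>M\<^esub> x'"
    unfolding eq[symmetric] using assms(1) c by (simp add: alg_assoc)
  finally show ?thesis using assms by simp
qed

lemma rho_quasi_coassoc':
  "u \<in> carrier U \<Longrightarrow> Pr' \<otimes>\<^bsub>UHH\<^esub> tmap_r U H H2 Dl (rho u) = dr H (rho u) \<otimes>\<^bsub>UHH\<^esub> Pr'"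
  by (rule inverse_swap[where x = Pr]) (simp_all add: rho_quasi_coassoc)

lemma lam_quasi_coassoc':
  "u \<in> carrier U \<Longrightarrow> Pl' \<otimes>\<^bsub>HHU\<^esub> tmap_r H U HU lam (lam u) = dH U (lam u) \<otimes>\<^bsub>HHU\<^esub> Pl'"
  by (rule inverse_swap[where x = Pl]) (simp_all add: lam_quasi_coassoc)

lemma coactions_commute':
  "u \<in> carrier U \<Longrightarrow> Th' \<otimes>\<^bsub>HUH\<^esub> tmap_r H U UH rho (lam u) = dl H (rho u) \<otimes>\<^bsub>HUH\<^esub> Th'"
  by (rule inverse_swap[where x = Th]) (simp_all add: coactions_commute)

text \<open>The mixed pentagons all have the shape a b c = d e. The first rearrangement gives their
  versions for the inverses; the second keeps e and a and inverts the other three, which is what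
  \<open>iso_coeff0_move_Th'\<close> requires.\<close>

lemma pentagon_inverse:
  assumes M: "alg M" and c: "a \<in> carrier M" "a' \<in> carrier M" "b \<in> carrier M" "b' \<in> carrier M"
      "c \<in> carrier M" "c' \<in> carrier M" "d \<in> carrier M" "d' \<in> carrier M" "e \<in> carrier M" "e' \<in> carrier M"
    and i: "a \<otimes>\<^bsub>M\<^esub> a' = \<one>\<^bsub>M\<^esub>" "b \<otimes>\<^bsub>M\<^esub> b' = \<one>\<^bsub>M\<^esub>" "c \<otimes>\<^bsub>M\<^esub> c' = \<one>\<^bsub>M\<^esub>"
      "d' \<otimes>\<^bsub>M\<^esub> d = \<one>\<^bsub>M\<^esub>" "e' \<otimes>\<^bsub>M\<^esub> e = \<one>\<^bsub>M\<^esub>"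
    and eq: "a \<otimes>\<^bsub>M\<^esub> b \<otimes>\<^bsub>M\<^esub> c = d \<otimes>\<^bsub>M\<^esub> e"
  shows "e' \<otimes>\<^bsub>M\<^esub> d' = c' \<otimes>\<^bsub>M\<^esub> b' \<otimes>\<^bsub>M\<^esub> a'" and "e \<otimes>\<^bsub>M\<^esub> c' \<otimes>\<^bsub>M\<^esub> b' = d' \<otimes>\<^bsub>M\<^esub> a"
proof -
  interpret m: Group.monoid M by (rule alg_monoid[OF M])
  have 1: "a \<otimes>\<^bsub>M\<^esub> b \<otimes>\<^bsub>M\<^esub> c \<otimes>\<^bsub>M\<^esub> (c' \<otimes>\<^bsub>M\<^esub> b') = a"
    using c i by (metis m.m_assoc m.m_closed m.r_one)
  have 2: "e \<otimes>\<^bsub>M\<^esub> (c' \<otimes>\<^bsub>M\<^esub> b') = d' \<otimes>\<^bsub>M\<^esub> a"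
  proof -
    have "d' \<otimes>\<^bsub>M\<^esub> a = d' \<otimes>\<^bsub>M\<^esub> (d \<otimes>\<^bsub>M\<^esub> e \<otimes>\<^bsub>M\<^esub> (c' \<otimes>\<^bsub>M\<^esub> b'))" using 1 eq by simp
    also have "\<dots> = (d' \<otimes>\<^bsub>M\<^esub> d) \<otimes>\<^bsub>M\<^esub> (e \<otimes>\<^bsub>M\<^esub> (c' \<otimes>\<^bsub>M\<^esub> b'))" using c by (simp add: m.m_assoc)
    finally show ?thesis using c i by simp
  qed
  show "e \<otimes>\<^bsub>M\<^esub> c' \<otimes>\<^bsub>M\<^esub> b' = d' \<otimes>\<^bsub>M\<^esub> a" using 2 c by (simp add: m.m_assoc)
  have "e' \<otimes>\<^bsub>M\<^esub> d' = e' \<otimes>\<^bsub>M\<^esub> (d' \<otimes>\<^bsub>M\<^esub> a) \<otimes>\<^bsub>M\<^esub> a'" using c i by (simp add: m.m_assoc)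
  also have "\<dots> = (e' \<otimes>\<^bsub>M\<^esub> e) \<otimes>\<^bsub>M\<^esub> (c' \<otimes>\<^bsub>M\<^esub> b' \<otimes>\<^bsub>M\<^esub> a')" unfolding 2[symmetric] using c by (simp add: m.m_assoc)
  also have "\<dots> = c' \<otimes>\<^bsub>M\<^esub> b' \<otimes>\<^bsub>M\<^esub> a'" using c i by simp
  finally show "e' \<otimes>\<^bsub>M\<^esub> d' = c' \<otimes>\<^bsub>M\<^esub> b' \<otimes>\<^bsub>M\<^esub> a'" .
qed

lemma left_mixed_pentagon':
  "dH UH Th' \<otimes>\<^bsub>HHUH\<^esub> tmap_r H HU HUH (tmap_r H U UH rho) Pl'
    = app3 H H U H \<one>\<^bsub>H\<^esub> Pl' \<otimes>\<^bsub>HHUH\<^esub> tmap_r H UH HUH (dl H) Th' \<otimes>\<^bsub>HHUH\<^esub> tens k H HUH \<one>\<^bsub>H\<^esub> Th'"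
  by (rule pentagon_inverse(1)[OF _ _ _ _ _ _ _ _ _ _ _ _ _ _ _ _ left_mixed_pentagon])
    (simp_all add: app3_mult flip: tmap_r_mult tsplit_mult)

lemma right_mixed_pentagon':
  "dl H2 Pr' \<otimes>\<^bsub>HUHH\<^esub> tmap_r H UH UHH (tmap_r U H H2 Dl) Th'
    = app3 H U H H \<one>\<^bsub>H\<^esub> Th' \<otimes>\<^bsub>HUHH\<^esub> tmap_r H UH UHH (dr H) Th' \<otimes>\<^bsub>HUHH\<^esub> tens k H UHH \<one>\<^bsub>H\<^esub> Pr'"
  by (rule pentagon_inverse(1)[OF _ _ _ _ _ _ _ _ _ _ _ _ _ _ _ _ right_mixed_pentagon])
    (simp_all add: app3_mult flip: tmap_r_mult tsplit_mult)

lemma right_mixed_pentagon'':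
  "dl H2 Pr \<otimes>\<^bsub>HUHH\<^esub> app3 H U H H \<one>\<^bsub>H\<^esub> Th' \<otimes>\<^bsub>HUHH\<^esub> tmap_r H UH UHH (dr H) Th'
    = tmap_r H UH UHH (tmap_r U H H2 Dl) Th' \<otimes>\<^bsub>HUHH\<^esub> tens k H UHH \<one>\<^bsub>H\<^esub> Pr"
  by (rule pentagon_inverse(2)[where a' = "tens k H UHH \<one>\<^bsub>H\<^esub> Pr'" and e' = "dl H2 Pr'",
        OF _ _ _ _ _ _ _ _ _ _ _ _ _ _ _ _ right_mixed_pentagon])
    (simp_all add: app3_mult flip: tmap_r_mult tsplit_mult)

end

section \<open>The contraction S\<inverse>(\<alpha> y) x and its two-fold version\<close>

context quasi_hopf_base
begin

text \<open>It sends x \<otimes> y to S\<inverse>(\<alpha> y) x, the expression that defines q.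
  Written through \<open>alpha_map\<close> it inherits the absorption of left factors
  \<Delta>(h).\<close>

definition alpha_inv_map where "alpha_inv_map Z = S' (alpha_map Z)"

lemma alpha_inv_map_lin [simp]: "alpha_inv_map \<in> lin k H2 H"
  unfolding alpha_inv_map_def[abs_def] by (intro lin_comp[OF S'_lin]) simp

lemma alpha_inv_map_closed [simp]: "Z \<in> carrier H2 \<Longrightarrow> alpha_inv_map Z \<in> carrier H"
  by (rule lin_closed[OF alpha_inv_map_lin])

lemma alpha_inv_map_tens: "p \<in> carrier H \<Longrightarrow> s \<in> carrier H \<Longrightarrow> alpha_inv_map (tens k H H p s) = S' (al \<otimes>\<^bsub>H\<^esub> s) \<otimes>\<^bsub>H\<^esub> p"
  by (simp add: alpha_inv_map_def S'_mult alg_assoc)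

lemma alpha_inv_map_contract:
  "h \<in> carrier H \<Longrightarrow> Z \<in> carrier H2 \<Longrightarrow> alpha_inv_map (Dl h \<otimes>\<^bsub>H2\<^esub> Z) = ep h \<odot>\<^bsub>H\<^esub> alpha_inv_map Z"
  by (simp add: alpha_inv_map_def alpha_map_contract lin_smult[OF S'_lin])

text \<open>Counterpart of \<open>gamma_map\<close> with the same pairing of slots, 1 with 4 and 2
  with 3: it computes the image of \<gamma> under the inverse flip.\<close>

definition alpha_inv_map2 where
  "alpha_inv_map2 t = tsum4 H2 t (\<lambda>a b c d. tens k H H (S' (al \<otimes>\<^bsub>H\<^esub> d) \<otimes>\<^bsub>H\<^esub> a) (S' (al \<otimes>\<^bsub>H\<^esub> c) \<otimes>\<^bsub>H\<^esub> b))"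

lemma alpha_inv_map2_lin [simp]: "alpha_inv_map2 \<in> lin k H4 H2"
  and alpha_inv_map2_tens [simp]: "a \<in> carrier H \<Longrightarrow> b \<in> carrier H \<Longrightarrow> c \<in> carrier H \<Longrightarrow> d \<in> carrier H \<Longrightarrow>
    alpha_inv_map2 (tens4 k H H H H a b c d) = tens k H H (alpha_inv_map (tens k H H a d)) (alpha_inv_map (tens k H H b c))"
proof -
  let ?f = "\<lambda>a b c d. tens k H H (S' (al \<otimes>\<^bsub>H\<^esub> d) \<otimes>\<^bsub>H\<^esub> a) (S' (al \<otimes>\<^bsub>H\<^esub> c) \<otimes>\<^bsub>H\<^esub> b)"
  have f: "\<And>b c d. b \<in> carrier H \<Longrightarrow> c \<in> carrier H \<Longrightarrow> d \<in> carrier H \<Longrightarrow> (\<lambda>a. ?f a b c d) \<in> lin k H H2"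
    "\<And>a c d. a \<in> carrier H \<Longrightarrow> c \<in> carrier H \<Longrightarrow> d \<in> carrier H \<Longrightarrow> (\<lambda>b. ?f a b c d) \<in> lin k H H2"
    "\<And>a b d. a \<in> carrier H \<Longrightarrow> b \<in> carrier H \<Longrightarrow> d \<in> carrier H \<Longrightarrow> (\<lambda>c. ?f a b c d) \<in> lin k H H2"
    "\<And>a b c. a \<in> carrier H \<Longrightarrow> b \<in> carrier H \<Longrightarrow> c \<in> carrier H \<Longrightarrow> (\<lambda>d. ?f a b c d) \<in> lin k H H2"
    by (intro lin_intros lin_comp[OF S'_lin]; simp)+
  show "alpha_inv_map2 \<in> lin k H4 H2" using tsum4_lin(1)[OF _ _ _ _ _ f] by (simp add: alpha_inv_map2_def[abs_def])
  show "a \<in> carrier H \<Longrightarrow> b \<in> carrier H \<Longrightarrow> c \<in> carrier H \<Longrightarrow> d \<in> carrier H \<Longrightarrow>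
    alpha_inv_map2 (tens4 k H H H H a b c d) = tens k H H (alpha_inv_map (tens k H H a d)) (alpha_inv_map (tens k H H b c))"
    unfolding alpha_inv_map2_def using tsum4_lin(2)[OF _ _ _ _ _ f] by (simp add: alpha_inv_map_tens)
qed

lemmas [additivity] = lin_add[OF alpha_inv_map2_lin] lin_add[OF alpha_inv_map_lin]

text \<open>S\<inverse> turns S(a) \<alpha> d v into S\<inverse>(\<alpha> d v) a. So
  \<open>V\<close> joins slots 3 and 4 and \<open>P\<close> joins slots 1 and 2, both from the
  right.\<close>

lemma alpha_inv_map2_flip:
  assumes t: "t \<in> carrier H4" and P: "P \<in> carrier H2" and V: "V \<in> carrier H2"
  shows "flip_S' (gamma_map t \<otimes>\<^bsub>H2\<^esub> V) \<otimes>\<^bsub>H2\<^esub> P = alpha_inv_map2 (t \<otimes>\<^bsub>H4\<^esub> app2 H H H2 V P)"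
  using md_H md_H P
proof (induct P rule: tensor_induct')
  case (tens p q)
  note pq = tens
  show ?case using md_H md_H V
  proof (induct V rule: tensor_induct')
    case (tens u v)
    show ?case
    proof (rule lin_eq4I[where f = "\<lambda>t. flip_S' (gamma_map t \<otimes>\<^bsub>H2\<^esub> tens k H H u v) \<otimes>\<^bsub>H2\<^esub> tens k H H p q"
          and g = "\<lambda>t. alpha_inv_map2 (t \<otimes>\<^bsub>H4\<^esub> app2 H H H2 (tens k H H u v) (tens k H H p q))", OF _ _ _ _ _ _ _ t])
      show "(\<lambda>t. flip_S' (gamma_map t \<otimes>\<^bsub>H2\<^esub> tens k H H u v) \<otimes>\<^bsub>H2\<^esub> tens k H H p q) \<in> lin k H4 H2"
        "(\<lambda>t. alpha_inv_map2 (t \<otimes>\<^bsub>H4\<^esub> app2 H H H2 (tens k H H u v) (tens k H H p q))) \<in> lin k H4 H2"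
        by (intro lin_intros lin_comp[OF gamma_map_lin] lin_comp[OF alpha_inv_map2_lin] lin_comp[OF flip_S'_lin]; use tens pq in simp)+
    qed (use tens pq in \<open>simp_all add: S'_mult alpha_inv_map_tens alg_assoc\<close>)
  qed (use t tens in \<open>simp_all add: additivity\<close>)
qed (use t V in \<open>simp_all add: additivity\<close>)

lemma alpha_inv_map2_contract_middle:
  assumes y: "y \<in> carrier H3" and t: "t \<in> carrier H4"
  shows "alpha_inv_map2 (tmap_r H H2 H3 (dH H) y \<otimes>\<^bsub>H4\<^esub> t) = alpha_inv_map2 (outer_slots (tmap_r H H2 H (counit_l H) y) \<otimes>\<^bsub>H4\<^esub> t)"
proof (rule lin_eq4I[where f = "\<lambda>t. alpha_inv_map2 (tmap_r H H2 H3 (dH H) y \<otimes>\<^bsub>H4\<^esub> t)"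
      and g = "\<lambda>t. alpha_inv_map2 (outer_slots (tmap_r H H2 H (counit_l H) y) \<otimes>\<^bsub>H4\<^esub> t)" and P = H2, OF _ _ _ _ _ _ _ t])
  fix a b c d assume abcd: "a \<in> carrier H" "b \<in> carrier H" "c \<in> carrier H" "d \<in> carrier H"
  have 1: "alpha_inv_map2 (tens k H H3 p (app2 H H H s X \<otimes>\<^bsub>H3\<^esub> tens3 k H H H b c d))
      = tens k H H (alpha_inv_map (tens k H H p (s \<otimes>\<^bsub>H\<^esub> d))) (alpha_inv_map (X \<otimes>\<^bsub>H2\<^esub> tens k H H b c))"
    if "X \<in> carrier H2" "p \<in> carrier H" "s \<in> carrier H" for X p s
    using md_H md_H that(1)
    by (induct X rule: tensor_induct') (use abcd that in \<open>simp_all add: additivity\<close>)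
  show "alpha_inv_map2 (tmap_r H H2 H3 (dH H) y \<otimes>\<^bsub>H4\<^esub> tens4 k H H H H a b c d) =
      alpha_inv_map2 (outer_slots (tmap_r H H2 H (counit_l H) y) \<otimes>\<^bsub>H4\<^esub> tens4 k H H H H a b c d)"
  proof (rule lin_eq3I[where f = "\<lambda>y. alpha_inv_map2 (tmap_r H H2 H3 (dH H) y \<otimes>\<^bsub>H4\<^esub> tens4 k H H H H a b c d)"
        and g = "\<lambda>y. alpha_inv_map2 (outer_slots (tmap_r H H2 H (counit_l H) y) \<otimes>\<^bsub>H4\<^esub> tens4 k H H H H a b c d)", OF _ _ _ _ _ _ y])
    show "(\<lambda>y. alpha_inv_map2 (tmap_r H H2 H3 (dH H) y \<otimes>\<^bsub>H4\<^esub> tens4 k H H H H a b c d)) \<in> lin k H3 H2"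
      "(\<lambda>y. alpha_inv_map2 (outer_slots (tmap_r H H2 H (counit_l H) y) \<otimes>\<^bsub>H4\<^esub> tens4 k H H H H a b c d)) \<in> lin k H3 H2"
      by (intro lin_intros lin_comp[OF alpha_inv_map2_lin] lin_comp[OF hom_lin[OF outer_slots_hom]]; use abcd in simp)+
  qed (use abcd in \<open>simp_all add: 1 alpha_inv_map_contract tens_smult mult_smult
          lin_smult[OF alpha_inv_map2_lin] lin_smult[OF hom_lin[OF outer_slots_hom]]\<close>)
qed (use y in \<open>simp_all add: lin_comp[OF alpha_inv_map2_lin] mult_lin_right\<close>)

text \<open>When nothing but \<open>Z\<close> is left in the last slot, the nested contraction
  factors into one of the outer pair and one of slots 2 and 3. These become the two occurrences of q
  in \<open>twist_q_rho\<close>.\<close>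

lemma alpha_inv_map2_factor:
  assumes Z: "Z \<in> carrier H2" and R: "R \<in> carrier H3" and V: "V \<in> carrier H2"
  shows "alpha_inv_map2 (outer_slots Z \<otimes>\<^bsub>H4\<^esub> (app3 H H H H \<one>\<^bsub>H\<^esub> R \<otimes>\<^bsub>H4\<^esub> app3 H H H H \<one>\<^bsub>H\<^esub> (app2 H H H \<one>\<^bsub>H\<^esub> V)))
    = tens k H H (alpha_inv_map Z) \<one>\<^bsub>H\<^esub> \<otimes>\<^bsub>H2\<^esub> (tmap_r H H2 H alpha_inv_map R \<otimes>\<^bsub>H2\<^esub> V)"
  using md_H md_H Z
proof (induct Z rule: tensor_induct')
  case (tens p s)
  note ps = tens
  show ?case using md_H md_H V
  proof (induct V rule: tensor_induct')
    case (tens u v)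
    show ?case
    proof (rule lin_eq3I[where f = "\<lambda>R. alpha_inv_map2 (outer_slots (tens k H H p s) \<otimes>\<^bsub>H4\<^esub> (app3 H H H H \<one>\<^bsub>H\<^esub> R \<otimes>\<^bsub>H4\<^esub>
              app3 H H H H \<one>\<^bsub>H\<^esub> (app2 H H H \<one>\<^bsub>H\<^esub> (tens k H H u v))))"
          and g = "\<lambda>R. tens k H H (alpha_inv_map (tens k H H p s)) \<one>\<^bsub>H\<^esub> \<otimes>\<^bsub>H2\<^esub> (tmap_r H H2 H alpha_inv_map R \<otimes>\<^bsub>H2\<^esub> tens k H H u v)",
          OF _ _ _ _ _ _ R])
      show "(\<lambda>R. alpha_inv_map2 (outer_slots (tens k H H p s) \<otimes>\<^bsub>H4\<^esub> (app3 H H H H \<one>\<^bsub>H\<^esub> R \<otimes>\<^bsub>H4\<^esub>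
              app3 H H H H \<one>\<^bsub>H\<^esub> (app2 H H H \<one>\<^bsub>H\<^esub> (tens k H H u v))))) \<in> lin k H3 H2"
        "(\<lambda>R. tens k H H (alpha_inv_map (tens k H H p s)) \<one>\<^bsub>H\<^esub> \<otimes>\<^bsub>H2\<^esub> (tmap_r H H2 H alpha_inv_map R \<otimes>\<^bsub>H2\<^esub> tens k H H u v))
          \<in> lin k H3 H2"
        by (intro lin_intros lin_comp[OF alpha_inv_map2_lin]; use tens ps in simp)+
    qed (use tens ps in \<open>simp_all add: alpha_inv_map_tens alg_assoc\<close>)
  qed (use R tens in \<open>simp_all add: additivity\<close>)
qed (use R V in \<open>simp_all add: additivity lin_add[OF hom_lin[OF outer_slots_hom]]\<close>)

end

section \<open>The element q and its relation to the Drinfeld twist\<close>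

context crossed_base
begin

text \<open>\<open>q_rho\<close> and, further below, \<open>p_rho\<close> are the elements
  \<open>X\<^sup>1 \<otimes> S\<inverse>(\<alpha> X\<^sup>3) X\<^sup>2\<close> and \<open>x\<^sup>1 \<otimes> x\<^sup>2 \<beta> S(x\<^sup>3)\<close> of Hausser and Nill, for \<open>X = \<Phi>\<^sub>\<rho>\<close>
  and \<open>x = \<Phi>\<^sub>\<rho>\<inverse>\<close>.\<close>

definition q_rho where "q_rho = tmap_r U H2 H alpha_inv_map Pr"
definition iso_coeff0 where "iso_coeff0 = dl H q_rho \<otimes>\<^bsub>HUH\<^esub> Th'"

lemma q_rho_closed [simp]: "q_rho \<in> carrier UH" by (simp add: q_rho_def)
lemma iso_coeff0_closed [simp]: "iso_coeff0 \<in> carrier HUH" by (simp add: iso_coeff0_def)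

text \<open>A right factor h of the last slot ends up in S\<inverse>(\<alpha> z h) = S\<inverse>(h)
  S\<inverse>(\<alpha> z) and therefore comes out on the far left.\<close>

lemma alpha_inv_map_mult_app2:
  assumes X: "X \<in> carrier UHH" and W: "W \<in> carrier UH" and h: "h \<in> carrier H"
  shows "tmap_r U H2 H alpha_inv_map (X \<otimes>\<^bsub>UHH\<^esub> app2 U H H h W)
    = tens k U H \<one>\<^bsub>U\<^esub> (S' h) \<otimes>\<^bsub>UH\<^esub> tmap_r U H2 H alpha_inv_map X \<otimes>\<^bsub>UH\<^esub> W"
  using md_U md_H W
proof (induct W rule: tensor_induct')
  case (tens u v)
  note uv = tens
  have 1: "alpha_inv_map (Z \<otimes>\<^bsub>H2\<^esub> tens k H H v h) = S' h \<otimes>\<^bsub>H\<^esub> alpha_inv_map Z \<otimes>\<^bsub>H\<^esub> v" if "Z \<in> carrier H2" for Z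
    using md_H md_H that
    by (induct Z rule: tensor_induct') (use uv h in \<open>simp_all add: additivity alpha_inv_map_tens S'_mult alg_assoc\<close>)
  show ?case using md_U _ X
    by (induct X rule: tensor_induct') (use tens h in \<open>simp_all add: additivity 1 alg_assoc\<close>)
qed (use X h in \<open>simp_all add: additivity\<close>)

lemma alpha_inv_map_contract_U:
  assumes Y: "Y \<in> carrier UH" and X: "X \<in> carrier UHH"
  shows "tmap_r U H2 H alpha_inv_map (tmap_r U H H2 Dl Y \<otimes>\<^bsub>UHH\<^esub> X) = tens k U H (counit_r U Y) \<one>\<^bsub>H\<^esub> \<otimes>\<^bsub>UH\<^esub> tmap_r U H2 H alpha_inv_map X"
  using md_U md_H Y
proof (induct Y rule: tensor_induct')
  case (tens u h)
  show ?case using md_U _ X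
    by (induct X rule: tensor_induct') (use tens in \<open>simp_all add: additivity alpha_inv_map_contract tens_smult mult_smult md_smult\<close>)
qed (use X in \<open>simp_all add: additivity\<close>)

text \<open>The contraction of \<open>rho_quasi_coassoc\<close>: on one side
  \<rho>(\<open>u0\<close>) and S\<inverse>(\<open>u1\<close>) come out to the right and to the left
  of q, on the other the comultiplication is absorbed and leaves u.\<close>

lemma q_rho_rho:
  assumes u: "u \<in> carrier U"
  shows "tsum UH (rho u) (\<lambda>u0 u1. tens k U H \<one>\<^bsub>U\<^esub> (S' u1) \<otimes>\<^bsub>UH\<^esub> q_rho \<otimes>\<^bsub>UH\<^esub> rho u0) = tens k U H u \<one>\<^bsub>H\<^esub> \<otimes>\<^bsub>UH\<^esub> q_rho"
proof -
  have "tsum UH (rho u) (\<lambda>u0 u1. tens k U H \<one>\<^bsub>U\<^esub> (S' u1) \<otimes>\<^bsub>UH\<^esub> q_rho \<otimes>\<^bsub>UH\<^esub> rho u0)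
      = tmap_r U H2 H alpha_inv_map (Pr \<otimes>\<^bsub>UHH\<^esub> dr H (rho u))"
  proof (rule tsum_eq_lin[where h = "\<lambda>Y. tmap_r U H2 H alpha_inv_map (Pr \<otimes>\<^bsub>UHH\<^esub> dr H Y)"])
    show "(\<lambda>Y. tmap_r U H2 H alpha_inv_map (Pr \<otimes>\<^bsub>UHH\<^esub> dr H Y)) \<in> lin k (U \<boxtimes> H) UH"
      by (intro lin_intros'; simp)
  qed (use u in \<open>simp_all add: alpha_inv_map_mult_app2 q_rho_def\<close>)
  also have "\<dots> = tens k U H u \<one>\<^bsub>H\<^esub> \<otimes>\<^bsub>UH\<^esub> q_rho"
    using u by (simp add: rho_quasi_coassoc alpha_inv_map_contract_U q_rho_def)
  finally show ?thesis .
qed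

lemma counit_r_one_Th': "tmap_r H UH UH (\<lambda>Y. tens k U H (counit_r U Y) \<one>\<^bsub>H\<^esub>) Th' = \<one>\<^bsub>HUH\<^esub>"
proof -
  have "tmap_r H UH UH (\<lambda>Y. tens k U H (counit_r U Y) \<one>\<^bsub>H\<^esub>) Th' = app2 H U H \<one>\<^bsub>H\<^esub> (tmap_r H UH U (counit_r U) Th')"
    unfolding app2_def by (subst tmap_r_comp) (simp_all add: tens_lin_left)
  then show ?thesis by simp
qed

text \<open>On h \<otimes> w \<otimes> m this is (1 \<otimes> 1 \<otimes> S\<inverse>(m)) g(1) (h
  \<otimes> \<rho>(w)), see \<open>iso_coeff0_move_tens\<close>. The outer slots multiply from
  opposite sides, so it is not multiplication by an element; written as the contraction of a genuine
  product in \<open>HUHH\<close> it becomes accessible to the mixed pentagon.\<close>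

definition iso_coeff0_move where
  "iso_coeff0_move X = tmap_r H UHH UH (tmap_r U H2 H alpha_inv_map)
    (dl H2 Pr \<otimes>\<^bsub>HUHH\<^esub> app3 H U H H \<one>\<^bsub>H\<^esub> Th' \<otimes>\<^bsub>HUHH\<^esub> tmap_r H UH UHH (dr H) X)"

lemma iso_coeff0_move_lin [simp]: "iso_coeff0_move \<in> lin k HUH HUH"
proof -
  have "(\<lambda>X. iso_coeff0_move X) \<in> lin k HUH HUH"
    unfolding iso_coeff0_move_def by (intro lin_intros'; simp)
  then show ?thesis by simp
qed

lemma iso_coeff0_move_tens:
  assumes "h \<in> carrier H" "w \<in> carrier U" "m \<in> carrier H"
  shows "iso_coeff0_move (tens3 k H U H h w m)
    = tens3 k H U H \<one>\<^bsub>H\<^esub> \<one>\<^bsub>U\<^esub> (S' m) \<otimes>\<^bsub>HUH\<^esub> iso_coeff0 \<otimes>\<^bsub>HUH\<^esub> tens k H UH h (rho w)"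
proof -
  let ?T = "tmap_r H UHH UH (tmap_r U H2 H alpha_inv_map)"
  have 1: "?T (X \<otimes>\<^bsub>HUHH\<^esub> tens k H UHH t (app2 U H H h W))
      = tens3 k H U H \<one>\<^bsub>H\<^esub> \<one>\<^bsub>U\<^esub> (S' h) \<otimes>\<^bsub>HUH\<^esub> ?T X \<otimes>\<^bsub>HUH\<^esub> tens k H UH t W"
    if "X \<in> carrier HUHH" "t \<in> carrier H" "W \<in> carrier UH" "h \<in> carrier H" for X t h W
    using md_H _ that(1)
    by (induct X rule: tensor_induct') (use that in \<open>simp_all add: additivity alpha_inv_map_mult_app2 alg_assoc\<close>)
  have 2: "?T (X \<otimes>\<^bsub>HUHH\<^esub> app3 H U H H \<one>\<^bsub>H\<^esub> Y) = ?T X \<otimes>\<^bsub>HUH\<^esub> Y"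
    if "X \<in> carrier HUHH" "Y \<in> carrier HUH" for X Y
    using md_H _ that(2)
    by (induct Y rule: tensor_induct') (use that in \<open>simp_all add: additivity 1\<close>)
  have 3: "?T (dl H2 Pr) = dl H q_rho"
    using tsplit_tmap_r[of U H2 H U H lam alpha_inv_map Pr] by (simp add: q_rho_def)
  have 4: "?T (dl H2 Pr \<otimes>\<^bsub>HUHH\<^esub> app3 H U H H \<one>\<^bsub>H\<^esub> Th') = iso_coeff0"
    by (simp add: 2 3 iso_coeff0_def)
  show ?thesis using assms by (simp add: iso_coeff0_move_def 1 4)
qed

text \<open>\<open>right_mixed_pentagon''\<close> moves \<theta> to the far left with its last slot
  comultiplied. The contraction absorbs this comultiplication, and the remaining counit of \<theta>
  is 1.\<close>

lemma iso_coeff0_move_Th':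
  assumes Y: "Y \<in> carrier UH"
  shows "iso_coeff0_move (Th' \<otimes>\<^bsub>HUH\<^esub> tens k H UH \<one>\<^bsub>H\<^esub> Y) = tens k H UH \<one>\<^bsub>H\<^esub> (tmap_r U H2 H alpha_inv_map (Pr \<otimes>\<^bsub>UHH\<^esub> dr H Y))"
proof -
  let ?Q = "tmap_r U H2 H alpha_inv_map" and ?D = "tmap_r H UH UHH (tmap_r U H H2 Dl)"
  let ?T = "tmap_r H UHH UH ?Q"
  have "iso_coeff0_move (Th' \<otimes>\<^bsub>HUH\<^esub> tens k H UH \<one>\<^bsub>H\<^esub> Y)
    = ?T (dl H2 Pr \<otimes>\<^bsub>HUHH\<^esub> app3 H U H H \<one>\<^bsub>H\<^esub> Th' \<otimes>\<^bsub>HUHH\<^esub> tmap_r H UH UHH (dr H) Th' \<otimes>\<^bsub>HUHH\<^esub> tens k H UHH \<one>\<^bsub>H\<^esub> (dr H Y))"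
    using Y by (simp add: iso_coeff0_move_def tmap_r_mult alg_assoc)
  also have "\<dots> = ?T (?D Th' \<otimes>\<^bsub>HUHH\<^esub> tens k H UHH \<one>\<^bsub>H\<^esub> (Pr \<otimes>\<^bsub>UHH\<^esub> dr H Y))"
    using Y by (simp add: right_mixed_pentagon'' alg_assoc)
  also have "\<dots> = tmap_r H UH UH (\<lambda>Y. tens k U H (counit_r U Y) \<one>\<^bsub>H\<^esub>) Th' \<otimes>\<^bsub>HUH\<^esub> ?T (tens k H UHH \<one>\<^bsub>H\<^esub> (Pr \<otimes>\<^bsub>UHH\<^esub> dr H Y))"
    by (rule tmap_r_semilin) (use Y in \<open>simp_all add: alpha_inv_map_contract_U lin_comp_tens_left\<close>)
  also have "tmap_r H UH UH (\<lambda>Y. tens k U H (counit_r U Y) \<one>\<^bsub>H\<^esub>) Th' = \<one>\<^bsub>HUH\<^esub>"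
    by (rule counit_r_one_Th')
  finally show ?thesis using Y by simp
qed

text \<open>Evaluates the operator \<open>iso_coeff0_move\<close> at \<theta> itself. This is how
  the \<theta> contained in \<Omega> finally disappears, in
  \<open>theta_sum_constant\<close>.\<close>

lemma iso_coeff0_rho_theta:
  "tsum3 HUH Th' (\<lambda>t1 t2 t3. tens3 k H U H \<one>\<^bsub>H\<^esub> \<one>\<^bsub>U\<^esub> (S' t3) \<otimes>\<^bsub>HUH\<^esub> iso_coeff0 \<otimes>\<^bsub>HUH\<^esub> tens k H UH t1 (rho t2))
    = tens k H UH \<one>\<^bsub>H\<^esub> q_rho"
proof -
  have "tsum3 HUH Th' (\<lambda>t1 t2 t3. tens3 k H U H \<one>\<^bsub>H\<^esub> \<one>\<^bsub>U\<^esub> (S' t3) \<otimes>\<^bsub>HUH\<^esub> iso_coeff0 \<otimes>\<^bsub>HUH\<^esub> tens k H UH t1 (rho t2)) = iso_coeff0_move Th'"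
    by (rule tsum3_eq_lin[of H U H]) (simp_all add: iso_coeff0_move_tens)
  then show ?thesis using iso_coeff0_move_Th'[of "\<one>\<^bsub>UH\<^esub>"] by (simp add: q_rho_def)
qed

lemma md_H2: "md H2" and md_H3: "md H3" by simp_all

text \<open>\<open>flip_twist\<close> trades the flipped f together with
  \<Delta>(S\<inverse>(\<alpha> s)) for a flipped \<gamma> \<Delta>(s); after that every factor is a
  right factor of \<open>twA\<close> under \<open>alpha_inv_map2\<close>.\<close>

lemma alpha_inv_map2_twist:
  assumes X: "X \<in> carrier H2" and Y: "Y \<in> carrier H2" and m: "m \<in> carrier H"
  shows "flip_S' (twF \<otimes>\<^bsub>H2\<^esub> Y) \<otimes>\<^bsub>H2\<^esub> Dl (alpha_inv_map X) \<otimes>\<^bsub>H2\<^esub> Dl m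
    = alpha_inv_map2 (twA \<otimes>\<^bsub>H4\<^esub> dH H2 (tmap_r H H H2 Dl X) \<otimes>\<^bsub>H4\<^esub> app2 H H H2 Y (Dl m))"
  using md_H md_H X
proof (induct X rule: tensor_induct')
  case (tens p s)
  have "flip_S' (twF \<otimes>\<^bsub>H2\<^esub> Y) \<otimes>\<^bsub>H2\<^esub> Dl (alpha_inv_map (tens k H H p s)) \<otimes>\<^bsub>H2\<^esub> Dl m
    = flip_S' Y \<otimes>\<^bsub>H2\<^esub> (flip_S' twF \<otimes>\<^bsub>H2\<^esub> Dl (S' (al \<otimes>\<^bsub>H\<^esub> s))) \<otimes>\<^bsub>H2\<^esub> (Dl p \<otimes>\<^bsub>H2\<^esub> Dl m)"
    using tens Y m by (simp add: alpha_inv_map_tens flip_S'_mult Dl_mult alg_assoc)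
  also have "\<dots> = flip_S' (gamma_map twA \<otimes>\<^bsub>H2\<^esub> (Dl s \<otimes>\<^bsub>H2\<^esub> Y)) \<otimes>\<^bsub>H2\<^esub> (Dl p \<otimes>\<^bsub>H2\<^esub> Dl m)"
    using tens Y m by (simp add: flip_twist flip_S'_mult twG_eq alg_assoc)
  also have "\<dots> = alpha_inv_map2 (twA \<otimes>\<^bsub>H4\<^esub> dH H2 (tmap_r H H H2 Dl (tens k H H p s)) \<otimes>\<^bsub>H4\<^esub> app2 H H H2 Y (Dl m))"
    using tens Y m by (simp add: alpha_inv_map2_flip app2_mult alg_assoc)
  finally show ?case .
qed (use Y m in \<open>simp_all add: additivity\<close>)

abbreviation "UH4 \<equiv> U \<boxtimes> H4"
abbreviation "alpha_inv_map2_U \<equiv> tmap_r U H4 H2 alpha_inv_map2"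

lemma alpha_inv_map2_U_twist:
  assumes Z: "Z \<in> carrier UHH" and W: "W \<in> carrier UH" and Y: "Y \<in> carrier H2"
  shows "tens k U H2 \<one>\<^bsub>U\<^esub> (flip_S' (twF \<otimes>\<^bsub>H2\<^esub> Y)) \<otimes>\<^bsub>UHH\<^esub> tmap_r U H H2 Dl (tmap_r U H2 H alpha_inv_map Z)
      \<otimes>\<^bsub>UHH\<^esub> tmap_r U H H2 Dl W
    = alpha_inv_map2_U (tens k U H4 \<one>\<^bsub>U\<^esub> twA \<otimes>\<^bsub>UH4\<^esub> tmap_r U H3 H4 (dH H2) (tmap_r U H2 H3 (tmap_r H H H2 Dl) Z)
      \<otimes>\<^bsub>UH4\<^esub> tmap_r U H3 H4 (dH H2) (app2 U H H2 Y W))"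
  using md_U md_H W
proof (induct W rule: tensor_induct')
  case (tens v m)
  show ?case using md_U _ Z
    by (induct Z rule: tensor_induct') (use tens Y in \<open>simp_all add: additivity alpha_inv_map2_twist\<close>)
qed (use Z Y in \<open>simp_all add: additivity\<close>)

lemma alpha_inv_map2_U_contract:
  assumes y: "y \<in> carrier UH3" and t: "t \<in> carrier UH4"
  shows "alpha_inv_map2_U (tmap_r U H3 H4 (tmap_r H H2 H3 (dH H)) y \<otimes>\<^bsub>UH4\<^esub> t)
    = alpha_inv_map2_U (tmap_r U H2 H4 outer_slots (tmap_r U H3 H2 (tmap_r H H2 H (counit_l H)) y) \<otimes>\<^bsub>UH4\<^esub> t)"
  using md_U md_H3 y
proof (induct y rule: tensor_induct')
  case (tens v m)
  show ?case using md_U _ t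
    by (induct t rule: tensor_induct') (use tens in \<open>simp_all add: additivity alpha_inv_map2_contract_middle\<close>)
qed (use t in \<open>simp_all add: additivity\<close>)

lemma alpha_inv_map2_U_factor:
  assumes X: "X \<in> carrier UHH" and Y: "Y \<in> carrier UH3" and V: "V \<in> carrier UHH"
  shows "alpha_inv_map2_U (tmap_r U H2 H4 outer_slots X \<otimes>\<^bsub>UH4\<^esub> (tmap_r U H3 H4 (app3 H H H H \<one>\<^bsub>H\<^esub>) Y
      \<otimes>\<^bsub>UH4\<^esub> tmap_r U H3 H4 (app3 H H H H \<one>\<^bsub>H\<^esub>) (app3 U H H H \<one>\<^bsub>H\<^esub> V)))
    = tmap_r U H2 H2 (\<lambda>Z. tens k H H (alpha_inv_map Z) \<one>\<^bsub>H\<^esub>) X \<otimes>\<^bsub>UHH\<^esub> (tmap_r U H3 H2 (tmap_r H H2 H alpha_inv_map) Y \<otimes>\<^bsub>UHH\<^esub> V)"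
  using md_U md_H2 X
proof (induct X rule: tensor_induct')
  case (tens x Z)
  note xZ = tens
  show ?case using md_U md_H3 Y
  proof (induct Y rule: tensor_induct')
    case (tens y R)
    show ?case using md_U _ V
      by (induct V rule: tensor_induct')
        (use xZ tens in \<open>simp_all add: additivity alpha_inv_map2_factor lin_comp_tens_left alg_assoc\<close>)
  qed (use V tens in \<open>simp_all add: additivity lin_comp_tens_left\<close>)
qed (use V Y in \<open>simp_all add: additivity lin_comp_tens_left\<close>)

text \<open>The left side is a single contraction of a product in \<open>UH4\<close>. The pentagon
  for \<rho> is used twice: first to rewrite the two copies of \<open>\<Phi>\<^sub>\<rho>\<close>
  that come from q and from the sum, then to pull the remaining \<Phi> through. What lands in the
  middle slots is absorbed, and the outer and the inner pair of slots each contribute one q.\<close>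

lemma twist_q_rho:
  "tsum UHH Pr (\<lambda>X1 Y. tens k U H2 \<one>\<^bsub>U\<^esub> (flip_S' (twF \<otimes>\<^bsub>H2\<^esub> Y)) \<otimes>\<^bsub>UHH\<^esub> tmap_r U H H2 Dl q_rho
      \<otimes>\<^bsub>UHH\<^esub> tmap_r U H H2 Dl (rho X1))
    = app2 U H H \<one>\<^bsub>H\<^esub> q_rho \<otimes>\<^bsub>UHH\<^esub> dr H q_rho \<otimes>\<^bsub>UHH\<^esub> Pr'"
proof -
  let ?D2 = "tmap_r U H3 H4 (dH H2)" and ?E3 = "tmap_r U H2 H3 (tmap_r H H H2 Dl)"
    and ?E2 = "tmap_r U H2 H3 (dH H)" and ?M = "tmap_r U H3 H4 (app3 H H H H \<one>\<^bsub>H\<^esub>)"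
    and ?N = "tmap_r U H3 H4 (tmap_r H H2 H3 (dH H))"
    and ?P = "app3 H H H H \<one>\<^bsub>H\<^esub> Ph" and ?A = "app3 U H H H \<one>\<^bsub>H\<^esub> Pr" and ?A' = "app3 U H H H \<one>\<^bsub>H\<^esub> Pr'"
    and ?o = "\<lambda>x. tens k U H3 \<one>\<^bsub>U\<^esub> x" and ?o4 = "\<lambda>x. tens k U H4 \<one>\<^bsub>U\<^esub> x"
  have 1: "tsum UHH Pr (\<lambda>X1 Y. tens k U H2 \<one>\<^bsub>U\<^esub> (flip_S' (twF \<otimes>\<^bsub>H2\<^esub> Y)) \<otimes>\<^bsub>UHH\<^esub> tmap_r U H H2 Dl q_rho
      \<otimes>\<^bsub>UHH\<^esub> tmap_r U H H2 Dl (rho X1)) = alpha_inv_map2_U (?o4 twA \<otimes>\<^bsub>UH4\<^esub> ?D2 (?E3 Pr) \<otimes>\<^bsub>UH4\<^esub> ?D2 (dr H2 Pr))"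
  proof (rule tsum_eq_lin[where h = "\<lambda>Y. alpha_inv_map2_U (?o4 twA \<otimes>\<^bsub>UH4\<^esub> ?D2 (?E3 Pr) \<otimes>\<^bsub>UH4\<^esub> ?D2 (dr H2 Y))"])
    show "(\<lambda>Y. alpha_inv_map2_U (?o4 twA \<otimes>\<^bsub>UH4\<^esub> ?D2 (?E3 Pr) \<otimes>\<^bsub>UH4\<^esub> ?D2 (dr H2 Y))) \<in> lin k UHH UHH"
      by (intro lin_intros'; simp)
  qed (simp_all add: q_rho_def alpha_inv_map2_U_twist)
  have A: "?A \<otimes>\<^bsub>UH3\<^esub> ?A' = \<one>\<^bsub>UH3\<^esub>" by (simp add: app3_mult)
  have pent: "?E3 Pr \<otimes>\<^bsub>UH3\<^esub> dr H2 Pr = ?o Ph \<otimes>\<^bsub>UH3\<^esub> (?E2 Pr \<otimes>\<^bsub>UH3\<^esub> ?A)"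
    using rho_pentagon by (simp add: alg_assoc)
  have pent': "?o Ph \<otimes>\<^bsub>UH3\<^esub> ?E2 Pr = ?E3 Pr \<otimes>\<^bsub>UH3\<^esub> (dr H2 Pr \<otimes>\<^bsub>UH3\<^esub> ?A')"
  proof -
    have "?E3 Pr \<otimes>\<^bsub>UH3\<^esub> (dr H2 Pr \<otimes>\<^bsub>UH3\<^esub> ?A') = ?E3 Pr \<otimes>\<^bsub>UH3\<^esub> dr H2 Pr \<otimes>\<^bsub>UH3\<^esub> ?A'"
      by (simp add: alg_assoc)
    also have "\<dots> = ?o Ph \<otimes>\<^bsub>UH3\<^esub> (?E2 Pr \<otimes>\<^bsub>UH3\<^esub> (?A \<otimes>\<^bsub>UH3\<^esub> ?A'))"
      unfolding pent by (simp add: alg_assoc)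
    finally show ?thesis by (simp add: A)
  qed
  \<comment> \<open>\<open>twA\<close> contains \<Phi>\<inverse> with its first slot comultiplied,
    which cancels against the \<Phi> produced by the pentagon.\<close>
  have o4: "?o4 twA \<otimes>\<^bsub>UH4\<^esub> ?D2 (?o Ph) = ?o4 ?P"
    by (simp add: twA_eq alg_assoc flip: tsplit_mult)
  have D2A: "?D2 ?A = ?M (?E2 Pr)"
  proof -
    have "?D2 ?A = tmap_r U H2 H4 (\<lambda>x. app3 H H H H \<one>\<^bsub>H\<^esub> (dH H x)) Pr"
      unfolding app3_def[of U] by (rule tmap_r_comp_eq) (simp_all add: tsplit_app2)
    also have "\<dots> = ?M (?E2 Pr)" by (rule tmap_r_comp[symmetric]) simp_all
    finally show ?thesis .
  qed
  have NA: "?M (?E3 Pr) = ?N ?A"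
  proof -
    have "?N ?A = tmap_r U H2 H4 (\<lambda>x. app3 H H H H \<one>\<^bsub>H\<^esub> (tmap_r H H H2 Dl x)) Pr"
      unfolding app3_def[of U] by (rule tmap_r_comp_eq) (simp_all add: tmap_r_tsplit_app2)
    also have "\<dots> = ?M (?E3 Pr)" by (rule tmap_r_comp[symmetric]) simp_all
    finally show ?thesis by simp
  qed
  \<comment> \<open>Here a comultiplication of the first \<open>H\<close>-slot becomes one in the
    middle pair of \<open>H4\<close>, where it can be absorbed.\<close>
  have PN: "?o4 ?P \<otimes>\<^bsub>UH4\<^esub> ?D2 (?E2 Pr) = ?N (?E2 Pr) \<otimes>\<^bsub>UH4\<^esub> ?o4 ?P"
  proof -
    have "?o4 ?P \<otimes>\<^bsub>UH4\<^esub> tmap_r U H2 H4 (\<lambda>x. dH H2 (dH H x)) Pr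
      = tmap_r U H2 H4 (\<lambda>x. tmap_r H H2 H3 (dH H) (dH H x)) Pr \<otimes>\<^bsub>UH4\<^esub> ?o4 ?P"
      by (rule tmap_r_intertwine) (simp_all add: Ph_intertwine tsplit_lin_comp tmap_r_lin_comp)
    then show ?thesis by (simp add: tmap_r_comp)
  qed
  \<comment> \<open>The second use of the pentagon, padded with a unit in the last slot.\<close>
  have M: "?o4 ?P \<otimes>\<^bsub>UH4\<^esub> ?M (?E2 Pr) = ?M (?E3 Pr) \<otimes>\<^bsub>UH4\<^esub> (?M (dr H2 Pr) \<otimes>\<^bsub>UH4\<^esub> ?M ?A')"
  proof -
    have "?o4 ?P \<otimes>\<^bsub>UH4\<^esub> ?M (?E2 Pr) = ?M (?o Ph \<otimes>\<^bsub>UH3\<^esub> ?E2 Pr)"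
      by (simp add: tmap_r_mult)
    then show ?thesis by (simp add: pent' tmap_r_mult)
  qed
  have "?o4 twA \<otimes>\<^bsub>UH4\<^esub> ?D2 (?E3 Pr) \<otimes>\<^bsub>UH4\<^esub> ?D2 (dr H2 Pr) = ?o4 twA \<otimes>\<^bsub>UH4\<^esub> ?D2 (?E3 Pr \<otimes>\<^bsub>UH3\<^esub> dr H2 Pr)"
    by (simp add: tmap_r_mult alg_assoc)
  also have "\<dots> = ?o4 twA \<otimes>\<^bsub>UH4\<^esub> ?D2 (?o Ph) \<otimes>\<^bsub>UH4\<^esub> (?D2 (?E2 Pr) \<otimes>\<^bsub>UH4\<^esub> ?D2 ?A)"
    unfolding pent by (simp add: tmap_r_mult alg_assoc del: tmap_r_tens)
  also have "\<dots> = ?o4 ?P \<otimes>\<^bsub>UH4\<^esub> ?D2 (?E2 Pr) \<otimes>\<^bsub>UH4\<^esub> ?M (?E2 Pr)"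
    unfolding o4 D2A by (simp add: alg_assoc)
  also have "\<dots> = ?N (?E2 Pr) \<otimes>\<^bsub>UH4\<^esub> (?o4 ?P \<otimes>\<^bsub>UH4\<^esub> ?M (?E2 Pr))"
    unfolding PN by (simp add: alg_assoc)
  also have "\<dots> = ?N (?E2 Pr \<otimes>\<^bsub>UH3\<^esub> ?A) \<otimes>\<^bsub>UH4\<^esub> (?M (dr H2 Pr) \<otimes>\<^bsub>UH4\<^esub> ?M ?A')"
    unfolding M NA by (simp add: tmap_r_mult alg_assoc)
  finally have 2: "?o4 twA \<otimes>\<^bsub>UH4\<^esub> ?D2 (?E3 Pr) \<otimes>\<^bsub>UH4\<^esub> ?D2 (dr H2 Pr)
    = ?N (?E2 Pr \<otimes>\<^bsub>UH3\<^esub> ?A) \<otimes>\<^bsub>UH4\<^esub> (?M (dr H2 Pr) \<otimes>\<^bsub>UH4\<^esub> ?M ?A')" .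
  \<comment> \<open>\<open>?c\<close> is the counit that remains after the middle pair has been
    absorbed. It reduces the absorbed product to \<open>\<Phi>\<^sub>\<rho>\<close>, whose
    contraction is q.\<close>
  let ?c = "tmap_r U H3 H2 (tmap_r H H2 H (counit_l H))"
  have c1: "?c (?E2 Pr) = Pr"
    by (rule tmap_r_comp_id) simp_all
  have c2: "?c ?A = \<one>\<^bsub>UHH\<^esub>"
  proof -
    have "?c ?A = tmap_r U H2 H2 (\<lambda>X. tens k H H (counit_r H X) \<one>\<^bsub>H\<^esub>) Pr"
      unfolding app3_def by (rule tmap_r_comp_eq) (simp_all add: tmap_r_counit_l_app2)
    also have "\<dots> = app2 U H H \<one>\<^bsub>H\<^esub> (tmap_r U H2 H (counit_r H) Pr)"
      unfolding app2_def by (subst tmap_r_comp) (simp_all add: tens_lin_left)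
    finally show ?thesis by simp
  qed
  have c: "?c (?E2 Pr \<otimes>\<^bsub>UH3\<^esub> ?A) = Pr"
    by (subst tmap_r_mult) (simp_all add: c1 c2)
  have q: "tmap_r U H2 H2 (\<lambda>Z. tens k H H (alpha_inv_map Z) \<one>\<^bsub>H\<^esub>) Pr = app2 U H H \<one>\<^bsub>H\<^esub> q_rho"
    unfolding app2_def q_rho_def by (subst tmap_r_comp) (simp_all add: tens_lin_left)
  have r: "tmap_r U H3 H2 (tmap_r H H2 H alpha_inv_map) (dr H2 Pr) = dr H q_rho"
    using tsplit_tmap_r[of U H2 U H H rho alpha_inv_map Pr] by (simp add: q_rho_def)
  show ?thesis
    unfolding 1 2 by (subst alpha_inv_map2_U_contract) (simp_all add: c alpha_inv_map2_U_factor q r alg_assoc)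
qed

end

context field_base
begin

lemma app2_one_right [simp]:
  assumes "nalg B" "nalg C" "md D" "y \<in> carrier D"
  shows "app2 B C D y \<one>\<^bsub>B \<boxtimes> C\<^esub> = tens k B (C \<boxtimes> D) \<one>\<^bsub>B\<^esub> (tens k C D \<one>\<^bsub>C\<^esub> y)"
  using app2_tens[of B C D "\<one>\<^bsub>B\<^esub>" "\<one>\<^bsub>C\<^esub>" y] assms by simp

lemma app3_one_right [simp]:
  assumes "nalg A" "nalg B" "nalg C" "md D" "y \<in> carrier D"
  shows "app3 A B C D y \<one>\<^bsub>A \<boxtimes> (B \<boxtimes> C)\<^esub> = tens4 k A B C D \<one>\<^bsub>A\<^esub> \<one>\<^bsub>B\<^esub> \<one>\<^bsub>C\<^esub> y"
  using app3_tens[of A B C D "\<one>\<^bsub>A\<^esub>" "\<one>\<^bsub>B \<boxtimes> C\<^esub>" y] assms by simp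

lemma last_slot_commute:
  assumes "alg A" "alg B" "alg C" "alg D" "y \<in> carrier D" "X \<in> carrier (A \<boxtimes> (B \<boxtimes> C))"
  shows "tens4 k A B C D \<one>\<^bsub>A\<^esub> \<one>\<^bsub>B\<^esub> \<one>\<^bsub>C\<^esub> y \<otimes>\<^bsub>A \<boxtimes> (B \<boxtimes> (C \<boxtimes> D))\<^esub> app3 A B C D \<one>\<^bsub>D\<^esub> X
    = app3 A B C D \<one>\<^bsub>D\<^esub> X \<otimes>\<^bsub>A \<boxtimes> (B \<boxtimes> (C \<boxtimes> D))\<^esub> tens4 k A B C D \<one>\<^bsub>A\<^esub> \<one>\<^bsub>B\<^esub> \<one>\<^bsub>C\<^esub> y"
  using assms by (simp add: app3_mult flip: app3_one_right)

end

context crossed_base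
begin

text \<open>\<open>pad4\<close> and \<open>pad5\<close> fill the last slots of \<open>H \<otimes> U \<otimes> H \<otimes> H\<close> and
  \<open>H \<otimes> H \<otimes> U \<otimes> H \<otimes> H\<close> with units, \<open>in1\<close>, \<open>in2\<close> and \<open>in45\<close> the first slots; \<open>D14\<close> comultiplies
  both \<open>H\<close>-slots of \<open>H \<otimes> U \<otimes> H\<close>.\<close>

abbreviation "pad4 \<equiv> app3 H U H H \<one>\<^bsub>H\<^esub>"
abbreviation "pad5 \<equiv> app3 H H U H2 \<one>\<^bsub>H2\<^esub>"
abbreviation "D3 \<equiv> tmap_r H UH UHH (tmap_r U H H2 Dl)"
abbreviation "R3 \<equiv> tmap_r H UH UHH (dr H)"
abbreviation "Lam \<equiv> tmap_r H UHH HUHH (dl H2)"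
abbreviation "DR u \<equiv> tmap_r U H H2 Dl (rho u)"
abbreviation "D14 X \<equiv> dH UHH (D3 X)"
abbreviation "in1 x \<equiv> tens k H UHH \<one>\<^bsub>H\<^esub> x"
abbreviation "in2 x \<equiv> tens k H HUHH \<one>\<^bsub>H\<^esub> x"
abbreviation "in45 s \<equiv> in2 (in1 (tens k U H2 \<one>\<^bsub>U\<^esub> s))"

lemma R3_dl:
  assumes X: "X \<in> carrier UH"
  shows "pad4 Th' \<otimes>\<^bsub>HUHH\<^esub> R3 (dl H X) = dl H2 (dr H X) \<otimes>\<^bsub>HUHH\<^esub> pad4 Th'"
  using md_U md_H X
  by (induct X rule: tensor_induct')
    (simp_all add: additivity tmap_r_tsplit_app2 tsplit_app2 app3_mult coactions_commute')

lemma dH_dl_Pl: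
  assumes K: "K \<in> carrier UHH"
  shows "dH UHH (dl H2 K) \<otimes>\<^bsub>HHUHH\<^esub> pad5 Pl' = pad5 Pl' \<otimes>\<^bsub>HHUHH\<^esub> Lam (dl H2 K)"
  using md_U md_H2 K
  by (induct K rule: tensor_induct')
    (simp_all add: additivity tmap_r_tsplit_app2 tsplit_app2 app3_mult lam_quasi_coassoc')

text \<open>The right half of the coefficient of a product in the smash product: \<theta>, then the
  second factor with \<rho> applied, then the inverse of \<open>\<Phi>\<^sub>\<rho>\<close>.
  Contracted by \<beta> it also describes the inverse map, see
  \<open>smash_to_crossed_eval3\<close>.\<close>

definition "smash_tail g = pad4 Th' \<otimes>\<^bsub>HUHH\<^esub> R3 g \<otimes>\<^bsub>HUHH\<^esub> in1 Pr'"

lemma smash_tail_closed [simp]: "g \<in> carrier HUH \<Longrightarrow> smash_tail g \<in> carrier HUHH"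
  by (simp add: smash_tail_def)

text \<open>By \<open>R3_dl\<close> the leading \<theta> passes \<rho>(q); it then meets the
  \<theta> of g(1), and the inverse right mixed pentagon merges the two into one with comultiplied
  last slot.\<close>

lemma smash_tail_iso_coeff0: "smash_tail iso_coeff0 = dl H2 (dr H q_rho \<otimes>\<^bsub>UHH\<^esub> Pr') \<otimes>\<^bsub>HUHH\<^esub> D3 Th'"
proof -
  have "smash_tail iso_coeff0 = (pad4 Th' \<otimes>\<^bsub>HUHH\<^esub> R3 (dl H q_rho)) \<otimes>\<^bsub>HUHH\<^esub> (R3 Th' \<otimes>\<^bsub>HUHH\<^esub> in1 Pr')"
    by (simp add: smash_tail_def iso_coeff0_def tmap_r_mult alg_assoc)
  also have "\<dots> = dl H2 (dr H q_rho) \<otimes>\<^bsub>HUHH\<^esub> (pad4 Th' \<otimes>\<^bsub>HUHH\<^esub> R3 Th' \<otimes>\<^bsub>HUHH\<^esub> in1 Pr')"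
    by (simp add: R3_dl alg_assoc)
  also have "\<dots> = dl H2 (dr H q_rho) \<otimes>\<^bsub>HUHH\<^esub> (dl H2 Pr' \<otimes>\<^bsub>HUHH\<^esub> D3 Th')"
    by (simp add: right_mixed_pentagon')
  finally show ?thesis by (simp add: tsplit_mult alg_assoc)
qed

lemma smash_tail_rho:
  assumes "g \<in> carrier HUH" "v \<in> carrier U"
  shows "smash_tail (g \<otimes>\<^bsub>HUH\<^esub> tens k H UH \<one>\<^bsub>H\<^esub> (rho v)) = smash_tail g \<otimes>\<^bsub>HUHH\<^esub> in1 (DR v)"
  using assms by (simp add: smash_tail_def tmap_r_mult alg_assoc rho_quasi_coassoc')

definition "iso_coeff v = iso_coeff0 \<otimes>\<^bsub>HUH\<^esub> tens k H UH \<one>\<^bsub>H\<^esub> (rho v)"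

lemma iso_coeff_closed [simp]: "v \<in> carrier U \<Longrightarrow> iso_coeff v \<in> carrier HUH"
  by (simp add: iso_coeff_def)

text \<open>The element of \<open>HHUHH\<close> by which the product of \<open>eval3 a b g\<close>
  and \<open>eval3 a' b' g'\<close> in the smash product is evaluated, see
  \<open>smash_eval3\<close>.\<close>

definition "smash_coeff g g' = pad5 Pl' \<otimes>\<^bsub>HHUHH\<^esub> Lam (pad4 g) \<otimes>\<^bsub>HHUHH\<^esub> in2 (smash_tail g')"

lemma smash_coeff_closed [simp]: "g \<in> carrier HUH \<Longrightarrow> g' \<in> carrier HUH \<Longrightarrow> smash_coeff g g' \<in> carrier HHUHH"
  by (simp add: smash_coeff_def)

lemma smash_coeff_iso_coeff0_iso_coeff:
  assumes v: "v \<in> carrier U"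
  shows "smash_coeff iso_coeff0 (iso_coeff v) = pad5 Pl' \<otimes>\<^bsub>HHUHH\<^esub> (Lam (pad4 iso_coeff0 \<otimes>\<^bsub>HUHH\<^esub> in1 (dr H q_rho \<otimes>\<^bsub>UHH\<^esub> Pr'))
    \<otimes>\<^bsub>HHUHH\<^esub> (in2 (D3 Th') \<otimes>\<^bsub>HHUHH\<^esub> in2 (in1 (DR v))))"
  using v by (simp add: smash_coeff_def iso_coeff_def smash_tail_rho smash_tail_iso_coeff0 tmap_r_mult alg_assoc)

text \<open>The sum over the \<theta> of \<Omega>. The first component and \<lambda> of the second
  multiply from the right, but S\<inverse> of the third stands on the left in slot 5, which acts on
  the second factor from \<open>B\<close>. Hence an operator on \<open>C\<close> and not a
  product.\<close>

definition theta_sum where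
  "theta_sum C = tsum3 HHUHH Th' (\<lambda>t1 t2 t3. in45 (tens k H H \<one>\<^bsub>H\<^esub> (S' t3)) \<otimes>\<^bsub>HHUHH\<^esub> C
    \<otimes>\<^bsub>HHUHH\<^esub> tens k H HUHH t1 (tmap_r H U UHH (\<lambda>u. DR u) (lam t2)))"

lemma DR_hom [simp]: "(\<lambda>u. DR u) \<in> alg_hom k U UHH"
  by (rule alg_homI) (simp_all add: lin_comp[OF tmap_r_lin] rho_mult tmap_r_mult)

lemma tmap_DR: "Y \<in> carrier HU \<Longrightarrow> tmap_r H U UHH (\<lambda>u. DR u) Y = D3 (tmap_r H U UH rho Y)"
  by (rule tmap_r_comp[symmetric]) simp_all

lemma theta_sum_lin [simp]: "theta_sum \<in> lin k HHUHH HHUHH"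
proof -
  have "(\<lambda>C. theta_sum C) \<in> lin k HHUHH HHUHH"
    unfolding theta_sum_def
    by (intro tsum_lin_param[of H UH] tsum_lin_param[of U H] lin_intros; simp)
  then show ?thesis by simp
qed

text \<open>The argument is what \<open>twist_q_rho\<close> leaves of \<Omega>. The inverse left
  mixed pentagon turns its \<theta> and \<open>\<Phi>\<^sub>\<lambda>\<inverse>\<close> into two
  copies of \<theta> behind \<open>pad5 Pl'\<close>. The summands then slip past the outer factors
  from both sides until they enclose one g(1), where \<open>iso_coeff0_rho_theta\<close> collapses
  the sum to q.\<close>

lemma theta_sum_constant:
  "theta_sum (dH UHH (dl H2 (app2 U H H \<one>\<^bsub>H\<^esub> q_rho \<otimes>\<^bsub>UHH\<^esub> dr H q_rho \<otimes>\<^bsub>UHH\<^esub> Pr')) \<otimes>\<^bsub>HHUHH\<^esub> D14 Th'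
      \<otimes>\<^bsub>HHUHH\<^esub> tmap_r H HU HUHH (tmap_r H U UHH (\<lambda>u. DR u)) Pl')
    = pad5 Pl' \<otimes>\<^bsub>HHUHH\<^esub> Lam (pad4 iso_coeff0 \<otimes>\<^bsub>HUHH\<^esub> in1 (dr H q_rho \<otimes>\<^bsub>UHH\<^esub> Pr')) \<otimes>\<^bsub>HHUHH\<^esub> in2 (D3 Th')"
proof -
  let ?K = "app2 U H H \<one>\<^bsub>H\<^esub> q_rho \<otimes>\<^bsub>UHH\<^esub> dr H q_rho \<otimes>\<^bsub>UHH\<^esub> Pr'"
  let ?E = "tmap_r H HU HUHH (tmap_r H U UHH (\<lambda>u. DR u)) Pl'"
  let ?F = "tmap_r H HUH HUHH D3"
  have K: "?K \<in> carrier UHH" by simp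
  have F1: "?F (dH UH Th') = D14 Th'"
    by (rule tsplit_tmap_r[symmetric]) simp_all
  have F2: "?F (tmap_r H HU HUH (tmap_r H U UH rho) Pl') = ?E"
    by (rule tmap_r_comp_eq) (simp_all add: tmap_DR)
  have F3: "?F (app3 H H U H \<one>\<^bsub>H\<^esub> Pl') = pad5 Pl'"
    unfolding app3_def by (rule tmap_r_comp_eq) (simp_all add: tmap_r_app2)
  have F4: "?F (tmap_r H UH HUH (dl H) Th') = Lam (D3 Th')"
  proof -
    have "?F (tmap_r H UH HUH (dl H) Th') = tmap_r H UH HUHH (\<lambda>x. dl H2 (tmap_r U H H2 Dl x)) Th'"
      by (rule tmap_r_comp_eq) (simp_all add: tsplit_tmap_r)
    also have "\<dots> = Lam (D3 Th')" by (rule tmap_r_comp[symmetric]) simp_all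
    finally show ?thesis .
  qed
  \<comment> \<open>The inverse left mixed pentagon with its last slot comultiplied.\<close>
  have DE: "D14 Th' \<otimes>\<^bsub>HHUHH\<^esub> ?E = pad5 Pl' \<otimes>\<^bsub>HHUHH\<^esub> (Lam (D3 Th') \<otimes>\<^bsub>HHUHH\<^esub> in2 (D3 Th'))"
  proof -
    have "D14 Th' \<otimes>\<^bsub>HHUHH\<^esub> ?E = ?F (dH UH Th' \<otimes>\<^bsub>HHUH\<^esub> tmap_r H HU HUH (tmap_r H U UH rho) Pl')"
      by (simp add: tmap_r_mult F1 F2)
    also have "\<dots> = pad5 Pl' \<otimes>\<^bsub>HHUHH\<^esub> (Lam (D3 Th') \<otimes>\<^bsub>HHUHH\<^esub> in2 (D3 Th'))"
      by (simp add: left_mixed_pentagon' tmap_r_mult F3 F4 alg_assoc)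
    finally show ?thesis .
  qed
  define C where "C = pad5 Pl' \<otimes>\<^bsub>HHUHH\<^esub> (Lam (dl H2 ?K \<otimes>\<^bsub>HUHH\<^esub> D3 Th') \<otimes>\<^bsub>HHUHH\<^esub> in2 (D3 Th'))"
  have C: "dH UHH (dl H2 ?K) \<otimes>\<^bsub>HHUHH\<^esub> D14 Th' \<otimes>\<^bsub>HHUHH\<^esub> ?E = C"
  proof -
    have "dH UHH (dl H2 ?K) \<otimes>\<^bsub>HHUHH\<^esub> D14 Th' \<otimes>\<^bsub>HHUHH\<^esub> ?E
      = dH UHH (dl H2 ?K) \<otimes>\<^bsub>HHUHH\<^esub> (D14 Th' \<otimes>\<^bsub>HHUHH\<^esub> ?E)" using K by (simp add: alg_assoc)
    also have "\<dots> = (dH UHH (dl H2 ?K) \<otimes>\<^bsub>HHUHH\<^esub> pad5 Pl') \<otimes>\<^bsub>HHUHH\<^esub> (Lam (D3 Th') \<otimes>\<^bsub>HHUHH\<^esub> in2 (D3 Th'))"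
      unfolding DE using K by (simp add: alg_assoc)
    also have "\<dots> = C"
      unfolding dH_dl_Pl[OF K] C_def using K by (simp add: tmap_r_mult alg_assoc)
    finally show ?thesis .
  qed
  define W where "W t1 t2 t3 = tens4 k H U H H \<one>\<^bsub>H\<^esub> \<one>\<^bsub>U\<^esub> \<one>\<^bsub>H\<^esub> (S' t3) \<otimes>\<^bsub>HUHH\<^esub> dl H2 ?K \<otimes>\<^bsub>HUHH\<^esub> D3 Th'
    \<otimes>\<^bsub>HUHH\<^esub> tens k H UHH t1 (DR t2)" for t1 t2 t3
  have W_closed: "W t1 t2 t3 \<in> carrier HUHH" if "t1 \<in> carrier H" "t2 \<in> carrier U" "t3 \<in> carrier H" for t1 t2 t3
    using that K by (simp add: W_def)
  have 1: "in45 (tens k H H \<one>\<^bsub>H\<^esub> (S' t3)) \<otimes>\<^bsub>HHUHH\<^esub> C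
      \<otimes>\<^bsub>HHUHH\<^esub> tens k H HUHH t1 (tmap_r H U UHH (\<lambda>u. DR u) (lam t2))
    = pad5 Pl' \<otimes>\<^bsub>HHUHH\<^esub> Lam (W t1 t2 t3) \<otimes>\<^bsub>HHUHH\<^esub> in2 (D3 Th')"
    if t: "t1 \<in> carrier H" "t2 \<in> carrier U" "t3 \<in> carrier H" for t1 t2 t3
  proof -
    \<comment> \<open>\<open>coactions_commute'\<close> carries the right factor of the summand past
      the second \<theta>; on the other side it has become an image under
      \<open>Lam\<close>.\<close>
    have a: "in2 (D3 Th') \<otimes>\<^bsub>HHUHH\<^esub> tens k H HUHH t1 (tmap_r H U UHH (\<lambda>u. DR u) (lam t2))
      = Lam (tens k H UHH t1 (DR t2)) \<otimes>\<^bsub>HHUHH\<^esub> in2 (D3 Th')"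
      using t coactions_commute'[of t2]
      by (simp add: tmap_DR tsplit_tmap_r flip: tmap_r_mult)
    have b: "in45 (tens k H H \<one>\<^bsub>H\<^esub> (S' t3)) = Lam (tens4 k H U H H \<one>\<^bsub>H\<^esub> \<one>\<^bsub>U\<^esub> \<one>\<^bsub>H\<^esub> (S' t3))"
      using t by simp
    have c: "in45 (tens k H H \<one>\<^bsub>H\<^esub> (S' t3)) \<otimes>\<^bsub>HHUHH\<^esub> pad5 Pl' = pad5 Pl' \<otimes>\<^bsub>HHUHH\<^esub> in45 (tens k H H \<one>\<^bsub>H\<^esub> (S' t3))"
      using t by (intro last_slot_commute) simp_all
    let ?s = "in45 (tens k H H \<one>\<^bsub>H\<^esub> (S' t3))" and ?r = "tens k H HUHH t1 (tmap_r H U UHH (\<lambda>u. DR u) (lam t2))"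
      and ?L = "Lam (dl H2 ?K \<otimes>\<^bsub>HUHH\<^esub> D3 Th')"
    have "?s \<otimes>\<^bsub>HHUHH\<^esub> C \<otimes>\<^bsub>HHUHH\<^esub> ?r = (?s \<otimes>\<^bsub>HHUHH\<^esub> pad5 Pl') \<otimes>\<^bsub>HHUHH\<^esub> (?L \<otimes>\<^bsub>HHUHH\<^esub> (in2 (D3 Th') \<otimes>\<^bsub>HHUHH\<^esub> ?r))"
      using t K by (simp add: C_def alg_assoc)
    also have "\<dots> = pad5 Pl' \<otimes>\<^bsub>HHUHH\<^esub> (?s \<otimes>\<^bsub>HHUHH\<^esub> (?L \<otimes>\<^bsub>HHUHH\<^esub> (Lam (tens k H UHH t1 (DR t2)) \<otimes>\<^bsub>HHUHH\<^esub> in2 (D3 Th'))))"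
      unfolding a c using t K by (simp add: alg_assoc)
    also have "\<dots> = pad5 Pl' \<otimes>\<^bsub>HHUHH\<^esub> Lam (W t1 t2 t3) \<otimes>\<^bsub>HHUHH\<^esub> in2 (D3 Th')"
      unfolding b W_def using t K by (simp add: tmap_r_mult alg_assoc del: tmap_r_tens)
    finally show ?thesis .
  qed
  define V where "V t1 t2 t3 = tens3 k H U H \<one>\<^bsub>H\<^esub> \<one>\<^bsub>U\<^esub> (S' t3) \<otimes>\<^bsub>HUH\<^esub> iso_coeff0 \<otimes>\<^bsub>HUH\<^esub> tens k H UH t1 (rho t2)" for t1 t2 t3
  have V_closed: "V t1 t2 t3 \<in> carrier HUH" if "t1 \<in> carrier H" "t2 \<in> carrier U" "t3 \<in> carrier H" for t1 t2 t3
    using that by (simp add: V_def)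
  have 2: "W t1 t2 t3 = pad4 iso_coeff0 \<otimes>\<^bsub>HUHH\<^esub> R3 (V t1 t2 t3) \<otimes>\<^bsub>HUHH\<^esub> in1 Pr'"
    if t: "t1 \<in> carrier H" "t2 \<in> carrier U" "t3 \<in> carrier H" for t1 t2 t3
  proof -
    let ?s = "tens4 k H U H H \<one>\<^bsub>H\<^esub> \<one>\<^bsub>U\<^esub> \<one>\<^bsub>H\<^esub> (S' t3)" and ?r = "tens k H UHH t1 (DR t2)"
    have s: "?s \<otimes>\<^bsub>HUHH\<^esub> pad4 X = pad4 X \<otimes>\<^bsub>HUHH\<^esub> ?s" if "X \<in> carrier HUH" for X
      using t that by (intro last_slot_commute) simp_all
    have sR: "?s = R3 (tens3 k H U H \<one>\<^bsub>H\<^esub> \<one>\<^bsub>U\<^esub> (S' t3))" using t by simp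
    have rR: "in1 Pr' \<otimes>\<^bsub>HUHH\<^esub> ?r = R3 (tens k H UH t1 (rho t2)) \<otimes>\<^bsub>HUHH\<^esub> in1 Pr'"
      using t by (simp add: rho_quasi_coassoc')
    \<comment> \<open>The factor q \<otimes> 1 of \<open>?K\<close> and the leading \<theta>
      \<otimes> 1 of \<open>smash_tail\<close> combine to a second copy of g(1).\<close>
    have k: "dl H2 ?K \<otimes>\<^bsub>HUHH\<^esub> D3 Th' = pad4 iso_coeff0 \<otimes>\<^bsub>HUHH\<^esub> (R3 iso_coeff0 \<otimes>\<^bsub>HUHH\<^esub> in1 Pr')"
    proof -
      have "dl H2 ?K \<otimes>\<^bsub>HUHH\<^esub> D3 Th' = pad4 (dl H q_rho) \<otimes>\<^bsub>HUHH\<^esub> smash_tail iso_coeff0"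
        by (simp add: smash_tail_iso_coeff0 tsplit_mult tsplit_app2 alg_assoc)
      then show ?thesis by (simp add: smash_tail_def iso_coeff0_def app3_mult alg_assoc flip: alg_assoc)
    qed
    have "W t1 t2 t3 = ?s \<otimes>\<^bsub>HUHH\<^esub> (dl H2 ?K \<otimes>\<^bsub>HUHH\<^esub> D3 Th') \<otimes>\<^bsub>HUHH\<^esub> ?r"
      unfolding W_def using t K by (simp add: alg_assoc)
    also have "\<dots> = (?s \<otimes>\<^bsub>HUHH\<^esub> pad4 iso_coeff0) \<otimes>\<^bsub>HUHH\<^esub> (R3 iso_coeff0 \<otimes>\<^bsub>HUHH\<^esub> (in1 Pr' \<otimes>\<^bsub>HUHH\<^esub> ?r))"
      unfolding k using t by (simp add: alg_assoc)
    also have "\<dots> = pad4 iso_coeff0 \<otimes>\<^bsub>HUHH\<^esub> R3 (V t1 t2 t3) \<otimes>\<^bsub>HUHH\<^esub> in1 Pr'"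
      unfolding s[OF iso_coeff0_closed] rR V_def unfolding sR
      using t by (simp add: tmap_r_mult alg_assoc del: tmap_r_tens)
    finally show ?thesis .
  qed
  have "theta_sum C = tsum3 HHUHH Th' (\<lambda>t1 t2 t3. pad5 Pl' \<otimes>\<^bsub>HHUHH\<^esub> Lam (pad4 iso_coeff0 \<otimes>\<^bsub>HUHH\<^esub> R3 (V t1 t2 t3) \<otimes>\<^bsub>HUHH\<^esub> in1 Pr') \<otimes>\<^bsub>HHUHH\<^esub> in2 (D3 Th'))"
    unfolding theta_sum_def
    by (rule tsum3_cong[of H U H]) (simp_all add: 1 2)
  also have "\<dots> = pad5 Pl' \<otimes>\<^bsub>HHUHH\<^esub> Lam (pad4 iso_coeff0 \<otimes>\<^bsub>HUHH\<^esub> R3 (tsum3 HUH Th' V) \<otimes>\<^bsub>HUHH\<^esub> in1 Pr') \<otimes>\<^bsub>HHUHH\<^esub> in2 (D3 Th')"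
  proof -
    let ?L = "\<lambda>X. pad5 Pl' \<otimes>\<^bsub>HHUHH\<^esub> Lam (pad4 iso_coeff0 \<otimes>\<^bsub>HUHH\<^esub> R3 X \<otimes>\<^bsub>HUHH\<^esub> in1 Pr') \<otimes>\<^bsub>HHUHH\<^esub> in2 (D3 Th')"
    have L: "?L \<in> lin k HUH HHUHH" by (intro lin_intros'; simp)
    show ?thesis
      by (rule lin_tsum3[OF _ _ _ _ _ L, of H U H, symmetric]) (simp_all add: V_closed)
  qed
  also have "tsum3 HUH Th' V = tens k H UH \<one>\<^bsub>H\<^esub> q_rho"
    unfolding V_def by (rule iso_coeff0_rho_theta)
  finally show ?thesis unfolding C by (simp add: alg_assoc)
qed

text \<open>The effect of \<Omega> on coefficients under G. \<open>o1\<close> and \<open>o2\<close>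
  act before the coefficient and so multiply from the right, \<open>o5\<close> and \<open>o4\<close>
  from the left because \<open>B\<close> is a right module, and \<open>o3\<close> enters the
  argument of g. The order is \<open>o5\<close>, \<open>o4\<close> since in the crossed product
  \<open>o5\<close> acts on the first factor; \<open>v\<close> stands for the rest of the product in
  \<open>U\<close>.\<close>

definition omega_map where
  "omega_map v X = tsum5 HHUHH X (\<lambda>o1 o2 o3 o4 o5. in45 (tens k H H o5 o4) \<otimes>\<^bsub>HHUHH\<^esub> (D14 iso_coeff0
    \<otimes>\<^bsub>HHUHH\<^esub> app2 H H UHH (DR (o3 \<otimes>\<^bsub>U\<^esub> v)) (tens k H H o1 o2)))"

lemma DR_lin_comp: "f \<in> lin k M U \<Longrightarrow> (\<lambda>x. DR (f x)) \<in> lin k M UHH"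
  by (rule lin_comp[OF hom_lin[OF DR_hom]])

context
  fixes v assumes v: "v \<in> carrier U"
begin

lemma omega_map_lin [simp]: "omega_map v \<in> lin k HHUHH HHUHH"
  and omega_map_tens [simp]: "a \<in> carrier H \<Longrightarrow> b \<in> carrier H \<Longrightarrow> c \<in> carrier U \<Longrightarrow> d \<in> carrier H \<Longrightarrow> e \<in> carrier H \<Longrightarrow>
    omega_map v (tens5 k H H U H H a b c d e) = in45 (tens k H H e d) \<otimes>\<^bsub>HHUHH\<^esub> (D14 iso_coeff0
    \<otimes>\<^bsub>HHUHH\<^esub> app2 H H UHH (DR (c \<otimes>\<^bsub>U\<^esub> v)) (tens k H H a b))"
proof -
  let ?f = "\<lambda>a b c d e. in45 (tens k H H e d) \<otimes>\<^bsub>HHUHH\<^esub> (D14 iso_coeff0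
    \<otimes>\<^bsub>HHUHH\<^esub> app2 H H UHH (DR (c \<otimes>\<^bsub>U\<^esub> v)) (tens k H H a b))"
  have f: "\<And>b c d e. b \<in> carrier H \<Longrightarrow> c \<in> carrier U \<Longrightarrow> d \<in> carrier H \<Longrightarrow> e \<in> carrier H \<Longrightarrow> (\<lambda>a. ?f a b c d e) \<in> lin k H HHUHH"
    "\<And>a c d e. a \<in> carrier H \<Longrightarrow> c \<in> carrier U \<Longrightarrow> d \<in> carrier H \<Longrightarrow> e \<in> carrier H \<Longrightarrow> (\<lambda>b. ?f a b c d e) \<in> lin k H HHUHH"
    "\<And>a b d e. a \<in> carrier H \<Longrightarrow> b \<in> carrier H \<Longrightarrow> d \<in> carrier H \<Longrightarrow> e \<in> carrier H \<Longrightarrow> (\<lambda>c. ?f a b c d e) \<in> lin k U HHUHH"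
    "\<And>a b c e. a \<in> carrier H \<Longrightarrow> b \<in> carrier H \<Longrightarrow> c \<in> carrier U \<Longrightarrow> e \<in> carrier H \<Longrightarrow> (\<lambda>d. ?f a b c d e) \<in> lin k H HHUHH"
    "\<And>a b c d. a \<in> carrier H \<Longrightarrow> b \<in> carrier H \<Longrightarrow> c \<in> carrier U \<Longrightarrow> d \<in> carrier H \<Longrightarrow> (\<lambda>e. ?f a b c d e) \<in> lin k H HHUHH"
    by (intro lin_intros app2_lin_comp app2_lin_comp_arg DR_lin_comp; use v in simp)+
  have "(\<lambda>X. omega_map v X) \<in> lin k HHUHH HHUHH"
    unfolding omega_map_def by (rule tsum5_lin(1)[OF _ _ _ _ _ _ f]) simp_all
  then show "omega_map v \<in> lin k HHUHH HHUHH" by simp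
  show "a \<in> carrier H \<Longrightarrow> b \<in> carrier H \<Longrightarrow> c \<in> carrier U \<Longrightarrow> d \<in> carrier H \<Longrightarrow> e \<in> carrier H \<Longrightarrow>
    omega_map v (tens5 k H H U H H a b c d e) = ?f a b c d e"
    unfolding omega_map_def by (rule tsum5_lin(2)[OF _ _ _ _ _ _ f]) simp_all
qed

abbreviation "EP P \<equiv> tmap_r H HU HUHH (tmap_r H U UHH (\<lambda>u. DR u)) P"
abbreviation "RV \<equiv> in2 (in1 (DR v))"

text \<open>The inner sums in the definition of \<open>Omega\<close>, from the innermost one outwards;
  \<open>omega_map v\<close> is evaluated on them one after the other.\<close>

definition Om7 where "Om7 X0 X2 X3 Xm1 Xm2 xl1 xl2 xl3 t1 t3 tm t0 =
  tsum HHUHH twF (\<lambda>f1 f2. tens5 k H H U H H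
        (Xm1 \<otimes>\<^bsub>H\<^esub> xl1 \<otimes>\<^bsub>H\<^esub> t1) (Xm2 \<otimes>\<^bsub>H\<^esub> xl2 \<otimes>\<^bsub>H\<^esub> tm) (X0 \<otimes>\<^bsub>U\<^esub> xl3 \<otimes>\<^bsub>U\<^esub> t0)
        (S' (f1 \<otimes>\<^bsub>H\<^esub> X2 \<otimes>\<^bsub>H\<^esub> t3)) (S' (f2 \<otimes>\<^bsub>H\<^esub> X3)))"
definition Om6 where "Om6 X0 X2 X3 Xm1 Xm2 xl1 xl2 xl3 t1 t2 t3 =
  tsum HHUHH (lam t2) (\<lambda>tm t0. Om7 X0 X2 X3 Xm1 Xm2 xl1 xl2 xl3 t1 t3 tm t0)"
definition Om5 where "Om5 X0 X2 X3 Xm1 Xm2 xl1 xl2 xl3 =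
  tsum3 HHUHH Th' (\<lambda>t1 t2 t3. Om6 X0 X2 X3 Xm1 Xm2 xl1 xl2 xl3 t1 t2 t3)"
definition Om4 where "Om4 X0 X2 X3 Xm1 Xm2 =
  tsum3 HHUHH Pl' (\<lambda>xl1 xl2 xl3. Om5 X0 X2 X3 Xm1 Xm2 xl1 xl2 xl3)"
definition Om3 where "Om3 X2 X3 Xm X0 = tsum HHUHH (Dl Xm) (\<lambda>Xm1 Xm2. Om4 X0 X2 X3 Xm1 Xm2)"
definition Om2 where "Om2 X1 X2 X3 = tsum HHUHH (lam X1) (\<lambda>Xm X0. Om3 X2 X3 Xm X0)"

lemma Omega_Om2: "Omega k H U = tsum3 HHUHH Pr (\<lambda>X1 X2 X3. Om2 X1 X2 X3)"
  by (simp add: Omega_def Let_def Om2_def Om3_def Om4_def Om5_def Om6_def Om7_def)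

abbreviation "body F C \<equiv> theta_sum (in45 F \<otimes>\<^bsub>HHUHH\<^esub> (D14 iso_coeff0 \<otimes>\<^bsub>HHUHH\<^esub> C)) \<otimes>\<^bsub>HHUHH\<^esub> RV"

context
  fixes X2 X3 assumes X: "X2 \<in> carrier H" "X3 \<in> carrier H"
begin

abbreviation "FX \<equiv> flip_S' (twF \<otimes>\<^bsub>H2\<^esub> tens k H H X2 X3)"

text \<open>S\<inverse> reverses \<open>f1 X2 t3\<close>, so S\<inverse>(\<open>t3\<close>) splits
  off on the left and leaves the inverse flip of f (\<open>X2 \<otimes> X3\<close>); the exchange in
  the flip agrees with the order \<open>o5\<close>, \<open>o4\<close> of
  \<open>omega_map\<close>.\<close>

lemma Om7:
  assumes "Xm1 \<in> carrier H" "Xm2 \<in> carrier H" "xl1 \<in> carrier H" "xl2 \<in> carrier H" "t1 \<in> carrier H"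
    "tm \<in> carrier H" "X0 \<in> carrier U" "xl3 \<in> carrier U" "t0 \<in> carrier U" "t3 \<in> carrier H"
  shows "Om7 X0 X2 X3 Xm1 Xm2 xl1 xl2 xl3 t1 t3 tm t0 \<in> carrier HHUHH"
    and "omega_map v (Om7 X0 X2 X3 Xm1 Xm2 xl1 xl2 xl3 t1 t3 tm t0) =
      in45 (tens k H H \<one>\<^bsub>H\<^esub> (S' t3) \<otimes>\<^bsub>H2\<^esub> FX) \<otimes>\<^bsub>HHUHH\<^esub> (D14 iso_coeff0 \<otimes>\<^bsub>HHUHH\<^esub>
        app2 H H UHH (DR (X0 \<otimes>\<^bsub>U\<^esub> xl3 \<otimes>\<^bsub>U\<^esub> t0 \<otimes>\<^bsub>U\<^esub> v))
          (tens k H H (Xm1 \<otimes>\<^bsub>H\<^esub> xl1 \<otimes>\<^bsub>H\<^esub> t1) (Xm2 \<otimes>\<^bsub>H\<^esub> xl2 \<otimes>\<^bsub>H\<^esub> tm)))" (is "_ = ?R")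
proof -
  show "Om7 X0 X2 X3 Xm1 Xm2 xl1 xl2 xl3 t1 t3 tm t0 \<in> carrier HHUHH"
    unfolding Om7_def by (rule tsum_closed'[of H H]) (use assms X in simp_all)
  let ?L = "\<lambda>F. in45 (tens k H H \<one>\<^bsub>H\<^esub> (S' t3) \<otimes>\<^bsub>H2\<^esub> flip_S' (F \<otimes>\<^bsub>H2\<^esub> tens k H H X2 X3)) \<otimes>\<^bsub>HHUHH\<^esub> (D14 iso_coeff0 \<otimes>\<^bsub>HHUHH\<^esub>
        app2 H H UHH (DR (X0 \<otimes>\<^bsub>U\<^esub> xl3 \<otimes>\<^bsub>U\<^esub> t0 \<otimes>\<^bsub>U\<^esub> v))
          (tens k H H (Xm1 \<otimes>\<^bsub>H\<^esub> xl1 \<otimes>\<^bsub>H\<^esub> t1) (Xm2 \<otimes>\<^bsub>H\<^esub> xl2 \<otimes>\<^bsub>H\<^esub> tm)))"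
  show "omega_map v (Om7 X0 X2 X3 Xm1 Xm2 xl1 xl2 xl3 t1 t3 tm t0) = ?R"
    unfolding Om7_def
  proof (rule lin_tsum_eq[where L' = ?L and M = H and N = H and P' = HHUHH])
    show "?L \<in> lin k H2 HHUHH"
      by (intro lin_intros lin_comp[OF flip_S'_lin]; use assms X v in simp)
  qed (use assms X in \<open>simp_all add: S'_mult alg_assoc\<close>)
qed

lemma Om6:
  assumes a: "Xm1 \<in> carrier H" "Xm2 \<in> carrier H" "xl1 \<in> carrier H" "xl2 \<in> carrier H" "t1 \<in> carrier H"
    "X0 \<in> carrier U" "xl3 \<in> carrier U" "t2 \<in> carrier U" "t3 \<in> carrier H"
  shows "Om6 X0 X2 X3 Xm1 Xm2 xl1 xl2 xl3 t1 t2 t3 \<in> carrier HHUHH"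
    and "omega_map v (Om6 X0 X2 X3 Xm1 Xm2 xl1 xl2 xl3 t1 t2 t3) =
      in45 (tens k H H \<one>\<^bsub>H\<^esub> (S' t3) \<otimes>\<^bsub>H2\<^esub> FX) \<otimes>\<^bsub>HHUHH\<^esub> (D14 iso_coeff0 \<otimes>\<^bsub>HHUHH\<^esub>
        (app2 H H UHH (DR (X0 \<otimes>\<^bsub>U\<^esub> xl3)) (tens k H H (Xm1 \<otimes>\<^bsub>H\<^esub> xl1) (Xm2 \<otimes>\<^bsub>H\<^esub> xl2))
         \<otimes>\<^bsub>HHUHH\<^esub> (tens k H HUHH t1 (tmap_r H U UHH (\<lambda>u. DR u) (lam t2)) \<otimes>\<^bsub>HHUHH\<^esub> RV)))" (is "_ = ?R")
proof -
  show "Om6 X0 X2 X3 Xm1 Xm2 xl1 xl2 xl3 t1 t2 t3 \<in> carrier HHUHH"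
    unfolding Om6_def by (rule tsum_closed'[of H U]) (use a in \<open>simp_all add: Om7(1)\<close>)
  let ?L = "\<lambda>Y. in45 (tens k H H \<one>\<^bsub>H\<^esub> (S' t3) \<otimes>\<^bsub>H2\<^esub> FX) \<otimes>\<^bsub>HHUHH\<^esub> (D14 iso_coeff0 \<otimes>\<^bsub>HHUHH\<^esub>
        (app2 H H UHH (DR (X0 \<otimes>\<^bsub>U\<^esub> xl3)) (tens k H H (Xm1 \<otimes>\<^bsub>H\<^esub> xl1) (Xm2 \<otimes>\<^bsub>H\<^esub> xl2))
         \<otimes>\<^bsub>HHUHH\<^esub> (tens k H HUHH t1 (tmap_r H U UHH (\<lambda>u. DR u) Y) \<otimes>\<^bsub>HHUHH\<^esub> RV)))"
  show "omega_map v (Om6 X0 X2 X3 Xm1 Xm2 xl1 xl2 xl3 t1 t2 t3) = ?R"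
    unfolding Om6_def
  proof (rule lin_tsum_eq[where L' = ?L and M = H and N = U and P' = HHUHH])
    show "?L \<in> lin k HU HHUHH"
      by (intro lin_intros; use a X v in simp)
  qed (use a X v in \<open>simp_all add: Om7 rho_mult tmap_r_mult alg_assoc\<close>)
qed

text \<open>At this level \<theta> is summed. Because of S\<inverse>(\<open>t3\<close>) on the left
  the sum does not become a factor but the operator \<open>theta_sum\<close>.\<close>

lemma Om5:
  assumes a: "Xm1 \<in> carrier H" "Xm2 \<in> carrier H" "xl1 \<in> carrier H" "xl2 \<in> carrier H"
    "X0 \<in> carrier U" "xl3 \<in> carrier U"
  shows "Om5 X0 X2 X3 Xm1 Xm2 xl1 xl2 xl3 \<in> carrier HHUHH"
    and "omega_map v (Om5 X0 X2 X3 Xm1 Xm2 xl1 xl2 xl3) =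
      body FX (app2 H H UHH (DR (X0 \<otimes>\<^bsub>U\<^esub> xl3)) (tens k H H (Xm1 \<otimes>\<^bsub>H\<^esub> xl1) (Xm2 \<otimes>\<^bsub>H\<^esub> xl2)))" (is "_ = body FX ?C")
proof -
  show "Om5 X0 X2 X3 Xm1 Xm2 xl1 xl2 xl3 \<in> carrier HHUHH"
    unfolding Om5_def by (rule tsum3_closed[of H U H]) (use a in \<open>simp_all add: Om6(1)\<close>)
  have C: "?C \<in> carrier HHUHH" using a by simp
  let ?t = "\<lambda>t1 t2 t3. in45 (tens k H H \<one>\<^bsub>H\<^esub> (S' t3)) \<otimes>\<^bsub>HHUHH\<^esub> (in45 FX \<otimes>\<^bsub>HHUHH\<^esub> (D14 iso_coeff0 \<otimes>\<^bsub>HHUHH\<^esub> ?C))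
    \<otimes>\<^bsub>HHUHH\<^esub> tens k H HUHH t1 (tmap_r H U UHH (\<lambda>u. DR u) (lam t2))"
  have t: "omega_map v (Om6 X0 X2 X3 Xm1 Xm2 xl1 xl2 xl3 t1 t2 t3) = ?t t1 t2 t3 \<otimes>\<^bsub>HHUHH\<^esub> RV"
    if tt: "t1 \<in> carrier H" "t2 \<in> carrier U" "t3 \<in> carrier H" for t1 t2 t3
  proof -
    have "in45 (tens k H H \<one>\<^bsub>H\<^esub> (S' t3) \<otimes>\<^bsub>H2\<^esub> FX) = in45 (tens k H H \<one>\<^bsub>H\<^esub> (S' t3)) \<otimes>\<^bsub>HHUHH\<^esub> in45 FX"
      using tt X by simp
    then show ?thesis
      unfolding Om6(2)[OF a(1-4) tt(1) a(5,6) tt(2,3)]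
      using tt X v C by (simp add: alg_assoc del: tens_mult app2_tens)
  qed
  have "omega_map v (Om5 X0 X2 X3 Xm1 Xm2 xl1 xl2 xl3)
    = tsum3 HHUHH Th' (\<lambda>t1 t2 t3. omega_map v (Om6 X0 X2 X3 Xm1 Xm2 xl1 xl2 xl3 t1 t2 t3))"
    unfolding Om5_def by (rule lin_tsum3[of H U H]) (use a in \<open>simp_all add: Om6(1)\<close>)
  also have "\<dots> = tsum3 HHUHH Th' (\<lambda>t1 t2 t3. ?t t1 t2 t3 \<otimes>\<^bsub>HHUHH\<^esub> RV)"
    by (rule tsum3_cong[of H U H]) (simp_all add: t)
  also have "\<dots> = body FX ?C"
    unfolding theta_sum_def
    by (rule lin_tsum3[of H U H, where L = "\<lambda>x. x \<otimes>\<^bsub>HHUHH\<^esub> RV", symmetric])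
      (use X v C in \<open>simp_all add: mult_lin_left\<close>)
  finally show "omega_map v (Om5 X0 X2 X3 Xm1 Xm2 xl1 xl2 xl3) = body FX ?C" .
qed

lemma body_lin_comp:
  assumes "f \<in> lin k M HHUHH"
  shows "(\<lambda>x. body FX (f x)) \<in> lin k M HHUHH"
  by (intro lin_intros lin_comp[OF theta_sum_lin] assms; use X v in simp)

lemma Om4:
  assumes a: "Xm1 \<in> carrier H" "Xm2 \<in> carrier H" "X0 \<in> carrier U"
  shows "Om4 X0 X2 X3 Xm1 Xm2 \<in> carrier HHUHH"
    and "omega_map v (Om4 X0 X2 X3 Xm1 Xm2) =
      body FX (app2 H H UHH (DR X0) (tens k H H Xm1 Xm2) \<otimes>\<^bsub>HHUHH\<^esub> EP Pl')" (is "_ = ?R")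
proof -
  show "Om4 X0 X2 X3 Xm1 Xm2 \<in> carrier HHUHH"
    unfolding Om4_def by (rule tsum3_closed[of H H U]) (use a in \<open>simp_all add: Om5(1)\<close>)
  let ?L = "\<lambda>P. body FX (app2 H H UHH (DR X0) (tens k H H Xm1 Xm2) \<otimes>\<^bsub>HHUHH\<^esub> EP P)"
  show "omega_map v (Om4 X0 X2 X3 Xm1 Xm2) = ?R"
    unfolding Om4_def
  proof (rule lin_tsum3_eq[where L' = ?L and A = H and B = H and C = U and P' = HHUHH])
    show "?L \<in> lin k HHU HHUHH"
      by (intro body_lin_comp lin_intros; use a in simp)
  qed (use a in \<open>simp_all add: Om5 rho_mult tmap_r_mult\<close>)
qed

lemma Om3:
  assumes a: "Xm \<in> carrier H" "X0 \<in> carrier U"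
  shows "Om3 X2 X3 Xm X0 \<in> carrier HHUHH"
    and "omega_map v (Om3 X2 X3 Xm X0) = body FX (app2 H H UHH (DR X0) (Dl Xm) \<otimes>\<^bsub>HHUHH\<^esub> EP Pl')" (is "_ = ?R")
proof -
  show "Om3 X2 X3 Xm X0 \<in> carrier HHUHH"
    unfolding Om3_def by (rule tsum_closed'[of H H]) (use a in \<open>simp_all add: Om4(1)\<close>)
  let ?L = "\<lambda>Z. body FX (app2 H H UHH (DR X0) Z \<otimes>\<^bsub>HHUHH\<^esub> EP Pl')"
  show "omega_map v (Om3 X2 X3 Xm X0) = ?R"
    unfolding Om3_def
  proof (rule lin_tsum_eq[where L' = ?L and M = H and N = H and P' = HHUHH])
    show "?L \<in> lin k H2 HHUHH"
      by (intro body_lin_comp lin_intros; use a in simp)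
  qed (use a in \<open>simp_all add: Om4\<close>)
qed

lemma Om2:
  assumes a: "X1 \<in> carrier U"
  shows "Om2 X1 X2 X3 \<in> carrier HHUHH"
    and "omega_map v (Om2 X1 X2 X3) =
      body FX (dH UHH (tmap_r H U UHH (\<lambda>u. DR u) (lam X1)) \<otimes>\<^bsub>HHUHH\<^esub> EP Pl')" (is "_ = ?R")
proof -
  show "Om2 X1 X2 X3 \<in> carrier HHUHH"
    unfolding Om2_def by (rule tsum_closed'[of H U]) (use a in \<open>simp_all add: Om3(1)\<close>)
  let ?L = "\<lambda>Y. body FX (dH UHH (tmap_r H U UHH (\<lambda>u. DR u) Y) \<otimes>\<^bsub>HHUHH\<^esub> EP Pl')"
  show "omega_map v (Om2 X1 X2 X3) = ?R"
    unfolding Om2_def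
  proof (rule lin_tsum_eq[where L' = ?L and M = H and N = U and P' = HHUHH])
    show "?L \<in> lin k HU HHUHH"
      by (intro body_lin_comp lin_intros tsplit_lin_comp; use a in simp)
  qed (use a in \<open>simp_all add: Om3\<close>)
qed

end

lemma Omega_closed: "Omega k H U \<in> carrier HHUHH"
  unfolding Omega_Om2 by (rule tsum3_closed[of U H H]) (simp_all add: Om2(1))

text \<open>What remains is the sum over \<open>\<Phi>\<^sub>\<rho>\<close>. Since g(1) (id
  \<otimes> \<rho>)(\<lambda>(\<open>X1\<close>)) = (\<lambda> \<otimes> id)(q
  \<rho>(\<open>X1\<close>)) \<theta>, this sum is the left side of \<open>twist_q_rho\<close> with
  \<lambda> and then \<Delta> applied to its first slots; \<open>theta_sum_constant\<close> turns
  the outcome into the coefficient of the smash product.\<close>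

lemma omega_map_Omega: "omega_map v (Omega k H U) = smash_coeff iso_coeff0 (iso_coeff v)"
proof -
  let ?D = "tmap_r U H H2 Dl"
  let ?B = "\<lambda>X1 Y. tens k U H2 \<one>\<^bsub>U\<^esub> (flip_S' (twF \<otimes>\<^bsub>H2\<^esub> Y)) \<otimes>\<^bsub>UHH\<^esub> ?D q_rho \<otimes>\<^bsub>UHH\<^esub> ?D (rho X1)"
  let ?M = "\<lambda>K. theta_sum (dH UHH (dl H2 K) \<otimes>\<^bsub>HHUHH\<^esub> D14 Th' \<otimes>\<^bsub>HHUHH\<^esub> EP Pl') \<otimes>\<^bsub>HHUHH\<^esub> RV"
  have M: "?M \<in> lin k UHH HHUHH"
    by (intro lin_intros' lin_comp[OF theta_sum_lin]; use v in simp)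
  have 1: "body (flip_S' (twF \<otimes>\<^bsub>H2\<^esub> Y)) (dH UHH (tmap_r H U UHH (\<lambda>u. DR u) (lam X1)) \<otimes>\<^bsub>HHUHH\<^esub> EP Pl') = ?M (?B X1 Y)"
    if X1: "X1 \<in> carrier U" and Y: "Y \<in> carrier H2" for X1 Y
  proof -
    let ?F = "flip_S' (twF \<otimes>\<^bsub>H2\<^esub> Y)"
    have e0: "iso_coeff0 \<otimes>\<^bsub>HUH\<^esub> tmap_r H U UH rho (lam X1) = dl H (q_rho \<otimes>\<^bsub>UH\<^esub> rho X1) \<otimes>\<^bsub>HUH\<^esub> Th'"
      using X1 by (simp add: iso_coeff0_def alg_assoc coactions_commute' tsplit_mult)
    have e1: "D14 (dl H Z \<otimes>\<^bsub>HUH\<^esub> Th') = dH UHH (dl H2 (?D Z)) \<otimes>\<^bsub>HHUHH\<^esub> D14 Th'" if "Z \<in> carrier UH" for Z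
      using that by (simp add: tmap_r_mult tsplit_mult tsplit_tmap_r)
    have "D14 iso_coeff0 \<otimes>\<^bsub>HHUHH\<^esub> dH UHH (tmap_r H U UHH (\<lambda>u. DR u) (lam X1))
      = D14 (iso_coeff0 \<otimes>\<^bsub>HUH\<^esub> tmap_r H U UH rho (lam X1))"
      using X1 by (simp add: tmap_DR tmap_r_mult tsplit_mult)
    also have "\<dots> = dH UHH (dl H2 (?D (q_rho \<otimes>\<^bsub>UH\<^esub> rho X1))) \<otimes>\<^bsub>HHUHH\<^esub> D14 Th'"
      unfolding e0 by (rule e1) (simp add: X1)
    finally have e2: "D14 iso_coeff0 \<otimes>\<^bsub>HHUHH\<^esub> dH UHH (tmap_r H U UHH (\<lambda>u. DR u) (lam X1))
      = dH UHH (dl H2 (?D (q_rho \<otimes>\<^bsub>UH\<^esub> rho X1))) \<otimes>\<^bsub>HHUHH\<^esub> D14 Th'" .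
    have pad5: "in45 ?F = dH UHH (dl H2 (tens k U H2 \<one>\<^bsub>U\<^esub> ?F))"
      using Y by simp
    have e4: "dH UHH (dl H2 (?B X1 Y)) = in45 ?F \<otimes>\<^bsub>HHUHH\<^esub> dH UHH (dl H2 (?D (q_rho \<otimes>\<^bsub>UH\<^esub> rho X1)))"
      unfolding pad5 using X1 Y by (simp add: tmap_r_mult tsplit_mult alg_assoc del: tsplit_tens)
    have "in45 ?F \<otimes>\<^bsub>HHUHH\<^esub> (D14 iso_coeff0 \<otimes>\<^bsub>HHUHH\<^esub> (dH UHH (tmap_r H U UHH (\<lambda>u. DR u) (lam X1)) \<otimes>\<^bsub>HHUHH\<^esub> EP Pl'))
      = in45 ?F \<otimes>\<^bsub>HHUHH\<^esub> ((D14 iso_coeff0 \<otimes>\<^bsub>HHUHH\<^esub> dH UHH (tmap_r H U UHH (\<lambda>u. DR u) (lam X1))) \<otimes>\<^bsub>HHUHH\<^esub> EP Pl')"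
      using X1 by (simp add: alg_assoc)
    also have "\<dots> = dH UHH (dl H2 (?B X1 Y)) \<otimes>\<^bsub>HHUHH\<^esub> D14 Th' \<otimes>\<^bsub>HHUHH\<^esub> EP Pl'"
      unfolding e2 e4 using X1 Y by (simp add: alg_assoc del: tens_mult)
    finally have "in45 ?F \<otimes>\<^bsub>HHUHH\<^esub> (D14 iso_coeff0 \<otimes>\<^bsub>HHUHH\<^esub> (dH UHH (tmap_r H U UHH (\<lambda>u. DR u) (lam X1)) \<otimes>\<^bsub>HHUHH\<^esub> EP Pl'))
      = dH UHH (dl H2 (?B X1 Y)) \<otimes>\<^bsub>HHUHH\<^esub> D14 Th' \<otimes>\<^bsub>HHUHH\<^esub> EP Pl'" .
    then show ?thesis by simp
  qed
  have "omega_map v (Omega k H U) = tsum3 HHUHH Pr (\<lambda>X1 X2 X3. omega_map v (Om2 X1 X2 X3))"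
    unfolding Omega_Om2 by (rule lin_tsum3[of U H H]) (simp_all add: Om2(1))
  also have "\<dots> = tsum HHUHH Pr (\<lambda>X1 Y. ?M (?B X1 Y))"
  proof (rule tsum_cong[where k = k and M = U and N = H2])
    fix X1 Y assume X1: "X1 \<in> carrier U" and Y: "Y \<in> carrier H2"
    show "tsum HHUHH Y (\<lambda>X2 X3. omega_map v (Om2 X1 X2 X3)) = ?M (?B X1 Y)"
    proof (rule tsum_eq_lin[where h = "\<lambda>Y. ?M (?B X1 Y)", OF _ _ _ _ Y])
      show "(\<lambda>Y. ?M (?B X1 Y)) \<in> lin k H2 HHUHH"
        by (intro lin_comp[OF M] lin_intros lin_comp[OF flip_S'_lin]; use X1 in simp)
    qed (use X1 in \<open>simp_all add: Om2(2) 1 del: tens_mult\<close>)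
  qed simp_all
  also have "\<dots> = ?M (tsum UHH Pr ?B)"
    by (rule lin_tsum[where h = ?M and M = U and N = H2, symmetric, OF _ _ _ _ M]) simp_all
  also have "\<dots> = smash_coeff iso_coeff0 (iso_coeff v)"
    unfolding twist_q_rho theta_sum_constant smash_coeff_iso_coeff0_iso_coeff[OF v] using v by (simp add: alg_assoc del: tens_mult)
  finally show ?thesis .
qed

end

end

section \<open>The isomorphism\<close>

locale iso_base = crossed_base k H U
  for k :: "('k, 'r) ring_scheme" and H :: "('k, 'h, 'x) quasi_hopf_scheme"
    and U :: "('k, 'h, 'u, 'y) bicomodule_algebra_scheme" +
  fixes A :: "('k, 'a, 'm) module_scheme" and l :: "'h \<Rightarrow> 'a \<Rightarrow> 'a"
    and B :: "('k, 'b, 'n) module_scheme" and r :: "'b \<Rightarrow> 'h \<Rightarrow> 'b"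
  assumes left_mod_alg: "left_module_algebra k H A l"
    and right_mod_alg: "right_module_algebra k H B r"
begin

interpretation la: left_module_algebra k H A l by (rule left_mod_alg)
interpretation ra: right_module_algebra k H B r by (rule right_mod_alg)

abbreviation "AB \<equiv> A \<boxtimes> B"
abbreviation "UB \<equiv> U \<boxtimes> B"
abbreviation "AUB \<equiv> A \<boxtimes> UB"
abbreviation "ABU \<equiv> AB \<boxtimes> U"

lemma nalg_A [simp]: "nalg A" using left_mod_alg by (simp add: left_module_algebra_def)
lemma nalg_B [simp]: "nalg B" using right_mod_alg by (simp add: right_module_algebra_def)
lemma md_AB: "md A" "md B" "md AB" by simp_all

lemma l_bilin: "bilinear_on k H A A l" using la.action by (simp add: left_action_def)
lemma r_bilin: "bilinear_on k B H B r" using ra.action by (simp add: right_action_def)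

lemma l_lin [simp]: "h \<in> carrier H \<Longrightarrow> l h \<in> lin k A A" "a \<in> carrier A \<Longrightarrow> (\<lambda>h. l h a) \<in> lin k H A"
  using bilinear_onD[OF l_bilin] by auto

lemma r_lin [simp]: "b \<in> carrier B \<Longrightarrow> r b \<in> lin k H B" "h \<in> carrier H \<Longrightarrow> (\<lambda>b. r b h) \<in> lin k B B"
  using bilinear_onD[OF r_bilin] by auto

lemma l_closed [simp]: "h \<in> carrier H \<Longrightarrow> a \<in> carrier A \<Longrightarrow> l h a \<in> carrier A"
  by (rule lin_closed[OF l_lin(1)])

lemma r_closed [simp]: "h \<in> carrier H \<Longrightarrow> b \<in> carrier B \<Longrightarrow> r b h \<in> carrier B"
  by (rule lin_closed[OF r_lin(2)])

lemma l_one [simp]: "a \<in> carrier A \<Longrightarrow> l \<one>\<^bsub>H\<^esub> a = a"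
  and l_mult: "g \<in> carrier H \<Longrightarrow> h \<in> carrier H \<Longrightarrow> a \<in> carrier A \<Longrightarrow> l (g \<otimes>\<^bsub>H\<^esub> h) a = l g (l h a)"
  using la.action by (auto simp: left_action_def)

lemma r_one [simp]: "b \<in> carrier B \<Longrightarrow> r b \<one>\<^bsub>H\<^esub> = b"
  and r_mult: "g \<in> carrier H \<Longrightarrow> h \<in> carrier H \<Longrightarrow> b \<in> carrier B \<Longrightarrow> r b (g \<otimes>\<^bsub>H\<^esub> h) = r (r b g) h"
  using ra.action by (auto simp: right_action_def)

lemma l_unit: "h \<in> carrier H \<Longrightarrow> l h \<one>\<^bsub>A\<^esub> = ep h \<odot>\<^bsub>A\<^esub> \<one>\<^bsub>A\<^esub>" by (rule la.action_one)
lemma r_unit: "h \<in> carrier H \<Longrightarrow> r \<one>\<^bsub>B\<^esub> h = ep h \<odot>\<^bsub>B\<^esub> \<one>\<^bsub>B\<^esub>" by (rule ra.action_one)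

lemmas mod_lin = lin_comp[OF l_lin(1)] lin_comp[OF l_lin(2)] lin_comp[OF r_lin(1)] lin_comp[OF r_lin(2)]

text \<open>Evaluates a coefficient on the two module elements; for the coefficient
  \<open>iso_coeff u\<close> this is G on a pure tensor.\<close>

definition eval3 where
  "eval3 a b X = tsum3 AUB X (\<lambda>h u m. tens3 k A U B (l h a) u (r b m))"

lemma eval3_lin [simp]: "a \<in> carrier A \<Longrightarrow> b \<in> carrier B \<Longrightarrow> eval3 a b \<in> lin k HUH AUB"
  and eval3_tens [simp]: "a \<in> carrier A \<Longrightarrow> b \<in> carrier B \<Longrightarrow> h \<in> carrier H \<Longrightarrow> u \<in> carrier U \<Longrightarrow> m \<in> carrier H \<Longrightarrow>
    eval3 a b (tens3 k H U H h u m) = tens3 k A U B (l h a) u (r b m)"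
proof -
  assume ab: "a \<in> carrier A" "b \<in> carrier B"
  let ?f = "\<lambda>h u m. tens3 k A U B (l h a) u (r b m)"
  have f: "\<And>u m. u \<in> carrier U \<Longrightarrow> m \<in> carrier H \<Longrightarrow> (\<lambda>h. ?f h u m) \<in> lin k H AUB"
    "\<And>h m. h \<in> carrier H \<Longrightarrow> m \<in> carrier H \<Longrightarrow> (\<lambda>u. ?f h u m) \<in> lin k U AUB"
    "\<And>h u. h \<in> carrier H \<Longrightarrow> u \<in> carrier U \<Longrightarrow> (\<lambda>m. ?f h u m) \<in> lin k H AUB"
    by (intro lin_intros; use ab in simp)+
  have "(\<lambda>X. eval3 a b X) \<in> lin k HUH AUB"
    unfolding eval3_def by (rule tsum3_lin(1)[OF _ _ _ _ f]) simp_all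
  then show "eval3 a b \<in> lin k HUH AUB" by simp
  show "h \<in> carrier H \<Longrightarrow> u \<in> carrier U \<Longrightarrow> m \<in> carrier H \<Longrightarrow> eval3 a b (tens3 k H U H h u m) = ?f h u m"
    unfolding eval3_def by (rule tsum3_lin(2)[OF _ _ _ _ f]) simp_all
qed

lemma eval3_closed [simp]: "a \<in> carrier A \<Longrightarrow> b \<in> carrier B \<Longrightarrow> X \<in> carrier HUH \<Longrightarrow> eval3 a b X \<in> carrier AUB"
  by (rule lin_closed[OF eval3_lin])

lemma eval3_lin_arg:
  assumes X: "X \<in> carrier HUH"
  shows "b \<in> carrier B \<Longrightarrow> (\<lambda>a. eval3 a b X) \<in> lin k A AUB"
    and "a \<in> carrier A \<Longrightarrow> (\<lambda>b. eval3 a b X) \<in> lin k B AUB"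
  unfolding eval3_def
  by (rule tsum_lin_param[of H UH, OF _ _ _ _ X] tsum_lin_param[of U H] | (intro lin_intros mod_lin)[1] | simp)+

definition eval5 where
  "eval5 a a' b b' X = tsum5 AUB X (\<lambda>z1 z2 z3 z4 z5.
    tens3 k A U B (l z1 a \<otimes>\<^bsub>A\<^esub> l z2 a') z3 (r b z4 \<otimes>\<^bsub>B\<^esub> r b' z5))"

context
  fixes a a' b b'
  assumes ab [simp]: "a \<in> carrier A" "a' \<in> carrier A" "b \<in> carrier B" "b' \<in> carrier B"
begin

lemma eval5_lin [simp]: "eval5 a a' b b' \<in> lin k HHUHH AUB"
  and eval5_tens [simp]: "c1 \<in> carrier H \<Longrightarrow> c2 \<in> carrier H \<Longrightarrow> c3 \<in> carrier U \<Longrightarrow> c4 \<in> carrier H \<Longrightarrow> c5 \<in> carrier H \<Longrightarrow>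
    eval5 a a' b b' (tens5 k H H U H H c1 c2 c3 c4 c5)
    = tens3 k A U B (l c1 a \<otimes>\<^bsub>A\<^esub> l c2 a') c3 (r b c4 \<otimes>\<^bsub>B\<^esub> r b' c5)"
proof -
  let ?f = "\<lambda>z1 z2 z3 z4 z5. tens3 k A U B (l z1 a \<otimes>\<^bsub>A\<^esub> l z2 a') z3 (r b z4 \<otimes>\<^bsub>B\<^esub> r b' z5)"
  have f: "\<And>b c d e. b \<in> carrier H \<Longrightarrow> c \<in> carrier U \<Longrightarrow> d \<in> carrier H \<Longrightarrow> e \<in> carrier H \<Longrightarrow> (\<lambda>a. ?f a b c d e) \<in> lin k H AUB"
    "\<And>a c d e. a \<in> carrier H \<Longrightarrow> c \<in> carrier U \<Longrightarrow> d \<in> carrier H \<Longrightarrow> e \<in> carrier H \<Longrightarrow> (\<lambda>b. ?f a b c d e) \<in> lin k H AUB"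
    "\<And>a b d e. a \<in> carrier H \<Longrightarrow> b \<in> carrier H \<Longrightarrow> d \<in> carrier H \<Longrightarrow> e \<in> carrier H \<Longrightarrow> (\<lambda>c. ?f a b c d e) \<in> lin k U AUB"
    "\<And>a b c e. a \<in> carrier H \<Longrightarrow> b \<in> carrier H \<Longrightarrow> c \<in> carrier U \<Longrightarrow> e \<in> carrier H \<Longrightarrow> (\<lambda>d. ?f a b c d e) \<in> lin k H AUB"
    "\<And>a b c d. a \<in> carrier H \<Longrightarrow> b \<in> carrier H \<Longrightarrow> c \<in> carrier U \<Longrightarrow> d \<in> carrier H \<Longrightarrow> (\<lambda>e. ?f a b c d e) \<in> lin k H AUB"
    by (intro lin_intros; simp)+
  have "(\<lambda>X. eval5 a a' b b' X) \<in> lin k HHUHH AUB"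
    unfolding eval5_def by (rule tsum5_lin(1)[OF _ _ _ _ _ _ f]) simp_all
  then show "eval5 a a' b b' \<in> lin k HHUHH AUB" by simp
  show "c1 \<in> carrier H \<Longrightarrow> c2 \<in> carrier H \<Longrightarrow> c3 \<in> carrier U \<Longrightarrow> c4 \<in> carrier H \<Longrightarrow> c5 \<in> carrier H \<Longrightarrow>
    eval5 a a' b b' (tens5 k H H U H H c1 c2 c3 c4 c5) = ?f c1 c2 c3 c4 c5"
    unfolding eval5_def by (rule tsum5_lin(2)[OF _ _ _ _ _ _ f]) simp_all
qed

end

lemma eval5_lin_arg:
  assumes X: "X \<in> carrier HHUHH"
  shows "a' \<in> carrier A \<Longrightarrow> b \<in> carrier B \<Longrightarrow> b' \<in> carrier B \<Longrightarrow> (\<lambda>a. eval5 a a' b b' X) \<in> lin k A AUB"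
    and "a \<in> carrier A \<Longrightarrow> b \<in> carrier B \<Longrightarrow> b' \<in> carrier B \<Longrightarrow> (\<lambda>a'. eval5 a a' b b' X) \<in> lin k A AUB"
    and "a \<in> carrier A \<Longrightarrow> a' \<in> carrier A \<Longrightarrow> b' \<in> carrier B \<Longrightarrow> (\<lambda>b. eval5 a a' b b' X) \<in> lin k B AUB"
    and "a \<in> carrier A \<Longrightarrow> a' \<in> carrier A \<Longrightarrow> b \<in> carrier B \<Longrightarrow> (\<lambda>b'. eval5 a a' b b' X) \<in> lin k B AUB"
  unfolding eval5_def
  by (rule tsum_lin_param[of H HUHH, OF _ _ _ _ X] tsum_lin_param[of H UHH] tsum_lin_param[of U H2]
      tsum_lin_param[of H H] | (intro lin_intros mod_lin)[1] | simp)+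

text \<open>On \<open>A\<close> the earlier action of \<open>h\<close> is a right factor of the
  coefficient. On \<open>B\<close> the action is from the right, so the earlier action of
  \<open>m\<close> is a left factor.\<close>

lemma eval5_action:
  assumes ab: "a \<in> carrier A" "a' \<in> carrier A" "b \<in> carrier B" "b' \<in> carrier B"
    and h: "h \<in> carrier H" "h' \<in> carrier H" "m \<in> carrier H" "m' \<in> carrier H" and X: "X \<in> carrier HHUHH"
  shows "eval5 (l h a) (l h' a') (r b m) (r b' m') X
    = eval5 a a' b b' (in45 (tens k H H m m') \<otimes>\<^bsub>HHUHH\<^esub> X \<otimes>\<^bsub>HHUHH\<^esub> app2 H H UHH \<one>\<^bsub>UHH\<^esub> (tens k H H h h'))"
proof (rule lin_eq5I[where f = "\<lambda>X. eval5 (l h a) (l h' a') (r b m) (r b' m') X"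
      and g = "\<lambda>X. eval5 a a' b b' (in45 (tens k H H m m') \<otimes>\<^bsub>HHUHH\<^esub> X \<otimes>\<^bsub>HHUHH\<^esub> app2 H H UHH \<one>\<^bsub>UHH\<^esub> (tens k H H h h'))"
      and P = AUB, OF _ _ _ _ _ _ _ _ X])
  show "(\<lambda>X. eval5 a a' b b' (in45 (tens k H H m m') \<otimes>\<^bsub>HHUHH\<^esub> X \<otimes>\<^bsub>HHUHH\<^esub> app2 H H UHH \<one>\<^bsub>UHH\<^esub> (tens k H H h h'))) \<in> lin k HHUHH AUB"
    by (intro lin_intros lin_comp[OF eval5_lin]; use ab h in simp)
qed (use ab h in \<open>simp_all add: l_mult r_mult\<close>)

lemma mult_l: "h \<in> carrier H \<Longrightarrow> a \<in> carrier A \<Longrightarrow> a' \<in> carrier A \<Longrightarrow>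
    l h (a \<otimes>\<^bsub>A\<^esub> a') = tsum A (Dl h) (\<lambda>h1 h2. l h1 a \<otimes>\<^bsub>A\<^esub> l h2 a')"
  by (rule la.action_mult)

lemma mult_r: "h \<in> carrier H \<Longrightarrow> b \<in> carrier B \<Longrightarrow> b' \<in> carrier B \<Longrightarrow>
    r (b \<otimes>\<^bsub>B\<^esub> b') h = tsum B (Dl h) (\<lambda>h1 h2. r b h1 \<otimes>\<^bsub>B\<^esub> r b' h2)"
  by (rule ra.action_mult)

text \<open>The module algebra axioms distribute the first and the last component of the coefficient
  over the two factors, which amounts to comultiplying both \<open>H\<close>-slots.\<close>

lemma eval3_mult:
  assumes ab [simp]: "a \<in> carrier A" "a' \<in> carrier A" "b \<in> carrier B" "b' \<in> carrier B" and X: "X \<in> carrier HUH"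
  shows "eval3 (a \<otimes>\<^bsub>A\<^esub> a') (b \<otimes>\<^bsub>B\<^esub> b') X = eval5 a a' b b' (D14 X)"
proof (rule lin_eq3I[where f = "eval3 (a \<otimes>\<^bsub>A\<^esub> a') (b \<otimes>\<^bsub>B\<^esub> b')" and g = "\<lambda>X. eval5 a a' b b' (D14 X)" and P = AUB,
      OF _ _ _ _ _ _ X])
  fix h u m assume hum [simp]: "h \<in> carrier H" "u \<in> carrier U" "m \<in> carrier H"
  have f1: "bilinear_on k H H A (\<lambda>h1 h2. l h1 a \<otimes>\<^bsub>A\<^esub> l h2 a')"
    by (intro bilinear_onI lin_intros; simp)
  have f2: "bilinear_on k H H B (\<lambda>h1 h2. r b h1 \<otimes>\<^bsub>B\<^esub> r b' h2)"
    by (intro bilinear_onI lin_intros; simp)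
  let ?fA = "\<lambda>Y. tsum A Y (\<lambda>h1 h2. l h1 a \<otimes>\<^bsub>A\<^esub> l h2 a')"
  let ?fB = "\<lambda>Z. tsum B Z (\<lambda>h1 h2. r b h1 \<otimes>\<^bsub>B\<^esub> r b' h2)"
  have fA: "?fA \<in> lin k H2 A" by (rule tsum_lin[OF _ _ _ f1]) simp_all
  have fB: "?fB \<in> lin k H2 B" by (rule tsum_lin[OF _ _ _ f2]) simp_all
  have 1: "tens3 k A U B (?fA Y) u (?fB Z) = eval5 a a' b b' (app2 H H UHH (tens k U H2 u Z) Y)"
    if Y: "Y \<in> carrier H2" and Z: "Z \<in> carrier H2" for Y Z
    using md_H md_H Y
  proof (induct Y rule: tensor_induct')
    case (tens p q)
    show ?case using md_H md_H Z
      by (induct Z rule: tensor_induct')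
        (use tens in \<open>simp_all add: tsum_tens[OF _ _ _ f1] tsum_tens[OF _ _ _ f2] lin_add[OF fB] lin_closed[OF fB]
          additivity lin_add[OF eval5_lin]\<close>)
  qed (use Z in \<open>simp_all add: lin_add[OF fA] lin_closed[OF fA] lin_closed[OF fB] additivity lin_add[OF eval5_lin]\<close>)
  show "eval3 (a \<otimes>\<^bsub>A\<^esub> a') (b \<otimes>\<^bsub>B\<^esub> b') (tens3 k H U H h u m) = eval5 a a' b b' (D14 (tens3 k H U H h u m))"
    by (simp add: mult_l mult_r 1)
qed (simp_all add: lin_comp[OF eval5_lin] lin_comp[OF tsplit_lin tmap_r_lin])

definition smash where "smash P Q = two_sided_smash_mult k H A l U B r P Q"

definition smash_pure where "smash_pure a u b a' u' b' = eval5 a a' b b' (smash_coeff (tens3 k H U H \<one>\<^bsub>H\<^esub> u \<one>\<^bsub>H\<^esub>) (tens3 k H U H \<one>\<^bsub>H\<^esub> u' \<one>\<^bsub>H\<^esub>))"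

text \<open>The parameters \<open>h\<close>, \<open>h'\<close>, \<open>m\<close>, \<open>m'\<close>
  are carried along so that one statement serves two readings in \<open>smash_eval3\<close>: as
  actions on the elements and as entries of the coefficients.\<close>

lemma smash_terms:
  assumes a [simp]: "a \<in> carrier A" "a' \<in> carrier A" "b \<in> carrier B" "b' \<in> carrier B" "u \<in> carrier U" "u' \<in> carrier U"
    and h [simp]: "h \<in> carrier H" "h' \<in> carrier H" "m \<in> carrier H" "m' \<in> carrier H"
  shows "tsum3 AUB Pl' (\<lambda>xl1 xl2 xl3. tsum3 AUB Th' (\<lambda>t1 t2 t3. tsum3 AUB Pr' (\<lambda>xr1 xr2 xr3.
    tsum AUB (lam u) (\<lambda>um u0. tsum AUB (rho u') (\<lambda>u'0 u'1.
      tens3 k A U B (l xl1 (l h a) \<otimes>\<^bsub>A\<^esub> l (xl2 \<otimes>\<^bsub>H\<^esub> um \<otimes>\<^bsub>H\<^esub> t1) (l h' a'))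
        (xl3 \<otimes>\<^bsub>U\<^esub> u0 \<otimes>\<^bsub>U\<^esub> t2 \<otimes>\<^bsub>U\<^esub> u'0 \<otimes>\<^bsub>U\<^esub> xr1)
        (r (r b m) (t3 \<otimes>\<^bsub>H\<^esub> u'1 \<otimes>\<^bsub>H\<^esub> xr2) \<otimes>\<^bsub>B\<^esub> r (r b' m') xr3))))))
    = eval5 a a' b b' (smash_coeff (tens3 k H U H h u m) (tens3 k H U H h' u' m'))"
proof -
  \<comment> \<open>All data of the product formula as separate linear arguments. The five sums are
    then removed one at a time, from the innermost outwards.\<close>
  define Z where "Z P L T W R = eval5 a a' b b' (pad5 P \<otimes>\<^bsub>HHUHH\<^esub> tens k H HUHH h (app2 H U H2 (tens k H H m \<one>\<^bsub>H\<^esub>) L)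
    \<otimes>\<^bsub>HHUHH\<^esub> in2 (pad4 T \<otimes>\<^bsub>HUHH\<^esub> tens k H UHH h' (app2 U H H m' W) \<otimes>\<^bsub>HUHH\<^esub> in1 R))" for P L T W R
  have lin: "(\<lambda>W. Z Px Lx Tx W Rx) \<in> lin k UH AUB" "(\<lambda>L. Z Px L Tx Wx Rx) \<in> lin k HU AUB"
    "(\<lambda>R. Z Px Lx Tx Wx R) \<in> lin k UHH AUB" "(\<lambda>T. Z Px Lx T Wx Rx) \<in> lin k HUH AUB"
    "(\<lambda>P. Z P Lx Tx Wx Rx) \<in> lin k HHU AUB"
    if "Px \<in> carrier HHU" "Lx \<in> carrier HU" "Tx \<in> carrier HUH" "Wx \<in> carrier UH" "Rx \<in> carrier UHH"
    for Px Lx Tx Wx Rx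
    unfolding Z_def
    by (intro lin_comp[OF eval5_lin] lin_intros'; use that in simp)+
  have 1: "tsum AUB (rho u') (\<lambda>u'0 u'1.
      tens3 k A U B (l xl1 (l h a) \<otimes>\<^bsub>A\<^esub> l (xl2 \<otimes>\<^bsub>H\<^esub> um \<otimes>\<^bsub>H\<^esub> t1) (l h' a'))
        (xl3 \<otimes>\<^bsub>U\<^esub> u0 \<otimes>\<^bsub>U\<^esub> t2 \<otimes>\<^bsub>U\<^esub> u'0 \<otimes>\<^bsub>U\<^esub> xr1)
        (r (r b m) (t3 \<otimes>\<^bsub>H\<^esub> u'1 \<otimes>\<^bsub>H\<^esub> xr2) \<otimes>\<^bsub>B\<^esub> r (r b' m') xr3))
    = Z (tens3 k H H U xl1 xl2 xl3) (tens k H U um u0) (tens3 k H U H t1 t2 t3) (rho u') (tens3 k U H H xr1 xr2 xr3)"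
    if [simp]: "xl1 \<in> carrier H" "xl2 \<in> carrier H" "xl3 \<in> carrier U" "um \<in> carrier H" "u0 \<in> carrier U"
      "t1 \<in> carrier H" "t2 \<in> carrier U" "t3 \<in> carrier H" "xr1 \<in> carrier U" "xr2 \<in> carrier H" "xr3 \<in> carrier H"
    for xl1 xl2 xl3 um u0 t1 t2 t3 xr1 xr2 xr3
    \<comment> \<open>\<open>q_rho\<close> is just some element of \<open>UH\<close>: the claims of
      \<open>lin\<close> share their membership premises, and the premise on the argument that is
      bound here needs a witness.\<close>
    by (rule tsum_eq_lin[OF _ _ _ lin(1)[OF _ _ _ q_rho_closed]]) (simp_all add: Z_def l_mult r_mult alg_assoc)
  have 2: "tsum AUB (lam u) (\<lambda>um u0. tsum AUB (rho u') (\<lambda>u'0 u'1.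
      tens3 k A U B (l xl1 (l h a) \<otimes>\<^bsub>A\<^esub> l (xl2 \<otimes>\<^bsub>H\<^esub> um \<otimes>\<^bsub>H\<^esub> t1) (l h' a'))
        (xl3 \<otimes>\<^bsub>U\<^esub> u0 \<otimes>\<^bsub>U\<^esub> t2 \<otimes>\<^bsub>U\<^esub> u'0 \<otimes>\<^bsub>U\<^esub> xr1)
        (r (r b m) (t3 \<otimes>\<^bsub>H\<^esub> u'1 \<otimes>\<^bsub>H\<^esub> xr2) \<otimes>\<^bsub>B\<^esub> r (r b' m') xr3)))
    = Z (tens3 k H H U xl1 xl2 xl3) (lam u) (tens3 k H U H t1 t2 t3) (rho u') (tens3 k U H H xr1 xr2 xr3)"
    if [simp]: "xl1 \<in> carrier H" "xl2 \<in> carrier H" "xl3 \<in> carrier U"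
      "t1 \<in> carrier H" "t2 \<in> carrier U" "t3 \<in> carrier H" "xr1 \<in> carrier U" "xr2 \<in> carrier H" "xr3 \<in> carrier H"
    for xl1 xl2 xl3 t1 t2 t3 xr1 xr2 xr3
    by (rule tsum_eq_lin[OF _ _ _ lin(2)[OF _ lam_closed[OF a(5)]]]) (simp_all add: 1)
  have 3: "tsum3 AUB Pr' (\<lambda>xr1 xr2 xr3. tsum AUB (lam u) (\<lambda>um u0. tsum AUB (rho u') (\<lambda>u'0 u'1.
      tens3 k A U B (l xl1 (l h a) \<otimes>\<^bsub>A\<^esub> l (xl2 \<otimes>\<^bsub>H\<^esub> um \<otimes>\<^bsub>H\<^esub> t1) (l h' a'))
        (xl3 \<otimes>\<^bsub>U\<^esub> u0 \<otimes>\<^bsub>U\<^esub> t2 \<otimes>\<^bsub>U\<^esub> u'0 \<otimes>\<^bsub>U\<^esub> xr1)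
        (r (r b m) (t3 \<otimes>\<^bsub>H\<^esub> u'1 \<otimes>\<^bsub>H\<^esub> xr2) \<otimes>\<^bsub>B\<^esub> r (r b' m') xr3))))
    = Z (tens3 k H H U xl1 xl2 xl3) (lam u) (tens3 k H U H t1 t2 t3) (rho u') Pr'"
    if [simp]: "xl1 \<in> carrier H" "xl2 \<in> carrier H" "xl3 \<in> carrier U"
      "t1 \<in> carrier H" "t2 \<in> carrier U" "t3 \<in> carrier H" for xl1 xl2 xl3 t1 t2 t3
    by (rule tsum3_eq_lin[OF _ _ _ _ lin(3)[OF _ _ _ _ Pr_closed(2)]]) (simp_all add: 2)
  have 4: "tsum3 AUB Th' (\<lambda>t1 t2 t3. tsum3 AUB Pr' (\<lambda>xr1 xr2 xr3. tsum AUB (lam u) (\<lambda>um u0. tsum AUB (rho u') (\<lambda>u'0 u'1.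
      tens3 k A U B (l xl1 (l h a) \<otimes>\<^bsub>A\<^esub> l (xl2 \<otimes>\<^bsub>H\<^esub> um \<otimes>\<^bsub>H\<^esub> t1) (l h' a'))
        (xl3 \<otimes>\<^bsub>U\<^esub> u0 \<otimes>\<^bsub>U\<^esub> t2 \<otimes>\<^bsub>U\<^esub> u'0 \<otimes>\<^bsub>U\<^esub> xr1)
        (r (r b m) (t3 \<otimes>\<^bsub>H\<^esub> u'1 \<otimes>\<^bsub>H\<^esub> xr2) \<otimes>\<^bsub>B\<^esub> r (r b' m') xr3)))))
    = Z (tens3 k H H U xl1 xl2 xl3) (lam u) Th' (rho u') Pr'"
    if [simp]: "xl1 \<in> carrier H" "xl2 \<in> carrier H" "xl3 \<in> carrier U" for xl1 xl2 xl3
    by (rule tsum3_eq_lin[OF _ _ _ _ lin(4)[OF _ _ Th_closed(2)]]) (simp_all add: 3)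
  have 5: "Z Pl' (lam u) Th' (rho u') Pr' = eval5 a a' b b' (smash_coeff (tens3 k H U H h u m) (tens3 k H U H h' u' m'))"
    by (simp add: Z_def smash_coeff_def smash_tail_def)
  show ?thesis
    unfolding 5[symmetric] by (rule tsum3_eq_lin[OF _ _ _ _ lin(5)[OF Pl_closed(2)]]) (simp_all add: 4)
qed

end

section \<open>The smash coefficient of two images under G\<close>

context crossed_base
begin

lemma smash_coeff_lin:
  assumes "f \<in> lin k M HUH"
  shows "g \<in> carrier HUH \<Longrightarrow> (\<lambda>x. smash_coeff (f x) g) \<in> lin k M HHUHH"
    and "g \<in> carrier HUH \<Longrightarrow> (\<lambda>x. smash_coeff g (f x)) \<in> lin k M HHUHH"
  unfolding smash_coeff_def smash_tail_def by (intro lin_intros' assms; simp)+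

text \<open>g(u) = g(1) (1 \<otimes> \<rho>(u)). In the product this \<rho>(u) has \<lambda> applied
  and stands to the left of \<theta>; \<open>coactions_commute'\<close> takes it across as
  \<lambda>(u) with \<rho> applied, which is a left factor of the second coefficient.\<close>

lemma smash_coeff_move:
  assumes u: "u \<in> carrier U" and g: "g' \<in> carrier HUH"
  shows "smash_coeff (iso_coeff u) g' = smash_coeff iso_coeff0 (dl H (tens k U H u \<one>\<^bsub>H\<^esub>) \<otimes>\<^bsub>HUH\<^esub> g')"
proof -
  have 1: "tmap_r H U UH rho (lam u) \<in> carrier HUH" using u by simp
  have p: "pad4 (tmap_r H U UH rho Y) = R3 (app2 H U H \<one>\<^bsub>H\<^esub> Y)" if "Y \<in> carrier HU" for Y
    using md_H md_U that by (induct Y rule: tensor_induct') (simp_all add: additivity)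
  have L: "Lam (in1 (app2 U H H \<one>\<^bsub>H\<^esub> (rho u))) = in2 (pad4 (dl H (rho u)))"
    using u by (simp add: tsplit_app2)
  have "pad4 (dl H (rho u)) \<otimes>\<^bsub>HUHH\<^esub> pad4 Th' = pad4 Th' \<otimes>\<^bsub>HUHH\<^esub> R3 (dl H (tens k U H u \<one>\<^bsub>H\<^esub>))"
  proof -
    have "pad4 (dl H (rho u)) \<otimes>\<^bsub>HUHH\<^esub> pad4 Th' = pad4 (Th' \<otimes>\<^bsub>HUH\<^esub> tmap_r H U UH rho (lam u))"
      using u by (simp add: app3_mult coactions_commute')
    also have "\<dots> = pad4 Th' \<otimes>\<^bsub>HUHH\<^esub> pad4 (tmap_r H U UH rho (lam u))"
      using u app3_mult[of H U H H "\<one>\<^bsub>H\<^esub>" "\<one>\<^bsub>H\<^esub>" Th' "tmap_r H U UH rho (lam u)"] by simp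
    finally show ?thesis using u p[of "lam u"] by simp
  qed
  then have q: "pad4 (dl H (rho u)) \<otimes>\<^bsub>HUHH\<^esub> smash_tail g' = smash_tail (dl H (tens k U H u \<one>\<^bsub>H\<^esub>) \<otimes>\<^bsub>HUH\<^esub> g')"
    using u g by (simp add: smash_tail_def tmap_r_mult alg_assoc[symmetric] del: tsplit_tens)
  have "smash_coeff (iso_coeff u) g' = pad5 Pl' \<otimes>\<^bsub>HHUHH\<^esub> (Lam (pad4 iso_coeff0) \<otimes>\<^bsub>HHUHH\<^esub> (Lam (in1 (app2 U H H \<one>\<^bsub>H\<^esub> (rho u))) \<otimes>\<^bsub>HHUHH\<^esub> in2 (smash_tail g')))"
  proof -
    have "pad4 (iso_coeff u) = pad4 iso_coeff0 \<otimes>\<^bsub>HUHH\<^esub> in1 (app2 U H H \<one>\<^bsub>H\<^esub> (rho u))"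
      using u app3_mult[of H U H H "\<one>\<^bsub>H\<^esub>" "\<one>\<^bsub>H\<^esub>" iso_coeff0 "tens k H UH \<one>\<^bsub>H\<^esub> (rho u)"] by (simp add: iso_coeff_def)
    then show ?thesis using u g by (simp add: smash_coeff_def tmap_r_mult alg_assoc)
  qed
  also have "\<dots> = pad5 Pl' \<otimes>\<^bsub>HHUHH\<^esub> (Lam (pad4 iso_coeff0) \<otimes>\<^bsub>HHUHH\<^esub> in2 (smash_tail (dl H (tens k U H u \<one>\<^bsub>H\<^esub>) \<otimes>\<^bsub>HUH\<^esub> g')))"
    unfolding L q[symmetric] using u g by simp
  finally show ?thesis using u g by (simp add: smash_coeff_def alg_assoc)
qed

text \<open>The extra factors sit in slot 5 on the left and in slot 2 on the right. The elements
  they have to pass carry units in these slots.\<close>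

lemma smash_coeff_outer:
  assumes s: "s \<in> carrier H" and m: "m \<in> carrier H" and g: "g \<in> carrier HUH"
  shows "smash_coeff iso_coeff0 (tens3 k H U H \<one>\<^bsub>H\<^esub> \<one>\<^bsub>U\<^esub> s \<otimes>\<^bsub>HUH\<^esub> g \<otimes>\<^bsub>HUH\<^esub> tens k H UH m \<one>\<^bsub>UH\<^esub>)
    = in45 (tens k H H \<one>\<^bsub>H\<^esub> s) \<otimes>\<^bsub>HHUHH\<^esub> smash_coeff iso_coeff0 g \<otimes>\<^bsub>HHUHH\<^esub> app2 H H UHH \<one>\<^bsub>UHH\<^esub> (tens k H H \<one>\<^bsub>H\<^esub> m)"
proof -
  let ?s4 = "tens4 k H U H H \<one>\<^bsub>H\<^esub> \<one>\<^bsub>U\<^esub> \<one>\<^bsub>H\<^esub> s" and ?s5 = "in45 (tens k H H \<one>\<^bsub>H\<^esub> s)"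
    and ?m = "tens k H UHH m \<one>\<^bsub>UHH\<^esub>"
  have c: "?s4 \<otimes>\<^bsub>HUHH\<^esub> pad4 X = pad4 X \<otimes>\<^bsub>HUHH\<^esub> ?s4" if "X \<in> carrier HUH" for X
    using s that by (intro last_slot_commute) simp_all
  have c5: "?s5 \<otimes>\<^bsub>HHUHH\<^esub> pad5 Pl' = pad5 Pl' \<otimes>\<^bsub>HHUHH\<^esub> ?s5"
    using s by (intro last_slot_commute) simp_all
  have sL: "?s5 = Lam ?s4" and s2: "?s5 = in2 ?s4" using s by simp_all
  have "smash_tail (tens3 k H U H \<one>\<^bsub>H\<^esub> \<one>\<^bsub>U\<^esub> s \<otimes>\<^bsub>HUH\<^esub> g \<otimes>\<^bsub>HUH\<^esub> tens k H UH m \<one>\<^bsub>UH\<^esub>)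
    = (pad4 Th' \<otimes>\<^bsub>HUHH\<^esub> ?s4) \<otimes>\<^bsub>HUHH\<^esub> (R3 g \<otimes>\<^bsub>HUHH\<^esub> (?m \<otimes>\<^bsub>HUHH\<^esub> in1 Pr'))"
    using s m g by (simp add: smash_tail_def tmap_r_mult alg_assoc)
  also have "?m \<otimes>\<^bsub>HUHH\<^esub> in1 Pr' = in1 Pr' \<otimes>\<^bsub>HUHH\<^esub> ?m" using m by simp
  finally have t: "smash_tail (tens3 k H U H \<one>\<^bsub>H\<^esub> \<one>\<^bsub>U\<^esub> s \<otimes>\<^bsub>HUH\<^esub> g \<otimes>\<^bsub>HUH\<^esub> tens k H UH m \<one>\<^bsub>UH\<^esub>)
    = ?s4 \<otimes>\<^bsub>HUHH\<^esub> smash_tail g \<otimes>\<^bsub>HUHH\<^esub> ?m"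
    unfolding c[OF Th_closed(2), symmetric] using s m g by (simp add: smash_tail_def alg_assoc del: tens_mult)
  have L: "Lam (pad4 iso_coeff0) \<otimes>\<^bsub>HHUHH\<^esub> ?s5 = ?s5 \<otimes>\<^bsub>HHUHH\<^esub> Lam (pad4 iso_coeff0)"
    unfolding sL using s c[OF iso_coeff0_closed] by (simp add: tmap_r_mult[symmetric] del: tmap_r_tens)
  have "smash_coeff iso_coeff0 (tens3 k H U H \<one>\<^bsub>H\<^esub> \<one>\<^bsub>U\<^esub> s \<otimes>\<^bsub>HUH\<^esub> g \<otimes>\<^bsub>HUH\<^esub> tens k H UH m \<one>\<^bsub>UH\<^esub>)
    = pad5 Pl' \<otimes>\<^bsub>HHUHH\<^esub> ((Lam (pad4 iso_coeff0) \<otimes>\<^bsub>HHUHH\<^esub> ?s5) \<otimes>\<^bsub>HHUHH\<^esub> (in2 (smash_tail g) \<otimes>\<^bsub>HHUHH\<^esub> in2 ?m))"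
    unfolding smash_coeff_def t using s m g by (simp add: alg_assoc)
  also have "\<dots> = (pad5 Pl' \<otimes>\<^bsub>HHUHH\<^esub> ?s5) \<otimes>\<^bsub>HHUHH\<^esub> (Lam (pad4 iso_coeff0) \<otimes>\<^bsub>HHUHH\<^esub> (in2 (smash_tail g) \<otimes>\<^bsub>HHUHH\<^esub> in2 ?m))"
    unfolding L using s m g by (simp add: alg_assoc del: tens_mult)
  also have "\<dots> = ?s5 \<otimes>\<^bsub>HHUHH\<^esub> smash_coeff iso_coeff0 g \<otimes>\<^bsub>HHUHH\<^esub> in2 ?m"
    unfolding c5[symmetric] smash_coeff_def using s m g by (simp add: alg_assoc del: tens_mult)
  finally show ?thesis using m by simp
qed

text \<open>\<open>q_rho_rho\<close> with \<lambda> applied moves u through q, at the price of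
  S\<inverse>(\<open>u1\<close>) on the left and \<rho>(\<open>u0\<close>) on the right. Past
  \<theta> the latter becomes \<rho> on the second slot of \<lambda>(\<open>u0\<close>) and joins
  \<rho>(u'). These are exactly the components of u in the crossed product.\<close>

lemma dl_iso_coeff:
  assumes u: "u \<in> carrier U" and u': "u' \<in> carrier U"
  shows "dl H (tens k U H u \<one>\<^bsub>H\<^esub>) \<otimes>\<^bsub>HUH\<^esub> iso_coeff u' = tsum HUH (rho u) (\<lambda>u0 u1. tsum HUH (lam u0) (\<lambda>m u00.
    tens3 k H U H \<one>\<^bsub>H\<^esub> \<one>\<^bsub>U\<^esub> (S' u1) \<otimes>\<^bsub>HUH\<^esub> iso_coeff (u00 \<otimes>\<^bsub>U\<^esub> u') \<otimes>\<^bsub>HUH\<^esub> tens k H UH m \<one>\<^bsub>UH\<^esub>))"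
proof -
  let ?t = "\<lambda>u0 u1. tens k U H \<one>\<^bsub>U\<^esub> (S' u1) \<otimes>\<^bsub>UH\<^esub> q_rho \<otimes>\<^bsub>UH\<^esub> rho u0"
  let ?L = "\<lambda>X. dl H X \<otimes>\<^bsub>HUH\<^esub> Th' \<otimes>\<^bsub>HUH\<^esub> tens k H UH \<one>\<^bsub>H\<^esub> (rho u')"
  have L: "?L \<in> lin k UH HUH" by (intro lin_intros'; use u' in simp)
  have "dl H (tens k U H u \<one>\<^bsub>H\<^esub>) \<otimes>\<^bsub>HUH\<^esub> iso_coeff u' = ?L (tens k U H u \<one>\<^bsub>H\<^esub> \<otimes>\<^bsub>UH\<^esub> q_rho)"
    using u u' by (simp add: iso_coeff_def iso_coeff0_def tsplit_mult alg_assoc del: tsplit_tens)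
  also have "\<dots> = ?L (tsum UH (rho u) ?t)" by (simp add: q_rho_rho[OF u])
  also have "\<dots> = tsum HUH (rho u) (\<lambda>u0 u1. ?L (?t u0 u1))"
    by (rule lin_tsum[where h = ?L and M = U and N = H, OF _ _ _ _ L]) (use u in simp_all)
  also have "\<dots> = tsum HUH (rho u) (\<lambda>u0 u1. tsum HUH (lam u0) (\<lambda>m u00.
    tens3 k H U H \<one>\<^bsub>H\<^esub> \<one>\<^bsub>U\<^esub> (S' u1) \<otimes>\<^bsub>HUH\<^esub> iso_coeff (u00 \<otimes>\<^bsub>U\<^esub> u') \<otimes>\<^bsub>HUH\<^esub> tens k H UH m \<one>\<^bsub>UH\<^esub>))"
  proof (rule tsum_cong[where k = k and M = U and N = H])
    fix u0 u1 assume [simp]: "u0 \<in> carrier U" "u1 \<in> carrier H"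
    let ?s = "tens3 k H U H \<one>\<^bsub>H\<^esub> \<one>\<^bsub>U\<^esub> (S' u1)"
    let ?M = "\<lambda>Y. ?s \<otimes>\<^bsub>HUH\<^esub> iso_coeff0 \<otimes>\<^bsub>HUH\<^esub> tmap_r H U UH rho Y \<otimes>\<^bsub>HUH\<^esub> tens k H UH \<one>\<^bsub>H\<^esub> (rho u')"
    have M: "?M \<in> lin k HU HUH" by (intro lin_intros'; use u' in simp)
    have s: "dl H (tens k U H \<one>\<^bsub>U\<^esub> (S' u1)) = ?s" by simp
    have "?L (?t u0 u1) = dl H (tens k U H \<one>\<^bsub>U\<^esub> (S' u1)) \<otimes>\<^bsub>HUH\<^esub> dl H q_rho \<otimes>\<^bsub>HUH\<^esub> (dl H (rho u0) \<otimes>\<^bsub>HUH\<^esub> Th')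
      \<otimes>\<^bsub>HUH\<^esub> tens k H UH \<one>\<^bsub>H\<^esub> (rho u')"
      using u' by (simp add: tsplit_mult alg_assoc del: tsplit_tens)
    also have "\<dots> = ?M (lam u0)"
      unfolding s using u' by (simp add: coactions_commute'[symmetric] iso_coeff0_def alg_assoc)
    also have "\<dots> = tsum HUH (lam u0) (\<lambda>m u00. ?s \<otimes>\<^bsub>HUH\<^esub> iso_coeff (u00 \<otimes>\<^bsub>U\<^esub> u') \<otimes>\<^bsub>HUH\<^esub> tens k H UH m \<one>\<^bsub>UH\<^esub>)"
      by (rule tsum_eq_lin[OF _ _ _ M, symmetric]) (use u' in \<open>simp_all add: iso_coeff_def rho_mult alg_assoc\<close>)
    finally show "?L (?t u0 u1) = tsum HUH (lam u0) (\<lambda>m u00. ?s \<otimes>\<^bsub>HUH\<^esub> iso_coeff (u00 \<otimes>\<^bsub>U\<^esub> u') \<otimes>\<^bsub>HUH\<^esub> tens k H UH m \<one>\<^bsub>UH\<^esub>)" .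
  qed (use u in simp_all)
  finally show ?thesis .
qed

text \<open>u is moved to the second coefficient, passed through q there, and its outer components
  are taken out of the product. The inner term is of the kind that \<open>omega_map_Omega\<close>
  identifies with \<Omega>.\<close>

lemma smash_coeff_iso_coeff_iso_coeff:
  assumes u: "u \<in> carrier U" and u': "u' \<in> carrier U"
  shows "smash_coeff (iso_coeff u) (iso_coeff u') = tsum HHUHH (rho u) (\<lambda>u0 u1. tsum HHUHH (lam u0) (\<lambda>m u00.
    in45 (tens k H H \<one>\<^bsub>H\<^esub> (S' u1)) \<otimes>\<^bsub>HHUHH\<^esub> smash_coeff iso_coeff0 (iso_coeff (u00 \<otimes>\<^bsub>U\<^esub> u'))
      \<otimes>\<^bsub>HHUHH\<^esub> app2 H H UHH \<one>\<^bsub>UHH\<^esub> (tens k H H \<one>\<^bsub>H\<^esub> m)))"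
proof -
  let ?t = "\<lambda>u1 m u00. tens3 k H U H \<one>\<^bsub>H\<^esub> \<one>\<^bsub>U\<^esub> (S' u1) \<otimes>\<^bsub>HUH\<^esub> iso_coeff (u00 \<otimes>\<^bsub>U\<^esub> u') \<otimes>\<^bsub>HUH\<^esub> tens k H UH m \<one>\<^bsub>UH\<^esub>"
  have Z: "smash_coeff iso_coeff0 \<in> lin k HUH HHUHH" using smash_coeff_lin(2)[OF lin_id iso_coeff0_closed] by simp
  have tc: "?t u1 m u00 \<in> carrier HUH" if "u1 \<in> carrier H" "m \<in> carrier H" "u00 \<in> carrier U" for u1 m u00
    using that u' by simp
  have "smash_coeff (iso_coeff u) (iso_coeff u') = smash_coeff iso_coeff0 (tsum HUH (rho u) (\<lambda>u0 u1. tsum HUH (lam u0) (?t u1)))"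
    using smash_coeff_move[OF u iso_coeff_closed[OF u']] dl_iso_coeff[OF u u'] by simp
  also have "\<dots> = tsum HHUHH (rho u) (\<lambda>u0 u1. smash_coeff iso_coeff0 (tsum HUH (lam u0) (?t u1)))"
    by (rule lin_tsum[where M = U and N = H, OF _ _ _ _ Z])
      (use u tc in \<open>auto intro!: tsum_closed'[of H U]\<close>)
  also have "\<dots> = tsum HHUHH (rho u) (\<lambda>u0 u1. tsum HHUHH (lam u0) (\<lambda>m u00.
    in45 (tens k H H \<one>\<^bsub>H\<^esub> (S' u1)) \<otimes>\<^bsub>HHUHH\<^esub> smash_coeff iso_coeff0 (iso_coeff (u00 \<otimes>\<^bsub>U\<^esub> u'))
      \<otimes>\<^bsub>HHUHH\<^esub> app2 H H UHH \<one>\<^bsub>UHH\<^esub> (tens k H H \<one>\<^bsub>H\<^esub> m)))"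
  proof (rule tsum_cong[where k = k and M = U and N = H])
    fix u0 u1 assume [simp]: "u0 \<in> carrier U" "u1 \<in> carrier H"
    have "smash_coeff iso_coeff0 (tsum HUH (lam u0) (?t u1)) = tsum HHUHH (lam u0) (\<lambda>m u00. smash_coeff iso_coeff0 (?t u1 m u00))"
      by (rule lin_tsum[where M = H and N = U, OF _ _ _ _ Z]) (use tc in simp_all)
    also have "\<dots> = tsum HHUHH (lam u0) (\<lambda>m u00.
      in45 (tens k H H \<one>\<^bsub>H\<^esub> (S' u1)) \<otimes>\<^bsub>HHUHH\<^esub> smash_coeff iso_coeff0 (iso_coeff (u00 \<otimes>\<^bsub>U\<^esub> u'))
        \<otimes>\<^bsub>HHUHH\<^esub> app2 H H UHH \<one>\<^bsub>UHH\<^esub> (tens k H H \<one>\<^bsub>H\<^esub> m))"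
      by (rule tsum_cong[where k = k and M = H and N = U], simp, simp, simp, rule smash_coeff_outer) (use u' in simp_all)
    finally show "smash_coeff iso_coeff0 (tsum HUH (lam u0) (?t u1)) = tsum HHUHH (lam u0) (\<lambda>m u00.
      in45 (tens k H H \<one>\<^bsub>H\<^esub> (S' u1)) \<otimes>\<^bsub>HHUHH\<^esub> smash_coeff iso_coeff0 (iso_coeff (u00 \<otimes>\<^bsub>U\<^esub> u'))
        \<otimes>\<^bsub>HHUHH\<^esub> app2 H H UHH \<one>\<^bsub>UHH\<^esub> (tens k H H \<one>\<^bsub>H\<^esub> m))" .
  qed (use u in simp_all)
  finally show ?thesis .
qed

end

context iso_base
begin

lemma tens3_unit_lin: "(\<lambda>u. tens3 k H U H \<one>\<^bsub>H\<^esub> u \<one>\<^bsub>H\<^esub>) \<in> lin k U HUH"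
  by (intro lin_intros; simp)

lemma smash_pure_lin:
  "u \<in> carrier U \<Longrightarrow> b \<in> carrier B \<Longrightarrow> a' \<in> carrier A \<Longrightarrow> u' \<in> carrier U \<Longrightarrow> b' \<in> carrier B \<Longrightarrow> (\<lambda>a. smash_pure a u b a' u' b') \<in> lin k A AUB"
  "a \<in> carrier A \<Longrightarrow> b \<in> carrier B \<Longrightarrow> a' \<in> carrier A \<Longrightarrow> u' \<in> carrier U \<Longrightarrow> b' \<in> carrier B \<Longrightarrow> (\<lambda>u. smash_pure a u b a' u' b') \<in> lin k U AUB"
  "u \<in> carrier U \<Longrightarrow> a \<in> carrier A \<Longrightarrow> a' \<in> carrier A \<Longrightarrow> u' \<in> carrier U \<Longrightarrow> b' \<in> carrier B \<Longrightarrow> (\<lambda>b. smash_pure a u b a' u' b') \<in> lin k B AUB"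
  "u \<in> carrier U \<Longrightarrow> b \<in> carrier B \<Longrightarrow> a \<in> carrier A \<Longrightarrow> u' \<in> carrier U \<Longrightarrow> b' \<in> carrier B \<Longrightarrow> (\<lambda>a'. smash_pure a u b a' u' b') \<in> lin k A AUB"
  "u \<in> carrier U \<Longrightarrow> b \<in> carrier B \<Longrightarrow> a' \<in> carrier A \<Longrightarrow> a \<in> carrier A \<Longrightarrow> b' \<in> carrier B \<Longrightarrow> (\<lambda>u'. smash_pure a u b a' u' b') \<in> lin k U AUB"
  "u \<in> carrier U \<Longrightarrow> b \<in> carrier B \<Longrightarrow> a' \<in> carrier A \<Longrightarrow> u' \<in> carrier U \<Longrightarrow> a \<in> carrier A \<Longrightarrow> (\<lambda>b'. smash_pure a u b a' u' b') \<in> lin k B AUB"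
  unfolding smash_pure_def
  by (simp_all add: eval5_lin_arg lin_comp[OF eval5_lin] smash_coeff_lin tens3_unit_lin)

definition smash_pure_left where "smash_pure_left a u b Q = tsum3 AUB Q (smash_pure a u b)"

lemma smash_pure_left_lin: "a \<in> carrier A \<Longrightarrow> u \<in> carrier U \<Longrightarrow> b \<in> carrier B \<Longrightarrow> (\<lambda>Q. smash_pure_left a u b Q) \<in> lin k AUB AUB"
  and smash_pure_left_tens: "a \<in> carrier A \<Longrightarrow> u \<in> carrier U \<Longrightarrow> b \<in> carrier B \<Longrightarrow> a' \<in> carrier A \<Longrightarrow> u' \<in> carrier U \<Longrightarrow> b' \<in> carrier B \<Longrightarrow>
    smash_pure_left a u b (tens3 k A U B a' u' b') = smash_pure a u b a' u' b'"
  unfolding smash_pure_left_def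
  by (rule tsum3_lin(1) tsum3_lin(2); simp add: smash_pure_lin)+

lemma smash_pure_left_lin_arg:
  assumes Q: "Q \<in> carrier AUB"
  shows "u \<in> carrier U \<Longrightarrow> b \<in> carrier B \<Longrightarrow> (\<lambda>a. smash_pure_left a u b Q) \<in> lin k A AUB"
    and "a \<in> carrier A \<Longrightarrow> b \<in> carrier B \<Longrightarrow> (\<lambda>u. smash_pure_left a u b Q) \<in> lin k U AUB"
    and "a \<in> carrier A \<Longrightarrow> u \<in> carrier U \<Longrightarrow> (\<lambda>b. smash_pure_left a u b Q) \<in> lin k B AUB"
  unfolding smash_pure_left_def
  by (rule tsum_lin_param[of A UB, OF _ _ _ _ Q], simp, simp, simp, simp, rule tsum_lin_param[of U B]; simp add: smash_pure_lin)+

lemma smash_eq: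
  assumes P: "P \<in> carrier AUB" and Q: "Q \<in> carrier AUB"
  shows "smash P Q = tsum3 AUB P (\<lambda>a u b. smash_pure_left a u b Q)"
  unfolding smash_def two_sided_smash_mult_def Let_def
proof (rule tsum3_cong[of A U B, OF _ _ _ P])
  fix a u b assume a: "a \<in> carrier A" "u \<in> carrier U" "b \<in> carrier B"
  show "tsum3 AUB Q (\<lambda>a' u' b'. tsum3 AUB Pl' (\<lambda>xl1 xl2 xl3. tsum3 AUB Th' (\<lambda>t1 t2 t3. tsum3 AUB Pr' (\<lambda>xr1 xr2 xr3.
    tsum AUB (lam u) (\<lambda>um u0. tsum AUB (rho u') (\<lambda>u'0 u'1.
      tens3 k A U B (l xl1 a \<otimes>\<^bsub>A\<^esub> l (xl2 \<otimes>\<^bsub>H\<^esub> um \<otimes>\<^bsub>H\<^esub> t1) a')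
        (xl3 \<otimes>\<^bsub>U\<^esub> u0 \<otimes>\<^bsub>U\<^esub> t2 \<otimes>\<^bsub>U\<^esub> u'0 \<otimes>\<^bsub>U\<^esub> xr1)
        (r b (t3 \<otimes>\<^bsub>H\<^esub> u'1 \<otimes>\<^bsub>H\<^esub> xr2) \<otimes>\<^bsub>B\<^esub> r b' xr3))))))) = smash_pure_left a u b Q"
    unfolding smash_pure_left_def
  proof (rule tsum3_cong[of A U B, OF _ _ _ Q])
    fix a' u' b' assume a': "a' \<in> carrier A" "u' \<in> carrier U" "b' \<in> carrier B"
    show "tsum3 AUB Pl' (\<lambda>xl1 xl2 xl3. tsum3 AUB Th' (\<lambda>t1 t2 t3. tsum3 AUB Pr' (\<lambda>xr1 xr2 xr3.
    tsum AUB (lam u) (\<lambda>um u0. tsum AUB (rho u') (\<lambda>u'0 u'1.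
      tens3 k A U B (l xl1 a \<otimes>\<^bsub>A\<^esub> l (xl2 \<otimes>\<^bsub>H\<^esub> um \<otimes>\<^bsub>H\<^esub> t1) a')
        (xl3 \<otimes>\<^bsub>U\<^esub> u0 \<otimes>\<^bsub>U\<^esub> t2 \<otimes>\<^bsub>U\<^esub> u'0 \<otimes>\<^bsub>U\<^esub> xr1)
        (r b (t3 \<otimes>\<^bsub>H\<^esub> u'1 \<otimes>\<^bsub>H\<^esub> xr2) \<otimes>\<^bsub>B\<^esub> r b' xr3)))))) = smash_pure a u b a' u' b'"
      using smash_terms[of a a' b b' u u' "\<one>\<^bsub>H\<^esub>" "\<one>\<^bsub>H\<^esub>" "\<one>\<^bsub>H\<^esub>" "\<one>\<^bsub>H\<^esub>"] a a' by (simp add: smash_pure_def)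
  qed simp_all
qed simp_all

lemma smash_lin:
  assumes Q: "Q \<in> carrier AUB"
  shows "(\<lambda>P. smash P Q) \<in> lin k AUB AUB" and "(\<lambda>P. smash Q P) \<in> lin k AUB AUB"
    and smash_tens: "a \<in> carrier A \<Longrightarrow> u \<in> carrier U \<Longrightarrow> b \<in> carrier B \<Longrightarrow> smash (tens3 k A U B a u b) Q = smash_pure_left a u b Q"
proof -
  have L: "(\<lambda>P. tsum3 AUB P (\<lambda>a u b. smash_pure_left a u b Q)) \<in> lin k AUB AUB" if Q: "Q \<in> carrier AUB" for Q
    by (rule tsum3_lin(1)) (simp_all add: smash_pure_left_lin_arg Q)
  show "(\<lambda>P. smash P Q) \<in> lin k AUB AUB"
    using L[OF Q] by (simp add: lin_def smash_eq Q Pi_iff)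
  have "(\<lambda>P. tsum3 AUB Q (\<lambda>a u b. smash_pure_left a u b P)) \<in> lin k AUB AUB"
    by (rule tsum_lin_param[of A UB, OF _ _ _ _ Q], simp, simp, simp, simp, rule tsum_lin_param[of U B]; simp add: smash_pure_left_lin)
  then show "(\<lambda>P. smash Q P) \<in> lin k AUB AUB"
    using L by (simp add: lin_def smash_eq Q Pi_iff)
  show "smash (tens3 k A U B a u b) Q = smash_pure_left a u b Q"
    if "a \<in> carrier A" "u \<in> carrier U" "b \<in> carrier B"
    using that Q by (simp add: smash_eq) (rule tsum3_lin(2); simp add: smash_pure_left_lin_arg Q)
qed

text \<open>Linearity reduces the claim to pure coefficients. There \<open>smash_terms\<close> is
  used twice, once for the acted-on elements with trivial entries and once for the original
  elements, and the two sums agree.\<close>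

lemma smash_eval3:
  assumes ab [simp]: "a \<in> carrier A" "a' \<in> carrier A" "b \<in> carrier B" "b' \<in> carrier B"
    and g: "g \<in> carrier HUH" and g': "g' \<in> carrier HUH"
  shows "smash (eval3 a b g) (eval3 a' b' g') = eval5 a a' b b' (smash_coeff g g')"
proof (rule lin_eq3I[where f = "\<lambda>g. smash (eval3 a b g) (eval3 a' b' g')" and g = "\<lambda>g. eval5 a a' b b' (smash_coeff g g')" and P = AUB,
      OF _ _ _ _ _ _ g])
  show "(\<lambda>g. smash (eval3 a b g) (eval3 a' b' g')) \<in> lin k HUH AUB"
    by (rule lin_comp[OF smash_lin(1)]) (use g' in simp_all)
  show "(\<lambda>g. eval5 a a' b b' (smash_coeff g g')) \<in> lin k HUH AUB"
    by (rule lin_comp[OF eval5_lin smash_coeff_lin(1)]) (use g' in \<open>simp_all add: lin_id\<close>)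
  fix h u m assume hum [simp]: "h \<in> carrier H" "u \<in> carrier U" "m \<in> carrier H"
  show "smash (eval3 a b (tens3 k H U H h u m)) (eval3 a' b' g') = eval5 a a' b b' (smash_coeff (tens3 k H U H h u m) g')"
  proof (rule lin_eq3I[where f = "\<lambda>g'. smash (eval3 a b (tens3 k H U H h u m)) (eval3 a' b' g')"
        and g = "\<lambda>g'. eval5 a a' b b' (smash_coeff (tens3 k H U H h u m) g')" and P = AUB, OF _ _ _ _ _ _ g'])
    show "(\<lambda>g'. smash (eval3 a b (tens3 k H U H h u m)) (eval3 a' b' g')) \<in> lin k HUH AUB"
      by (rule lin_comp[OF smash_lin(2)]) simp_all
    show "(\<lambda>g'. eval5 a a' b b' (smash_coeff (tens3 k H U H h u m) g')) \<in> lin k HUH AUB"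
      by (rule lin_comp[OF eval5_lin smash_coeff_lin(2)]) (simp_all add: lin_id)
    fix h' u' m' assume hum' [simp]: "h' \<in> carrier H" "u' \<in> carrier U" "m' \<in> carrier H"
    show "smash (eval3 a b (tens3 k H U H h u m)) (eval3 a' b' (tens3 k H U H h' u' m'))
      = eval5 a a' b b' (smash_coeff (tens3 k H U H h u m) (tens3 k H U H h' u' m'))"
    proof -
      have "smash (eval3 a b (tens3 k H U H h u m)) (eval3 a' b' (tens3 k H U H h' u' m'))
        = eval5 (l h a) (l h' a') (r b m) (r b' m') (smash_coeff (tens3 k H U H \<one>\<^bsub>H\<^esub> u \<one>\<^bsub>H\<^esub>) (tens3 k H U H \<one>\<^bsub>H\<^esub> u' \<one>\<^bsub>H\<^esub>))"
        by (simp add: smash_tens smash_pure_left_tens smash_pure_def)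
      also have "\<dots> = eval5 a a' b b' (smash_coeff (tens3 k H U H h u m) (tens3 k H U H h' u' m'))"
        using smash_terms[of "l h a" "l h' a'" "r b m" "r b' m'" u u' "\<one>\<^bsub>H\<^esub>" "\<one>\<^bsub>H\<^esub>" "\<one>\<^bsub>H\<^esub>" "\<one>\<^bsub>H\<^esub>"]
          smash_terms[of a a' b b' u u' h h' m m'] by simp
      finally show ?thesis .
    qed
  qed simp_all
qed simp_all

end

text \<open>Outside its context \<open>Omega_closed\<close> still carries the parameter
  \<open>v\<close>; the unit is taken for it.\<close>

lemma (in crossed_base) Omega_carrier [simp]: "Omega k H U \<in> carrier HHUHH"
  by (rule Omega_closed[of "\<one>\<^bsub>U\<^esub>"]) simp

section \<open>Multiplicativity of G\<close>

context iso_base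
begin

abbreviation "tL \<equiv> tensor_lact k A B l"
abbreviation "tR \<equiv> tensor_ract k A B r"

lemma tL_bilin: "h \<in> carrier H \<Longrightarrow> bilinear_on k A B AB (\<lambda>a b. tens k A B (l h a) b)"
  by (intro bilinear_onI lin_intros; simp)

lemma tR_bilin: "h \<in> carrier H \<Longrightarrow> bilinear_on k A B AB (\<lambda>a b. tens k A B a (r b h))"
  by (intro bilinear_onI lin_intros; simp)

lemma tL_lin [simp]: "h \<in> carrier H \<Longrightarrow> tL h \<in> lin k AB AB"
  using tsum_lin[OF md_AB tL_bilin] by (simp add: tensor_lact_def[abs_def])

lemma tR_lin [simp]: "h \<in> carrier H \<Longrightarrow> (\<lambda>X. tR X h) \<in> lin k AB AB"
  using tsum_lin[OF md_AB tR_bilin] by (simp add: tensor_ract_def[abs_def])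

lemma tL_lin_arg [simp]: "X \<in> carrier AB \<Longrightarrow> (\<lambda>h. tL h X) \<in> lin k H AB"
  unfolding tensor_lact_def by (rule tsum_lin_param[OF md_AB md_H]; (intro lin_intros)?; simp)

lemma tR_lin_arg [simp]: "X \<in> carrier AB \<Longrightarrow> tR X \<in> lin k H AB"
proof -
  assume X: "X \<in> carrier AB"
  have "(\<lambda>h. tR X h) \<in> lin k H AB"
    unfolding tensor_ract_def by (rule tsum_lin_param[OF md_AB md_H X]) (intro lin_intros; simp)
  then show ?thesis by simp
qed

lemma tL_tens [simp]: "h \<in> carrier H \<Longrightarrow> a \<in> carrier A \<Longrightarrow> b \<in> carrier B \<Longrightarrow>
    tL h (tens k A B a b) = tens k A B (l h a) b"
  unfolding tensor_lact_def by (rule tsum_tens[OF md_AB tL_bilin])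

lemma tR_tens [simp]: "h \<in> carrier H \<Longrightarrow> a \<in> carrier A \<Longrightarrow> b \<in> carrier B \<Longrightarrow>
    tR (tens k A B a b) h = tens k A B a (r b h)"
  unfolding tensor_ract_def by (rule tsum_tens[OF md_AB tR_bilin])

lemma tL_closed [simp]: "h \<in> carrier H \<Longrightarrow> X \<in> carrier AB \<Longrightarrow> tL h X \<in> carrier AB"
  by (rule lin_closed[OF tL_lin])

lemma tR_closed [simp]: "h \<in> carrier H \<Longrightarrow> X \<in> carrier AB \<Longrightarrow> tR X h \<in> carrier AB"
  by (rule lin_closed[OF tR_lin])

lemma iso_coeff_lin [simp]: "iso_coeff \<in> lin k U HUH"
proof -
  have "(\<lambda>u. iso_coeff u) \<in> lin k U HUH"
    unfolding iso_coeff_def by (intro lin_intros; simp)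
  then show ?thesis by simp
qed

definition crossed_to_smash where "crossed_to_smash X = tsum AUB X (\<lambda>c u. tsum AUB c (\<lambda>a b. eval3 a b (iso_coeff u)))"

lemma crossed_to_smash_inner:
  assumes u: "u \<in> carrier U"
  shows "(\<lambda>c. tsum AUB c (\<lambda>a b. eval3 a b (iso_coeff u))) \<in> lin k AB AUB"
    and "a \<in> carrier A \<Longrightarrow> b \<in> carrier B \<Longrightarrow> tsum AUB (tens k A B a b) (\<lambda>a b. eval3 a b (iso_coeff u)) = eval3 a b (iso_coeff u)"
  by (rule tsum2_lin(1) tsum2_lin(2); use u in \<open>simp add: eval3_lin_arg\<close>)+

lemma crossed_to_smash_inner_arg: "c \<in> carrier AB \<Longrightarrow> (\<lambda>u. tsum AUB c (\<lambda>a b. eval3 a b (iso_coeff u))) \<in> lin k U AUB"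
  by (rule tsum_lin_param[of A B]; (rule lin_comp[OF eval3_lin])?; simp)

lemma crossed_to_smash_lin [simp]: "crossed_to_smash \<in> lin k ABU AUB"
  and crossed_to_smash_tens: "c \<in> carrier AB \<Longrightarrow> u \<in> carrier U \<Longrightarrow> crossed_to_smash (tens k AB U c u) = tsum AUB c (\<lambda>a b. eval3 a b (iso_coeff u))"
proof -
  have "(\<lambda>X. crossed_to_smash X) \<in> lin k ABU AUB"
    unfolding crossed_to_smash_def by (rule tsum2_lin(1)) (simp_all add: crossed_to_smash_inner crossed_to_smash_inner_arg)
  then show "crossed_to_smash \<in> lin k ABU AUB" by simp
  show "c \<in> carrier AB \<Longrightarrow> u \<in> carrier U \<Longrightarrow> crossed_to_smash (tens k AB U c u) = tsum AUB c (\<lambda>a b. eval3 a b (iso_coeff u))"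
    unfolding crossed_to_smash_def by (rule tsum2_lin(2)) (simp_all add: crossed_to_smash_inner crossed_to_smash_inner_arg)
qed

lemma crossed_to_smash_tens3 [simp]: "a \<in> carrier A \<Longrightarrow> b \<in> carrier B \<Longrightarrow> u \<in> carrier U \<Longrightarrow>
    crossed_to_smash (tens k AB U (tens k A B a b) u) = eval3 a b (iso_coeff u)"
  by (simp add: crossed_to_smash_tens crossed_to_smash_inner)

lemma crossed_to_smash_closed [simp]: "X \<in> carrier ABU \<Longrightarrow> crossed_to_smash X \<in> carrier AUB"
  by (rule lin_closed[OF crossed_to_smash_lin])

definition cross where "cross P Q = diag_crossed_mult k H AB tL tR U P Q"

definition crossed_pure where "crossed_pure c u c' u' = tsum5 ABU (Omega k H U) (\<lambda>o1 o2 o3 o4 o5.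
    tsum ABU (rho u) (\<lambda>u0 u1. tsum ABU (lam u0) (\<lambda>u0m u00. tens k AB U
        (tR (tL o1 c) o5 \<otimes>\<^bsub>AB\<^esub> tR (tL (o2 \<otimes>\<^bsub>H\<^esub> u0m) c') (S' u1 \<otimes>\<^bsub>H\<^esub> o4))
        (o3 \<otimes>\<^bsub>U\<^esub> u00 \<otimes>\<^bsub>U\<^esub> u'))))"

lemma cross_eq: "cross P Q = tsum ABU P (\<lambda>c u. tsum ABU Q (\<lambda>c' u'. crossed_pure c u c' u'))"
  by (simp add: cross_def diag_crossed_mult_def crossed_pure_def Let_def)

context
  fixes u u'
  assumes u [simp]: "u \<in> carrier U" "u' \<in> carrier U"
begin

lemma crossed_pure_inner_closed:
  assumes "c \<in> carrier AB" "c' \<in> carrier AB" "o1 \<in> carrier H" "o2 \<in> carrier H" "o3 \<in> carrier U" "o4 \<in> carrier H" "o5 \<in> carrier H"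
  shows "tsum ABU (rho u) (\<lambda>u0 u1. tsum ABU (lam u0) (\<lambda>u0m u00. tens k AB U
        (tR (tL o1 c) o5 \<otimes>\<^bsub>AB\<^esub> tR (tL (o2 \<otimes>\<^bsub>H\<^esub> u0m) c') (S' u1 \<otimes>\<^bsub>H\<^esub> o4))
        (o3 \<otimes>\<^bsub>U\<^esub> u00 \<otimes>\<^bsub>U\<^esub> u'))) \<in> carrier ABU"
  by (rule tsum_closed'[of U H], simp, simp, simp, simp, rule tsum_closed'[of H U]) (use assms in simp_all)

lemma crossed_pure_closed: "c \<in> carrier AB \<Longrightarrow> c' \<in> carrier AB \<Longrightarrow> crossed_pure c u c' u' \<in> carrier ABU"
  unfolding crossed_pure_def by (rule tsum5_closed[of H H U H H]) (simp_all add: crossed_pure_inner_closed)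

lemma crossed_pure_lin:
  assumes c: "c \<in> carrier AB"
  shows "(\<lambda>c'. crossed_pure c u c' u') \<in> lin k AB ABU" and "(\<lambda>c'. crossed_pure c' u c u') \<in> lin k AB ABU"
proof -
  have "(\<lambda>c'. tsum ABU (rho u) (\<lambda>u0 u1. tsum ABU (lam u0) (\<lambda>u0m u00. tens k AB U
        (tR (tL o1 c) o5 \<otimes>\<^bsub>AB\<^esub> tR (tL (o2 \<otimes>\<^bsub>H\<^esub> u0m) c') (S' u1 \<otimes>\<^bsub>H\<^esub> o4))
        (o3 \<otimes>\<^bsub>U\<^esub> u00 \<otimes>\<^bsub>U\<^esub> u')))) \<in> lin k AB ABU"
    "(\<lambda>c'. tsum ABU (rho u) (\<lambda>u0 u1. tsum ABU (lam u0) (\<lambda>u0m u00. tens k AB U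
        (tR (tL o1 c') o5 \<otimes>\<^bsub>AB\<^esub> tR (tL (o2 \<otimes>\<^bsub>H\<^esub> u0m) c) (S' u1 \<otimes>\<^bsub>H\<^esub> o4))
        (o3 \<otimes>\<^bsub>U\<^esub> u00 \<otimes>\<^bsub>U\<^esub> u')))) \<in> lin k AB ABU"
    if "o1 \<in> carrier H" "o2 \<in> carrier H" "o3 \<in> carrier U" "o4 \<in> carrier H" "o5 \<in> carrier H" for o1 o2 o3 o4 o5
    by (rule tsum_lin_param[of U H], simp, simp, simp, simp, simp,
      rule tsum_lin_param[of H U], simp, simp, simp, simp, simp,
      intro lin_intros lin_comp[OF tL_lin] lin_comp[OF tR_lin]; use c that in simp)+
  then show "(\<lambda>c'. crossed_pure c u c' u') \<in> lin k AB ABU" "(\<lambda>c'. crossed_pure c' u c u') \<in> lin k AB ABU"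
    unfolding crossed_pure_def by (intro tsum5_lin_param[of H H U H H]; simp)+
qed

text \<open>Both sides are values of \<open>eval5 a a' b b'\<close>. On the left
  \<open>eval3_mult\<close> and \<open>eval5_action\<close> turn the crossed product into
  \<open>omega_map\<close> at \<Omega>; on the right \<open>smash_coeff_iso_coeff_iso_coeff\<close>
  expands the coefficient over the same components of u. \<open>omega_map_Omega\<close> matches the
  two sums term by term.\<close>

lemma crossed_to_smash_crossed_pure_pure:
  assumes ab [simp]: "a \<in> carrier A" "b \<in> carrier B" "a' \<in> carrier A" "b' \<in> carrier B"
  shows "crossed_to_smash (crossed_pure (tens k A B a b) u (tens k A B a' b') u') = smash (eval3 a b (iso_coeff u)) (eval3 a' b' (iso_coeff u'))"
proof -
  let ?F = "\<lambda>o1 o2 o3 o4 o5 u0 u1 u0m u00. tens k AB U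
        (tR (tL o1 (tens k A B a b)) o5 \<otimes>\<^bsub>AB\<^esub> tR (tL (o2 \<otimes>\<^bsub>H\<^esub> u0m) (tens k A B a' b')) (S' u1 \<otimes>\<^bsub>H\<^esub> o4))
        (o3 \<otimes>\<^bsub>U\<^esub> u00 \<otimes>\<^bsub>U\<^esub> u')"
  let ?e = "\<lambda>X u1 u0m u00. in45 (tens k H H \<one>\<^bsub>H\<^esub> (S' u1)) \<otimes>\<^bsub>HHUHH\<^esub> omega_map (u00 \<otimes>\<^bsub>U\<^esub> u') X
      \<otimes>\<^bsub>HHUHH\<^esub> app2 H H UHH \<one>\<^bsub>UHH\<^esub> (tens k H H \<one>\<^bsub>H\<^esub> u0m)"
  \<comment> \<open>Everything that happens to \<Omega>, as one linear map of its five-slot tensor,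
    so that the sum over \<Omega> is removed in a single step.\<close>
  let ?L = "\<lambda>X. tsum AUB (rho u) (\<lambda>u0 u1. tsum AUB (lam u0) (\<lambda>u0m u00. eval5 a a' b b' (?e X u1 u0m u00)))"
  have F: "?F o1 o2 o3 o4 o5 u0 u1 u0m u00 \<in> carrier ABU"
    if "o1 \<in> carrier H" "o2 \<in> carrier H" "o3 \<in> carrier U" "o4 \<in> carrier H" "o5 \<in> carrier H"
      "u0 \<in> carrier U" "u1 \<in> carrier H" "u0m \<in> carrier H" "u00 \<in> carrier U" for o1 o2 o3 o4 o5 u0 u1 u0m u00
    using that by simp
  have 1: "crossed_to_smash (?F o1 o2 o3 o4 o5 u0 u1 u0m u00) = eval5 a a' b b' (?e (tens5 k H H U H H o1 o2 o3 o4 o5) u1 u0m u00)"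
    if o [simp]: "o1 \<in> carrier H" "o2 \<in> carrier H" "o3 \<in> carrier U" "o4 \<in> carrier H" "o5 \<in> carrier H"
      "u0 \<in> carrier U" "u1 \<in> carrier H" "u0m \<in> carrier H" "u00 \<in> carrier U" for o1 o2 o3 o4 o5 u0 u1 u0m u00
  proof -
    let ?w = "o3 \<otimes>\<^bsub>U\<^esub> u00 \<otimes>\<^bsub>U\<^esub> u'"
    have w: "D14 (iso_coeff ?w) = D14 iso_coeff0 \<otimes>\<^bsub>HHUHH\<^esub> app2 H H UHH (DR ?w) \<one>\<^bsub>H2\<^esub>"
      by (simp add: iso_coeff_def tmap_r_mult[of H UH UHH] tsplit_mult)
    have "crossed_to_smash (?F o1 o2 o3 o4 o5 u0 u1 u0m u00)
      = eval5 (l o1 a) (l (o2 \<otimes>\<^bsub>H\<^esub> u0m) a') (r b o5) (r b' (S' u1 \<otimes>\<^bsub>H\<^esub> o4)) (D14 (iso_coeff ?w))"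
      by (simp add: eval3_mult)
    also have "\<dots> = eval5 a a' b b' (in45 (tens k H H o5 (S' u1 \<otimes>\<^bsub>H\<^esub> o4)) \<otimes>\<^bsub>HHUHH\<^esub> D14 (iso_coeff ?w)
      \<otimes>\<^bsub>HHUHH\<^esub> app2 H H UHH \<one>\<^bsub>UHH\<^esub> (tens k H H o1 (o2 \<otimes>\<^bsub>H\<^esub> u0m)))"
      by (rule eval5_action) simp_all
    also have "in45 (tens k H H o5 (S' u1 \<otimes>\<^bsub>H\<^esub> o4)) \<otimes>\<^bsub>HHUHH\<^esub> D14 (iso_coeff ?w)
      \<otimes>\<^bsub>HHUHH\<^esub> app2 H H UHH \<one>\<^bsub>UHH\<^esub> (tens k H H o1 (o2 \<otimes>\<^bsub>H\<^esub> u0m)) = ?e (tens5 k H H U H H o1 o2 o3 o4 o5) u1 u0m u00"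
    proof -
      have "in45 (tens k H H o5 (S' u1 \<otimes>\<^bsub>H\<^esub> o4)) = in45 (tens k H H \<one>\<^bsub>H\<^esub> (S' u1)) \<otimes>\<^bsub>HHUHH\<^esub> in45 (tens k H H o5 o4)"
        by simp
      moreover have "app2 H H UHH (DR ?w) \<one>\<^bsub>H2\<^esub> \<otimes>\<^bsub>HHUHH\<^esub> app2 H H UHH \<one>\<^bsub>UHH\<^esub> (tens k H H o1 (o2 \<otimes>\<^bsub>H\<^esub> u0m))
        = app2 H H UHH (DR (o3 \<otimes>\<^bsub>U\<^esub> (u00 \<otimes>\<^bsub>U\<^esub> u'))) (tens k H H o1 o2) \<otimes>\<^bsub>HHUHH\<^esub> app2 H H UHH \<one>\<^bsub>UHH\<^esub> (tens k H H \<one>\<^bsub>H\<^esub> u0m)"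
        by (simp add: app2_mult alg_assoc del: app2_tens app2_one_right)
      ultimately show ?thesis
        unfolding w by (simp add: alg_assoc del: tens_mult app2_tens app2_one_right)
    qed
    finally show ?thesis .
  qed
  have "crossed_to_smash (crossed_pure (tens k A B a b) u (tens k A B a' b') u') = ?L (Omega k H U)"
    unfolding crossed_pure_def
  proof (rule lin_tsum5_eq[where L = crossed_to_smash and L' = ?L and A = H and B = H and C = U and D = H and E = H and P' = AUB])
    show "?L \<in> lin k HHUHH AUB"
      by (rule tsum_lin_param[of U H], simp, simp, simp, simp, simp, rule tsum_lin_param[of H U], simp, simp, simp, simp, simp,
          intro lin_comp[OF eval5_lin] lin_intros; simp)
    fix o1 o2 o3 o4 o5 assume o [simp]: "o1 \<in> carrier H" "o2 \<in> carrier H" "o3 \<in> carrier U" "o4 \<in> carrier H" "o5 \<in> carrier H"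
    show "tsum ABU (rho u) (\<lambda>u0 u1. tsum ABU (lam u0) (\<lambda>u0m u00. ?F o1 o2 o3 o4 o5 u0 u1 u0m u00)) \<in> carrier ABU"
      by (rule crossed_pure_inner_closed) simp_all
    have "crossed_to_smash (tsum ABU (rho u) (\<lambda>u0 u1. tsum ABU (lam u0) (\<lambda>u0m u00. ?F o1 o2 o3 o4 o5 u0 u1 u0m u00)))
      = tsum AUB (rho u) (\<lambda>u0 u1. crossed_to_smash (tsum ABU (lam u0) (\<lambda>u0m u00. ?F o1 o2 o3 o4 o5 u0 u1 u0m u00)))"
      by (rule lin_tsum[where M = U and N = H, OF _ _ _ _ crossed_to_smash_lin], simp, simp, simp, simp, simp, rule tsum_closed'[of H U]) simp_all
    also have "\<dots> = ?L (tens5 k H H U H H o1 o2 o3 o4 o5)"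
    proof (rule tsum_cong[where k = k and M = U and N = H])
      fix u0 u1 assume [simp]: "u0 \<in> carrier U" "u1 \<in> carrier H"
      have "crossed_to_smash (tsum ABU (lam u0) (\<lambda>u0m u00. ?F o1 o2 o3 o4 o5 u0 u1 u0m u00))
        = tsum AUB (lam u0) (\<lambda>u0m u00. crossed_to_smash (?F o1 o2 o3 o4 o5 u0 u1 u0m u00))"
        by (rule lin_tsum[where M = H and N = U, OF _ _ _ _ crossed_to_smash_lin]) simp_all
      also have "\<dots> = tsum AUB (lam u0) (\<lambda>u0m u00. eval5 a a' b b' (?e (tens5 k H H U H H o1 o2 o3 o4 o5) u1 u0m u00))"
        by (rule tsum_cong[where k = k and M = H and N = U], simp, simp, simp, rule 1[of _ _ _ _ _ u0]) simp_all
      finally show "crossed_to_smash (tsum ABU (lam u0) (\<lambda>u0m u00. ?F o1 o2 o3 o4 o5 u0 u1 u0m u00))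
        = tsum AUB (lam u0) (\<lambda>u0m u00. eval5 a a' b b' (?e (tens5 k H H U H H o1 o2 o3 o4 o5) u1 u0m u00))" .
    qed simp_all
    finally show "crossed_to_smash (tsum ABU (rho u) (\<lambda>u0 u1. tsum ABU (lam u0) (\<lambda>u0m u00. ?F o1 o2 o3 o4 o5 u0 u1 u0m u00)))
      = ?L (tens5 k H H U H H o1 o2 o3 o4 o5)" .
  qed simp_all
  also have "\<dots> = eval5 a a' b b' (smash_coeff (iso_coeff u) (iso_coeff u'))"
  proof -
    let ?z = "\<lambda>u1 u0m u00. in45 (tens k H H \<one>\<^bsub>H\<^esub> (S' u1)) \<otimes>\<^bsub>HHUHH\<^esub> smash_coeff iso_coeff0 (iso_coeff (u00 \<otimes>\<^bsub>U\<^esub> u'))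
      \<otimes>\<^bsub>HHUHH\<^esub> app2 H H UHH \<one>\<^bsub>UHH\<^esub> (tens k H H \<one>\<^bsub>H\<^esub> u0m)"
    have "eval5 a a' b b' (smash_coeff (iso_coeff u) (iso_coeff u')) = tsum AUB (rho u) (\<lambda>u0 u1. eval5 a a' b b' (tsum HHUHH (lam u0) (\<lambda>u0m u00. ?z u1 u0m u00)))"
      unfolding smash_coeff_iso_coeff_iso_coeff[OF u]
      by (rule lin_tsum[where M = U and N = H, OF _ _ _ _ eval5_lin], simp, simp, simp, simp, simp, simp, simp, simp, simp,
          rule tsum_closed'[of H U]) simp_all
    also have "\<dots> = ?L (Omega k H U)"
    proof (rule tsum_cong[where k = k and M = U and N = H])
      fix u0 u1 assume [simp]: "u0 \<in> carrier U" "u1 \<in> carrier H"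
      have "eval5 a a' b b' (tsum HHUHH (lam u0) (\<lambda>u0m u00. ?z u1 u0m u00))
        = tsum AUB (lam u0) (\<lambda>u0m u00. eval5 a a' b b' (?z u1 u0m u00))"
        by (rule lin_tsum[where M = H and N = U, OF _ _ _ _ eval5_lin]) simp_all
      also have "\<dots> = tsum AUB (lam u0) (\<lambda>u0m u00. eval5 a a' b b' (?e (Omega k H U) u1 u0m u00))"
        by (rule tsum_cong[where k = k and M = H and N = U]) (simp_all add: omega_map_Omega)
      finally show "eval5 a a' b b' (tsum HHUHH (lam u0) (\<lambda>u0m u00. ?z u1 u0m u00))
        = tsum AUB (lam u0) (\<lambda>u0m u00. eval5 a a' b b' (?e (Omega k H U) u1 u0m u00))" .
    qed simp_all
    finally show ?thesis by simp
  qed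
  finally show ?thesis by (simp add: smash_eval3)
qed

lemma crossed_to_smash_crossed_pure:
  assumes c: "c \<in> carrier AB" and c': "c' \<in> carrier AB"
  shows "crossed_to_smash (crossed_pure c u c' u') = smash (crossed_to_smash (tens k AB U c u)) (crossed_to_smash (tens k AB U c' u'))"
proof (rule lin_eqI[where f = "\<lambda>c. crossed_to_smash (crossed_pure c u c' u')" and g = "\<lambda>c. smash (crossed_to_smash (tens k AB U c u)) (crossed_to_smash (tens k AB U c' u'))"
      and P = AUB, OF md_AB(1,2) _ _ _ c])
  show "(\<lambda>c. crossed_to_smash (crossed_pure c u c' u')) \<in> lin k AB AUB" by (rule lin_comp[OF crossed_to_smash_lin crossed_pure_lin(2)[OF c']])
  show "(\<lambda>c. smash (crossed_to_smash (tens k AB U c u)) (crossed_to_smash (tens k AB U c' u'))) \<in> lin k AB AUB"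
    by (rule lin_comp[OF smash_lin(1) lin_comp[OF crossed_to_smash_lin tens_lin_left]]) (use c' in simp_all)
  fix a b assume ab [simp]: "a \<in> carrier A" "b \<in> carrier B"
  show "crossed_to_smash (crossed_pure (tens k A B a b) u c' u') = smash (crossed_to_smash (tens k AB U (tens k A B a b) u)) (crossed_to_smash (tens k AB U c' u'))"
  proof (rule lin_eqI[where f = "\<lambda>c'. crossed_to_smash (crossed_pure (tens k A B a b) u c' u')"
        and g = "\<lambda>c'. smash (crossed_to_smash (tens k AB U (tens k A B a b) u)) (crossed_to_smash (tens k AB U c' u'))" and P = AUB, OF md_AB(1,2) _ _ _ c'])
    show "(\<lambda>c'. crossed_to_smash (crossed_pure (tens k A B a b) u c' u')) \<in> lin k AB AUB" by (rule lin_comp[OF crossed_to_smash_lin crossed_pure_lin(1)]) simp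
    show "(\<lambda>c'. smash (crossed_to_smash (tens k AB U (tens k A B a b) u)) (crossed_to_smash (tens k AB U c' u'))) \<in> lin k AB AUB"
      by (rule lin_comp[OF smash_lin(2) lin_comp[OF crossed_to_smash_lin tens_lin_left]]) simp_all
  qed (simp add: crossed_to_smash_crossed_pure_pure)
qed

end

lemma crossed_to_smash_cross:
  assumes P: "P \<in> carrier ABU" and Q: "Q \<in> carrier ABU"
  shows "cross P Q \<in> carrier ABU" and "crossed_to_smash (cross P Q) = smash (crossed_to_smash P) (crossed_to_smash Q)"
proof -
  have c1: "tsum ABU Q (\<lambda>c' u'. crossed_pure c u c' u') \<in> carrier ABU" if "c \<in> carrier AB" "u \<in> carrier U" for c u
    by (rule tsum_closed'[of AB U]) (use that Q in \<open>simp_all add: crossed_pure_closed\<close>)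
  show "cross P Q \<in> carrier ABU"
    unfolding cross_eq by (rule tsum_closed'[of AB U]) (use P c1 in simp_all)
  show "crossed_to_smash (cross P Q) = smash (crossed_to_smash P) (crossed_to_smash Q)"
    unfolding cross_eq
  proof (rule lin_tsum_eq[where L = crossed_to_smash and L' = "\<lambda>P. smash (crossed_to_smash P) (crossed_to_smash Q)" and M = AB and N = U and P' = AUB])
    show "(\<lambda>P. smash (crossed_to_smash P) (crossed_to_smash Q)) \<in> lin k ABU AUB"
      by (rule lin_comp[OF smash_lin(1) crossed_to_smash_lin]) (use Q in simp)
    fix c u assume cu [simp]: "c \<in> carrier AB" "u \<in> carrier U"
    show "crossed_to_smash (tsum ABU Q (\<lambda>c' u'. crossed_pure c u c' u')) = smash (crossed_to_smash (tens k AB U c u)) (crossed_to_smash Q)"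
    proof (rule lin_tsum_eq[where L = crossed_to_smash and L' = "\<lambda>Q. smash (crossed_to_smash (tens k AB U c u)) (crossed_to_smash Q)" and M = AB and N = U and P' = AUB])
      show "(\<lambda>Q. smash (crossed_to_smash (tens k AB U c u)) (crossed_to_smash Q)) \<in> lin k ABU AUB"
        by (rule lin_comp[OF smash_lin(2) crossed_to_smash_lin]) simp
    qed (use Q in \<open>simp_all add: crossed_pure_closed crossed_to_smash_crossed_pure\<close>)
  qed (use P c1 in simp_all)
qed

end

section \<open>Composite contractions for the inverse map\<close>

context quasi_hopf_base
begin

text \<open>The S of \<open>beta_map\<close> undoes the S\<inverse> of \<open>alpha_inv_map\<close>,
  and the two contractions compose to x \<beta> S(y) \<alpha> z, which is 1 at \<Phi>.\<close>

lemma beta_map_alpha_inv_map: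
  assumes t: "t \<in> carrier H3" and X: "X \<in> carrier H2"
  shows "beta_map (tmap_r H H2 H alpha_inv_map t \<otimes>\<^bsub>H2\<^esub> X) = beta_alpha_map (t \<otimes>\<^bsub>H3\<^esub> app2 H H H \<one>\<^bsub>H\<^esub> X)"
  using md_H md_H X
proof (induct X rule: tensor_induct')
  case (tens x y)
  show ?case
  proof (rule lin_eq3I[where f = "\<lambda>t. beta_map (tmap_r H H2 H alpha_inv_map t \<otimes>\<^bsub>H2\<^esub> tens k H H x y)"
        and g = "\<lambda>t. beta_alpha_map (t \<otimes>\<^bsub>H3\<^esub> app2 H H H \<one>\<^bsub>H\<^esub> (tens k H H x y))", OF _ _ _ _ _ _ t])
    show "(\<lambda>t. beta_map (tmap_r H H2 H alpha_inv_map t \<otimes>\<^bsub>H2\<^esub> tens k H H x y)) \<in> lin k H3 H"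
      "(\<lambda>t. beta_alpha_map (t \<otimes>\<^bsub>H3\<^esub> app2 H H H \<one>\<^bsub>H\<^esub> (tens k H H x y))) \<in> lin k H3 H"
      by (intro lin_comp[OF beta_map_lin] lin_comp[OF beta_alpha_map_lin] lin_intros; use tens in simp)+
  qed (use tens in \<open>simp_all add: alpha_inv_map_tens S_mult alg_assoc\<close>)
qed (use t in \<open>simp_all add: additivity\<close>)

text \<open>The composite in the other order. Its image under S is S(x) \<alpha> y \<beta> S(z), the
  expression that the antipode axiom evaluates to 1 at \<Phi>\<inverse>.\<close>

definition alpha_beta_map where "alpha_beta_map t = alpha_inv_map (tmap_r H H2 H beta_map t)"

lemma alpha_beta_map_lin [simp]: "alpha_beta_map \<in> lin k H3 H"
  unfolding alpha_beta_map_def[abs_def] by (intro lin_comp[OF alpha_inv_map_lin]) simp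

lemma alpha_beta_map_closed [simp]: "t \<in> carrier H3 \<Longrightarrow> alpha_beta_map t \<in> carrier H"
  by (rule lin_closed[OF alpha_beta_map_lin])

lemma alpha_beta_map_tens: "p \<in> carrier H \<Longrightarrow> Z \<in> carrier H2 \<Longrightarrow> alpha_beta_map (tens k H H2 p Z) = S' (al \<otimes>\<^bsub>H\<^esub> beta_map Z) \<otimes>\<^bsub>H\<^esub> p"
  by (simp add: alpha_beta_map_def alpha_inv_map_tens)

lemma k_l_one [simp]: "x \<in> carrier k \<Longrightarrow> \<one>\<^bsub>k\<^esub> \<otimes>\<^bsub>k\<^esub> x = x"
  using base_field by (simp add: field.is_ring ring.ring_simprules)

lemmas [additivity] = lin_add[OF alpha_beta_map_lin]

lemma alpha_beta_map_contract_left: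
  assumes "Y \<in> carrier H2" "t \<in> carrier H3"
  shows "alpha_beta_map (dH H Y \<otimes>\<^bsub>H3\<^esub> t) = counit_l H Y \<otimes>\<^bsub>H\<^esub> alpha_beta_map t"
  using md_H md_H assms(1)
proof (induct Y rule: tensor_induct')
  case (tens y z)
  have 2: "alpha_beta_map (app2 H H H z X \<otimes>\<^bsub>H3\<^esub> tens3 k H H H a b c)
      = z \<otimes>\<^bsub>H\<^esub> S' (alpha_map (X \<otimes>\<^bsub>H2\<^esub> tens k H H a b) \<otimes>\<^bsub>H\<^esub> be \<otimes>\<^bsub>H\<^esub> S c)"
    if "a \<in> carrier H" "b \<in> carrier H" "c \<in> carrier H" "X \<in> carrier H2" for a b c X
    using md_H md_H that(4)
    by (induct X rule: tensor_induct')
      (use that tens in \<open>simp_all add: additivity alpha_beta_map_tens S_mult S'_mult alg_assoc\<close>)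
  have 3: "alpha_beta_map (tens3 k H H H a b c) = S' (alpha_map (tens k H H a b) \<otimes>\<^bsub>H\<^esub> be \<otimes>\<^bsub>H\<^esub> S c)"
    if "a \<in> carrier H" "b \<in> carrier H" "c \<in> carrier H" for a b c
    using that by (simp add: alpha_beta_map_tens S'_mult alg_assoc)
  show ?case
  proof (rule lin_eq3I[where f = "\<lambda>t. alpha_beta_map (dH H (tens k H H y z) \<otimes>\<^bsub>H3\<^esub> t)"
        and g = "\<lambda>t. counit_l H (tens k H H y z) \<otimes>\<^bsub>H\<^esub> alpha_beta_map t", OF _ _ _ _ _ _ assms(2)])
    show "(\<lambda>t. alpha_beta_map (dH H (tens k H H y z) \<otimes>\<^bsub>H3\<^esub> t)) \<in> lin k H3 H"
      "(\<lambda>t. counit_l H (tens k H H y z) \<otimes>\<^bsub>H\<^esub> alpha_beta_map t) \<in> lin k H3 H"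
      by (intro lin_comp[OF alpha_beta_map_lin] lin_intros; use tens in simp)+
  qed (use tens in \<open>simp_all add: 2 3 alpha_map_contract mult_smult lin_smult[OF S'_lin] del: alpha_map_tens\<close>)
qed (use assms in \<open>simp_all add: additivity\<close>)

lemma alpha_beta_map_contract_right:
  assumes "Y \<in> carrier H2" "t \<in> carrier H3"
  shows "alpha_beta_map (t \<otimes>\<^bsub>H3\<^esub> tmap_r H H H2 Dl Y) = alpha_beta_map t \<otimes>\<^bsub>H\<^esub> counit_r H Y"
  using md_H md_H assms(1)
proof (induct Y rule: tensor_induct')
  case (tens y z)
  show ?case using md_H _ assms(2)
    by (induct t rule: tensor_induct')
      (use tens in \<open>simp_all add: additivity alpha_beta_map_tens beta_map_contract mult_smult md_smult lin_smult[OF S'_lin] alg_assoc\<close>)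
qed (use assms in \<open>simp_all add: additivity\<close>)

interpretation qh: quasi_hopf_algebra k H by (rule quasi_hopf)

lemma alpha_beta_map_Ph' [simp]: "alpha_beta_map Ph' = \<one>\<^bsub>H\<^esub>"
proof -
  have L: "(\<lambda>X. S (alpha_beta_map X)) \<in> lin k H3 H" by (rule lin_comp[OF S_lin alpha_beta_map_lin])
  have "S (alpha_beta_map Ph') = tsum3 H Ph' (\<lambda>x y z. S x \<otimes>\<^bsub>H\<^esub> al \<otimes>\<^bsub>H\<^esub> y \<otimes>\<^bsub>H\<^esub> be \<otimes>\<^bsub>H\<^esub> S z)"
    by (rule tsum3_eq_lin[OF _ _ _ _ L, symmetric]) (simp_all add: alpha_beta_map_tens S_mult alg_assoc)
  also have "\<dots> = \<one>\<^bsub>H\<^esub>" by (rule qh.antip_reass_inv)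
  finally show ?thesis using S'_S[of "alpha_beta_map Ph'"] by simp
qed

lemma beta_map_app2:
  "\<lbrakk>X \<in> carrier H2; p \<in> carrier H\<rbrakk> \<Longrightarrow> beta_map (tens k H H p \<one>\<^bsub>H\<^esub> \<otimes>\<^bsub>H2\<^esub> X) = p \<otimes>\<^bsub>H\<^esub> beta_map X"
  by (simp add: beta_map_mult_tens)

lemma beta_map_semilin:
  assumes X: "X \<in> carrier H2" and t: "t \<in> carrier H3"
  shows "tmap_r H H2 H beta_map (app2 H H H \<one>\<^bsub>H\<^esub> X \<otimes>\<^bsub>H3\<^esub> t) = X \<otimes>\<^bsub>H2\<^esub> tmap_r H H2 H beta_map t"
  unfolding app2_def
  by (subst tmap_r_semilin[where q = "\<lambda>x. x"])
    (use X t in \<open>simp_all add: beta_map_app2 tens_lin_left lin_id tmap_r_id\<close>)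

lemma alpha_beta_map_app2:
  assumes "X \<in> carrier H2" "t \<in> carrier H3"
  shows "alpha_beta_map (app2 H H H \<one>\<^bsub>H\<^esub> X \<otimes>\<^bsub>H3\<^esub> t) = alpha_inv_map (X \<otimes>\<^bsub>H2\<^esub> tmap_r H H2 H beta_map t)"
  using assms by (simp add: alpha_beta_map_def beta_map_semilin)

end

context crossed_base
begin

abbreviation "beta_U \<equiv> tmap_r U H2 H beta_map"
abbreviation "beta_HU \<equiv> tmap_r H UHH UH beta_U"

definition p_rho where "p_rho = beta_U Pr'"

lemma p_rho_closed [simp]: "p_rho \<in> carrier UH" by (simp add: p_rho_def)

text \<open>In Sweedler form \<rho>(\<open>q\<^sup>1\<close>) p (1 \<otimes>
  S(\<open>q\<^sup>2\<close>)) = 1 \<otimes> 1. The contractions hidden in q and p combine to x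
  \<beta> S(y) \<alpha> z on the last three slots of \<open>UH3\<close>. The pentagon for \<rho>
  places \<Phi> between two factors that this contraction absorbs.\<close>

lemma beta_U_q_rho: "beta_U (dr H q_rho \<otimes>\<^bsub>UHH\<^esub> Pr') = \<one>\<^bsub>UH\<^esub>"
proof -
  let ?E3 = "tmap_r U H2 H3 (tmap_r H H H2 Dl)" and ?E2 = "tmap_r U H2 H3 (dH H)" and ?A' = "app3 U H H H \<one>\<^bsub>H\<^esub> Pr'"
    and ?A = "app3 U H H H \<one>\<^bsub>H\<^esub> Pr" and ?B = "tmap_r U H3 H beta_alpha_map" and ?o = "tens k U H3 \<one>\<^bsub>U\<^esub> Ph"
  have r: "dr H q_rho = tmap_r U H3 H2 (tmap_r H H2 H alpha_inv_map) (dr H2 Pr)"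
    using tsplit_tmap_r[of U H2 U H H rho alpha_inv_map Pr] by (simp add: q_rho_def)
  have 1: "beta_U (tmap_r U H3 H2 (tmap_r H H2 H alpha_inv_map) Y \<otimes>\<^bsub>UHH\<^esub> X) = ?B (Y \<otimes>\<^bsub>UH3\<^esub> app3 U H H H \<one>\<^bsub>H\<^esub> X)"
    if Y: "Y \<in> carrier UH3" and X: "X \<in> carrier UHH" for X Y
    using md_U md_H3 Y
  proof (induct Y rule: tensor_induct')
    case (tens y t)
    show ?case using md_U md_H2 X
      by (induct X rule: tensor_induct') (use tens in \<open>simp_all add: additivity beta_map_alpha_inv_map\<close>)
  qed (use X in \<open>simp_all add: additivity\<close>)
  have A: "?A \<otimes>\<^bsub>UH3\<^esub> ?A' = \<one>\<^bsub>UH3\<^esub>" by (simp add: app3_mult)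
  have E: "?E3 Pr' \<otimes>\<^bsub>UH3\<^esub> ?E3 Pr = \<one>\<^bsub>UH3\<^esub>" by (simp flip: tmap_r_mult)
  have pent: "?E3 Pr \<otimes>\<^bsub>UH3\<^esub> dr H2 Pr = ?o \<otimes>\<^bsub>UH3\<^esub> ?E2 Pr \<otimes>\<^bsub>UH3\<^esub> ?A"
    using rho_pentagon by simp
  \<comment> \<open>Of the outer factors on the right side, the first has slots 3 and 4 comultiplied
    and is absorbed by \<alpha>, the last has slots 2 and 3 comultiplied and is absorbed by
    \<beta>.\<close>
  have 2: "dr H2 Pr \<otimes>\<^bsub>UH3\<^esub> ?A' = ?E3 Pr' \<otimes>\<^bsub>UH3\<^esub> (?o \<otimes>\<^bsub>UH3\<^esub> ?E2 Pr)"
  proof -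
    have "dr H2 Pr \<otimes>\<^bsub>UH3\<^esub> ?A' = (?E3 Pr' \<otimes>\<^bsub>UH3\<^esub> ?E3 Pr) \<otimes>\<^bsub>UH3\<^esub> (dr H2 Pr \<otimes>\<^bsub>UH3\<^esub> ?A')"
      by (simp add: E)
    also have "\<dots> = ?E3 Pr' \<otimes>\<^bsub>UH3\<^esub> ((?E3 Pr \<otimes>\<^bsub>UH3\<^esub> dr H2 Pr) \<otimes>\<^bsub>UH3\<^esub> ?A')"
      by (simp add: alg_assoc)
    also have "\<dots> = ?E3 Pr' \<otimes>\<^bsub>UH3\<^esub> (?o \<otimes>\<^bsub>UH3\<^esub> (?E2 Pr \<otimes>\<^bsub>UH3\<^esub> (?A \<otimes>\<^bsub>UH3\<^esub> ?A')))"
      unfolding pent by (simp add: alg_assoc)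
    finally show ?thesis by (simp add: A)
  qed
  have "beta_U (dr H q_rho \<otimes>\<^bsub>UHH\<^esub> Pr') = ?B (?E3 Pr' \<otimes>\<^bsub>UH3\<^esub> (?o \<otimes>\<^bsub>UH3\<^esub> ?E2 Pr))"
    unfolding r by (simp add: 1 2)
  also have "\<dots> = tmap_r U H2 H (counit_r H) Pr' \<otimes>\<^bsub>UH\<^esub> ?B (?o \<otimes>\<^bsub>UH3\<^esub> ?E2 Pr)"
    by (rule tmap_r_semilin) (simp_all add: beta_alpha_map_contract_left)
  also have "?B (?o \<otimes>\<^bsub>UH3\<^esub> ?E2 Pr) = ?B ?o \<otimes>\<^bsub>UH\<^esub> tmap_r U H2 H (counit_l H) Pr"
    by (rule tmap_r_semilin_right) (simp_all add: beta_alpha_map_contract_right)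
  finally show ?thesis by simp
qed

text \<open>The companion relation (1 \<otimes> S\<inverse>(\<open>p\<^sup>2\<close>)) q
  \<rho>(\<open>p\<^sup>1\<close>) = 1 \<otimes> 1, proved in the same way with
  \<open>alpha_beta_map\<close> and \<Phi>\<inverse> in place of \<open>beta_alpha_map\<close> and
  \<Phi>.\<close>

lemma alpha_inv_U_p_rho: "tmap_r U H2 H alpha_inv_map (Pr \<otimes>\<^bsub>UHH\<^esub> dr H p_rho) = \<one>\<^bsub>UH\<^esub>"
proof -
  let ?E3 = "tmap_r U H2 H3 (tmap_r H H H2 Dl)" and ?E2 = "tmap_r U H2 H3 (dH H)"
    and ?A = "app3 U H H H \<one>\<^bsub>H\<^esub> Pr" and ?B = "tmap_r U H3 H alpha_beta_map" and ?o = "\<lambda>x. tens k U H3 \<one>\<^bsub>U\<^esub> x"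
  have r: "dr H p_rho = tmap_r U H3 H2 (tmap_r H H2 H beta_map) (dr H2 Pr')"
    using tsplit_tmap_r[of U H2 U H H rho beta_map Pr'] by (simp add: p_rho_def)
  have 1: "tmap_r U H2 H alpha_inv_map (X \<otimes>\<^bsub>UHH\<^esub> tmap_r U H3 H2 (tmap_r H H2 H beta_map) Y) = ?B (app3 U H H H \<one>\<^bsub>H\<^esub> X \<otimes>\<^bsub>UH3\<^esub> Y)"
    if Y: "Y \<in> carrier UH3" and X: "X \<in> carrier UHH" for X Y
    using md_U md_H3 Y
  proof (induct Y rule: tensor_induct')
    case (tens y t)
    show ?case using md_U md_H2 X
      by (induct X rule: tensor_induct') (use tens in \<open>simp_all add: additivity alpha_beta_map_app2\<close>)
  qed (use X in \<open>simp_all add: additivity\<close>)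
  have E2: "?E2 Pr' \<otimes>\<^bsub>UH3\<^esub> ?E2 Pr = \<one>\<^bsub>UH3\<^esub>" by (simp flip: tmap_r_mult)
  have D: "dr H2 Pr \<otimes>\<^bsub>UH3\<^esub> dr H2 Pr' = \<one>\<^bsub>UH3\<^esub>" by (simp flip: tsplit_mult)
  have pent: "?o Ph \<otimes>\<^bsub>UH3\<^esub> ?E2 Pr \<otimes>\<^bsub>UH3\<^esub> ?A = ?E3 Pr \<otimes>\<^bsub>UH3\<^esub> dr H2 Pr"
    using rho_pentagon by simp
  have 2: "?A \<otimes>\<^bsub>UH3\<^esub> dr H2 Pr' = ?E2 Pr' \<otimes>\<^bsub>UH3\<^esub> (?o Ph' \<otimes>\<^bsub>UH3\<^esub> ?E3 Pr)"
  proof -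
    have "?E2 Pr' \<otimes>\<^bsub>UH3\<^esub> (?o Ph' \<otimes>\<^bsub>UH3\<^esub> ?E3 Pr) = ?E2 Pr' \<otimes>\<^bsub>UH3\<^esub> (?o Ph' \<otimes>\<^bsub>UH3\<^esub> (?E3 Pr \<otimes>\<^bsub>UH3\<^esub> (dr H2 Pr \<otimes>\<^bsub>UH3\<^esub> dr H2 Pr')))"
      by (simp add: D)
    also have "\<dots> = ?E2 Pr' \<otimes>\<^bsub>UH3\<^esub> (?o Ph' \<otimes>\<^bsub>UH3\<^esub> ((?E3 Pr \<otimes>\<^bsub>UH3\<^esub> dr H2 Pr) \<otimes>\<^bsub>UH3\<^esub> dr H2 Pr'))"
      by (simp add: alg_assoc)
    also have "\<dots> = ?E2 Pr' \<otimes>\<^bsub>UH3\<^esub> ((?o Ph' \<otimes>\<^bsub>UH3\<^esub> ?o Ph) \<otimes>\<^bsub>UH3\<^esub> (?E2 Pr \<otimes>\<^bsub>UH3\<^esub> (?A \<otimes>\<^bsub>UH3\<^esub> dr H2 Pr')))"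
      unfolding pent[symmetric] by (simp add: alg_assoc del: tens_mult)
    also have "\<dots> = (?E2 Pr' \<otimes>\<^bsub>UH3\<^esub> ?E2 Pr) \<otimes>\<^bsub>UH3\<^esub> (?A \<otimes>\<^bsub>UH3\<^esub> dr H2 Pr')"
      by (simp add: alg_assoc)
    finally show ?thesis by (simp add: E2)
  qed
  have "tmap_r U H2 H alpha_inv_map (Pr \<otimes>\<^bsub>UHH\<^esub> dr H p_rho) = ?B (?E2 Pr' \<otimes>\<^bsub>UH3\<^esub> (?o Ph' \<otimes>\<^bsub>UH3\<^esub> ?E3 Pr))"
    unfolding r by (simp add: 1 2)
  also have "\<dots> = tmap_r U H2 H (counit_l H) Pr' \<otimes>\<^bsub>UH\<^esub> ?B (?o Ph' \<otimes>\<^bsub>UH3\<^esub> ?E3 Pr)"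
    by (rule tmap_r_semilin) (simp_all add: alpha_beta_map_contract_left)
  also have "?B (?o Ph' \<otimes>\<^bsub>UH3\<^esub> ?E3 Pr) = ?B (?o Ph') \<otimes>\<^bsub>UH\<^esub> tmap_r U H2 H (counit_r H) Pr"
    by (rule tmap_r_semilin_right) (simp_all add: alpha_beta_map_contract_right)
  finally show ?thesis by simp
qed

definition inv_coeff where "inv_coeff w = Th' \<otimes>\<^bsub>HUH\<^esub> tens k H UH \<one>\<^bsub>H\<^esub> (rho w \<otimes>\<^bsub>UH\<^esub> p_rho)"

lemma inv_coeff_lin [simp]: "inv_coeff \<in> lin k U HUH"
proof -
  have "(\<lambda>w. inv_coeff w) \<in> lin k U HUH"
    unfolding inv_coeff_def by (intro lin_intros; simp)
  then show ?thesis by simp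
qed

lemma inv_coeff_closed [simp]: "w \<in> carrier U \<Longrightarrow> inv_coeff w \<in> carrier HUH"
  by (rule lin_closed[OF inv_coeff_lin])

text \<open>G after F on coefficients: the contraction lets u out on the left, and then p cancels
  against q by \<open>alpha_inv_U_p_rho\<close>.\<close>

lemma iso_coeff0_move_inv_coeff:
  assumes u: "u \<in> carrier U"
  shows "iso_coeff0_move (inv_coeff u) = tens3 k H U H \<one>\<^bsub>H\<^esub> u \<one>\<^bsub>H\<^esub>"
proof -
  have "Pr \<otimes>\<^bsub>UHH\<^esub> dr H (rho u \<otimes>\<^bsub>UH\<^esub> p_rho) = tmap_r U H H2 Dl (rho u) \<otimes>\<^bsub>UHH\<^esub> (Pr \<otimes>\<^bsub>UHH\<^esub> dr H p_rho)"
    using u rho_quasi_coassoc[OF u] by (simp add: tsplit_mult flip: alg_assoc)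
  then show ?thesis
    using u by (simp add: inv_coeff_def iso_coeff0_move_Th' alpha_inv_map_contract_U alpha_inv_U_p_rho)
qed

lemma beta_U_app2:
  assumes W: "W \<in> carrier UH" and X: "X \<in> carrier UHH" and m: "m \<in> carrier H"
  shows "beta_U (app2 U H H m W \<otimes>\<^bsub>UHH\<^esub> X) = W \<otimes>\<^bsub>UH\<^esub> beta_U X \<otimes>\<^bsub>UH\<^esub> tens k U H \<one>\<^bsub>U\<^esub> (S m)"
  using md_U md_H W
proof (induct W rule: tensor_induct')
  case (tens v p)
  show ?case using md_U md_H2 X
    by (induct X rule: tensor_induct') (use tens m in \<open>simp_all add: additivity beta_map_mult_tens\<close>)
qed (use X m in \<open>simp_all add: additivity\<close>)

lemma beta_U_contract:
  assumes Y: "Y \<in> carrier UH" and X: "X \<in> carrier UHH"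
  shows "beta_U (X \<otimes>\<^bsub>UHH\<^esub> tmap_r U H H2 Dl Y) = beta_U X \<otimes>\<^bsub>UH\<^esub> tens k U H (counit_r U Y) \<one>\<^bsub>H\<^esub>"
  using md_U md_H Y
proof (induct Y rule: tensor_induct')
  case (tens u h)
  show ?case using md_U md_H2 X
    by (induct X rule: tensor_induct') (use tens in \<open>simp_all add: additivity beta_map_contract tens_smult mult_smult md_smult\<close>)
qed (use X in \<open>simp_all add: additivity\<close>)

lemma beta_HU_smash_tail_lin: "(\<lambda>X. beta_HU (smash_tail X)) \<in> lin k HUH HUH"
  unfolding smash_tail_def by (intro lin_intros'; simp)

lemma beta_HU_pad4:
  assumes Y: "Y \<in> carrier HUH" and X: "X \<in> carrier HUHH"
  shows "beta_HU (pad4 Y \<otimes>\<^bsub>HUHH\<^esub> X) = Y \<otimes>\<^bsub>HUH\<^esub> beta_HU X"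
  unfolding app3_def
  by (subst tmap_r_semilin[where q = "\<lambda>x. x"])
    (use X Y in \<open>simp_all add: beta_U_app2 lin_id tmap_r_id\<close>)

text \<open>Contracting the tail by \<beta> is what F does to a coefficient:
  \<open>\<Phi>\<^sub>\<rho>\<inverse>\<close> becomes the p behind \<rho>(w), and m comes out as
  S(m), to be undone by the S\<inverse> in \<open>eval3_inv\<close>.\<close>

lemma beta_HU_smash_tail_tens:
  assumes "h \<in> carrier H" "w \<in> carrier U" "m \<in> carrier H"
  shows "beta_HU (smash_tail (tens3 k H U H h w m)) = inv_coeff w \<otimes>\<^bsub>HUH\<^esub> tens3 k H U H h \<one>\<^bsub>U\<^esub> (S m)"
  using assms by (simp add: smash_tail_def alg_assoc beta_HU_pad4 beta_U_app2 inv_coeff_def p_rho_def)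

text \<open>F after G on coefficients. \<open>smash_tail_iso_coeff0\<close> exposes \<rho>(q)
  \<open>\<Phi>\<^sub>\<rho>\<inverse>\<close>, which contracts to 1 by \<open>beta_U_q_rho\<close>.
  The comultiplied last slot behind it is absorbed, and the counits of \<theta> and of \<rho>(u)
  leave u.\<close>

lemma beta_HU_smash_tail_iso_coeff:
  assumes u: "u \<in> carrier U"
  shows "beta_HU (smash_tail (iso_coeff u)) = tens3 k H U H \<one>\<^bsub>H\<^esub> u \<one>\<^bsub>H\<^esub>"
proof -
  have "smash_tail (iso_coeff u) = dl H2 (dr H q_rho \<otimes>\<^bsub>UHH\<^esub> Pr') \<otimes>\<^bsub>HUHH\<^esub> D3 (Th' \<otimes>\<^bsub>HUH\<^esub> tens k H UH \<one>\<^bsub>H\<^esub> (rho u))"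
    using u by (simp add: iso_coeff_def smash_tail_rho smash_tail_iso_coeff0 tmap_r_mult[of H UH UHH] alg_assoc)
  then have "beta_HU (smash_tail (iso_coeff u)) = beta_HU (dl H2 (dr H q_rho \<otimes>\<^bsub>UHH\<^esub> Pr'))
    \<otimes>\<^bsub>HUH\<^esub> tmap_r H UH UH (\<lambda>Y. tens k U H (counit_r U Y) \<one>\<^bsub>H\<^esub>) (Th' \<otimes>\<^bsub>HUH\<^esub> tens k H UH \<one>\<^bsub>H\<^esub> (rho u))"
    using u by (simp only:) (rule tmap_r_semilin_right; simp add: beta_U_contract lin_comp_tens_left)
  also have "beta_HU (dl H2 (dr H q_rho \<otimes>\<^bsub>UHH\<^esub> Pr')) = \<one>\<^bsub>HUH\<^esub>"
    using tsplit_tmap_r[of U H2 H U H lam beta_map "dr H q_rho \<otimes>\<^bsub>UHH\<^esub> Pr'"] by (simp add: beta_U_q_rho)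
  also have "tmap_r H UH UH (\<lambda>Y. tens k U H (counit_r U Y) \<one>\<^bsub>H\<^esub>) (Th' \<otimes>\<^bsub>HUH\<^esub> tens k H UH \<one>\<^bsub>H\<^esub> (rho u))
    = tens3 k H U H \<one>\<^bsub>H\<^esub> u \<one>\<^bsub>H\<^esub>"
  proof -
    have h: "(\<lambda>Y. tens k U H (counit_r U Y) \<one>\<^bsub>H\<^esub>) \<in> alg_hom k UH UH"
      by (rule alg_homI) (simp_all add: lin_comp_tens_left hom_one[OF counit_r_hom] hom_mult[OF counit_r_hom])
    show ?thesis using u h by (simp add: tmap_r_mult[OF _ _ _ h] counit_r_one_Th')
  qed
  finally show ?thesis using u by simp
qed

text \<open>For the unit: \<open>H\<close> acts on the units of \<open>A\<close> and
  \<open>B\<close> through \<epsilon>, so G sends 1 to this element of \<open>U\<close> between two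
  units. The normalisation \<epsilon>(\<alpha>) = 1 enters through q.\<close>

lemma iso_coeff0_counit: "counit_r U (counit_l UH iso_coeff0) = \<one>\<^bsub>U\<^esub>"
proof -
  have 1: "counit_l UH (dl H X) = X" if "X \<in> carrier UH" for X
    using md_U md_H that by (induct X rule: tensor_induct') (simp_all add: additivity counit_l_app2)
  have 2: "ep (alpha_inv_map Z) = ep (counit_r H Z)" if "Z \<in> carrier H2" for Z
    using md_H md_H that
    by (induct Z rule: tensor_induct') (simp_all add: additivity alpha_inv_map_tens ep_mult ep_add ep_smult)
  have "counit_r U (tmap_r U H2 H alpha_inv_map X) = counit_r U (tmap_r U H2 H (counit_r H) X)" if "X \<in> carrier UHH" for X
    using md_U md_H2 that by (induct X rule: tensor_induct') (simp_all add: additivity 2)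
  then have q: "counit_r U q_rho = \<one>\<^bsub>U\<^esub>"
    by (simp add: q_rho_def hom_one[OF counit_r_hom])
  have 3: "counit_r U (counit_l UH X) = counit_l U (tmap_r H UH U (counit_r U) X)" if "X \<in> carrier HUH" for X
    by (rule counit_l_tmap_r[symmetric]) (use that in simp_all)
  show ?thesis
    by (simp add: iso_coeff0_def hom_mult[OF counit_l_hom] hom_mult[OF counit_r_hom] 1 q) (simp add: 3 hom_one[OF counit_l_hom])
qed

end

context iso_base
begin

lemma eval3_action:
  assumes ab: "a \<in> carrier A" "b \<in> carrier B" and h: "h \<in> carrier H" "m \<in> carrier H" and X: "X \<in> carrier HUH"
  shows "eval3 (l h a) (r b m) X = eval3 a b (tens3 k H U H \<one>\<^bsub>H\<^esub> \<one>\<^bsub>U\<^esub> m \<otimes>\<^bsub>HUH\<^esub> X \<otimes>\<^bsub>HUH\<^esub> tens k H UH h \<one>\<^bsub>UH\<^esub>)"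
proof (rule lin_eq3I[where f = "\<lambda>X. eval3 (l h a) (r b m) X" and P = AUB
      and g = "\<lambda>X. eval3 a b (tens3 k H U H \<one>\<^bsub>H\<^esub> \<one>\<^bsub>U\<^esub> m \<otimes>\<^bsub>HUH\<^esub> X \<otimes>\<^bsub>HUH\<^esub> tens k H UH h \<one>\<^bsub>UH\<^esub>)", OF _ _ _ _ _ _ X])
  show "(\<lambda>X. eval3 a b (tens3 k H U H \<one>\<^bsub>H\<^esub> \<one>\<^bsub>U\<^esub> m \<otimes>\<^bsub>HUH\<^esub> X \<otimes>\<^bsub>HUH\<^esub> tens k H UH h \<one>\<^bsub>UH\<^esub>)) \<in> lin k HUH AUB"
    by (intro lin_comp[OF eval3_lin] lin_intros; use ab h in simp)
qed (use ab h in \<open>simp_all add: l_mult r_mult\<close>)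

text \<open>The S\<inverse> in the last slot restores the order reversed by the right action: an
  earlier action on \<open>a\<close> and \<open>b\<close> multiplies the coefficient from the right
  in both outer slots, see \<open>eval3_inv_action\<close>.\<close>

definition eval3_inv where
  "eval3_inv a b X = tsum3 ABU X (\<lambda>h u m. tens k AB U (tens k A B (l h a) (r b (S' m))) u)"

lemma eval3_inv_lin [simp]: "a \<in> carrier A \<Longrightarrow> b \<in> carrier B \<Longrightarrow> eval3_inv a b \<in> lin k HUH ABU"
  and eval3_inv_tens [simp]: "a \<in> carrier A \<Longrightarrow> b \<in> carrier B \<Longrightarrow> h \<in> carrier H \<Longrightarrow> u \<in> carrier U \<Longrightarrow> m \<in> carrier H \<Longrightarrow>
    eval3_inv a b (tens3 k H U H h u m) = tens k AB U (tens k A B (l h a) (r b (S' m))) u"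
proof -
  assume ab: "a \<in> carrier A" "b \<in> carrier B"
  let ?f = "\<lambda>h u m. tens k AB U (tens k A B (l h a) (r b (S' m))) u"
  have f: "\<And>u m. u \<in> carrier U \<Longrightarrow> m \<in> carrier H \<Longrightarrow> (\<lambda>h. ?f h u m) \<in> lin k H ABU"
    "\<And>h m. h \<in> carrier H \<Longrightarrow> m \<in> carrier H \<Longrightarrow> (\<lambda>u. ?f h u m) \<in> lin k U ABU"
    "\<And>h u. h \<in> carrier H \<Longrightarrow> u \<in> carrier U \<Longrightarrow> (\<lambda>m. ?f h u m) \<in> lin k H ABU"
    by (intro lin_intros lin_comp[OF r_lin(1)]; use ab in simp)+
  have "(\<lambda>X. eval3_inv a b X) \<in> lin k HUH ABU"
    unfolding eval3_inv_def by (rule tsum3_lin(1)[OF _ _ _ _ f]) simp_all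
  then show "eval3_inv a b \<in> lin k HUH ABU" by simp
  show "h \<in> carrier H \<Longrightarrow> u \<in> carrier U \<Longrightarrow> m \<in> carrier H \<Longrightarrow> eval3_inv a b (tens3 k H U H h u m) = ?f h u m"
    unfolding eval3_inv_def by (rule tsum3_lin(2)[OF _ _ _ _ f]) simp_all
qed

lemma eval3_inv_lin_arg:
  assumes X: "X \<in> carrier HUH"
  shows "b \<in> carrier B \<Longrightarrow> (\<lambda>a. eval3_inv a b X) \<in> lin k A ABU"
    and "a \<in> carrier A \<Longrightarrow> (\<lambda>b. eval3_inv a b X) \<in> lin k B ABU"
  unfolding eval3_inv_def
  by (rule tsum_lin_param[of H UH, OF _ _ _ _ X] tsum_lin_param[of U H] | (intro lin_intros mod_lin)[1] | simp)+

lemma eval3_inv_action: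
  assumes ab: "a \<in> carrier A" "b \<in> carrier B" and h: "h \<in> carrier H" "m \<in> carrier H" and X: "X \<in> carrier HUH"
  shows "eval3_inv (l h a) (r b m) X = eval3_inv a b (X \<otimes>\<^bsub>HUH\<^esub> tens3 k H U H h \<one>\<^bsub>U\<^esub> (S m))"
proof (rule lin_eq3I[where f = "\<lambda>X. eval3_inv (l h a) (r b m) X" and P = ABU
      and g = "\<lambda>X. eval3_inv a b (X \<otimes>\<^bsub>HUH\<^esub> tens3 k H U H h \<one>\<^bsub>U\<^esub> (S m))", OF _ _ _ _ _ _ X])
  show "(\<lambda>X. eval3_inv a b (X \<otimes>\<^bsub>HUH\<^esub> tens3 k H U H h \<one>\<^bsub>U\<^esub> (S m))) \<in> lin k HUH ABU"
    by (intro lin_comp[OF eval3_inv_lin] lin_intros; use ab h in simp)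
qed (use ab h in \<open>simp_all add: l_mult r_mult S'_mult\<close>)

definition smash_to_crossed where "smash_to_crossed X = tsum3 ABU X (\<lambda>a u b. eval3_inv a b (inv_coeff u))"

lemma smash_to_crossed_lin [simp]: "smash_to_crossed \<in> lin k AUB ABU"
  and smash_to_crossed_tens [simp]: "a \<in> carrier A \<Longrightarrow> u \<in> carrier U \<Longrightarrow> b \<in> carrier B \<Longrightarrow> smash_to_crossed (tens3 k A U B a u b) = eval3_inv a b (inv_coeff u)"
proof -
  have "(\<lambda>X. smash_to_crossed X) \<in> lin k AUB ABU"
    unfolding smash_to_crossed_def by (rule tsum3_lin(1)) (simp_all add: eval3_inv_lin_arg lin_comp[OF eval3_inv_lin])
  then show "smash_to_crossed \<in> lin k AUB ABU" by simp
  show "a \<in> carrier A \<Longrightarrow> u \<in> carrier U \<Longrightarrow> b \<in> carrier B \<Longrightarrow> smash_to_crossed (tens3 k A U B a u b) = eval3_inv a b (inv_coeff u)"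
    unfolding smash_to_crossed_def by (rule tsum3_lin(2)) (simp_all add: eval3_inv_lin_arg lin_comp[OF eval3_inv_lin])
qed

lemma smash_to_crossed_closed [simp]: "X \<in> carrier AUB \<Longrightarrow> smash_to_crossed X \<in> carrier ABU"
  by (rule lin_closed[OF smash_to_crossed_lin])

lemma smash_to_crossed_eval3:
  assumes ab: "a \<in> carrier A" "b \<in> carrier B" and X: "X \<in> carrier HUH"
  shows "smash_to_crossed (eval3 a b X) = eval3_inv a b (beta_HU (smash_tail X))"
  by (rule lin_eq3I[where f = "\<lambda>X. smash_to_crossed (eval3 a b X)" and g = "\<lambda>X. eval3_inv a b (beta_HU (smash_tail X))" and P = ABU, OF _ _ _ _ _ _ X])
    (use ab in \<open>simp_all add: lin_comp[OF smash_to_crossed_lin eval3_lin] lin_comp[OF eval3_inv_lin beta_HU_smash_tail_lin] beta_HU_smash_tail_tens eval3_inv_action\<close>)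

lemma crossed_to_smash_eval3_inv:
  assumes ab: "a \<in> carrier A" "b \<in> carrier B" and X: "X \<in> carrier HUH"
  shows "crossed_to_smash (eval3_inv a b X) = eval3 a b (iso_coeff0_move X)"
proof (rule lin_eq3I[where f = "\<lambda>X. crossed_to_smash (eval3_inv a b X)" and g = "\<lambda>X. eval3 a b (iso_coeff0_move X)" and P = AUB, OF _ _ _ _ _ _ X])
  fix h u m assume [simp]: "h \<in> carrier H" "u \<in> carrier U" "m \<in> carrier H"
  show "crossed_to_smash (eval3_inv a b (tens3 k H U H h u m)) = eval3 a b (iso_coeff0_move (tens3 k H U H h u m))"
    using ab by (simp add: iso_coeff0_move_tens eval3_action iso_coeff_def alg_assoc)
qed (use ab in \<open>simp_all add: lin_comp[OF crossed_to_smash_lin eval3_inv_lin] lin_comp[OF eval3_lin iso_coeff0_move_lin]\<close>)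

lemma smash_to_crossed_crossed_to_smash [simp]:
  assumes X: "X \<in> carrier ABU" shows "smash_to_crossed (crossed_to_smash X) = X"
proof (rule lin_eqI[where f = "\<lambda>X. smash_to_crossed (crossed_to_smash X)" and g = "\<lambda>X. X", OF md_AB(3) md_U _ lin_id _ X])
  show "(\<lambda>X. smash_to_crossed (crossed_to_smash X)) \<in> lin k ABU ABU" by (rule lin_comp[OF smash_to_crossed_lin crossed_to_smash_lin])
  fix c u assume c: "c \<in> carrier AB" and u: "u \<in> carrier U"
  show "smash_to_crossed (crossed_to_smash (tens k AB U c u)) = tens k AB U c u"
  proof (rule lin_eqI[where f = "\<lambda>c. smash_to_crossed (crossed_to_smash (tens k AB U c u))" and g = "\<lambda>c. tens k AB U c u" and P = ABU,
        OF md_AB(1,2) _ _ _ c])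
    show "(\<lambda>c. smash_to_crossed (crossed_to_smash (tens k AB U c u))) \<in> lin k AB ABU"
      by (rule lin_comp[OF smash_to_crossed_lin lin_comp[OF crossed_to_smash_lin tens_lin_left]]) (use u in simp_all)
  qed (use u in \<open>simp_all add: tens_lin_left smash_to_crossed_eval3 beta_HU_smash_tail_iso_coeff\<close>)
qed

lemma crossed_to_smash_smash_to_crossed [simp]:
  assumes X: "X \<in> carrier AUB" shows "crossed_to_smash (smash_to_crossed X) = X"
proof (rule lin_eq3I[where f = "\<lambda>X. crossed_to_smash (smash_to_crossed X)" and g = "\<lambda>X. X" and P = AUB, OF _ _ _ _ _ _ X])
  show "(\<lambda>X. crossed_to_smash (smash_to_crossed X)) \<in> lin k AUB AUB" by (rule lin_comp[OF crossed_to_smash_lin smash_to_crossed_lin])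
qed (simp_all add: lin_id crossed_to_smash_eval3_inv iso_coeff0_move_inv_coeff)

lemma crossed_to_smash_one: "crossed_to_smash \<one>\<^bsub>ABU\<^esub> = \<one>\<^bsub>AUB\<^esub>"
proof -
  have 1: "eval3 \<one>\<^bsub>A\<^esub> \<one>\<^bsub>B\<^esub> X = tens3 k A U B \<one>\<^bsub>A\<^esub> (counit_r U (counit_l UH X)) \<one>\<^bsub>B\<^esub>" if X: "X \<in> carrier HUH" for X
  proof (rule lin_eq3I[where f = "\<lambda>X. eval3 \<one>\<^bsub>A\<^esub> \<one>\<^bsub>B\<^esub> X"
        and g = "\<lambda>X. tens3 k A U B \<one>\<^bsub>A\<^esub> (counit_r U (counit_l UH X)) \<one>\<^bsub>B\<^esub>" and P = AUB, OF _ _ _ _ _ _ X])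
    show "(\<lambda>X. tens3 k A U B \<one>\<^bsub>A\<^esub> (counit_r U (counit_l UH X)) \<one>\<^bsub>B\<^esub>) \<in> lin k HUH AUB"
      by (intro lin_intros lin_comp[OF counit_r_lin]; simp)
  qed (simp_all add: l_unit r_unit tens_smult lin_smult[OF counit_r_lin] md_smult_commute)
  have "crossed_to_smash \<one>\<^bsub>ABU\<^esub> = eval3 \<one>\<^bsub>A\<^esub> \<one>\<^bsub>B\<^esub> (iso_coeff \<one>\<^bsub>U\<^esub>)"
    using crossed_to_smash_tens3[of "\<one>\<^bsub>A\<^esub>" "\<one>\<^bsub>B\<^esub>" "\<one>\<^bsub>U\<^esub>"] by simp
  also have "\<dots> = \<one>\<^bsub>AUB\<^esub>"
    by (simp add: iso_coeff_def 1 iso_coeff0_counit)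
  finally show ?thesis .
qed

section \<open>\<open>A \<otimes> B\<close> as an \<open>H\<close>-bimodule algebra, and the
  isomorphism\<close>

interpretation la: left_module_algebra k H A l by (rule left_mod_alg)
interpretation ra: right_module_algebra k H B r by (rule right_mod_alg)

lemmas AB_eqI = lin_eqI[OF md_AB(1,2), where P = AB]

lemma tL_left_action: "left_action k H AB tL"
proof -
  have 1: "bilinear_on k H AB AB tL" by (rule bilinear_onI) simp_all
  have 2: "tL \<one>\<^bsub>H\<^esub> c = c" if c: "c \<in> carrier AB" for c
    by (rule AB_eqI[where g = "\<lambda>c. c", OF _ _ _ c]) (simp_all add: lin_id)
  have 3: "tL (g \<otimes>\<^bsub>H\<^esub> h) c = tL g (tL h c)" if "g \<in> carrier H" "h \<in> carrier H" and c: "c \<in> carrier AB" for g h c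
    by (rule AB_eqI[where g = "\<lambda>c. tL g (tL h c)", OF _ _ _ c])
      (use that in \<open>simp_all add: lin_comp[OF tL_lin tL_lin] l_mult\<close>)
  show ?thesis using 1 2 3 by (simp add: left_action_def)
qed

lemma tR_right_action: "right_action k H AB tR"
proof -
  have 1: "bilinear_on k AB H AB tR" by (rule bilinear_onI) simp_all
  have 2: "tR c \<one>\<^bsub>H\<^esub> = c" if c: "c \<in> carrier AB" for c
    by (rule AB_eqI[where f = "\<lambda>c. tR c \<one>\<^bsub>H\<^esub>" and g = "\<lambda>c. c", OF _ _ _ c]) (simp_all add: lin_id)
  have 3: "tR c (g \<otimes>\<^bsub>H\<^esub> h) = tR (tR c g) h" if "g \<in> carrier H" "h \<in> carrier H" and c: "c \<in> carrier AB" for g h c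
    by (rule AB_eqI[where f = "\<lambda>c. tR c (g \<otimes>\<^bsub>H\<^esub> h)" and g = "\<lambda>c. tR (tR c g) h", OF _ _ _ c])
      (use that in \<open>simp_all add: lin_comp[OF tR_lin tR_lin] r_mult\<close>)
  show ?thesis using 1 2 3 by (simp add: right_action_def)
qed

lemma tL_tR_commute:
  assumes "h \<in> carrier H" "h' \<in> carrier H" and c: "c \<in> carrier AB"
  shows "tR (tL h c) h' = tL h (tR c h')"
  by (rule AB_eqI[where f = "\<lambda>c. tR (tL h c) h'" and g = "\<lambda>c. tL h (tR c h')", OF _ _ _ c])
    (use assms in \<open>simp_all add: lin_comp[OF tL_lin tR_lin] lin_comp[OF tR_lin tL_lin]\<close>)

text \<open>On pure tensors the left action moves only the \<open>A\<close>-components, so the sum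
  over \<Delta>(h) can be pulled out of the first tensor factor.\<close>

lemma tL_mult:
  assumes h: "h \<in> carrier H" and c: "c \<in> carrier AB" "c' \<in> carrier AB"
  shows "tL h (c \<otimes>\<^bsub>AB\<^esub> c') = tsum AB (Dl h) (\<lambda>h1 h2. tL h1 c \<otimes>\<^bsub>AB\<^esub> tL h2 c')"
proof (rule AB_eqI[where f = "\<lambda>c. tL h (c \<otimes>\<^bsub>AB\<^esub> c')" and g = "\<lambda>c. tsum AB (Dl h) (\<lambda>h1 h2. tL h1 c \<otimes>\<^bsub>AB\<^esub> tL h2 c')"
     , OF _ _ _ c(1)])
  show "(\<lambda>c. tL h (c \<otimes>\<^bsub>AB\<^esub> c')) \<in> lin k AB AB" by (rule lin_comp[OF tL_lin mult_lin_left]) (use h c in simp_all)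
  show "(\<lambda>c. tsum AB (Dl h) (\<lambda>h1 h2. tL h1 c \<otimes>\<^bsub>AB\<^esub> tL h2 c')) \<in> lin k AB AB"
    by (rule tsum_lin_param[of H H]; (intro lin_intros)?; use h c in simp)
  fix a b assume ab [simp]: "a \<in> carrier A" "b \<in> carrier B"
  show "tL h (tens k A B a b \<otimes>\<^bsub>AB\<^esub> c') = tsum AB (Dl h) (\<lambda>h1 h2. tL h1 (tens k A B a b) \<otimes>\<^bsub>AB\<^esub> tL h2 c')"
  proof (rule AB_eqI[where f = "\<lambda>c'. tL h (tens k A B a b \<otimes>\<^bsub>AB\<^esub> c')"
        and g = "\<lambda>c'. tsum AB (Dl h) (\<lambda>h1 h2. tL h1 (tens k A B a b) \<otimes>\<^bsub>AB\<^esub> tL h2 c')", OF _ _ _ c(2)])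
    show "(\<lambda>c'. tL h (tens k A B a b \<otimes>\<^bsub>AB\<^esub> c')) \<in> lin k AB AB" by (rule lin_comp[OF tL_lin mult_lin_right]) (use h c in simp_all)
    show "(\<lambda>c'. tsum AB (Dl h) (\<lambda>h1 h2. tL h1 (tens k A B a b) \<otimes>\<^bsub>AB\<^esub> tL h2 c')) \<in> lin k AB AB"
      by (rule tsum_lin_param[of H H]; (intro lin_intros)?; use h c in simp)
    fix a' b' assume ab' [simp]: "a' \<in> carrier A" "b' \<in> carrier B"
    have "tens k A B (tsum A (Dl h) (\<lambda>h1 h2. l h1 a \<otimes>\<^bsub>A\<^esub> l h2 a')) (b \<otimes>\<^bsub>B\<^esub> b')
      = tsum AB (Dl h) (\<lambda>h1 h2. tens k A B (l h1 a \<otimes>\<^bsub>A\<^esub> l h2 a') (b \<otimes>\<^bsub>B\<^esub> b'))"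
      by (rule lin_tsum[where k = k and h = "\<lambda>x. tens k A B x (b \<otimes>\<^bsub>B\<^esub> b')" and M = H and N = H and P = A])
        (use h in \<open>simp_all add: tens_lin_left\<close>)
    also have "\<dots> = tsum AB (Dl h) (\<lambda>h1 h2. tL h1 (tens k A B a b) \<otimes>\<^bsub>AB\<^esub> tL h2 (tens k A B a' b'))"
      by (rule tsum_cong[where k = k and M = H and N = H]) (use h in simp_all)
    finally show "tL h (tens k A B a b \<otimes>\<^bsub>AB\<^esub> tens k A B a' b')
      = tsum AB (Dl h) (\<lambda>h1 h2. tL h1 (tens k A B a b) \<otimes>\<^bsub>AB\<^esub> tL h2 (tens k A B a' b'))"
      using h by (simp add: mult_l)
  qed
qed

lemma tR_mult:
  assumes h: "h \<in> carrier H" and c: "c \<in> carrier AB" "c' \<in> carrier AB"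
  shows "tR (c \<otimes>\<^bsub>AB\<^esub> c') h = tsum AB (Dl h) (\<lambda>h1 h2. tR c h1 \<otimes>\<^bsub>AB\<^esub> tR c' h2)"
proof (rule AB_eqI[where f = "\<lambda>c. tR (c \<otimes>\<^bsub>AB\<^esub> c') h" and g = "\<lambda>c. tsum AB (Dl h) (\<lambda>h1 h2. tR c h1 \<otimes>\<^bsub>AB\<^esub> tR c' h2)"
     , OF _ _ _ c(1)])
  show "(\<lambda>c. tR (c \<otimes>\<^bsub>AB\<^esub> c') h) \<in> lin k AB AB" by (rule lin_comp[OF tR_lin mult_lin_left]) (use h c in simp_all)
  show "(\<lambda>c. tsum AB (Dl h) (\<lambda>h1 h2. tR c h1 \<otimes>\<^bsub>AB\<^esub> tR c' h2)) \<in> lin k AB AB"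
    by (rule tsum_lin_param[of H H]; (intro lin_intros)?; use h c in simp)
  fix a b assume ab [simp]: "a \<in> carrier A" "b \<in> carrier B"
  show "tR (tens k A B a b \<otimes>\<^bsub>AB\<^esub> c') h = tsum AB (Dl h) (\<lambda>h1 h2. tR (tens k A B a b) h1 \<otimes>\<^bsub>AB\<^esub> tR c' h2)"
  proof (rule AB_eqI[where f = "\<lambda>c'. tR (tens k A B a b \<otimes>\<^bsub>AB\<^esub> c') h"
        and g = "\<lambda>c'. tsum AB (Dl h) (\<lambda>h1 h2. tR (tens k A B a b) h1 \<otimes>\<^bsub>AB\<^esub> tR c' h2)", OF _ _ _ c(2)])
    show "(\<lambda>c'. tR (tens k A B a b \<otimes>\<^bsub>AB\<^esub> c') h) \<in> lin k AB AB" by (rule lin_comp[OF tR_lin mult_lin_right]) (use h c in simp_all)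
    show "(\<lambda>c'. tsum AB (Dl h) (\<lambda>h1 h2. tR (tens k A B a b) h1 \<otimes>\<^bsub>AB\<^esub> tR c' h2)) \<in> lin k AB AB"
      by (rule tsum_lin_param[of H H]; (intro lin_intros)?; use h c in simp)
    fix a' b' assume ab' [simp]: "a' \<in> carrier A" "b' \<in> carrier B"
    have "tens k A B (a \<otimes>\<^bsub>A\<^esub> a') (tsum B (Dl h) (\<lambda>h1 h2. r b h1 \<otimes>\<^bsub>B\<^esub> r b' h2))
      = tsum AB (Dl h) (\<lambda>h1 h2. tens k A B (a \<otimes>\<^bsub>A\<^esub> a') (r b h1 \<otimes>\<^bsub>B\<^esub> r b' h2))"
      by (rule lin_tsum[where k = k and h = "tens k A B (a \<otimes>\<^bsub>A\<^esub> a')" and M = H and N = H and P = B])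
        (use h in \<open>simp_all add: tens_lin_right\<close>)
    also have "\<dots> = tsum AB (Dl h) (\<lambda>h1 h2. tR (tens k A B a b) h1 \<otimes>\<^bsub>AB\<^esub> tR (tens k A B a' b') h2)"
      by (rule tsum_cong[where k = k and M = H and N = H]) (use h in simp_all)
    finally show "tR (tens k A B a b \<otimes>\<^bsub>AB\<^esub> tens k A B a' b') h
      = tsum AB (Dl h) (\<lambda>h1 h2. tR (tens k A B a b) h1 \<otimes>\<^bsub>AB\<^esub> tR (tens k A B a' b') h2)"
      using h by (simp add: mult_r)
  qed
qed

lemma tL_tR_lin [simp]: "h \<in> carrier H \<Longrightarrow> m \<in> carrier H \<Longrightarrow> (\<lambda>c. tR (tL h c) m) \<in> lin k AB AB"
  by (rule lin_comp[OF tR_lin tL_lin])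

text \<open>On pure tensors the two associators live in different factors, \<Phi> acting from the
  left on \<open>A\<close> and \<Phi>\<inverse> from the right on \<open>B\<close>. The tensor
  product of the two sums is the required double sum.\<close>

lemma AB_quasi_assoc:
  assumes c: "c \<in> carrier AB" "c' \<in> carrier AB" "c'' \<in> carrier AB"
  shows "c \<otimes>\<^bsub>AB\<^esub> c' \<otimes>\<^bsub>AB\<^esub> c'' = tsum3 AB Ph (\<lambda>X Y Z. tsum3 AB Ph' (\<lambda>x y z.
    tR (tL X c) x \<otimes>\<^bsub>AB\<^esub> (tR (tL Y c') y \<otimes>\<^bsub>AB\<^esub> tR (tL Z c'') z)))" (is "_ = ?R c c' c''")
proof -
  have lin: "(\<lambda>c. ?R c c' c'') \<in> lin k AB AB" "(\<lambda>c'. ?R c c' c'') \<in> lin k AB AB" "(\<lambda>c''. ?R c c' c'') \<in> lin k AB AB"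
    "(\<lambda>c. c \<otimes>\<^bsub>AB\<^esub> c' \<otimes>\<^bsub>AB\<^esub> c'') \<in> lin k AB AB" "(\<lambda>c'. c \<otimes>\<^bsub>AB\<^esub> c' \<otimes>\<^bsub>AB\<^esub> c'') \<in> lin k AB AB"
    "(\<lambda>c''. c \<otimes>\<^bsub>AB\<^esub> c' \<otimes>\<^bsub>AB\<^esub> c'') \<in> lin k AB AB"
    if "c \<in> carrier AB" "c' \<in> carrier AB" "c'' \<in> carrier AB" for c c' c''
    by ((rule tsum3_lin_param[of H H H]; (rule tsum3_lin_param[of H H H])?; (intro lin_intros)?; use that in simp)
      | (intro lin_intros; use that in simp))+
  have pure: "tens k A B a b \<otimes>\<^bsub>AB\<^esub> tens k A B a' b' \<otimes>\<^bsub>AB\<^esub> tens k A B a'' b''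
      = ?R (tens k A B a b) (tens k A B a' b') (tens k A B a'' b'')"
    if [simp]: "a \<in> carrier A" "a' \<in> carrier A" "a'' \<in> carrier A" "b \<in> carrier B" "b' \<in> carrier B" "b'' \<in> carrier B"
    for a a' a'' b b' b''
  proof -
    let ?f = "\<lambda>X Y Z. l X a \<otimes>\<^bsub>A\<^esub> (l Y a' \<otimes>\<^bsub>A\<^esub> l Z a'')" and ?g = "\<lambda>x y z. r b x \<otimes>\<^bsub>B\<^esub> (r b' y \<otimes>\<^bsub>B\<^esub> r b'' z)"
    have g: "tsum3 B Ph' ?g \<in> carrier B" by (rule tsum3_closed[of H H H]) simp_all
    have "tens k A B a b \<otimes>\<^bsub>AB\<^esub> tens k A B a' b' \<otimes>\<^bsub>AB\<^esub> tens k A B a'' b'' = tens k A B (tsum3 A Ph ?f) (tsum3 B Ph' ?g)"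
      by (simp add: la.mult_quasi_assoc ra.mult_quasi_assoc)
    also have "\<dots> = tsum3 AB Ph (\<lambda>X Y Z. tens k A B (?f X Y Z) (tsum3 B Ph' ?g))"
      by (rule lin_tsum3[where L = "\<lambda>x. tens k A B x (tsum3 B Ph' ?g)" and A = H and B = H and C = H and P = A])
        (use g in \<open>simp_all add: tens_lin_left\<close>)
    also have "\<dots> = ?R (tens k A B a b) (tens k A B a' b') (tens k A B a'' b'')"
    proof (rule tsum3_cong[where A = H and B = H and C = H])
      fix X Y Z assume [simp]: "X \<in> carrier H" "Y \<in> carrier H" "Z \<in> carrier H"
      have "tens k A B (?f X Y Z) (tsum3 B Ph' ?g) = tsum3 AB Ph' (\<lambda>x y z. tens k A B (?f X Y Z) (?g x y z))"
        by (rule lin_tsum3[where L = "tens k A B (?f X Y Z)" and A = H and B = H and C = H and P = B])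
          (simp_all add: tens_lin_right)
      also have "\<dots> = tsum3 AB Ph' (\<lambda>x y z. tR (tL X (tens k A B a b)) x \<otimes>\<^bsub>AB\<^esub>
          (tR (tL Y (tens k A B a' b')) y \<otimes>\<^bsub>AB\<^esub> tR (tL Z (tens k A B a'' b'')) z))"
        by (rule tsum3_cong[where A = H and B = H and C = H]) simp_all
      finally show "tens k A B (?f X Y Z) (tsum3 B Ph' ?g) = tsum3 AB Ph' (\<lambda>x y z. tR (tL X (tens k A B a b)) x \<otimes>\<^bsub>AB\<^esub>
          (tR (tL Y (tens k A B a' b')) y \<otimes>\<^bsub>AB\<^esub> tR (tL Z (tens k A B a'' b'')) z))" .
    qed simp_all
    finally show ?thesis .
  qed
  show ?thesis
  proof (rule AB_eqI[where f = "\<lambda>c. c \<otimes>\<^bsub>AB\<^esub> c' \<otimes>\<^bsub>AB\<^esub> c''" and g = "\<lambda>c. ?R c c' c''", OF lin(4,1)[OF c] _ c(1)])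
    fix a b assume ab: "a \<in> carrier A" "b \<in> carrier B"
    then have 1: "tens k A B a b \<in> carrier AB" by simp
    show "tens k A B a b \<otimes>\<^bsub>AB\<^esub> c' \<otimes>\<^bsub>AB\<^esub> c'' = ?R (tens k A B a b) c' c''"
    proof (rule AB_eqI[where f = "\<lambda>c'. tens k A B a b \<otimes>\<^bsub>AB\<^esub> c' \<otimes>\<^bsub>AB\<^esub> c''" and g = "\<lambda>c'. ?R (tens k A B a b) c' c''"
         , OF lin(5,2)[OF 1 c(2,3)] _ c(2)])
      fix a' b' assume ab': "a' \<in> carrier A" "b' \<in> carrier B"
      then have 2: "tens k A B a' b' \<in> carrier AB" by simp
      show "tens k A B a b \<otimes>\<^bsub>AB\<^esub> tens k A B a' b' \<otimes>\<^bsub>AB\<^esub> c'' = ?R (tens k A B a b) (tens k A B a' b') c''"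
        by (rule AB_eqI[where f = "\<lambda>c''. tens k A B a b \<otimes>\<^bsub>AB\<^esub> tens k A B a' b' \<otimes>\<^bsub>AB\<^esub> c''"
              and g = "\<lambda>c''. ?R (tens k A B a b) (tens k A B a' b') c''", OF lin(6,3)[OF 1 2 c(3)] _ c(3)])
          (rule pure; use ab ab' in simp)
    qed
  qed
qed

lemma AB_bimodule_algebra: "bimodule_algebra k H AB tL tR"
proof -
  have "tL h \<one>\<^bsub>AB\<^esub> = ep h \<odot>\<^bsub>AB\<^esub> \<one>\<^bsub>AB\<^esub>" "tR \<one>\<^bsub>AB\<^esub> h = ep h \<odot>\<^bsub>AB\<^esub> \<one>\<^bsub>AB\<^esub>" if "h \<in> carrier H" for h
    using that by (simp_all add: l_unit r_unit tens_smult flip: tens_one)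
  moreover have "nalg AB" by simp
  ultimately show ?thesis
    by (simp add: bimodule_algebra_def bimodule_algebra_axioms_def tL_left_action tR_right_action tL_tR_commute
        AB_quasi_assoc tL_mult tR_mult)
qed

text \<open>Multiplicativity and preservation of the unit were shown for G, where coefficients can
  be compared; they are transported to F because the two maps are mutually inverse.\<close>

lemma smash_to_crossed_iso:
  "smash_to_crossed \<in> alg_iso k (two_sided_smash_product k H A l U B r) (diag_crossed_product k H AB tL tR U)"
proof -
  have mult: "smash_to_crossed (smash P Q) = cross (smash_to_crossed P) (smash_to_crossed Q)" if PQ: "P \<in> carrier AUB" "Q \<in> carrier AUB" for P Q
  proof -
    have "smash_to_crossed (smash P Q) = smash_to_crossed (smash (crossed_to_smash (smash_to_crossed P)) (crossed_to_smash (smash_to_crossed Q)))" by (simp only: crossed_to_smash_smash_to_crossed PQ)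
    also have "\<dots> = smash_to_crossed (crossed_to_smash (cross (smash_to_crossed P) (smash_to_crossed Q)))" using PQ by (simp only: crossed_to_smash_cross smash_to_crossed_closed)
    also have "\<dots> = cross (smash_to_crossed P) (smash_to_crossed Q)" by (intro smash_to_crossed_crossed_to_smash crossed_to_smash_cross(1) smash_to_crossed_closed PQ)
    finally show ?thesis .
  qed
  have one: "smash_to_crossed \<one>\<^bsub>AUB\<^esub> = \<one>\<^bsub>ABU\<^esub>"
    using smash_to_crossed_crossed_to_smash[of "\<one>\<^bsub>ABU\<^esub>"] unfolding crossed_to_smash_one by simp
  have "bij_betw smash_to_crossed (carrier AUB) (carrier ABU)"
    by (rule bij_betw_byWitness[where f' = crossed_to_smash]) (auto simp: lin_closed[OF crossed_to_smash_lin])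
  then show ?thesis
    using mult one lin_add[OF smash_to_crossed_lin] lin_smult[OF smash_to_crossed_lin]
    by (simp add: alg_iso_def alg_hom_def ring_hom_def two_sided_smash_product_def diag_crossed_product_def
        Pi_iff smash_def cross_def)
qed

end

theorem proposition6p3:
  fixes k :: "('k, 'r) ring_scheme"
    and H :: "('k, 'h, 'x) quasi_hopf_scheme"
    and A :: "('k, 'a, 'm) module_scheme" and l :: "'h \<Rightarrow> 'a \<Rightarrow> 'a"
    and B :: "('k, 'b, 'n) module_scheme" and r :: "'b \<Rightarrow> 'h \<Rightarrow> 'b"
    and U :: "('k, 'h, 'u, 'y) bicomodule_algebra_scheme"
  assumes "quasi_hopf_algebra k H"
    and "left_module_algebra k H A l"
    and "right_module_algebra k H B r"
    and "bicomodule_algebra k H U"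
  shows "bimodule_algebra k H (tensor k A B) (tensor_lact k A B l) (tensor_ract k A B r) \<and>
    (\<exists>F. F \<in> alg_iso k
      (two_sided_smash_product k H A l U B r)
      (diag_crossed_product k H (tensor k A B) (tensor_lact k A B l) (tensor_ract k A B r) U))"
proof -
  interpret iso_base k H U A l B r
    using assms by (intro iso_base.intro iso_base_axioms.intro crossed_base.intro crossed_base_axioms.intro quasi_hopf_base.intro)
  show ?thesis using AB_bimodule_algebra smash_to_crossed_iso by blast
qed

end
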